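(* (Distorted HWI inequality) Let $(X,d,\nu)$ be a weak $\mathrm{CD}(K,N)$ space for some $K\in\mathbb R$ and $N\in(1,\infty]$. Let $\mu_0,\mu_1\in P^{ac}_c(X,\nu)$ be such that $\mu_0$ has a Lipschitz density $\rho_0$. Then there exists an optimal transference plan $\pi$ (w.r.t. $d^2$) of coupling $(\mu_0,\mu_1)$ such that for any $U\in DC_N$, with $p(r)=rU'(r)-U(r)$, $$U_\nu(\mu_0)\le U^{\breve\beta^{(K,N)}_{0+}}_{\breve\pi,\nu}(\mu_1)+\int_{X\times X}p(\rho_0(x))\Big[\frac{d}{dt}\Big|_{t=1}\beta^{(K,N)}_t(x,y)\Big]\pi(dy|x)\,\nu(dx)+\int_{X\times X}U''(\rho_0(x))\,|\nabla^-\rho_0(x)|\,d(x,y)\,\pi(dx\,dy),$$ where $\pi(dx\,dy)=\pi(dy|x)\mu_0(dx)$ and $\beta^{(K,N)}_{0+}=\lim_{t\to0^+}\beta^{(K,N)}_t$. Moreover: (i) if $K=0$ and $U_\nu(\mu_1)<\infty$, then $$U_\nu(\mu_0)-U_\nu(\mu_1)\le\int_{X\times X}U''(\rho_0(x))|\nabla^-\rho_0(x)|\,d(x,y)\,\pi(dx\,dy)\le W_2(\mu_0,\mu_1)\sqrt{I^-_{U,\nu}(\mu_0)};$$ (ii) if $N=\infty$ and $U_\nu(\mu_1)<\infty$, then $$U_\nu(\mu_0)-U_\nu(\mu_1)\le\int_{X\times X}U''(\rho_0(x))|\nabla^-\rho_0(x)|\,d(x,y)\,\pi(dx\,dy)-\frac{K_{\infty,U}}2W_2(\mu_0,\mu_1)^2\le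 W_2(\mu_0,\mu_1)\sqrt{I^-_{U,\nu}(\mu_0)}-\frac{K_{\infty,U}}2W_2(\mu_0,\mu_1)^2,$$ where $K_{\infty,U}=\inf_{r>0}\frac{K\,p(r)}{r}$.
   Context: Spaces. An irreversible metric on $X$ is $d:X\times X\to[0,\infty)$ with $d(x,y)=0$ iff $x=y$ and the triangle inequality (no symmetry). Topology: generated by forward balls $B^+_x(r)=\{y:d(x,y)<r\}$. $\lambda_d(A)=\inf\{\lambda\ge1:d(x,y)\le\lambda d(y,x)\ \forall x,y\in A\}$. $(X,d)$ is a forward metric space if for some point $\star$ and some nondecreasing $\Theta:[0,\infty)\to[1,\infty)$ one has $\lambda_d(\overline{B^+_\star(r)})\le\Theta(r)$ for all $r>0$. It is forward boundedly compact if all closed forward balls are compact. It is a forward geodesic space if any $x,y$ are joined by a constant-speed minimal geodesic, i.e. continuous $\gamma:[0,1]\to X$ from $x$ to $y$ with $d(\gamma(s),\gamma(t))=(t-s)d(x,y)$ for $0\le s\le t\le1$; $\Gamma(X)$ is the set of these curves. "-measure space" means equipped with a nonnegative locally finite Borel measure. $P^{ac}_c(X,\nu)$: compactly supported probability measures absolutely continuous w.r.t. $\nu$. Gradients. $f:X\to\mathbb R$ is Lipschitz if for some $C>0$, $f(y)-f(x)\le C\,d(x,y)$ for all $x,y$. $|\nabla^-f|(x)=\limsup_{y\to x}\frac{[f(y)-f(x)]_-}{d(x,y)}$, $[a]_-=\max\{-a,0\}$ ($x$ non-isolated). For $\mu=\rho\nu$ with Lipschitz $\rho$: $I^-_{U,\nu}(\mu)=\int_X\rho\,U''(\rho)^2|\nabla^-\rho|^2d\nu$.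 Optimal transport. $W_2(\mu_0,\mu_1)^2=\inf_\pi\int d(x,y)^2d\pi(x,y)$ over couplings $\pi$ of $(\mu_0,\mu_1)$; minimizers are the optimal transference plans (w.r.t. $d^2$). With $e_t(\gamma)=\gamma(t)$, a dynamical optimal transference plan is a probability measure $\Pi$ on $\Gamma(X)$ with $(e_0,e_1)_\sharp\Pi$ optimal; $\mu_t=(e_t)_\sharp\Pi$ is a displacement interpolation, associated with $\pi=(e_0,e_1)_\sharp\Pi$. Functionals. For $N\in[1,\infty]$, $DC_N$ is the set of continuous convex $U:[0,\infty)\to\mathbb R$, $C^2$ on $(0,\infty)$, $U(0)=0$, such that with $p(r)=rU'(r)-U(r)$ the function $r\mapsto p(r)/r^{1-1/N}$ is nondecreasing. Put $U'(\infty)=\lim_{r\to\infty}U(r)/r$. For compactly supported $\mu=\rho\nu+\mu_s$ (Lebesgue decomposition w.r.t. $\nu$), $U_\nu(\mu)=\int_XU(\rho)\,d\nu+U'(\infty)\mu_s[X]$, and for measurable $\beta:X\times X\to(0,\infty]$ and $\pi\in P(X\times X)$ with first marginal $\mu$, disintegrated as $\pi(dx\,dy)=\mu(dx)\pi(dy|x)$, $$U^\beta_{\pi,\nu}(\mu)=\int_{X\times X}U\Big(\frac{\rho(x)}{\beta(x,y)}\Big)\beta(x,y)\,\pi(dy|x)\,\nu(dx)+U'(\infty)\mu_s[X],$$ with the conventions $U(0)/0=U'(0)$, $U(\infty)/\infty=U'(\infty)$. Coefficients. $\mathfrak s_{K,N}(r)=\sqrt{\tfrac{N-1}{K}}\sin\big(r\sqrt{\tfrac{K}{N-1}}\big)$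 if $K>0$, $r$ if $K=0$, $\sqrt{\tfrac{N-1}{-K}}\sinh\big(r\sqrt{\tfrac{-K}{N-1}}\big)$ if $K<0$. For $N\in(1,\infty)$, $t\in(0,1]$: $\beta^{(K,N)}_t(x,y)=\infty$ if $K>0$ and $d(x,y)\ge\pi\sqrt{(N-1)/K}$, and otherwise $\beta^{(K,N)}_t(x,y)=\big(\frac{\mathfrak s_{K,N}(t\,d(x,y))}{t\,\mathfrak s_{K,N}(d(x,y))}\big)^{N-1}$ (equal to $1$ if $x=y$); in the definition of weak $\mathrm{CD}(K,N)$ below, $\beta^{(K,N)}_0=1$. $\beta^{(K,\infty)}_t=\lim_{N\uparrow\infty}\beta^{(K,N)}_t=e^{\frac K6(1-t^2)d(x,y)^2}$, $t\in(0,1]$. $\breve\beta(x,y)=\beta(y,x)$ and $\breve\pi$ is the image of $\pi$ under $(x,y)\mapsto(y,x)$. If $K>0$, $N\in(1,\infty)$ and $\sup_{x,y}d(x,y)=\pi\sqrt{(N-1)/K}$, then $U^{\beta^{(K,N)}_t}_{\pi,\nu}$, $U^{\breve\beta^{(K,N)}_t}_{\breve\pi,\nu}$ (and likewise the derivative $\frac{d}{dt}|_{t=1}\beta_t^{(K,N)}$) are understood as limits as $N'\downarrow N$ of the same expressions with $N'$. Weak $\mathrm{CD}(K,N)$. A forward boundedly compact, $\sigma$-finite forward geodesic-measure space $(X,d,\nu)$ is a weak $\mathrm{CD}(K,N)$ space if for any two compactly supported probability measures $\mu_0,\mu_1$ with $\mathrm{supp}\,\mu_i\subset\mathrm{supp}\,\nu$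 there are a displacement interpolation $(\mu_t)_{0\le t\le1}$ and an associated optimal transference plan $\pi$ from $\mu_0$ to $\mu_1$ such that for all $U\in DC_N$ and $t\in[0,1]$: $U_\nu(\mu_t)\le(1-t)\,U^{\beta^{(K,N)}_{1-t}}_{\pi,\nu}(\mu_0)+t\,U^{\breve\beta^{(K,N)}_t}_{\breve\pi,\nu}(\mu_1)$. *)

theory Defs
  imports "HOL-Probability.Probability"
begin

section \<open>Irreversible metric spaces\<close>

text \<open>The underlying set is the whole type \<open>'a\<close>.\<close>

definition irreversible_metric :: "('a \<Rightarrow> 'a \<Rightarrow> real) \<Rightarrow> bool" where
  "irreversible_metric d \<longleftrightarrow>
     (\<forall>x y. 0 \<le> d x y) \<and> (\<forall>x y. d x y = 0 \<longleftrightarrow> x = y) \<and>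
     (\<forall>x y z. d x z \<le> d x y + d y z)"

definition fball :: "('a \<Rightarrow> 'a \<Rightarrow> real) \<Rightarrow> 'a \<Rightarrow> real \<Rightarrow> 'a set" where
  "fball d x r = {y. d x y < r}"

definition ftop :: "('a \<Rightarrow> 'a \<Rightarrow> real) \<Rightarrow> 'a topology" where
  "ftop d = topology_generated_by {fball d x r | x r. True}"

definition reversibility :: "('a \<Rightarrow> 'a \<Rightarrow> real) \<Rightarrow> 'a set \<Rightarrow> ereal" where
  "reversibility d A = Inf {ereal l | l. 1 \<le> l \<and> (\<forall>x\<in>A. \<forall>y\<in>A. d x y \<le> l * d y x)}"

definition forward_metric_space :: "('a \<Rightarrow> 'a \<Rightarrow> real) \<Rightarrow> bool" where
  "forward_metric_space d \<longleftrightarrow> irreversible_metric d \<and>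
     (\<exists>p \<Theta>. mono_on {0..} \<Theta> \<and> (\<forall>r\<ge>0. 1 \<le> \<Theta> r) \<and>
        (\<forall>r>0. reversibility d (ftop d closure_of fball d p r) \<le> ereal (\<Theta> r)))"

definition forward_boundedly_compact :: "('a \<Rightarrow> 'a \<Rightarrow> real) \<Rightarrow> bool" where
  "forward_boundedly_compact d \<longleftrightarrow>
     (\<forall>x. \<forall>r>0. compactin (ftop d) (ftop d closure_of fball d x r))"

text \<open>Curves on \<open>[0,1]\<close> are represented by functions that are \<open>undefined\<close> off \<open>[0,1]\<close>, so
  that distinct functions are distinct curves.\<close>

definition geodesics :: "('a \<Rightarrow> 'a \<Rightarrow> real) \<Rightarrow> (real \<Rightarrow> 'a) set" where
  "geodesics d = {\<gamma> \<in> extensional {0..1}.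
     continuous_map (top_of_set {0..1}) (ftop d) \<gamma> \<and>
     (\<forall>s t. 0 \<le> s \<and> s \<le> t \<and> t \<le> 1 \<longrightarrow> d (\<gamma> s) (\<gamma> t) = (t - s) * d (\<gamma> 0) (\<gamma> 1))}"

definition forward_geodesic_space :: "('a \<Rightarrow> 'a \<Rightarrow> real) \<Rightarrow> bool" where
  "forward_geodesic_space d \<longleftrightarrow> forward_metric_space d \<and>
     (\<forall>x y. \<exists>\<gamma>\<in>geodesics d. \<gamma> 0 = x \<and> \<gamma> 1 = y)"


section \<open>Measures\<close>

definition fborel :: "('a \<Rightarrow> 'a \<Rightarrow> real) \<Rightarrow> 'a measure" where
  "fborel d = sigma UNIV {V. openin (ftop d) V}"

definition locally_finite_borel :: "('a \<Rightarrow> 'a \<Rightarrow> real) \<Rightarrow> 'a measure \<Rightarrow> bool" where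
  "locally_finite_borel d \<nu> \<longleftrightarrow> sets \<nu> = sets (fborel d) \<and>
     (\<forall>x. \<exists>V. openin (ftop d) V \<and> x \<in> V \<and> emeasure \<nu> V < \<infinity>)"

definition msupp :: "('a \<Rightarrow> 'a \<Rightarrow> real) \<Rightarrow> 'a measure \<Rightarrow> 'a set" where
  "msupp d \<mu> = {x. \<forall>V. openin (ftop d) V \<and> x \<in> V \<longrightarrow> 0 < emeasure \<mu> V}"

definition prob_c :: "('a \<Rightarrow> 'a \<Rightarrow> real) \<Rightarrow> 'a measure set" where
  "prob_c d = {\<mu>. prob_space \<mu> \<and> sets \<mu> = sets (fborel d) \<and> compactin (ftop d) (msupp d \<mu>)}"

definition prob_ac_c :: "('a \<Rightarrow> 'a \<Rightarrow> real) \<Rightarrow> 'a measure \<Rightarrow> 'a measure set" where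
  "prob_ac_c d \<nu> = {\<mu> \<in> prob_c d. absolutely_continuous \<nu> \<mu>}"

definition lebesgue_decomposition ::
    "'a measure \<Rightarrow> 'a measure \<Rightarrow> ('a \<Rightarrow> real) \<Rightarrow> 'a measure \<Rightarrow> bool" where
  "lebesgue_decomposition \<nu> \<mu> \<rho> \<mu>s \<longleftrightarrow>
     \<rho> \<in> borel_measurable \<nu> \<and> (\<forall>x. 0 \<le> \<rho> x) \<and> sets \<mu>s = sets \<nu> \<and>
     (\<forall>A\<in>sets \<nu>. emeasure \<mu> A = emeasure (density \<nu> (\<lambda>x. ennreal (\<rho> x))) A + emeasure \<mu>s A) \<and>
     (\<exists>S\<in>null_sets \<nu>. emeasure \<mu>s (space \<nu> - S) = 0)"

text \<open>The decomposition is unique (up to \<open>\<nu>\<close>-null sets for \<open>\<rho>\<close>), so the choice made here does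
  not affect any of the functionals below.\<close>

definition ac_density :: "'a measure \<Rightarrow> 'a measure \<Rightarrow> 'a \<Rightarrow> real" where
  "ac_density \<nu> \<mu> = (SOME \<rho>. \<exists>\<mu>s. lebesgue_decomposition \<nu> \<mu> \<rho> \<mu>s)"

definition singular_part :: "'a measure \<Rightarrow> 'a measure \<Rightarrow> 'a measure" where
  "singular_part \<nu> \<mu> = (SOME \<mu>s. \<exists>\<rho>. lebesgue_decomposition \<nu> \<mu> \<rho> \<mu>s)"

text \<open>The measure \<open>\<kappa>(dy|x) \<mu>(dx)\<close>.\<close>

definition kernel_prod :: "'a measure \<Rightarrow> ('a \<Rightarrow> 'a measure) \<Rightarrow> ('a \<times> 'a) measure" where
  "kernel_prod \<mu> \<kappa> = measure_of (space (\<mu> \<Otimes>\<^sub>M \<mu>)) (sets (\<mu> \<Otimes>\<^sub>M \<mu>))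
     (\<lambda>A. \<integral>\<^sup>+x. emeasure (\<kappa> x) (Pair x -` A) \<partial>\<mu>)"

text \<open>\<open>\<pi>(dy|x)\<close> for \<open>\<pi>\<close> with first marginal \<open>\<mu>\<close>; it is determined for \<open>\<mu>\<close>-almost every \<open>x\<close>.
  Where it is integrated against \<open>\<nu>\<close> below, the integrand vanishes wherever the density of
  \<open>\<mu>\<close> does, so the choice is immaterial.\<close>

definition cond_kernel :: "('a \<times> 'a) measure \<Rightarrow> 'a measure \<Rightarrow> 'a \<Rightarrow> 'a measure" where
  "cond_kernel \<pi> \<mu> = (SOME \<kappa>. \<kappa> \<in> measurable \<mu> (prob_algebra \<mu>) \<and> \<pi> = kernel_prod \<mu> \<kappa>)"

text \<open>Integral of an extended-real function. By the arithmetic of \<open>ereal\<close>, the undefined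
  \<open>\<infinity> - \<infinity>\<close> is \<open>\<infinity>\<close> here and in all sums below.\<close>

definition eintegral :: "'b measure \<Rightarrow> ('b \<Rightarrow> ereal) \<Rightarrow> ereal" where
  "eintegral M f =
     enn2ereal (\<integral>\<^sup>+x. e2ennreal (f x) \<partial>M) - enn2ereal (\<integral>\<^sup>+x. e2ennreal (- f x) \<partial>M)"

definition esqrt :: "ennreal \<Rightarrow> ennreal" where
  "esqrt a = (if a = \<infinity> then \<infinity> else ennreal (sqrt (enn2real a)))"


section \<open>Optimal transport\<close>

definition couplings ::
    "('a \<Rightarrow> 'a \<Rightarrow> real) \<Rightarrow> 'a measure \<Rightarrow> 'a measure \<Rightarrow> ('a \<times> 'a) measure set" where
  "couplings d \<mu>0 \<mu>1 = {\<pi>. prob_space \<pi> \<and> sets \<pi> = sets (fborel d \<Otimes>\<^sub>M fborel d) \<and>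
     distr \<pi> (fborel d) fst = \<mu>0 \<and> distr \<pi> (fborel d) snd = \<mu>1}"

definition transport_cost :: "('a \<Rightarrow> 'a \<Rightarrow> real) \<Rightarrow> ('a \<times> 'a) measure \<Rightarrow> ennreal" where
  "transport_cost d \<pi> = (\<integral>\<^sup>+(x, y). ennreal ((d x y)\<^sup>2) \<partial>\<pi>)"

definition W2 :: "('a \<Rightarrow> 'a \<Rightarrow> real) \<Rightarrow> 'a measure \<Rightarrow> 'a measure \<Rightarrow> ennreal" where
  "W2 d \<mu>0 \<mu>1 = esqrt (INF \<pi>\<in>couplings d \<mu>0 \<mu>1. transport_cost d \<pi>)"

definition optimal_plan ::
    "('a \<Rightarrow> 'a \<Rightarrow> real) \<Rightarrow> 'a measure \<Rightarrow> 'a measure \<Rightarrow> ('a \<times> 'a) measure \<Rightarrow> bool" where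
  "optimal_plan d \<mu>0 \<mu>1 \<pi> \<longleftrightarrow> \<pi> \<in> couplings d \<mu>0 \<mu>1 \<and>
     (\<forall>\<pi>'\<in>couplings d \<mu>0 \<mu>1. transport_cost d \<pi> \<le> transport_cost d \<pi>')"

definition swap_plan :: "('a \<Rightarrow> 'a \<Rightarrow> real) \<Rightarrow> ('a \<times> 'a) measure \<Rightarrow> ('a \<times> 'a) measure" where
  "swap_plan d \<pi> = distr \<pi> (fborel d \<Otimes>\<^sub>M fborel d) (\<lambda>(x, y). (y, x))"

text \<open>The set of geodesics carries the Borel sets of the compact-open topology, i.e. of uniform
  convergence.\<close>

definition geodesic_topology :: "('a \<Rightarrow> 'a \<Rightarrow> real) \<Rightarrow> (real \<Rightarrow> 'a) topology" where
  "geodesic_topology d = topology_generated_by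
     {{\<gamma> \<in> geodesics d. \<gamma> ` C \<subseteq> V} | C V. compact C \<and> C \<subseteq> {0..1} \<and> openin (ftop d) V}"

definition geodesic_borel :: "('a \<Rightarrow> 'a \<Rightarrow> real) \<Rightarrow> (real \<Rightarrow> 'a) measure" where
  "geodesic_borel d = sigma (geodesics d) {W. openin (geodesic_topology d) W}"

definition interpolant ::
    "('a \<Rightarrow> 'a \<Rightarrow> real) \<Rightarrow> (real \<Rightarrow> 'a) measure \<Rightarrow> real \<Rightarrow> 'a measure" where
  "interpolant d Q t = distr Q (fborel d) (\<lambda>\<gamma>. \<gamma> t)"

definition endpoint_plan ::
    "('a \<Rightarrow> 'a \<Rightarrow> real) \<Rightarrow> (real \<Rightarrow> 'a) measure \<Rightarrow> ('a \<times> 'a) measure" where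
  "endpoint_plan d Q = distr Q (fborel d \<Otimes>\<^sub>M fborel d) (\<lambda>\<gamma>. (\<gamma> 0, \<gamma> 1))"

definition dynamical_optimal_plan ::
    "('a \<Rightarrow> 'a \<Rightarrow> real) \<Rightarrow> (real \<Rightarrow> 'a) measure \<Rightarrow> bool" where
  "dynamical_optimal_plan d Q \<longleftrightarrow> prob_space Q \<and> sets Q = sets (geodesic_borel d) \<and>
     optimal_plan d (interpolant d Q 0) (interpolant d Q 1) (endpoint_plan d Q)"

definition displacement_interpolation ::
    "('a \<Rightarrow> 'a \<Rightarrow> real) \<Rightarrow> (real \<Rightarrow> 'a measure) \<Rightarrow> ('a \<times> 'a) measure \<Rightarrow> bool" where
  "displacement_interpolation d \<mu> \<pi> \<longleftrightarrow> (\<exists>Q. dynamical_optimal_plan d Q \<and>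
     (\<forall>t\<in>{0..1}. \<mu> t = interpolant d Q t) \<and> \<pi> = endpoint_plan d Q)"


section \<open>Gradients\<close>

definition forward_lipschitz :: "('a \<Rightarrow> 'a \<Rightarrow> real) \<Rightarrow> ('a \<Rightarrow> real) \<Rightarrow> bool" where
  "forward_lipschitz d f \<longleftrightarrow> (\<exists>C>0. \<forall>x y. f y - f x \<le> C * d x y)"

text \<open>At an isolated point the filter is trivial and the value is \<open>0\<close>.\<close>

definition descending_slope :: "('a \<Rightarrow> 'a \<Rightarrow> real) \<Rightarrow> ('a \<Rightarrow> real) \<Rightarrow> 'a \<Rightarrow> ennreal" where
  "descending_slope d f x = Limsup (atin (ftop d) x) (\<lambda>y. ennreal (max (- (f y - f x)) 0 / d x y))"


section \<open>Functionals\<close>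

definition pressure :: "(real \<Rightarrow> real) \<Rightarrow> real \<Rightarrow> real" where
  "pressure U r = r * deriv U r - U r"

text \<open>Members of \<open>DC_N\<close> are functions on the whole real line of which only the values on
  \<open>[0,\<infinity>)\<close> are constrained or used; \<open>1/N = 0\<close> for \<open>N = \<infinity>\<close>.\<close>

definition DC :: "ereal \<Rightarrow> (real \<Rightarrow> real) set" where
  "DC N = {U. continuous_on {0..} U \<and> convex_on {0..} U \<and> U 0 = 0 \<and>
     (\<forall>r>0. U differentiable (at r) \<and> deriv U differentiable (at r)) \<and>
     continuous_on {0<..} (deriv (deriv U)) \<and>
     mono_on {0<..} (\<lambda>r. pressure U r / r powr (1 - real_of_ereal (1 / N)))}"

definition deriv_infty :: "(real \<Rightarrow> real) \<Rightarrow> ereal" where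
  "deriv_infty U = Lim at_top (\<lambda>r. ereal (U r / r))"

text \<open>\<open>U'(0)\<close> as an extended real, using \<open>U 0 = 0\<close>.\<close>

definition deriv_zero :: "(real \<Rightarrow> real) \<Rightarrow> ereal" where
  "deriv_zero U = Lim (at_right 0) (\<lambda>r. ereal (U r / r))"

definition U_fun :: "(real \<Rightarrow> real) \<Rightarrow> 'a measure \<Rightarrow> 'a measure \<Rightarrow> ereal" where
  "U_fun U \<nu> \<mu> = eintegral \<nu> (\<lambda>x. ereal (U (ac_density \<nu> \<mu> x))) +
     deriv_infty U * enn2ereal (emeasure (singular_part \<nu> \<mu>) (space \<nu>))"

text \<open>\<open>U(r/b) b\<close> for \<open>r \<in> [0,\<infinity>)\<close>, \<open>b \<in> (0,\<infinity>]\<close>. If \<open>b = \<infinity>\<close>, it is read as \<open>r U(v)/v\<close> at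
  \<open>v = r/b = 0\<close>, with \<open>U(0)/0 = U'(0)\<close>. The companion convention \<open>U(\<infinity>)/\<infinity> = U'(\<infinity>)\<close> never
  applies, since \<open>r < \<infinity>\<close> and \<open>b > 0\<close>.\<close>

definition U_distorted :: "(real \<Rightarrow> real) \<Rightarrow> real \<Rightarrow> ereal \<Rightarrow> ereal" where
  "U_distorted U r b = (if b = \<infinity> then ereal r * deriv_zero U
     else ereal (U (r / real_of_ereal b) * real_of_ereal b))"

definition U_beta ::
    "(real \<Rightarrow> real) \<Rightarrow> 'a measure \<Rightarrow> ('a \<Rightarrow> 'a \<Rightarrow> ereal) \<Rightarrow> ('a \<times> 'a) measure \<Rightarrow> 'a measure \<Rightarrow> ereal"
  where
  "U_beta U \<nu> \<beta> \<pi> \<mu> =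
     eintegral (kernel_prod \<nu> (cond_kernel \<pi> \<mu>))
       (\<lambda>(x, y). U_distorted U (ac_density \<nu> \<mu> x) (\<beta> x y)) +
     deriv_infty U * enn2ereal (emeasure (singular_part \<nu> \<mu>) (space \<nu>))"

definition fisher_minus ::
    "('a \<Rightarrow> 'a \<Rightarrow> real) \<Rightarrow> (real \<Rightarrow> real) \<Rightarrow> 'a measure \<Rightarrow> ('a \<Rightarrow> real) \<Rightarrow> ennreal" where
  "fisher_minus d U \<nu> \<rho> =
     (\<integral>\<^sup>+x. ennreal (\<rho> x * (deriv (deriv U) (\<rho> x))\<^sup>2) * (descending_slope d \<rho> x)\<^sup>2 \<partial>\<nu>)"

definition K_infty :: "real \<Rightarrow> (real \<Rightarrow> real) \<Rightarrow> ereal" where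
  "K_infty K U = (INF r\<in>{0<..}. ereal (K * pressure U r / r))"


section \<open>Distortion coefficients\<close>

definition s_KN :: "real \<Rightarrow> real \<Rightarrow> real \<Rightarrow> real" where
  "s_KN K n r =
     (if K > 0 then sqrt ((n - 1) / K) * sin (r * sqrt (K / (n - 1)))
      else if K = 0 then r
      else sqrt ((n - 1) / - K) * sinh (r * sqrt (- K / (n - 1))))"

definition myers_diameter :: "real \<Rightarrow> real \<Rightarrow> real" where
  "myers_diameter K n = pi * sqrt ((n - 1) / K)"

definition beta_coef ::
    "('a \<Rightarrow> 'a \<Rightarrow> real) \<Rightarrow> real \<Rightarrow> ereal \<Rightarrow> real \<Rightarrow> 'a \<Rightarrow> 'a \<Rightarrow> ereal" where
  "beta_coef d K N t x y =
     (if t = 0 then 1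
      else if N = \<infinity> then ereal (exp (K / 6 * (1 - t\<^sup>2) * (d x y)\<^sup>2))
      else let n = real_of_ereal N in
        if K > 0 \<and> d x y \<ge> myers_diameter K n then \<infinity>
        else if x = y then 1
        else ereal ((s_KN K n (t * d x y) / (t * s_KN K n (d x y))) powr (n - 1)))"

definition beta_zero_plus ::
    "('a \<Rightarrow> 'a \<Rightarrow> real) \<Rightarrow> real \<Rightarrow> ereal \<Rightarrow> 'a \<Rightarrow> 'a \<Rightarrow> ereal" where
  "beta_zero_plus d K N x y = Lim (at_right 0) (\<lambda>t. beta_coef d K N t x y)"

text \<open>The coefficients live on \<open>t \<le> 1\<close>, so the derivative at \<open>1\<close> is a left derivative.\<close>

definition beta_deriv_one ::
    "('a \<Rightarrow> 'a \<Rightarrow> real) \<Rightarrow> real \<Rightarrow> ereal \<Rightarrow> 'a \<Rightarrow> 'a \<Rightarrow> ereal" where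
  "beta_deriv_one d K N x y =
     Lim (at_left 1) (\<lambda>t. (beta_coef d K N 1 x y - beta_coef d K N t x y) / ereal (1 - t))"

text \<open>In the case of maximal diameter, expressions depending on \<open>N\<close> through the coefficients
  are read as limits \<open>N' \<down> N\<close>.\<close>

definition myers_limit ::
    "('a \<Rightarrow> 'a \<Rightarrow> real) \<Rightarrow> real \<Rightarrow> ereal \<Rightarrow> (ereal \<Rightarrow> ereal) \<Rightarrow> ereal" where
  "myers_limit d K N F =
     (if K > 0 \<and> N \<noteq> \<infinity> \<and>
         (SUP (x, y)\<in>UNIV. ereal (d x y)) = ereal (myers_diameter K (real_of_ereal N))
      then Lim (at_right N) F else F N)"

definition U_KN ::
    "('a \<Rightarrow> 'a \<Rightarrow> real) \<Rightarrow> real \<Rightarrow> ereal \<Rightarrow> (real \<Rightarrow> real) \<Rightarrow> 'a measure \<Rightarrow>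
     real \<Rightarrow> ('a \<times> 'a) measure \<Rightarrow> 'a measure \<Rightarrow> ereal" where
  "U_KN d K N U \<nu> t \<pi> \<mu> =
     myers_limit d K N (\<lambda>N'. U_beta U \<nu> (beta_coef d K N' t) \<pi> \<mu>)"

definition U_KN_rev ::
    "('a \<Rightarrow> 'a \<Rightarrow> real) \<Rightarrow> real \<Rightarrow> ereal \<Rightarrow> (real \<Rightarrow> real) \<Rightarrow> 'a measure \<Rightarrow>
     real \<Rightarrow> ('a \<times> 'a) measure \<Rightarrow> 'a measure \<Rightarrow> ereal" where
  "U_KN_rev d K N U \<nu> t \<pi> \<mu> =
     myers_limit d K N
       (\<lambda>N'. U_beta U \<nu> (\<lambda>x y. beta_coef d K N' t y x) (swap_plan d \<pi>) \<mu>)"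

definition U_KN_rev_zero_plus ::
    "('a \<Rightarrow> 'a \<Rightarrow> real) \<Rightarrow> real \<Rightarrow> ereal \<Rightarrow> (real \<Rightarrow> real) \<Rightarrow> 'a measure \<Rightarrow>
     ('a \<times> 'a) measure \<Rightarrow> 'a measure \<Rightarrow> ereal" where
  "U_KN_rev_zero_plus d K N U \<nu> \<pi> \<mu> =
     myers_limit d K N
       (\<lambda>N'. U_beta U \<nu> (\<lambda>x y. beta_zero_plus d K N' y x) (swap_plan d \<pi>) \<mu>)"

definition beta_deriv_KN ::
    "('a \<Rightarrow> 'a \<Rightarrow> real) \<Rightarrow> real \<Rightarrow> ereal \<Rightarrow> 'a \<Rightarrow> 'a \<Rightarrow> ereal" where
  "beta_deriv_KN d K N x y = myers_limit d K N (\<lambda>N'. beta_deriv_one d K N' x y)"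


section \<open>Weak curvature-dimension condition\<close>

definition weak_CD :: "('a \<Rightarrow> 'a \<Rightarrow> real) \<Rightarrow> 'a measure \<Rightarrow> real \<Rightarrow> ereal \<Rightarrow> bool" where
  "weak_CD d \<nu> K N \<longleftrightarrow>
     forward_geodesic_space d \<and> forward_boundedly_compact d \<and>
     locally_finite_borel d \<nu> \<and> sigma_finite_measure \<nu> \<and>
     (\<forall>\<mu>0\<in>prob_c d. \<forall>\<mu>1\<in>prob_c d. msupp d \<mu>0 \<subseteq> msupp d \<nu> \<and> msupp d \<mu>1 \<subseteq> msupp d \<nu> \<longrightarrow>
       (\<exists>\<mu> \<pi>. displacement_interpolation d \<mu> \<pi> \<and> \<mu> 0 = \<mu>0 \<and> \<mu> 1 = \<mu>1 \<and>
         (\<forall>U\<in>DC N. \<forall>t\<in>{0..1}.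
            U_fun U \<nu> (\<mu> t) \<le>
              ereal (1 - t) * U_KN d K N U \<nu> (1 - t) \<pi> \<mu>0 + ereal t * U_KN_rev d K N U \<nu> t \<pi> \<mu>1)))"

end

theory Submission
  imports Defs
begin

text \<open>Along a displacement interpolation \<open>\<mu>\<^sub>t\<close> from \<open>\<mu>\<^sub>0\<close>, convexity of \<open>U\<close> bounds
  \<open>(U\<^sub>\<nu>(\<mu>\<^sub>0) - U\<^sub>\<nu>(\<mu>\<^sub>t)) / t\<close> by the mean over the transport geodesics of the difference quotient of
  \<open>U' \<circ> \<rho>\<^sub>0\<close>, whose upper limit as \<open>t \<rightarrow> 0\<close> is at most \<open>U''(\<rho>\<^sub>0) |\<nabla>\<^sup>-\<rho>\<^sub>0| d\<close>. Writing
  \<open>U(\<rho>/\<beta>) \<beta> = \<rho> m(\<rho>/\<beta>)\<close> with \<open>m(r) = U(r)/r\<close>, disintegration turns the distorted functionals into integrals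
  against \<open>\<pi>\<close>. In the \<open>CD\<close> inequality at time \<open>t\<close>, divided by \<open>t\<close>, the source term then has the limit
  \<open>p(\<rho>\<^sub>0)/\<rho>\<^sub>0 \<beta>'\<^sub>1\<close>, because \<open>r\<^sup>2 m'(r) = p(r)\<close>, and the target term involves \<open>\<beta>\<^sub>0\<^sub>+\<close>. The limits are justified by
  domination when \<open>U\<close> is tame, i.e. linear near \<open>0\<close> and of at most linear pressure; a general \<open>U\<close> is
  approximated by tame functions obtained by damping \<open>p(r)/r\<^sup>1\<^sup>-\<^sup>1\<^sup>/\<^sup>N\<close>. The consequences for \<open>K = 0\<close> and
  \<open>N = \<infinity>\<close> follow from the Cauchy-Schwarz inequality and from \<open>r m'(r) = p(r)/r\<close>, which compares \<open>m\<close>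
  with the logarithm.\<close>

section \<open>Forward metric spaces\<close>

text \<open>All passages to the limit are upper limits, so bounds from above suffice, and the
  convention \<open>\<infinity> - \<infinity> = \<infinity>\<close> keeps the limsup of a sum below
  the sum of the limsups. The source quotient is bounded above because the coefficient at time
  \<open>1 - t\<close> is at least \<open>exp (- C t)\<close> and linear pressure makes
  \<open>m\<close> Lipschitz as a function of the logarithm. Linearity near \<open>0\<close> makes
  \<open>U'\<close> a C^1 function on the whole line with finite \<open>U'(0)\<close>; this controls
  geodesics that run into zeros of \<open>\<rho>0\<close> and pairs with infinite coefficient.
  Interpolants may have a singular part, so the tangent of \<open>U\<close> is taken at a bounded
  version of \<open>\<rho>0\<close> that can be integrated against any probability measure. Damping
  acts on the pressure because membership in \<open>DC N\<close> is a condition on it, and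
  \<open>m\<close> is recovered by integration. At maximal diameter the limit over larger dimensions
  turns the derivative of the coefficient at extremal pairs from \<open>\<infinity>\<close> into
  \<open>-\<infinity>\<close>, so that limit is evaluated before \<open>t\<close> tends to
  \<open>0\<close>. The disintegration rests on the separability and completeness that compactness
  of closed balls provides.\<close>

lemma irreversible_metricD:
  assumes "irreversible_metric d"
  shows "0 \<le> d x y" "d x y = 0 \<longleftrightarrow> x = y" "d x z \<le> d x y + d y z" "d x x = 0"
  using assms unfolding irreversible_metric_def by auto

text \<open>The triangle inequality recentres balls: around a point \<open>x\<close> of
  \<open>fball d y r\<close> the ball of radius \<open>r - d y x\<close> fits. The orientation of
  the distances matches, so no symmetry enters.\<close>

lemma openin_ftop:
  assumes "irreversible_metric d"
  shows "openin (ftop d) V \<longleftrightarrow> (\<forall>x\<in>V. \<exists>r>0. fball d x r \<subseteq> V)"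
proof
  assume "openin (ftop d) V"
  then have "generate_topology_on {fball d x r | x r. True} V"
    by (simp add: ftop_def openin_topology_generated_by_iff)
  then show "\<forall>x\<in>V. \<exists>r>0. fball d x r \<subseteq> V"
  proof induction
    case (Int a b)
    show ?case
    proof
      fix x assume "x \<in> a \<inter> b"
      then obtain r s where "r > 0" "s > 0" "fball d x r \<subseteq> a" "fball d x s \<subseteq> b"
        using Int by blast
      then show "\<exists>r>0. fball d x r \<subseteq> a \<inter> b"
        by (intro exI[of _ "min r s"]) (auto simp: fball_def)
    qed
  next
    case (UN K)
    show ?case
    proof
      fix x assume "x \<in> \<Union> K"
      then obtain k where k: "k \<in> K" "x \<in> k" by auto
      then obtain r where "r > 0" "fball d x r \<subseteq> k" using UN.IH by blast
      then show "\<exists>r>0. fball d x r \<subseteq> \<Union> K" using k by blast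
    qed
  next
    case (Basis s)
    then obtain y r where s: "s = fball d y r" by auto
    show ?case
    proof
      fix x assume "x \<in> s"
      then have "r - d y x > 0" by (simp add: s fball_def)
      moreover have "fball d x (r - d y x) \<subseteq> s"
        unfolding s fball_def
        by (auto simp: less_diff_eq add.commute intro: le_less_trans[OF irreversible_metricD(3)[OF assms, of y _ x]])
      ultimately show "\<exists>r>0. fball d x r \<subseteq> s" by blast
    qed
  qed auto
next
  assume *: "\<forall>x\<in>V. \<exists>r>0. fball d x r \<subseteq> V"
  have "V = \<Union> {fball d x r | x r. x \<in> V \<and> r > 0 \<and> fball d x r \<subseteq> V}" (is "V = \<Union> ?B")
  proof
    show "V \<subseteq> \<Union> ?B"
    proof
      fix x assume x: "x \<in> V"
      then obtain r where r: "r > 0" "fball d x r \<subseteq> V" using * by auto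
      have "x \<in> fball d x r" using r irreversible_metricD(4)[OF assms] by (simp add: fball_def)
      with x r show "x \<in> \<Union> ?B" by blast
    qed
  qed auto
  moreover have "openin (ftop d) (\<Union> ?B)"
    unfolding ftop_def
    by (intro openin_Union) (auto intro!: topology_generated_by_Basis)
  ultimately show "openin (ftop d) V" by simp
qed

locale fbc_space =
  fixes d :: "'a \<Rightarrow> 'a \<Rightarrow> real"
  assumes forward_metric: "forward_metric_space d"
    and boundedly_compact: "forward_boundedly_compact d"
begin

lemma metric: "irreversible_metric d"
  using forward_metric by (simp add: forward_metric_space_def)

lemmas d_nonneg [simp] = irreversible_metricD(1)[OF metric]
  and d_zero = irreversible_metricD(2)[OF metric]
  and d_tri = irreversible_metricD(3)[OF metric]
  and d_refl [simp] = irreversible_metricD(4)[OF metric]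

lemmas openin_iff = openin_ftop[OF metric]

lemma topspace_ftop [simp]: "topspace (ftop d) = UNIV"
proof -
  have "openin (ftop d) UNIV" unfolding openin_iff by (auto intro: exI[of _ 1])
  then show ?thesis using openin_subset by fastforce
qed

lemma openin_fball: "openin (ftop d) (fball d x r)"
  unfolding ftop_def by (auto intro!: topology_generated_by_Basis)

lemma centre_in_fball [simp]: "x \<in> fball d x r \<longleftrightarrow> 0 < r"
  by (simp add: fball_def)

text \<open>The point about which reversibility is controlled. All later boundedness statements
  refer to it, since comparability of \<open>d x y\<close> and \<open>d y x\<close> is available
  only on balls with this centre.\<close>

definition base :: 'a where
  "base = (SOME p. \<exists>\<Theta>. \<forall>r>0. reversibility d (ftop d closure_of fball d p r) \<le> ereal (\<Theta> r))"

text \<open>The infimum in \<open>reversibility\<close> is below \<open>\<Theta> r + 1\<close>, so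
  some admissible constant exists. Balls of nonpositive radius are empty.\<close>

lemma reversible_on_balls:
  "\<exists>C\<ge>1. \<forall>x\<in>ftop d closure_of fball d base r. \<forall>y\<in>ftop d closure_of fball d base r. d x y \<le> C * d y x"
proof (cases "r > 0")
  case True
  have "\<exists>p \<Theta>. \<forall>r>0. reversibility d (ftop d closure_of fball d p r) \<le> ereal (\<Theta> r)"
    using forward_metric unfolding forward_metric_space_def by blast
  then obtain \<Theta> where "reversibility d (ftop d closure_of fball d base r) \<le> ereal (\<Theta> r)"
    using someI_ex[of "\<lambda>p. \<exists>\<Theta>. \<forall>r>0. reversibility d (ftop d closure_of fball d p r) \<le> ereal (\<Theta> r)"] True
    unfolding base_def by blast
  also have "\<dots> < ereal (\<Theta> r + 1)" by simp
  finally show ?thesis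
    unfolding reversibility_def Inf_less_iff by auto
next
  case False
  then have "fball d base r = {}" by (auto simp: fball_def not_less intro: order_trans[OF _ d_nonneg])
  then show ?thesis by (auto intro: exI[of _ 1])
qed

lemma fball_subset_closure: "fball d x r \<subseteq> ftop d closure_of fball d x r"
  by (intro closure_of_subset) simp

lemma reversible_bounded:
  obtains C where "C \<ge> 1" "\<And>x y. d base x < r \<Longrightarrow> d base y < r \<Longrightarrow> d x y \<le> C * d y x"
proof -
  obtain C where "C \<ge> 1" "\<forall>x\<in>ftop d closure_of fball d base r. \<forall>y\<in>ftop d closure_of fball d base r. d x y \<le> C * d y x"
    using reversible_on_balls by blast
  moreover have "x \<in> ftop d closure_of fball d base r" if "d base x < r" for x
    using fball_subset_closure that unfolding fball_def by blast
  ultimately show ?thesis using that by blast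
qed

text \<open>Reversibility on the ball of radius \<open>d base x + 1\<close> compares
  \<open>d y x\<close> with \<open>d x y\<close> as soon as \<open>d x y < 1\<close>; forward
  neighbourhoods of a point are thus also backward neighbourhoods.\<close>

lemma reverse_small:
  assumes "r > 0"
  obtains e where "e > 0" "\<And>y. d x y < e \<Longrightarrow> d y x < r"
proof -
  obtain C where C: "C \<ge> 1" "\<And>y z. d base y < d base x + 1 \<Longrightarrow> d base z < d base x + 1 \<Longrightarrow> d y z \<le> C * d z y"
    using reversible_bounded by blast
  show ?thesis
  proof
    show "min 1 (r / C) > 0" using assms C by simp
    fix y assume y: "d x y < min 1 (r / C)"
    then have "d base y < d base x + 1" using d_tri[of base y x] by simp
    then have "d y x \<le> C * d x y" using C by simp
    also have "\<dots> < C * (r / C)" using y C by (intro mult_strict_left_mono) auto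
    finally show "d y x < r" using C by simp
  qed
qed

text \<open>Compactness gives finitely many centres whose forward balls of radius
  \<open>1 / Suc k\<close> cover a closed ball, which controls only \<open>d q x\<close>. Centres
  and points lie in the same closed ball, so its reversibility constant also controls
  \<open>d x q\<close>.\<close>

lemma countable_dense:
  obtains D where "countable D" "\<And>x e. e > 0 \<Longrightarrow> \<exists>q\<in>D. d q x < e \<and> d x q < e"
proof -
  let ?K = "\<lambda>n::nat. ftop d closure_of fball d base (real n + 1)"
  have "\<exists>F. finite F \<and> F \<subseteq> ?K n \<and> ?K n \<subseteq> (\<Union>y\<in>F. fball d y (1 / real (Suc k)))" for n k
  proof -
    have "compactin (ftop d) (?K n)" using boundedly_compact unfolding forward_boundedly_compact_def by simp
    moreover have "?K n \<subseteq> \<Union> ((\<lambda>y. fball d y (1 / real (Suc k))) ` ?K n)" by auto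
    ultimately obtain \<F> where F: "finite \<F>" "\<F> \<subseteq> (\<lambda>y. fball d y (1 / real (Suc k))) ` ?K n" "?K n \<subseteq> \<Union>\<F>"
      using compactinD[of "ftop d" "?K n" "(\<lambda>y. fball d y (1 / real (Suc k))) ` ?K n"] openin_fball by blast
    then obtain F where "F \<subseteq> ?K n" "finite F" "\<F> = (\<lambda>y. fball d y (1 / real (Suc k))) ` F"
      by (meson finite_subset_image)
    then show ?thesis using F by auto
  qed
  then obtain F where F: "\<And>n k. finite (F n k)" "\<And>n k. F n k \<subseteq> ?K n"
    "\<And>n k. ?K n \<subseteq> (\<Union>y\<in>F n k. fball d y (1 / real (Suc k)))" by metis
  show ?thesis
  proof
    show "countable (\<Union>n k. F n k)" using F(1) by (intro countable_UN) (auto intro: countable_finite)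
    fix x and e :: real assume e: "e > 0"
    obtain n where n: "d base x < real n" using reals_Archimedean2 by blast
    obtain C where C: "C \<ge> 1" "\<forall>x\<in>?K n. \<forall>y\<in>?K n. d x y \<le> C * d y x" using reversible_on_balls by blast
    obtain k where k: "1 / real (Suc k) < e / C" using e C nat_approx_posE[of "e / C"] by (auto simp: )
    have x: "x \<in> ?K n" using n fball_subset_closure by (fastforce simp: fball_def)
    then obtain q where q: "q \<in> F n k" "d q x < 1 / real (Suc k)" using F(3)[of n k] by (auto simp: fball_def)
    then have "d x q \<le> C * d q x" using C x F(2) by blast
    also have "\<dots> < C * (e / C)" using q k C by (intro mult_strict_left_mono) auto
    finally have "d x q < e" using C by simp
    moreover have "e / C \<le> e" using C e by (simp add: field_simps)
    then have "d q x < e" using q k by linarith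
    ultimately show "\<exists>q\<in>(\<Union>n k. F n k). d q x < e \<and> d x q < e" using q by auto
  qed
qed

definition dense_seq :: "nat \<Rightarrow> 'a" where
  "dense_seq = (SOME q. \<forall>x e. e > 0 \<longrightarrow> (\<exists>j. d (q j) x < e \<and> d x (q j) < e))"

lemma dense_seq:
  assumes "e > 0"
  obtains j where "d (dense_seq j) x < e" "d x (dense_seq j) < e"
proof -
  obtain D where D: "countable D" "\<And>x e. e > 0 \<Longrightarrow> \<exists>q\<in>D. d q x < e \<and> d x q < e"
    using countable_dense by metis
  have ne: "D \<noteq> {}" using D(2)[of 1] by auto
  have "\<forall>x e. e > 0 \<longrightarrow> (\<exists>j. d (from_nat_into D j) x < e \<and> d x (from_nat_into D j) < e)"
    using D(2) from_nat_into_surj[OF D(1)] by metis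
  then have "\<forall>x e. e > 0 \<longrightarrow> (\<exists>j. d (dense_seq j) x < e \<and> d x (dense_seq j) < e)"
    unfolding dense_seq_def
    by (rule someI[of "\<lambda>q. \<forall>x e. e > 0 \<longrightarrow> (\<exists>j. d (q j) x < e \<and> d x (q j) < e)"])
  then show ?thesis using that assms by blast
qed

lemma small_ball_in_open:
  assumes "openin (ftop d) V" "x \<in> V"
  obtains j k where "x \<in> fball d (dense_seq j) (1 / real (Suc k))" "fball d (dense_seq j) (1 / real (Suc k)) \<subseteq> V"
proof -
  obtain r where r: "r > 0" "fball d x r \<subseteq> V" using assms openin_iff by blast
  obtain k where k: "1 / real (Suc k) < r / 2" using r nat_approx_posE[of "r/2"] by (auto simp: )
  obtain j where j: "d (dense_seq j) x < 1 / real (Suc k)" "d x (dense_seq j) < 1 / real (Suc k)"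
    using dense_seq[of "1 / real (Suc k)" x] by auto
  show ?thesis
  proof
    show "x \<in> fball d (dense_seq j) (1 / real (Suc k))" using j by (simp add: fball_def)
    show "fball d (dense_seq j) (1 / real (Suc k)) \<subseteq> V"
    proof
      fix z assume "z \<in> fball d (dense_seq j) (1 / real (Suc k))"
      then have "d x z < r" using j k d_tri[of x z "dense_seq j"] by (simp add: fball_def)
      then show "z \<in> V" using r by (auto simp: fball_def)
    qed
  qed
qed

lemma open_eq_Union_balls:
  assumes "openin (ftop d) V"
  shows "V = (\<Union>(j, k) \<in> {(j, k). fball d (dense_seq j) (1 / real (Suc k)) \<subseteq> V}. fball d (dense_seq j) (1 / real (Suc k)))"
  (is "_ = ?W")
proof
  show "V \<subseteq> ?W"
  proof
    fix x assume "x \<in> V"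
    then obtain j k where "x \<in> fball d (dense_seq j) (1 / real (Suc k))" "fball d (dense_seq j) (1 / real (Suc k)) \<subseteq> V"
      using small_ball_in_open[OF assms] by blast
    then show "x \<in> ?W" by blast
  qed
qed blast

lemma sets_open: "openin (ftop d) V \<Longrightarrow> V \<in> sets (fborel d)"
  by (simp add: fborel_def)

lemma space_fborel [simp]: "space (fborel d) = UNIV"
  by (simp add: fborel_def)

lemma sets_fball [measurable]: "fball d x r \<in> sets (fborel d)"
  by (simp add: sets_open openin_fball)

text \<open>Every open set is a countable union of balls about \<open>dense_seq\<close>, so
  measurability reduces to the distances from countably many points.\<close>

lemma measurable_into_fborel:
  assumes "\<And>j k. {z \<in> space M. d (dense_seq j) (f z) < 1 / real (Suc k)} \<in> sets M"
  shows "f \<in> measurable M (fborel d)"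
  unfolding fborel_def
proof (rule measurable_measure_of)
  fix V assume "V \<in> {V. openin (ftop d) V}"
  then have V: "openin (ftop d) V" by simp
  have "f -` V \<inter> space M = (\<Union>(j, k) \<in> {(j, k). fball d (dense_seq j) (1 / real (Suc k)) \<subseteq> V}.
      {z \<in> space M. d (dense_seq j) (f z) < 1 / real (Suc k)})"
    by (subst open_eq_Union_balls[OF V]) (auto simp: fball_def)
  also have "\<dots> \<in> sets M" using assms by (intro sets.countable_UN'') auto
  finally show "f -` V \<inter> space M \<in> sets M" .
qed auto

lemma measurable_dist_from [measurable]: "(\<lambda>y. d x y) \<in> borel_measurable (fborel d)"
proof (rule borel_measurableI_less)
  fix r have "{y \<in> space (fborel d). d x y < r} = fball d x r" by (auto simp: fball_def)
  then show "{y \<in> space (fborel d). d x y < r} \<in> sets (fborel d)" by simp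
qed

lemma openin_dist_to: "openin (ftop d) {x. d x q < r}"
  unfolding openin_iff
proof
  fix x assume "x \<in> {x. d x q < r}"
  then have "r - d x q > 0" by simp
  then obtain e where e: "e > 0" "\<And>y. d x y < e \<Longrightarrow> d y x < r - d x q" using reverse_small by blast
  have "fball d x e \<subseteq> {x. d x q < r}"
    using e(2) by (auto simp: fball_def less_diff_eq intro: le_less_trans[OF d_tri[of _ q x]])
  then show "\<exists>e>0. fball d x e \<subseteq> {x. d x q < r}" using e by blast
qed

lemma measurable_dist_to [measurable]: "(\<lambda>x. d x q) \<in> borel_measurable (fborel d)"
  by (rule borel_measurableI_less) (use openin_dist_to in \<open>auto intro: sets_open\<close>)

text \<open>Measurability for the product sigma-algebra comes from writing \<open>d x y\<close> as
  the infimum of \<open>d x q + d q y\<close> over the dense sequence: each summand depends on a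
  single coordinate, and points \<open>q\<close> close to \<open>y\<close> in both directions attain
  the infimum up to any error.\<close>

lemma measurable_dist:
  "(\<lambda>(x, y). d x y) \<in> borel_measurable (fborel d \<Otimes>\<^sub>M fborel d)"
proof -
  have eq: "d x y = (INF j. d x (dense_seq j) + d (dense_seq j) y)" for x y
  proof (rule antisym)
    show "d x y \<le> (INF j. d x (dense_seq j) + d (dense_seq j) y)"
      by (intro cINF_greatest) (auto intro: d_tri)
    show "(INF j. d x (dense_seq j) + d (dense_seq j) y) \<le> d x y"
    proof (rule field_le_epsilon)
      fix e :: real assume "e > 0"
      then obtain j where j: "d (dense_seq j) y < e / 2" "d y (dense_seq j) < e / 2"
        using dense_seq[of "e/2" y] by auto
      have "(INF j. d x (dense_seq j) + d (dense_seq j) y) \<le> d x (dense_seq j) + d (dense_seq j) y"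
        by (intro cINF_lower bdd_belowI2[of _ 0]) auto
      also have "\<dots> \<le> d x y + e" using j d_tri[of x "dense_seq j" y] by simp
      finally show "(INF j. d x (dense_seq j) + d (dense_seq j) y) \<le> d x y + e" .
    qed
  qed
  have "(\<lambda>p. INF j. d (fst p) (dense_seq j) + d (dense_seq j) (snd p)) \<in> borel_measurable (fborel d \<Otimes>\<^sub>M fborel d)"
    by (intro borel_measurable_cINF) (auto intro!: bdd_belowI2[of _ 0])
  then show ?thesis by (simp add: eq[symmetric] case_prod_beta)
qed

lemma measurable_dist' [measurable (raw)]:
  assumes "f \<in> measurable M (fborel d)" "g \<in> measurable M (fborel d)"
  shows "(\<lambda>z. d (f z) (g z)) \<in> borel_measurable M"
  using measurable_compose[OF measurable_Pair[OF assms] measurable_dist] by simp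

lemma closed_msupp: "openin (ftop d) (- msupp d \<mu>)"
proof -
  have "- msupp d \<mu> = \<Union> {V. openin (ftop d) V \<and> emeasure \<mu> V = 0}"
    by (auto simp: msupp_def not_gr_zero)
  also have "openin (ftop d) \<dots>" by blast
  finally show ?thesis .
qed

text \<open>The complement of the support is a possibly uncountable union of null open sets, but
  each of its points lies in a null ball of the countable base.\<close>

lemma AE_msupp:
  assumes "sets \<mu> = sets (fborel d)"
  shows "AE x in \<mu>. x \<in> msupp d \<mu>"
proof -
  let ?I = "{(j, k). emeasure \<mu> (fball d (dense_seq j) (1 / real (Suc k))) = 0}"
  let ?W = "\<Union>(j, k) \<in> ?I. fball d (dense_seq j) (1 / real (Suc k))"
  have m: "fball d x r \<in> sets \<mu>" for x r using assms by simp
  have "?W \<in> null_sets \<mu>"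
    by (intro null_sets_UN') (auto simp: null_sets_def m)
  moreover have "{x \<in> space \<mu>. x \<notin> msupp d \<mu>} \<subseteq> ?W"
  proof
    fix x assume "x \<in> {x \<in> space \<mu>. x \<notin> msupp d \<mu>}"
    then obtain V where V: "openin (ftop d) V" "x \<in> V" "emeasure \<mu> V = 0" by (auto simp: msupp_def)
    then obtain j k where "x \<in> fball d (dense_seq j) (1 / real (Suc k))" "fball d (dense_seq j) (1 / real (Suc k)) \<subseteq> V"
      using small_ball_in_open by blast
    moreover then have "emeasure \<mu> (fball d (dense_seq j) (1 / real (Suc k))) = 0"
      using V emeasure_mono[of _ V \<mu>] sets_open[OF V(1)] assms by (metis le_zero_eq)
    ultimately show "x \<in> ?W" by blast
  qed
  ultimately show ?thesis by (rule AE_I')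
qed

lemma compactin_bounded:
  assumes "compactin (ftop d) S"
  obtains R where "\<And>x. x \<in> S \<Longrightarrow> d base x < R"
proof -
  have "S \<subseteq> \<Union> (range (\<lambda>n. fball d base (real n)))"
    using reals_Archimedean2 by (auto simp: fball_def)
  then obtain \<F> where F: "finite \<F>" "\<F> \<subseteq> range (\<lambda>n. fball d base (real n))" "S \<subseteq> \<Union>\<F>"
    using compactinD[OF assms, of "range (\<lambda>n. fball d base (real n))"] openin_fball by blast
  then obtain F where F': "finite F" "\<F> = (\<lambda>n. fball d base (real n)) ` F"
    by (meson finite_subset_image)
  show ?thesis
  proof
    fix x assume "x \<in> S"
    then obtain n where n: "n \<in> F" "d base x < real n" using F F' by (auto simp: fball_def)
    then have "n \<le> Max (insert 0 F)" using F' by auto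
    with n show "d base x < real (Max (insert 0 F))" by linarith
  qed
qed

lemma emeasure_compactin_finite:
  assumes "locally_finite_borel d \<nu>" "compactin (ftop d) S" "S \<in> sets \<nu>"
  shows "emeasure \<nu> S < \<infinity>"
proof -
  have s: "sets \<nu> = sets (fborel d)" using assms(1) by (simp add: locally_finite_borel_def)
  let ?V = "{V. openin (ftop d) V \<and> emeasure \<nu> V < \<infinity>}"
  have "S \<subseteq> \<Union> ?V" using assms(1) unfolding locally_finite_borel_def by blast
  then obtain \<F> where F: "finite \<F>" "\<F> \<subseteq> ?V" "S \<subseteq> \<Union>\<F>"
    using compactinD[OF assms(2), of ?V] by blast
  have m: "\<And>V. V \<in> \<F> \<Longrightarrow> V \<in> sets \<nu>" using F s sets_open by auto
  have "emeasure \<nu> S \<le> emeasure \<nu> (\<Union>V\<in>\<F>. V)" using F m by (intro emeasure_mono) auto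
  also have "\<dots> \<le> (\<Sum>V\<in>\<F>. emeasure \<nu> V)" using F m by (intro emeasure_subadditive_finite) auto
  also have "\<dots> < \<infinity>" using F(1,2) by (induction rule: finite_induct) (auto simp: ennreal_add_less_top less_top)
  finally show ?thesis .
qed

section \<open>Lipschitz functions and the descending slope\<close>

lemma openin_lipschitz:
  assumes "forward_lipschitz d f"
  shows "openin (ftop d) {x. f x < a}" "openin (ftop d) {x. a < f x}"
proof -
  obtain C where C: "C > 0" "\<And>x y. f y - f x \<le> C * d x y" using assms unfolding forward_lipschitz_def by blast
  show "openin (ftop d) {x. f x < a}" unfolding openin_iff
  proof
    fix x assume "x \<in> {x. f x < a}"
    then have "(a - f x) / C > 0" using C by simp
    moreover have "fball d x ((a - f x) / C) \<subseteq> {x. f x < a}"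
    proof
      fix y assume "y \<in> fball d x ((a - f x) / C)"
      then have "C * d x y < a - f x" using C by (simp add: fball_def field_simps)
      then show "y \<in> {x. f x < a}" using C(2)[of y x] by simp
    qed
    ultimately show "\<exists>r>0. fball d x r \<subseteq> {x. f x < a}" by blast
  qed
  show "openin (ftop d) {x. a < f x}" unfolding openin_iff
  proof
    fix x assume "x \<in> {x. a < f x}"
    then have "(f x - a) / C > 0" using C by simp
    \<comment> \<open>The Lipschitz condition bounds \<open>f x - f y\<close> by the reversed
      distance \<open>d y x\<close>, so superlevel sets need backward smallness.\<close>
    then obtain e where e: "e > 0" "\<And>y. d x y < e \<Longrightarrow> d y x < (f x - a) / C" using reverse_small by blast
    have "fball d x e \<subseteq> {x. a < f x}"
    proof
      fix y assume "y \<in> fball d x e"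
      then have "C * d y x < f x - a" using C e(2)[of y] by (simp add: fball_def field_simps)
      then show "y \<in> {x. a < f x}" using C(2)[of x y] by simp
    qed
    then show "\<exists>r>0. fball d x r \<subseteq> {x. a < f x}" using e by blast
  qed
qed

lemma measurable_lipschitz:
  assumes "forward_lipschitz d f"
  shows "f \<in> borel_measurable (fborel d)"
  by (rule borel_measurableI_less) (use openin_lipschitz[OF assms] in \<open>auto intro: sets_open\<close>)

text \<open>The radii \<open>1 / Suc k\<close> are cofinal among punctured neighbourhoods, which
  turns the upper limit along a filter into a countable infimum. Measurability uses this form, and
  so does the choice of a definite radius in the slope estimate.\<close>

lemma descending_slope_eq:
  "descending_slope d f x =
    (INF k. SUP y\<in>{y. d x y < 1 / real (Suc k) \<and> y \<noteq> x}. ennreal (max (- (f y - f x)) 0 / d x y))"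
  (is "_ = (INF k. ?S k)")
proof (rule antisym)
  show "descending_slope d f x \<le> (INF k. ?S k)"
  proof (rule INF_greatest)
    fix k
    have "eventually (\<lambda>y. y \<in> {y. d x y < 1 / real (Suc k) \<and> y \<noteq> x}) (atin (ftop d) x)"
      unfolding eventually_atin
      by (intro disjI2 exI[of _ "fball d x (1 / real (Suc k))"]) (auto simp: openin_fball, auto simp: fball_def)
    then have "\<forall>\<^sub>F y in atin (ftop d) x. ennreal (max (- (f y - f x)) 0 / d x y) \<le> ?S k"
      by eventually_elim (auto intro!: SUP_upper2)
    then show "descending_slope d f x \<le> ?S k"
      unfolding descending_slope_def by (rule Limsup_bounded)
  qed
  show "(INF k. ?S k) \<le> descending_slope d f x"
    unfolding descending_slope_def
  proof (rule Limsup_greatest)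
    fix P assume "eventually P (atin (ftop d) x)"
    then obtain V where V: "openin (ftop d) V" "x \<in> V" "\<And>y. y \<in> V - {x} \<Longrightarrow> P y"
      unfolding eventually_atin by auto
    obtain r where r: "r > 0" "fball d x r \<subseteq> V" using V openin_iff by blast
    obtain k where k: "1 / real (Suc k) < r" using r nat_approx_posE[of r] by auto
    have "(INF k. ?S k) \<le> ?S k" by (rule INF_lower) simp
    also have "\<dots> \<le> (SUP y\<in>Collect P. ennreal (max (- (f y - f x)) 0 / d x y))"
      proof (rule SUP_subset_mono)
      show "{y. d x y < 1 / real (Suc k) \<and> y \<noteq> x} \<subseteq> Collect P"
      proof
        fix y assume "y \<in> {y. d x y < 1 / real (Suc k) \<and> y \<noteq> x}"
        then have "y \<in> V - {x}" using r k by (auto simp: fball_def)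
        then show "y \<in> Collect P" using V(3) by simp
      qed
    qed simp
    finally show "(INF k. ?S k) \<le> \<dots>" .
  qed
qed

text \<open>For a fixed radius the supremum over \<open>y\<close> has open superlevel sets: for each
  \<open>y\<close> the conditions on \<open>x\<close> are open, and a union over all
  \<open>y\<close> stays open. The remaining infimum over radii is countable.\<close>

lemma measurable_descending_slope:
  assumes "forward_lipschitz d f"
  shows "descending_slope d f \<in> borel_measurable (fborel d)"
proof -
  have [measurable]: "f \<in> borel_measurable (fborel d)" by (rule measurable_lipschitz[OF assms])
  let ?F = "\<lambda>x y. max (- (f y - f x)) 0 / d x y"
  have cont: "continuous_map (ftop d) euclideanreal f"
    using openin_lipschitz[OF assms] by (simp add: continuous_map_upper_lower_semicontinuous_lt)
  have cont2: "continuous_map (ftop d) euclideanreal (\<lambda>x. d x y)" for y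
  proof -
    have "openin (ftop d) {x. a < d x y}" for a
      unfolding openin_iff
    proof
      fix x assume "x \<in> {x. a < d x y}"
      then have "fball d x (d x y - a) \<subseteq> {x. a < d x y}" "d x y - a > 0"
        using d_tri[of x y] by (auto simp: fball_def) (smt (verit) d_tri)
      then show "\<exists>r>0. fball d x r \<subseteq> {x. a < d x y}" by blast
    qed
    then show ?thesis using openin_dist_to by (simp add: continuous_map_upper_lower_semicontinuous_lt)
  qed
  have op: "openin (ftop d) {x. \<exists>y. d x y < r \<and> y \<noteq> x \<and> a < ?F x y}" if "a \<ge> 0" for r a
  proof -
    have "openin (ftop d) {x. d x y < r \<and> y \<noteq> x \<and> a < ?F x y}" for y
    proof -
      \<comment> \<open>Since \<open>a \<ge> 0\<close>, exceeding \<open>a\<close> excludes the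
        value \<open>0\<close> of the positive part, so the quotient can be cleared and a strict
        inequality between continuous functions of \<open>x\<close> remains.\<close>
      have eq: "{x. d x y < r \<and> y \<noteq> x \<and> a < ?F x y} = {x. d x y < r} \<inter> {x. 0 < d x y} \<inter> {x. 0 < f x - f y - a * d x y}"
        (is "?A = ?B")
      proof (rule set_eqI)
        fix x
        show "x \<in> ?A \<longleftrightarrow> x \<in> ?B"
        proof (cases "y = x")
          case False
          then have pos: "d x y > 0" using d_zero[of x y] d_nonneg[of x y] by (auto simp: order_less_le)
          have "0 \<le> a * d x y" using that by simp
          then show ?thesis using pos False by (auto simp: less_divide_eq max_def)
        qed simp
      qed
      have "continuous_map (ftop d) euclideanreal (\<lambda>x. f x - f y - a * d x y)"
        using cont cont2 by (intro continuous_intros) auto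
      then have "openin (ftop d) {x. 0 < f x - f y - a * d x y}" "openin (ftop d) {x. 0 < d x y}"
        using cont2[of y]
        by (auto simp only: continuous_map_upper_lower_semicontinuous_lt topspace_ftop UNIV_I simp_thms)
      then show ?thesis unfolding eq using openin_dist_to by (intro openin_Int)
    qed
    then have "openin (ftop d) (\<Union>y. {x. d x y < r \<and> y \<noteq> x \<and> a < ?F x y})" by blast
    also have "(\<Union>y. {x. d x y < r \<and> y \<noteq> x \<and> a < ?F x y}) = {x. \<exists>y. d x y < r \<and> y \<noteq> x \<and> a < ?F x y}" by auto
    finally show ?thesis .
  qed
  have "(\<lambda>x. SUP y\<in>{y. d x y < r \<and> y \<noteq> x}. ennreal (?F x y)) \<in> borel_measurable (fborel d)" for r
  proof (rule borel_measurableI_greater)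
    fix a :: ennreal
    show "{x \<in> space (fborel d). a < (SUP y\<in>{y. d x y < r \<and> y \<noteq> x}. ennreal (?F x y))} \<in> sets (fborel d)"
    proof (cases a)
      case (real b)
      have "{x \<in> space (fborel d). a < (SUP y\<in>{y. d x y < r \<and> y \<noteq> x}. ennreal (?F x y))}
        = {x. \<exists>y. d x y < r \<and> y \<noteq> x \<and> b < ?F x y}"
        using real by (auto simp: less_SUP_iff ennreal_less_iff)
      then show ?thesis using op[OF real(1)] sets_open by simp
    qed simp
  qed
  then show ?thesis
    unfolding descending_slope_eq[abs_def] by measurable
qed

end

section \<open>Disintegration\<close>

text \<open>Identification with a monadic bind shows that the formula in \<open>kernel_prod\<close>
  is countably additive and imports the integration rules.\<close>

lemma kernel_prod_eq_bind:
  assumes k: "\<kappa> \<in> measurable M (prob_algebra N)" and s: "sets N = sets M" and ne: "space M \<noteq> {}"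
  shows "kernel_prod M \<kappa> = M \<bind> (\<lambda>x. distr (\<kappa> x) (M \<Otimes>\<^sub>M M) (Pair x))"
    and "(\<lambda>x. distr (\<kappa> x) (M \<Otimes>\<^sub>M M) (Pair x)) \<in> measurable M (subprob_algebra (M \<Otimes>\<^sub>M M))"
proof -
  have [measurable]: "\<kappa> \<in> measurable M (subprob_algebra M)"
    using measurable_prob_algebraD[OF k] subprob_algebra_cong[OF s] by simp
  show m: "(\<lambda>x. distr (\<kappa> x) (M \<Otimes>\<^sub>M M) (Pair x)) \<in> measurable M (subprob_algebra (M \<Otimes>\<^sub>M M))"
    by (rule measurable_distr2[where M = M]) auto
  let ?B = "M \<bind> (\<lambda>x. distr (\<kappa> x) (M \<Otimes>\<^sub>M M) (Pair x))"
  have sB: "sets ?B = sets (M \<Otimes>\<^sub>M M)"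
    using ne by (intro sets_bind[OF _ ne]) auto
  have "kernel_prod M \<kappa> = measure_of (space ?B) (sets ?B) (emeasure ?B)"
    unfolding kernel_prod_def sB sets_eq_imp_space_eq[OF sB]
  proof (rule measure_of_eq)
    fix A assume "A \<in> sigma_sets (space (M \<Otimes>\<^sub>M M)) (sets (M \<Otimes>\<^sub>M M))"
    then have A: "A \<in> sets (M \<Otimes>\<^sub>M M)" by (simp add: sets.sigma_sets_eq)
    have "emeasure ?B A = (\<integral>\<^sup>+x. emeasure (distr (\<kappa> x) (M \<Otimes>\<^sub>M M) (Pair x)) A \<partial>M)"
      by (rule emeasure_bind[OF ne m A])
    also have "\<dots> = (\<integral>\<^sup>+x. emeasure (\<kappa> x) (Pair x -` A) \<partial>M)"
    proof (rule nn_integral_cong)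
      fix x assume x: "x \<in> space M"
      have sk: "sets (\<kappa> x) = sets M" "space (\<kappa> x) = space M"
        using measurable_space[OF k x] s sets_eq_imp_space_eq[OF s] by (auto simp: space_prob_algebra dest: sets_eq_imp_space_eq)
      have "Pair x -` A \<inter> space (\<kappa> x) = Pair x -` A"
        using sets.sets_into_space[OF A] sk by (auto simp: space_pair_measure)
      moreover have "Pair x \<in> measurable (\<kappa> x) (M \<Otimes>\<^sub>M M)"
        using x measurable_Pair1'[OF x, of M] measurable_cong_sets[OF sk(1) refl] by blast
      ultimately show "emeasure (distr (\<kappa> x) (M \<Otimes>\<^sub>M M) (Pair x)) A = emeasure (\<kappa> x) (Pair x -` A)"
        using A by (simp add: emeasure_distr)
    qed
    finally show "(\<integral>\<^sup>+x. emeasure (\<kappa> x) (Pair x -` A) \<partial>M) = emeasure ?B A" by simp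
  qed (use sets.space_closed in auto)
  then show "kernel_prod M \<kappa> = ?B" by (simp add: measure_of_of_measure)
qed

lemma nn_integral_kernel_prod:
  assumes k: "\<kappa> \<in> measurable M (prob_algebra N)" and s: "sets N = sets M" and ne: "space M \<noteq> {}"
    and f: "f \<in> borel_measurable (M \<Otimes>\<^sub>M M)"
  shows "(\<integral>\<^sup>+z. f z \<partial>kernel_prod M \<kappa>) = (\<integral>\<^sup>+x. \<integral>\<^sup>+y. f (x, y) \<partial>\<kappa> x \<partial>M)"
  unfolding kernel_prod_eq_bind(1)[OF k s ne] nn_integral_bind[OF f kernel_prod_eq_bind(2)[OF k s ne]]
proof (rule nn_integral_cong)
  fix x assume x: "x \<in> space M"
  have sk: "sets (\<kappa> x) = sets M"
    using measurable_space[OF k x] s by (auto simp: space_prob_algebra)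
  show "(\<integral>\<^sup>+z. f z \<partial>distr (\<kappa> x) (M \<Otimes>\<^sub>M M) (Pair x)) = (\<integral>\<^sup>+y. f (x, y) \<partial>\<kappa> x)"
    by (rule nn_integral_distr) (simp_all only: measurable_cong_sets[OF sk refl] measurable_Pair1'[OF x] measurable_distr_eq1 f)
qed

lemma sets_kernel_prod [simp]: "sets (kernel_prod M \<kappa>) = sets (M \<Otimes>\<^sub>M M)"
  unfolding kernel_prod_def by (rule sets.sets_measure_of_eq)

text \<open>On the set where \<open>g < f\<close> the difference is nonnegative with integral zero;
  finiteness of the integral of \<open>g\<close> permits the subtraction.\<close>

lemma AE_le_of_set_nn_integral_le:
  fixes f g :: "'a \<Rightarrow> ennreal"
  assumes [measurable]: "f \<in> borel_measurable M" "g \<in> borel_measurable M"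
    and le: "\<And>A. A \<in> sets M \<Longrightarrow> (\<integral>\<^sup>+x. f x * indicator A x \<partial>M) \<le> (\<integral>\<^sup>+x. g x * indicator A x \<partial>M)"
    and fin: "(\<integral>\<^sup>+x. g x \<partial>M) < \<infinity>"
  shows "AE x in M. f x \<le> g x"
proof -
  define A where "A = {x \<in> space M. g x < f x}"
  have A [measurable]: "A \<in> sets M" unfolding A_def by measurable
  have gA: "(\<integral>\<^sup>+x. g x * indicator A x \<partial>M) \<noteq> \<infinity>"
  proof -
    have "(\<integral>\<^sup>+x. g x * indicator A x \<partial>M) \<le> (\<integral>\<^sup>+x. g x \<partial>M)"
      by (intro nn_integral_mono) (auto split: split_indicator)
    then show ?thesis using fin by auto
  qed
  have "(\<integral>\<^sup>+x. f x * indicator A x - g x * indicator A x \<partial>M)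
      = (\<integral>\<^sup>+x. f x * indicator A x \<partial>M) - (\<integral>\<^sup>+x. g x * indicator A x \<partial>M)"
    using gA by (intro nn_integral_diff) (auto simp: A_def split: split_indicator)
  also have "\<dots> = 0" using le[OF A] gA by (simp add: diff_eq_0_iff_ennreal less_top)
  finally have "AE x in M. f x * indicator A x - g x * indicator A x = 0"
    by (subst (asm) nn_integral_0_iff_AE) auto
  moreover have "AE x in M. g x \<noteq> \<infinity>" using fin by (intro nn_integral_PInf_AE) auto
  moreover have "AE x in M. x \<in> space M" by (rule AE_space)
  ultimately show ?thesis
    by eventually_elim (auto simp: A_def diff_eq_0_iff_ennreal less_top not_less split: split_indicator_asm)
qed

text \<open>For each \<open>r\<close> the measure sending \<open>A\<close> to
  \<open>P (A \<times> {..r})\<close> has a density \<open>f r\<close> with respect to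
  \<open>M\<close>. Outside a null set these are monotone over the rationals with limits
  \<open>0\<close> and \<open>1\<close>; making them right continuous gives, for every
  \<open>x\<close>, the distribution function of a measure on the line.\<close>

lemma regular_conditional_distribution_real:
  fixes P :: "('a \<times> real) measure"
  assumes M: "prob_space M" and P: "prob_space P" and sP: "sets P = sets (M \<Otimes>\<^sub>M borel)"
    and marg: "distr P M fst = M"
  obtains \<kappa> where "\<kappa> \<in> measurable M (prob_algebra borel)"
    "\<And>A a. A \<in> sets M \<Longrightarrow> emeasure P (A \<times> {..a}) = (\<integral>\<^sup>+x. emeasure (\<kappa> x) {..a} * indicator A x \<partial>M)"
proof -
  interpret M: prob_space M by fact
  interpret P: prob_space P by fact
  have fstP: "fst \<in> measurable P M" unfolding measurable_cong_sets[OF sP refl] by simp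
  have margA: "emeasure P (A \<times> UNIV) = emeasure M A" if "A \<in> sets M" for A
  proof -
    have "emeasure M A = emeasure (distr P M fst) A" by (simp add: marg)
    also have "\<dots> = emeasure P (fst -` A \<inter> space P)" using fstP that by (rule emeasure_distr)
    also have "fst -` A \<inter> space P = A \<times> UNIV"
      using sets.sets_into_space[OF that] sets_eq_imp_space_eq[OF sP] by (auto simp: space_pair_measure)
    finally show ?thesis by simp
  qed
  define R where "R r = distr (density P (indicator (UNIV \<times> {..r}))) M fst" for r
  have rect: "A \<times> B \<in> sets P" if "A \<in> sets M" "B \<in> sets borel" for A B
    using that sP by auto
  have ind_meas: "(indicator (UNIV \<times> {..r}) :: _ \<Rightarrow> ennreal) \<in> borel_measurable P" for r :: real
  proof -
    have "(\<lambda>z. indicator {..r} (snd z) :: ennreal) \<in> borel_measurable (M \<Otimes>\<^sub>M borel)" by measurable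
    also have "(\<lambda>z. indicator {..r} (snd z) :: ennreal) = indicator (UNIV \<times> {..r})"
      by (auto simp: fun_eq_iff split: split_indicator)
    finally show ?thesis by (simp only: measurable_cong_sets[OF sP refl])
  qed
  have R: "emeasure (R r) A = emeasure P (A \<times> {..r})" if A: "A \<in> sets M" for A r
  proof -
    have "emeasure (R r) A = emeasure (density P (indicator (UNIV \<times> {..r}))) (fst -` A \<inter> space P)"
      unfolding R_def using fstP A by (subst emeasure_distr) auto
    also have "fst -` A \<inter> space P = A \<times> UNIV"
      using sets.sets_into_space[OF A] sets_eq_imp_space_eq[OF sP] by (auto simp: space_pair_measure)
    also have "emeasure (density P (indicator (UNIV \<times> {..r}))) (A \<times> UNIV) = (\<integral>\<^sup>+z. indicator (A \<times> {..r}) z \<partial>P)"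
      using rect[OF A, of UNIV] ind_meas by (subst emeasure_density) (auto intro!: nn_integral_cong split: split_indicator)
    also have "\<dots> = emeasure P (A \<times> {..r})" using rect[OF A] by simp
    finally show ?thesis .
  qed
  have sR: "sets (R r) = sets M" for r by (simp add: R_def)
  have acR: "absolutely_continuous M (R r)" for r
    unfolding absolutely_continuous_def
  proof
    fix A assume A: "A \<in> null_sets M"
    then have "emeasure P (A \<times> {..r}) \<le> emeasure P (A \<times> UNIV)"
      using rect[of A UNIV] by (intro emeasure_mono) auto
    then show "A \<in> null_sets (R r)" using A by (auto simp: null_sets_def sR R margA)
  qed
  define f where "f r = RN_deriv M (R r)" for r
  have f_meas [measurable]: "f r \<in> borel_measurable M" for r by (simp add: f_def)
  have f: "(\<integral>\<^sup>+x. f r x * indicator A x \<partial>M) = emeasure P (A \<times> {..r})" if A: "A \<in> sets M" for A r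
    using M.density_RN_deriv[OF acR sR, of r] A by (metis R emeasure_density f_def f_meas)
  have f_int: "(\<integral>\<^sup>+x. f r x \<partial>M) = emeasure P (space M \<times> {..r})" for r
    using f[OF sets.top, of r] by (simp cong: nn_integral_cong)
  have f_fin: "(\<integral>\<^sup>+x. f r x \<partial>M) < \<infinity>" for r
    unfolding f_int by (simp add: less_top[symmetric])
  have sub: "A \<times> {..r} \<subseteq> A \<times> {..s}" if "r \<le> s" for A :: "'a set" and r s :: real using that by auto
  have mono: "AE x in M. f r x \<le> f s x" if "r \<le> s" for r s
    by (rule AE_le_of_set_nn_integral_le)
       (auto simp: f f_fin[unfolded infinity_ennreal_def] intro!: emeasure_mono sub that rect)
  have le1: "AE x in M. f r x \<le> 1" for r
  proof (rule AE_le_of_set_nn_integral_le)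
    fix A assume A: "A \<in> sets M"
    have "emeasure P (A \<times> {..r}) \<le> emeasure P (A \<times> UNIV)"
      using rect[OF A, of UNIV] by (intro emeasure_mono) auto
    then show "(\<integral>\<^sup>+x. f r x * indicator A x \<partial>M) \<le> (\<integral>\<^sup>+x. 1 * indicator A x \<partial>M)"
      using A by (simp add: f margA)
  qed (auto simp: M.emeasure_space_1)
  have inf0: "AE x in M. (INF n::nat. f (- real n) x) = 0"
  proof -
    have "(\<integral>\<^sup>+x. (INF n::nat. f (- real n) x) \<partial>M) \<le> (INF n::nat. emeasure P (space M \<times> {..- real n}))"
      by (rule INF_greatest) (auto simp: f_int[symmetric] intro!: nn_integral_mono INF_lower)
    also have "\<dots> = emeasure P (\<Inter>n::nat. space M \<times> {..- real n})"
      by (rule INF_emeasure_decseq) (auto simp: decseq_def intro!: rect)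
    also have "(\<Inter>n::nat. space M \<times> {..- real n}) = {}"
    proof (safe)
      fix x and y :: real assume *: "(x, y) \<in> (\<Inter>n::nat. space M \<times> {..- real n})"
      obtain n :: nat where "- y < real n" using reals_Archimedean2 by blast
      moreover have "y \<le> - real n" using * by blast
      ultimately show "(x, y) \<in> {}" by simp
    qed
    finally have "(\<integral>\<^sup>+x. (INF n::nat. f (- real n) x) \<partial>M) = 0" by simp
    then show ?thesis by (subst (asm) nn_integral_0_iff_AE) auto
  qed
  have sup1: "AE x in M. (SUP n::nat. f (real n) x) = 1"
  proof -
    have le: "AE x in M. (SUP n::nat. f (real n) x) \<le> 1"
      using AE_all_countable[THEN iffD2, of "\<lambda>n::nat. \<lambda>x. f (real n) x \<le> 1", OF allI[OF le1]]
      by eventually_elim (auto intro: SUP_least)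
    have "1 = emeasure P (\<Union>n::nat. space M \<times> {..real n})"
    proof -
      have "(\<Union>n::nat. space M \<times> {..real n}) = space P"
        using real_arch_simple sets_eq_imp_space_eq[OF sP] by (auto simp: space_pair_measure)
      then show ?thesis by (simp add: P.emeasure_space_1)
    qed
    also have "\<dots> = (SUP n::nat. emeasure P (space M \<times> {..real n}))"
      by (rule SUP_emeasure_incseq[symmetric]) (auto simp: incseq_def intro!: rect)
    also have "\<dots> \<le> (\<integral>\<^sup>+x. (SUP n::nat. f (real n) x) \<partial>M)"
      by (rule SUP_least) (auto simp: f_int[symmetric] intro!: nn_integral_mono SUP_upper)
    finally have ge: "1 \<le> (\<integral>\<^sup>+x. (SUP n::nat. f (real n) x) \<partial>M)" .
    have le': "(\<integral>\<^sup>+x. (SUP n::nat. f (real n) x) \<partial>M) \<le> (\<integral>\<^sup>+x. 1 \<partial>M)"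
      using le by (rule nn_integral_mono_AE)
    have "(\<integral>\<^sup>+x. 1 - (SUP n::nat. f (real n) x) \<partial>M) = (\<integral>\<^sup>+x. 1 \<partial>M) - (\<integral>\<^sup>+x. (SUP n::nat. f (real n) x) \<partial>M)"
      using le le' by (intro nn_integral_diff) (auto simp: M.emeasure_space_1 top_unique)
    also have "\<dots> = 0" using ge by (simp add: M.emeasure_space_1 diff_eq_0_iff_ennreal less_top)
    finally have "AE x in M. 1 - (SUP n::nat. f (real n) x) = 0"
      by (subst (asm) nn_integral_0_iff_AE) auto
    with le show ?thesis
      by eventually_elim (auto simp: diff_eq_0_iff_ennreal)
  qed
  define good where "good x \<longleftrightarrow> (\<forall>r\<in>\<rat>. \<forall>s\<in>\<rat>. r \<le> s \<longrightarrow> f r x \<le> f s x) \<and> (\<forall>r\<in>\<rat>. f r x \<le> 1) \<and>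
    (INF n::nat. f (- real n) x) = 0 \<and> (SUP n::nat. f (real n) x) = 1" for x
  have good_meas [measurable]: "Measurable.pred M good"
    unfolding good_def using countable_rat by measurable
  have AE_good: "AE x in M. good x"
    unfolding good_def using mono le1 inf0 sup1
    by (auto simp: AE_ball_countable countable_rat)
  \<comment> \<open>At exceptional \<open>x\<close> the distribution function of the unit mass at
    \<open>0\<close> is substituted, so that monotonicity and limits hold everywhere.\<close>
  define h where "h r x = (if good x then f r x else indicator {0..} r)" for r x
  have h_meas [measurable]: "h r \<in> borel_measurable M" for r unfolding h_def by measurable
  have h_mono: "h r x \<le> h s x" if "r \<in> \<rat>" "s \<in> \<rat>" "r \<le> s" for r s x
    using that by (auto simp: h_def good_def split: split_indicator)
  have h_le1: "h r x \<le> 1" if "r \<in> \<rat>" for r x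
    using that by (auto simp: h_def good_def split: split_indicator)
  have h_inf: "(INF n::nat. h (- real n) x) = 0" for x
  proof (cases "good x")
    case False
    have "(INF n::nat. h (- real n) x) \<le> h (- real 1) x" by (rule INF_lower) simp
    then show ?thesis using False by (simp add: h_def)
  qed (simp add: h_def good_def)
  have h_sup: "(SUP n::nat. h (real n) x) = 1" for x
    by (cases "good x") (simp_all add: h_def good_def)
  \<comment> \<open>The infimum over rationals strictly above \<open>a\<close> enforces right
    continuity; it may differ from \<open>h a x\<close> even at rational \<open>a\<close>.\<close>
  define F where "F x a = enn2real (INF r\<in>{r\<in>\<rat>. a < r}. h r x)" for x a
  have ne: "{r\<in>\<rat>. a < r} \<noteq> {}" for a :: real using Rats_dense_in_real[of a "a + 1"] by auto
  have G_le1: "(INF r\<in>{r\<in>\<rat>. a < r}. h r x) \<le> 1" for a x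
  proof -
    obtain r where "r \<in> {r\<in>\<rat>. a < r}" using ne[of a] by blast
    then show ?thesis using h_le1[of r x] by (intro INF_lower2[of r]) auto
  qed
  have eF: "ennreal (F x a) = (INF r\<in>{r\<in>\<rat>. a < r}. h r x)" for x a
    unfolding F_def by (intro ennreal_enn2real le_less_trans[OF G_le1 ennreal_one_less_top])
  have F0: "0 \<le> F x a" for x a by (simp add: F_def)
  have F_le: "ennreal (F x a) \<le> h r x" if "r \<in> \<rat>" "a < r" for x a r
    unfolding eF using that by (auto intro: INF_lower)
  have F_ge: "h r x \<le> ennreal (F x a)" if "r \<in> \<rat>" "r \<le> a" for x a r
    unfolding eF using that by (intro INF_greatest h_mono) auto
  have F_mono: "F x a \<le> F x b" if "a \<le> b" for x a b
  proof -
    have "ennreal (F x a) \<le> ennreal (F x b)"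
      unfolding eF using that by (intro INF_superset_mono) auto
    then show ?thesis using F0 by (simp add: ennreal_le_iff)
  qed
  have F1: "F x a \<le> 1" for x a using G_le1[of x a] unfolding eF[symmetric] by simp
  have F_right: "continuous (at_right a) (F x)" for x a
    unfolding continuous_within
  proof (rule tendstoI)
    fix e :: real assume e: "e > 0"
    have "(INF r\<in>{r\<in>\<rat>. a < r}. h r x) < ennreal (F x a + e)"
      unfolding eF[symmetric] using e F0 by (simp add: ennreal_less_iff)
    then obtain r where r: "r \<in> \<rat>" "a < r" "h r x < ennreal (F x a + e)" by (auto simp: INF_less_iff)
    have "eventually (\<lambda>b. b \<in> {a<..<r}) (at_right a)" using r eventually_at_right_real by blast
    then show "\<forall>\<^sub>F b in at_right a. dist (F x b) (F x a) < e"
    proof eventually_elim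
      case (elim b)
      then have "ennreal (F x b) < ennreal (F x a + e)" using F_le[of r b x] r by auto
      then have "F x b < F x a + e" using F0[of x b] by (simp add: ennreal_less_iff)
      with F_mono[of a b x] elim show ?case by (simp add: dist_real_def)
    qed
  qed
  have F_bot: "(F x \<longlongrightarrow> 0) at_bot" for x
  proof (rule tendstoI)
    fix e :: real assume e: "e > 0"
    have "(INF n::nat. h (- real n) x) < ennreal e" using e by (simp add: h_inf)
    then obtain n :: nat where n: "h (- real n) x < ennreal e" by (auto simp: INF_less_iff)
    have "eventually (\<lambda>b. b < - real n) at_bot" by (rule eventually_gt_at_bot)
    then show "\<forall>\<^sub>F b in at_bot. dist (F x b) 0 < e"
    proof eventually_elim
      case (elim b)
      then have "ennreal (F x b) < ennreal e" using F_le[of "- real n" b x] n by auto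
      then show ?case using F0[of x b] by (simp add: ennreal_less_iff)
    qed
  qed
  have F_top: "(F x \<longlongrightarrow> 1) at_top" for x
  proof (rule tendstoI)
    fix e :: real assume e: "e > 0"
    have "ennreal (1 - e) < (SUP n::nat. h (real n) x)" using e ennreal_lessI[of 1 "1 - e"] by (simp add: h_sup)
    then obtain n :: nat where n: "ennreal (1 - e) < h (real n) x" by (auto simp: less_SUP_iff)
    have "eventually (\<lambda>b. real n \<le> b) at_top" by (rule eventually_ge_at_top)
    then show "\<forall>\<^sub>F b in at_top. dist (F x b) 1 < e"
    proof eventually_elim
      case (elim b)
      then have "ennreal (1 - e) < ennreal (F x b)" using F_ge[of "real n" b x] n by auto
      then have "1 - e < F x b" using F0[of x b] by (cases "1 - e \<ge> 0") (auto simp: ennreal_less_iff)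
      then show ?case using F1[of x b] by (simp add: dist_real_def)
    qed
  qed
  define \<kappa> where "\<kappa> x = interval_measure (F x)" for x
  have rd: "real_distribution (\<kappa> x)" for x
    unfolding \<kappa>_def by (rule real_distribution_interval_measure) (use F_mono F_right F_bot F_top in auto)
  have k_atMost: "emeasure (\<kappa> x) {..a} = ennreal (F x a)" for x a
    unfolding \<kappa>_def by (rule emeasure_interval_measure_Iic) (use F_mono F_right F_bot in auto)
  have F_meas: "(\<lambda>x. ennreal (F x a)) \<in> borel_measurable M" for a
    unfolding eF using countable_subset[OF _ countable_rat, of "{r\<in>\<rat>. a < r}"] by measurable
  show ?thesis
  proof
    show "\<kappa> \<in> measurable M (prob_algebra borel)"
    proof (rule measurable_prob_algebra_generated[where \<Omega> = UNIV and G = "range atMost"])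
      show "sets (borel :: real measure) = sigma_sets UNIV (range atMost)"
        unfolding borel_eq_atMost by (simp add: sets_measure_of)
      show "Int_stable (range (atMost :: real \<Rightarrow> real set))"
        by (auto simp: Int_stable_def)
      fix x show "prob_space (\<kappa> x)" using rd[of x] by (simp add: real_distribution_def)
      show "sets (\<kappa> x) = sets borel" by (simp add: \<kappa>_def)
    next
      fix A :: "real set" assume "A \<in> range atMost"
      then show "(\<lambda>x. emeasure (\<kappa> x) A) \<in> borel_measurable M" using k_atMost F_meas by auto
    qed auto
  next
    fix A and a :: real assume A: "A \<in> sets M"
    \<comment> \<open>The identity is known for the densities at rationals; a decreasing rational
      sequence carries it to \<open>a\<close>, by monotone convergence on one side and continuity
      from above of \<open>P\<close> on the other.\<close>
    obtain r where r: "\<And>n. r n \<in> \<rat>" "\<And>n. a < r n" "decseq r" "r \<longlonglongrightarrow> a"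
    proof -
      have "\<exists>q\<in>\<rat>. a < q \<and> q < a + 1" by (rule Rats_dense_in_real) simp
      then obtain r0 where r0: "r0 \<in> \<rat>" "a < r0" by auto
      have "\<exists>r. \<forall>n. (r n \<in> \<rat> \<and> a < r n \<and> r n < a + 1 / real (Suc n)) \<and> r (Suc n) \<le> r n"
      proof (rule dependent_nat_choice)
        show "\<exists>x. x \<in> \<rat> \<and> a < x \<and> x < a + 1 / real (Suc 0)" using Rats_dense_in_real[of a "a+1"] by auto
        fix x n assume "x \<in> \<rat> \<and> a < x \<and> x < a + 1 / real (Suc n)"
        then show "\<exists>y. (y \<in> \<rat> \<and> a < y \<and> y < a + 1 / real (Suc (Suc n))) \<and> y \<le> x"
          using Rats_dense_in_real[of a "min x (a + 1 / real (Suc (Suc n)))"] by auto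
      qed
      then obtain r where r: "\<And>n. r n \<in> \<rat>" "\<And>n. a < r n" "\<And>n. r n < a + 1 / real (Suc n)" "\<And>n. r (Suc n) \<le> r n" by blast
      moreover have "r \<longlonglongrightarrow> a"
      proof (rule tendsto_sandwich[of "\<lambda>_. a"])
        show "(\<lambda>n. a + 1 / real (Suc n)) \<longlonglongrightarrow> a"
          using LIMSEQ_inverse_real_of_nat_add[of a] by (simp add: inverse_eq_divide)
      qed (use r in \<open>auto intro!: always_eventually less_imp_le\<close>)
      ultimately show ?thesis using that decseq_SucI by blast
    qed
    have "(\<integral>\<^sup>+x. emeasure (\<kappa> x) {..a} * indicator A x \<partial>M) = (\<integral>\<^sup>+x. (INF n. h (r n) x * indicator A x) \<partial>M)"
    proof (rule nn_integral_cong)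
      fix x
      have "ennreal (F x a) = (INF n. h (r n) x)"
      proof (rule antisym)
        show "ennreal (F x a) \<le> (INF n. h (r n) x)" using r F_le by (intro INF_greatest) auto
        show "(INF n. h (r n) x) \<le> ennreal (F x a)"
          unfolding eF
        proof (rule INF_greatest)
          fix q assume q: "q \<in> {r\<in>\<rat>. a < r}"
          then have "eventually (\<lambda>n. r n < q) sequentially" using r(4) order_tendstoD(2) by fastforce
          then obtain n where "r n < q" by (auto simp: eventually_sequentially)
          then show "(INF n. h (r n) x) \<le> h q x" using q r h_mono[of "r n" q x] by (intro INF_lower2[of n]) auto
        qed
      qed
      then show "emeasure (\<kappa> x) {..a} * indicator A x = (INF n. h (r n) x * indicator A x)"
        by (auto simp: k_atMost split: split_indicator)
    qed
    also have "\<dots> = (INF n. \<integral>\<^sup>+x. h (r n) x * indicator A x \<partial>M)"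
    proof (rule nn_integral_monotone_convergence_INF_decseq[where i = 0])
      show "decseq (\<lambda>n x. h (r n) x * indicator A x)"
        proof (rule decseq_SucI, rule le_funI)
        fix n x
        show "h (r (Suc n)) x * indicator A x \<le> h (r n) x * indicator A x"
          using r by (intro mult_right_mono h_mono) (auto simp: decseq_Suc_iff)
      qed
      have "(\<integral>\<^sup>+x. h (r 0) x * indicator A x \<partial>M) \<le> (\<integral>\<^sup>+x. 1 \<partial>M)"
        using h_le1 r by (intro nn_integral_mono) (auto split: split_indicator)
      then show "(\<integral>\<^sup>+x. h (r 0) x * indicator A x \<partial>M) < \<infinity>" using le_less_trans[OF _ ennreal_one_less_top] by (simp add: M.emeasure_space_1)
    qed (use A in measurable)
    also have "\<dots> = (INF n. emeasure P (A \<times> {..r n}))"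
    proof (rule INF_cong[OF refl])
      fix n
      have "(\<integral>\<^sup>+x. h (r n) x * indicator A x \<partial>M) = (\<integral>\<^sup>+x. f (r n) x * indicator A x \<partial>M)"
        using AE_good by (intro nn_integral_cong_AE) (auto simp: h_def)
      then show "(\<integral>\<^sup>+x. h (r n) x * indicator A x \<partial>M) = emeasure P (A \<times> {..r n})" using f[OF A] by simp
    qed
    also have "\<dots> = emeasure P (\<Inter>n. A \<times> {..r n})"
      using r(3) by (intro INF_emeasure_decseq) (auto simp: decseq_Suc_iff intro!: rect A intro: order_trans)
    also have "(\<Inter>n. A \<times> {..r n}) = A \<times> {..a}"
    proof safe
      fix x y assume *: "(x, y) \<in> (\<Inter>n. A \<times> {..r n})"
      then show "x \<in> A" by auto
      show "y \<le> a" using * by (intro LIMSEQ_le_const[OF r(4)]) auto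
    next
      fix x y n assume "y \<le> a" then show "y \<le> r n" using r(2)[of n] by linarith
    qed
    finally show "emeasure P (A \<times> {..a}) = (\<integral>\<^sup>+x. emeasure (\<kappa> x) {..a} * indicator A x \<partial>M)" by simp
  qed
qed

text \<open>A uniqueness argument on half-lines with \<open>A\<close> fixed extends the identity to
  rectangles, and one on rectangles identifies \<open>P\<close> with a bind; the integral formula is
  the one for binds.\<close>

lemma regular_conditional_distribution_real':
  fixes P :: "('a \<times> real) measure"
  assumes M: "prob_space M" and P: "prob_space P" and sP: "sets P = sets (M \<Otimes>\<^sub>M borel)"
    and marg: "distr P M fst = M"
  obtains \<kappa> where "\<kappa> \<in> measurable M (prob_algebra borel)"
    "\<And>f. f \<in> borel_measurable (M \<Otimes>\<^sub>M borel) \<Longrightarrow> (\<integral>\<^sup>+z. f z \<partial>P) = (\<integral>\<^sup>+x. \<integral>\<^sup>+y. f (x, y) \<partial>\<kappa> x \<partial>M)"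
proof -
  interpret M: prob_space M by fact
  interpret P: prob_space P by fact
  obtain \<kappa> where k: "\<kappa> \<in> measurable M (prob_algebra borel)"
    and atMost: "\<And>A a. A \<in> sets M \<Longrightarrow> emeasure P (A \<times> {..a}) = (\<integral>\<^sup>+x. emeasure (\<kappa> x) {..a} * indicator A x \<partial>M)"
    using regular_conditional_distribution_real[OF assms] by blast
  note [measurable] = measurable_prob_algebraD[OF k]
  have sk: "sets (\<kappa> x) = sets borel" "space (\<kappa> x) = UNIV" if "x \<in> space M" for x
    using measurable_space[OF k that] by (auto simp: space_prob_algebra dest: sets_eq_imp_space_eq)
  let ?N = "\<lambda>x. distr (\<kappa> x) (M \<Otimes>\<^sub>M borel) (Pair x)"
  have m: "?N \<in> measurable M (subprob_algebra (M \<Otimes>\<^sub>M borel))"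
    by (rule measurable_distr2[where M = borel]) auto
  have eN: "emeasure (?N x) (A \<times> B) = emeasure (\<kappa> x) B * indicator A x"
    if "x \<in> space M" "A \<in> sets M" "B \<in> sets borel" for x A B
  proof -
    have "emeasure (?N x) (A \<times> B) = emeasure (\<kappa> x) (Pair x -` (A \<times> B) \<inter> space (\<kappa> x))"
      using that measurable_Pair1'[OF that(1), of borel] measurable_cong_sets[OF sk(1)[OF that(1)] refl]
      by (subst emeasure_distr) auto
    also have "Pair x -` (A \<times> B) \<inter> space (\<kappa> x) = (if x \<in> A then B else {})"
      using sk(2)[OF that(1)] by auto
    finally show ?thesis by (auto split: split_indicator)
  qed
  let ?B = "M \<bind> ?N"
  have sB: "sets ?B = sets (M \<Otimes>\<^sub>M borel)"
    by (intro sets_bind[OF _ M.not_empty]) auto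
  have eB: "emeasure ?B (A \<times> B) = (\<integral>\<^sup>+x. emeasure (\<kappa> x) B * indicator A x \<partial>M)"
    if "A \<in> sets M" "B \<in> sets borel" for A B
    using that by (subst emeasure_bind[OF M.not_empty m]) (auto intro!: nn_integral_cong simp: eN)
  have snd: "snd \<in> measurable P borel" "snd \<in> measurable ?B borel"
    unfolding measurable_cong_sets[OF sP refl] measurable_cong_sets[OF sB refl] by simp_all
  have snd_vimage: "snd -` B \<inter> space P \<inter> (A \<times> UNIV) = A \<times> B" "snd -` B \<inter> space ?B \<inter> (A \<times> UNIV) = A \<times> B"
    if "A \<in> sets M" for A B
    using sets.sets_into_space[OF that] sets_eq_imp_space_eq[OF sP] sets_eq_imp_space_eq[OF sB]
    by (auto simp: space_pair_measure)
  have distr_snd: "emeasure (distr (density Q (indicator (A \<times> UNIV))) borel snd) B = emeasure Q (A \<times> B)"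
    if "A \<in> sets M" "B \<in> sets borel" "sets Q = sets (M \<Otimes>\<^sub>M borel)" for A B Q
  proof -
    have "snd \<in> measurable Q borel" unfolding measurable_cong_sets[OF that(3) refl] by simp
    then have "emeasure (distr (density Q (indicator (A \<times> UNIV))) borel snd) B
      = emeasure (density Q (indicator (A \<times> UNIV))) (snd -` B \<inter> space Q)"
      using that by (subst emeasure_distr) auto
    also have "\<dots> = emeasure Q ((A \<times> UNIV) \<inter> (snd -` B \<inter> space Q))"
    proof (rule emeasure_restricted)
      show "A \<times> UNIV \<in> sets Q" using that by simp
      show "snd -` B \<inter> space Q \<in> sets Q" by (rule measurable_sets[OF \<open>snd \<in> measurable Q borel\<close> that(2)])
    qed
    also have "(A \<times> UNIV) \<inter> (snd -` B \<inter> space Q) = A \<times> B"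
      using sets.sets_into_space[OF that(1)] sets_eq_imp_space_eq[OF that(3)] by (auto simp: space_pair_measure)
    finally show ?thesis .
  qed
  have rect: "emeasure P (A \<times> B) = emeasure ?B (A \<times> B)" if A: "A \<in> sets M" and B: "B \<in> sets borel" for A B
  proof -
    have "distr (density P (indicator (A \<times> UNIV))) borel snd = distr (density ?B (indicator (A \<times> UNIV))) borel snd"
    proof (rule measure_eqI_generator_eq[where E = "range atMost" and \<Omega> = UNIV and A = "\<lambda>n. {..real n}"])
      show "sets (distr (density P (indicator (A \<times> UNIV))) borel snd) = sigma_sets UNIV (range (atMost :: real \<Rightarrow> _))"
        "sets (distr (density ?B (indicator (A \<times> UNIV))) borel snd) = sigma_sets UNIV (range (atMost :: real \<Rightarrow> _))"
        by (simp_all add: borel_eq_atMost sets_measure_of)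
      show "(\<Union>i. {..real i}) = UNIV" using real_arch_simple by auto
      show "emeasure (distr (density P (indicator (A \<times> UNIV))) borel snd) {..real i} \<noteq> \<infinity>" for i
        using A by (subst distr_snd[OF _ _ sP]) auto
      fix X :: "real set" assume "X \<in> range atMost"
      then show "emeasure (distr (density P (indicator (A \<times> UNIV))) borel snd) X
          = emeasure (distr (density ?B (indicator (A \<times> UNIV))) borel snd) X"
        using A by (auto simp: distr_snd[OF _ _ sP] distr_snd[OF _ _ sB] eB atMost)
    qed (auto simp: Int_stable_def)
    then show ?thesis using distr_snd[OF A B sP] distr_snd[OF A B sB] by simp
  qed
  have PB: "P = ?B"
  proof (rule measure_eqI_generator_eq[OF Int_stable_pair_measure_generator pair_measure_closed])
    show "sets P = sigma_sets (space M \<times> space borel) {a \<times> b |a b. a \<in> sets M \<and> b \<in> sets borel}"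
      "sets ?B = sigma_sets (space M \<times> space borel) {a \<times> b |a b. a \<in> sets M \<and> b \<in> sets borel}"
      using sP sB by (simp_all add: sets_pair_measure)
    show "range (\<lambda>_::nat. space M \<times> UNIV) \<subseteq> {a \<times> b |a b. a \<in> sets M \<and> b \<in> sets (borel :: real measure)}"
      using sets.top[of M] sets.top[of "borel :: real measure"] unfolding space_borel by blast
    show "emeasure P (space M \<times> UNIV) \<noteq> \<infinity>" by simp
  qed (auto simp: rect)
  show ?thesis
  proof (rule that[OF k])
    fix f :: "'a \<times> real \<Rightarrow> ennreal" assume f: "f \<in> borel_measurable (M \<Otimes>\<^sub>M borel)"
    show "(\<integral>\<^sup>+z. f z \<partial>P) = (\<integral>\<^sup>+x. \<integral>\<^sup>+y. f (x, y) \<partial>\<kappa> x \<partial>M)"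
      unfolding PB nn_integral_bind[OF f m]
    proof (rule nn_integral_cong)
      fix x assume x: "x \<in> space M"
      show "(\<integral>\<^sup>+z. f z \<partial>?N x) = (\<integral>\<^sup>+y. f (x, y) \<partial>\<kappa> x)"
        by (rule nn_integral_distr)
           (simp_all only: measurable_cong_sets[OF sk(1)[OF x] refl] measurable_Pair1'[OF x] measurable_distr_eq1 f)
    qed
  qed
qed

section \<open>Coding sequences of bits by ternary expansions\<close>

definition shift3 :: "real \<Rightarrow> real" where
  "shift3 z = 3 * (z - (if 1 \<le> z then 1 else 0))"

text \<open>Digits are \<open>0\<close> or \<open>1\<close> and position \<open>0\<close> has weight
  \<open>1\<close>. The part after position \<open>0\<close> is at most \<open>1/2\<close>, so
  comparison with \<open>1\<close> reads the leading digit, and \<open>shift3\<close> removes it and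
  moves the others up. In base \<open>2\<close> the tail could reach \<open>1\<close> and the code
  would be ambiguous.\<close>

lemma shift3_code:
  fixes B :: "nat \<Rightarrow> bool"
  shows "1 \<le> (shift3 ^^ n) (\<Sum>k. of_bool (B k) / 3 ^ k) \<longleftrightarrow> B n"
proof -
  have geometric: "summable (\<lambda>k. 1 / 3 ^ k :: real)" using summable_geometric[of "1/3::real"] by (simp add: power_divide)
  have summable: "summable (\<lambda>k. of_bool (C k) / 3 ^ k :: real)" for C :: "nat \<Rightarrow> bool"
    by (rule summable_comparison_test[OF _ geometric]) auto
  have nonneg: "0 \<le> (\<Sum>k. of_bool (C k) / 3 ^ k :: real)" for C :: "nat \<Rightarrow> bool"
    by (rule suminf_nonneg[OF summable]) auto
  have upper: "(\<Sum>k. of_bool (C k) / 3 ^ k :: real) \<le> 3 / 2" for C :: "nat \<Rightarrow> bool"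
  proof -
    have "(\<Sum>k. of_bool (C k) / 3 ^ k :: real) \<le> (\<Sum>k. 1 / 3 ^ k)"
      by (rule suminf_le[OF _ summable geometric]) auto
    then show ?thesis using suminf_geometric[of "1/3::real"] by (simp add: power_divide)
  qed
  have split: "(\<Sum>k. of_bool (C k) / 3 ^ k :: real) = of_bool (C 0) + (\<Sum>k. of_bool (C (Suc k)) / 3 ^ k) / 3" for C :: "nat \<Rightarrow> bool"
  proof -
    have "(\<Sum>k. of_bool (C (Suc k)) / 3 ^ Suc k :: real) = (\<Sum>k. of_bool (C (Suc k)) / 3 ^ k) / 3"
      using suminf_divide[OF summable[of "\<lambda>k. C (Suc k)"], of 3] by (simp add: mult.commute)
    then show ?thesis using suminf_split_head[OF summable[of C]] by simp
  qed
  have ge1: "1 \<le> (\<Sum>k. of_bool (C k) / 3 ^ k :: real) \<longleftrightarrow> C 0" for C :: "nat \<Rightarrow> bool"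
    using split[of C] nonneg[of "\<lambda>k. C (Suc k)"] upper[of "\<lambda>k. C (Suc k)"] by (auto simp: of_bool_def)
  have "(shift3 ^^ n) (\<Sum>k. of_bool (B k) / 3 ^ k) = (\<Sum>k. of_bool (B (k + n)) / 3 ^ k)"
  proof (induction n)
    case (Suc n)
    have "shift3 (\<Sum>k. of_bool (B (k + n)) / 3 ^ k) = (\<Sum>k. of_bool (B (k + Suc n)) / 3 ^ k)"
      using split[of "\<lambda>k. B (k + n)"] ge1[of "\<lambda>k. B (k + n)"] by (auto simp: shift3_def)
    then show ?case using Suc by simp
  qed simp
  then show ?thesis using ge1[of "\<lambda>k. B (k + n)"] by simp
qed

lemma measurable_shift3 [measurable]: "(shift3 ^^ n) \<in> borel_measurable borel"
proof (induction n)
  case (Suc n)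
  have [measurable]: "shift3 \<in> borel_measurable borel" unfolding shift3_def by measurable
  show ?case using Suc by simp
qed simp

context fbc_space
begin

text \<open>Points are coded by reals: the ternary digits record membership in the members of a countable
  base, so that decoding is a measurable left inverse.\<close>

definition near :: "nat \<Rightarrow> 'a \<Rightarrow> bool" where
  "near n y \<longleftrightarrow> (case prod_decode n of (j, m) \<Rightarrow> d (dense_seq j) y < (1/2) ^ m \<and> d y (dense_seq j) < (1/2) ^ m)"

definition code :: "'a \<Rightarrow> real" where
  "code y = (\<Sum>n. of_bool (near n y) / 3 ^ n)"

text \<open>In a code the digit at \<open>prod_encode (j, m)\<close> records whether
  \<open>dense_seq j\<close> is within \<open>(1/2) ^ m\<close> of the point in both directions.
  Taking the least such \<open>j\<close> keeps the choice measurable in the real argument.\<close>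

definition approx :: "nat \<Rightarrow> real \<Rightarrow> 'a" where
  "approx m z = dense_seq (LEAST j. 1 \<le> (shift3 ^^ prod_encode (j, m)) z)"

definition approx_Cauchy :: "real \<Rightarrow> bool" where
  "approx_Cauchy z \<longleftrightarrow> (\<forall>k. \<exists>n. \<forall>i\<ge>n. \<forall>j\<ge>n. d (approx i z) (approx j z) < 1 / real (Suc k))"

text \<open>For reals that are not codes the approximations may fail to be Cauchy, and the value is
  \<open>base\<close>. The limit is required in both directions because \<open>d\<close> is not
  symmetric.\<close>

definition decode :: "real \<Rightarrow> 'a" where
  "decode z = (if approx_Cauchy z then SOME y. (\<lambda>m. d y (approx m z)) \<longlonglongrightarrow> 0 \<and> (\<lambda>m. d (approx m z) y) \<longlonglongrightarrow> 0 else base)"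

lemma approx_code: "d (approx m (code y)) y < (1/2) ^ m" "d y (approx m (code y)) < (1/2) ^ m"
proof -
  have eq: "1 \<le> (shift3 ^^ prod_encode (j, m)) (code y) \<longleftrightarrow> d (dense_seq j) y < (1/2) ^ m \<and> d y (dense_seq j) < (1/2) ^ m" for j
    unfolding code_def shift3_code near_def by simp
  obtain j where "d (dense_seq j) y < (1/2) ^ m" "d y (dense_seq j) < (1/2) ^ m" by (rule dense_seq[of "(1/2)^m"]) simp
  then have "1 \<le> (shift3 ^^ prod_encode (j, m)) (code y)" using eq by blast
  then have "1 \<le> (shift3 ^^ prod_encode (LEAST j. 1 \<le> (shift3 ^^ prod_encode (j, m)) (code y), m)) (code y)"
    by (rule LeastI)
  then show "d (approx m (code y)) y < (1/2) ^ m" "d y (approx m (code y)) < (1/2) ^ m"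
    unfolding eq approx_def by auto
qed

text \<open>A tail lies in a compact closed ball. Were there no cluster point, finitely many balls,
  each eventually avoided by the sequence, would cover it. The Cauchy property upgrades a cluster
  point to a limit, and reversibility on the ball gives the other direction.\<close>

lemma Cauchy_converges:
  assumes "\<And>k. \<exists>n. \<forall>i\<ge>n. \<forall>j\<ge>n. d (g i) (g j) < 1 / real (Suc k)"
  obtains y where "(\<lambda>m. d y (g m)) \<longlonglongrightarrow> 0" "(\<lambda>m. d (g m) y) \<longlonglongrightarrow> 0"
proof -
  have cauchy: "\<exists>n. \<forall>i\<ge>n. \<forall>j\<ge>n. d (g i) (g j) < e" if "e > 0" for e
  proof -
    obtain k where "1 / real (Suc k) < e" by (rule nat_approx_posE[OF \<open>e > 0\<close>])
    then show ?thesis using assms[of k] by (meson order_less_trans)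
  qed
  obtain n0 where n0: "\<And>i j. i \<ge> n0 \<Longrightarrow> j \<ge> n0 \<Longrightarrow> d (g i) (g j) < 1" using cauchy[of 1] by auto
  define r where "r = d base (g n0) + 1"
  let ?K = "ftop d closure_of fball d base r"
  have in_ball: "g i \<in> fball d base r" if "i \<ge> n0" for i
    using n0[of n0 i] that d_tri[of base "g i" "g n0"] by (simp add: fball_def r_def)
  have K: "compactin (ftop d) ?K"
    using boundedly_compact unfolding forward_boundedly_compact_def r_def by (simp add: add_nonneg_pos)
  have "\<exists>y\<in>?K. \<forall>e>0. \<forall>n. \<exists>i\<ge>n. d y (g i) < e"
  proof (rule ccontr)
    assume "\<not> ?thesis"
    then obtain e n where en: "\<And>y. y \<in> ?K \<Longrightarrow> e y > 0" "\<And>y i. y \<in> ?K \<Longrightarrow> i \<ge> n y \<Longrightarrow> \<not> d y (g i) < e y" by metis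
    obtain \<F> where F: "finite \<F>" "\<F> \<subseteq> (\<lambda>y. fball d y (e y)) ` ?K" "?K \<subseteq> \<Union>\<F>"
      using compactinD[OF K, of "(\<lambda>y. fball d y (e y)) ` ?K"] openin_fball en(1) by (force simp: fball_def)
    then obtain Y where Y: "Y \<subseteq> ?K" "finite Y" "\<F> = (\<lambda>y. fball d y (e y)) ` Y" by (meson finite_subset_image)
    define i where "i = Max (insert n0 (n ` Y))"
    have i: "i \<ge> n0" "\<And>y. y \<in> Y \<Longrightarrow> i \<ge> n y" using Y by (auto simp: i_def)
    have "g i \<in> ?K" using in_ball[OF i(1)] fball_subset_closure by blast
    then obtain y where "y \<in> Y" "d y (g i) < e y" using F(3) Y(3) by (auto simp: fball_def)
    then show False using en(2)[of y i] i(2) Y(1) by blast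
  qed
  then obtain y where y: "y \<in> ?K" "\<And>e n. e > 0 \<Longrightarrow> \<exists>i\<ge>n. d y (g i) < e" by blast
  obtain C where C: "C \<ge> 1" "\<forall>x\<in>?K. \<forall>y\<in>?K. d x y \<le> C * d y x" using reversible_on_balls by blast
  have lim: "(\<lambda>m. d y (g m)) \<longlonglongrightarrow> 0"
  proof (rule LIMSEQ_I)
    fix e :: real assume "e > 0"
    then obtain n where n: "\<And>i j. i \<ge> n \<Longrightarrow> j \<ge> n \<Longrightarrow> d (g i) (g j) < e / 2" using cauchy[of "e/2"] by auto
    obtain i where i: "i \<ge> n" "d y (g i) < e / 2" using y(2)[of "e/2" n] \<open>e > 0\<close> by auto
    have "norm (d y (g m) - 0) < e" if "m \<ge> n" for m
      using n[OF i(1) that] i(2) d_tri[of y "g m" "g i"] by simp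
    then show "\<exists>n. \<forall>m\<ge>n. norm (d y (g m) - 0) < e" by blast
  qed
  have "(\<lambda>m. d (g m) y) \<longlonglongrightarrow> 0"
  proof (rule tendsto_sandwich[of "\<lambda>_. 0"])
    show "\<forall>\<^sub>F m in sequentially. d (g m) y \<le> C * d y (g m)"
      using eventually_ge_at_top[of n0]
    proof eventually_elim
      case (elim m)
      then have "g m \<in> ?K" using in_ball fball_subset_closure by blast
      then show ?case using C y by blast
    qed
    show "(\<lambda>m. C * d y (g m)) \<longlonglongrightarrow> 0" using tendsto_mult_left[OF lim, of C] by simp
  qed auto
  with lim show ?thesis using that by blast
qed

lemma decode_limit:
  assumes "approx_Cauchy z"
  shows "(\<lambda>m. d (decode z) (approx m z)) \<longlonglongrightarrow> 0" "(\<lambda>m. d (approx m z) (decode z)) \<longlonglongrightarrow> 0"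
proof -
  have "\<exists>y. (\<lambda>m. d y (approx m z)) \<longlonglongrightarrow> 0 \<and> (\<lambda>m. d (approx m z) y) \<longlonglongrightarrow> 0"
    using Cauchy_converges[of "\<lambda>m. approx m z"] assms unfolding approx_Cauchy_def by metis
  from someI_ex[OF this]
  show "(\<lambda>m. d (decode z) (approx m z)) \<longlonglongrightarrow> 0" "(\<lambda>m. d (approx m z) (decode z)) \<longlonglongrightarrow> 0"
    using assms by (auto simp: decode_def)
qed

lemma decode_code [simp]: "decode (code y) = y"
proof -
  let ?g = "\<lambda>m. approx m (code y)"
  have lim: "(\<lambda>m. (1/2::real) ^ m) \<longlonglongrightarrow> 0" by (simp add: LIMSEQ_realpow_zero)
  have l1: "(\<lambda>m. d (?g m) y) \<longlonglongrightarrow> 0" "(\<lambda>m. d y (?g m)) \<longlonglongrightarrow> 0"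
    by (rule tendsto_sandwich[OF _ _ tendsto_const lim];
        use approx_code[where y = y] in \<open>auto intro!: always_eventually less_imp_le\<close>)+
  have c: "approx_Cauchy (code y)"
    unfolding approx_Cauchy_def
  proof
    fix k
    have e: "1 / real (Suc k) / 2 > 0" by simp
    have "eventually (\<lambda>m. d (?g m) y < 1 / real (Suc k) / 2 \<and> d y (?g m) < 1 / real (Suc k) / 2) sequentially"
      using order_tendstoD(2)[OF l1(1) e] order_tendstoD(2)[OF l1(2) e] by (rule eventually_conj)
    then obtain n where n: "\<And>m. m \<ge> n \<Longrightarrow> d (?g m) y < 1 / real (Suc k) / 2 \<and> d y (?g m) < 1 / real (Suc k) / 2"
      by (auto simp: eventually_sequentially)
    have "d (?g i) (?g j) < 1 / real (Suc k)" if "i \<ge> n" "j \<ge> n" for i j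
      using n[OF that(1)] n[OF that(2)] d_tri[of "?g i" "?g j" y] by linarith
    then show "\<exists>n. \<forall>i\<ge>n. \<forall>j\<ge>n. d (?g i) (?g j) < 1 / real (Suc k)" by blast
  qed
  have "(\<lambda>m. d y (?g m) + d (?g m) (decode (code y))) \<longlonglongrightarrow> 0 + 0"
    by (rule tendsto_add[OF l1(2) decode_limit(2)[OF c]])
  then have "d y (decode (code y)) \<le> 0"
    by (intro LIMSEQ_le_const[of _ "0::real"]) (auto intro: d_tri)
  then have "d y (decode (code y)) = 0" using d_nonneg[of y "decode (code y)"] by linarith
  then show ?thesis using d_zero by auto
qed

lemma measurable_code: "code \<in> borel_measurable (fborel d)"
proof -
  have [measurable]: "Measurable.pred (fborel d) (near n)" for n
    unfolding near_def by (cases "prod_decode n") simp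
  show ?thesis unfolding code_def by measurable
qed

text \<open>The limit is picked by choice, yet its distance from \<open>dense_seq j\<close> is the
  limit of the distances of the approximations, which depend measurably on the argument. The
  sandwich uses convergence in both directions.\<close>

lemma measurable_decode: "decode \<in> measurable borel (fborel d)"
proof (rule measurable_into_fborel)
  fix j k
  have idx [measurable]: "(\<lambda>z. LEAST j. 1 \<le> (shift3 ^^ prod_encode (j, m)) z) \<in> measurable borel (count_space UNIV)" for m
    by measurable
  have dd [measurable]: "(\<lambda>z. d x (approx i z)) \<in> borel_measurable borel" for x i
    unfolding approx_def by (rule measurable_compose[OF idx]) simp
  have dd' [measurable]: "(\<lambda>z. d (approx i z) (approx j z)) \<in> borel_measurable borel" for i j
    by (unfold approx_def[of i]) (rule measurable_compose_countable[OF _ idx], rule dd)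
  have c [measurable]: "Measurable.pred borel approx_Cauchy"
    unfolding approx_Cauchy_def by measurable
  have eq: "d (dense_seq j) (decode z) = (if approx_Cauchy z then lim (\<lambda>m. d (dense_seq j) (approx m z)) else d (dense_seq j) base)" for z
  proof (cases "approx_Cauchy z")
    case True
    have "(\<lambda>m. d (dense_seq j) (approx m z)) \<longlonglongrightarrow> d (dense_seq j) (decode z)"
    proof (rule tendsto_sandwich)
      show "\<forall>\<^sub>F m in sequentially. d (dense_seq j) (decode z) - d (approx m z) (decode z) \<le> d (dense_seq j) (approx m z)"
        using d_tri[of "dense_seq j" "decode z"] by (auto simp: diff_le_eq)
      show "\<forall>\<^sub>F m in sequentially. d (dense_seq j) (approx m z) \<le> d (dense_seq j) (decode z) + d (decode z) (approx m z)"
        using d_tri by auto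
      show "(\<lambda>m. d (dense_seq j) (decode z) - d (approx m z) (decode z)) \<longlonglongrightarrow> d (dense_seq j) (decode z)"
        using tendsto_diff[OF tendsto_const decode_limit(2)[OF True]] by simp
      show "(\<lambda>m. d (dense_seq j) (decode z) + d (decode z) (approx m z)) \<longlonglongrightarrow> d (dense_seq j) (decode z)"
        using tendsto_add[OF tendsto_const decode_limit(1)[OF True]] by simp
    qed
    then show ?thesis using True by (simp add: limI)
  qed (simp add: decode_def)
  have "(\<lambda>z. d (dense_seq j) (decode z)) \<in> borel_measurable borel"
    unfolding eq by measurable
  then show "{z \<in> space borel. d (dense_seq j) (decode z) < 1 / real (Suc k)} \<in> sets borel" by measurable
qed

text \<open>The second coordinate is carried to the line by \<open>code\<close>, disintegrated
  there, and the kernel is pushed back by \<open>decode\<close>; \<open>decode_code\<close> recovers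
  \<open>\<pi>\<close>. This is the existence behind the choice in
  \<open>cond_kernel\<close>.\<close>

theorem disintegration:
  assumes M: "prob_space M" "sets M = sets (fborel d)"
    and \<pi>: "prob_space \<pi>" "sets \<pi> = sets (fborel d \<Otimes>\<^sub>M fborel d)" and marg: "distr \<pi> (fborel d) fst = M"
  shows "\<exists>\<kappa>. \<kappa> \<in> measurable M (prob_algebra M) \<and> \<pi> = kernel_prod M \<kappa>"
proof -
  interpret M: prob_space M by fact
  interpret \<pi>: prob_space \<pi> by fact
  note [measurable_cong] = M(2) \<pi>(2)
  note [measurable] = measurable_code measurable_decode
  define P where "P = distr \<pi> (M \<Otimes>\<^sub>M borel) (\<lambda>z. (fst z, code (snd z)))"
  have sP: "sets P = sets (M \<Otimes>\<^sub>M borel)" by (simp add: P_def)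
  have P: "prob_space P" unfolding P_def by (rule \<pi>.prob_space_distr) measurable
  have "distr P M fst = distr \<pi> M (fst \<circ> (\<lambda>z. (fst z, code (snd z))))"
    unfolding P_def by (rule distr_distr) measurable
  also have "\<dots> = distr \<pi> (fborel d) fst" by (rule distr_cong) (auto simp: M(2))
  finally have "distr P M fst = M" by (simp add: marg)
  from regular_conditional_distribution_real'[OF M(1) P sP this]
  obtain \<kappa> where k [measurable]: "\<kappa> \<in> measurable M (prob_algebra borel)" and
    int: "\<And>f. f \<in> borel_measurable (M \<Otimes>\<^sub>M borel) \<Longrightarrow> (\<integral>\<^sup>+z. f z \<partial>P) = (\<integral>\<^sup>+x. \<integral>\<^sup>+y. f (x, y) \<partial>\<kappa> x \<partial>M)" by blast
  define \<kappa>' where "\<kappa>' x = distr (\<kappa> x) M decode" for x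
  have k' [measurable]: "\<kappa>' \<in> measurable M (prob_algebra M)" unfolding \<kappa>'_def by measurable
  have sk: "sets (\<kappa> x) = sets borel" if "x \<in> space M" for x
    using measurable_space[OF k that] by (auto simp: space_prob_algebra)
  have "\<pi> = kernel_prod M \<kappa>'"
  proof (rule measure_eqI)
    show "sets \<pi> = sets (kernel_prod M \<kappa>')"
      using \<pi>(2) M(2) by (simp cong: sets_pair_measure_cong)
    fix E assume "E \<in> sets \<pi>"
    then have E [measurable]: "E \<in> sets (M \<Otimes>\<^sub>M M)" using \<pi>(2) M(2) by (simp cong: sets_pair_measure_cong)
    have sE: "E \<in> sets (kernel_prod M \<kappa>')" using E by simp
    have "emeasure (kernel_prod M \<kappa>') E = (\<integral>\<^sup>+z. indicator E z \<partial>kernel_prod M \<kappa>')" using sE by simp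
    also have "\<dots> = (\<integral>\<^sup>+x. \<integral>\<^sup>+y. indicator E (x, y) \<partial>\<kappa>' x \<partial>M)"
      by (rule nn_integral_kernel_prod[OF k' refl M.not_empty]) measurable
    also have "\<dots> = (\<integral>\<^sup>+x. \<integral>\<^sup>+z. indicator E (x, decode z) \<partial>\<kappa> x \<partial>M)"
    proof (rule nn_integral_cong)
      fix x assume x [measurable]: "x \<in> space M"
      note [measurable_cong] = sk[OF x]
      show "(\<integral>\<^sup>+y. indicator E (x, y) \<partial>\<kappa>' x) = (\<integral>\<^sup>+z. indicator E (x, decode z) \<partial>\<kappa> x)"
        unfolding \<kappa>'_def by (rule nn_integral_distr) (use x in measurable)
    qed
    also have "\<dots> = (\<integral>\<^sup>+z. indicator E (fst z, decode (snd z)) \<partial>P)"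
      by (subst int) auto
    also have "\<dots> = (\<integral>\<^sup>+z. indicator E (fst z, decode (code (snd z))) \<partial>\<pi>)"
      unfolding P_def by (subst nn_integral_distr) auto
    also have "\<dots> = emeasure \<pi> E" using \<open>E \<in> sets \<pi>\<close> by simp
    finally show "emeasure \<pi> E = emeasure (kernel_prod M \<kappa>') E" by simp
  qed
  with k' show ?thesis by blast
qed

end

section \<open>Extended-real integrals\<close>

lemma eintegral_mono_AE:
  assumes "AE x in M. f x \<le> g x"
  shows "eintegral M f \<le> eintegral M g"
proof -
  have "(\<integral>\<^sup>+x. e2ennreal (f x) \<partial>M) \<le> (\<integral>\<^sup>+x. e2ennreal (g x) \<partial>M)"
    using assms by (intro nn_integral_mono_AE) (auto intro!: e2ennreal_mono)
  moreover have "(\<integral>\<^sup>+x. e2ennreal (- g x) \<partial>M) \<le> (\<integral>\<^sup>+x. e2ennreal (- f x) \<partial>M)"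
    using assms by (intro nn_integral_mono_AE) (auto intro!: e2ennreal_mono)
  ultimately show ?thesis
    unfolding eintegral_def by (intro ereal_minus_mono) (simp_all add: less_eq_ennreal.rep_eq)
qed

lemma eintegral_cong_AE:
  assumes "AE x in M. f x = g x"
  shows "eintegral M f = eintegral M g"
  using assms by (intro antisym eintegral_mono_AE) auto

lemma eintegral_integrable:
  assumes "integrable M f"
  shows "eintegral M (\<lambda>x. ereal (f x)) = ereal (\<integral>x. f x \<partial>M)"
proof -
  have "(\<integral>\<^sup>+x. ennreal (f x) \<partial>M) < \<infinity>" "(\<integral>\<^sup>+x. ennreal (- f x) \<partial>M) < \<infinity>"
    using assms unfolding real_integrable_def by (auto simp: less_top)
  then show ?thesis
    unfolding eintegral_def real_lebesgue_integral_def[OF assms]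
    by (cases "\<integral>\<^sup>+x. ennreal (f x) \<partial>M"; cases "\<integral>\<^sup>+x. ennreal (- f x) \<partial>M") (auto simp: enn2ereal_ennreal)
qed

lemma eintegral_nonneg:
  assumes "AE x in M. 0 \<le> f x"
  shows "eintegral M f = enn2ereal (\<integral>\<^sup>+x. e2ennreal (f x) \<partial>M)"
proof -
  have "(\<integral>\<^sup>+x. e2ennreal (- f x) \<partial>M) = (\<integral>\<^sup>+x. 0 \<partial>M)"
    using assms by (intro nn_integral_cong_AE) (auto simp: e2ennreal_neg)
  then show ?thesis unfolding eintegral_def by (simp add: zero_ennreal.rep_eq)
qed

text \<open>Reverse Fatou under the majorant \<open>w\<close> treats the positive parts, the
  ordinary Fatou lemma the negative parts. No integrable minorant is involved, so limits equal to
  \<open>-\<infinity>\<close> are covered.\<close>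

lemma limsup_eintegral_le:
  fixes f :: "nat \<Rightarrow> 'a \<Rightarrow> ereal"
  assumes [measurable]: "\<And>n. f n \<in> borel_measurable M" "w \<in> borel_measurable M"
    and dom: "\<And>n. AE x in M. e2ennreal (f n x) \<le> w x" and w: "(\<integral>\<^sup>+x. w x \<partial>M) < \<infinity>"
    and lim: "AE x in M. limsup (\<lambda>n. f n x) \<le> g x"
  shows "limsup (\<lambda>n. eintegral M (f n)) \<le> eintegral M g"
proof -
  let ?P = "\<lambda>n. \<integral>\<^sup>+x. e2ennreal (f n x) \<partial>M" and ?N = "\<lambda>n. \<integral>\<^sup>+x. e2ennreal (- f n x) \<partial>M"
  have e2_limsup: "limsup (\<lambda>n. e2ennreal (u n)) = e2ennreal (limsup u)" for u :: "nat \<Rightarrow> ereal"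
    by (rule Limsup_compose_continuous_mono) (auto simp: continuous_on_e2ennreal mono_def intro: e2ennreal_mono)
  have e2_liminf: "liminf (\<lambda>n. e2ennreal (u n)) = e2ennreal (liminf u)" for u :: "nat \<Rightarrow> ereal"
    by (rule Liminf_compose_continuous_mono) (auto simp: continuous_on_e2ennreal mono_def intro: e2ennreal_mono)
  have en_limsup: "limsup (\<lambda>n. enn2ereal (u n)) = enn2ereal (limsup u)" for u :: "nat \<Rightarrow> ennreal"
    by (rule Limsup_compose_continuous_mono) (auto simp: continuous_on_enn2ereal mono_def less_eq_ennreal.rep_eq)
  have en_liminf: "liminf (\<lambda>n. enn2ereal (u n)) = enn2ereal (liminf u)" for u :: "nat \<Rightarrow> ennreal"
    by (rule Liminf_compose_continuous_mono) (auto simp: continuous_on_enn2ereal mono_def less_eq_ennreal.rep_eq)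
  have "limsup ?P \<le> (\<integral>\<^sup>+x. limsup (\<lambda>n. e2ennreal (f n x)) \<partial>M)"
    using dom w by (intro nn_integral_limsup) auto
  also have "\<dots> \<le> (\<integral>\<^sup>+x. e2ennreal (g x) \<partial>M)"
    using lim unfolding e2_limsup by (intro nn_integral_mono_AE) (auto intro!: e2ennreal_mono)
  finally have P: "limsup (\<lambda>n. enn2ereal (?P n)) \<le> enn2ereal (\<integral>\<^sup>+x. e2ennreal (g x) \<partial>M)"
    unfolding en_limsup by (simp add: less_eq_ennreal.rep_eq)
  have "(\<integral>\<^sup>+x. e2ennreal (- g x) \<partial>M) \<le> (\<integral>\<^sup>+x. liminf (\<lambda>n. e2ennreal (- f n x)) \<partial>M)"
    using lim unfolding e2_liminf ereal_Liminf_uminus by (intro nn_integral_mono_AE) (auto intro!: e2ennreal_mono)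
  also have "\<dots> \<le> liminf ?N" by (intro nn_integral_liminf) auto
  finally have N: "enn2ereal (\<integral>\<^sup>+x. e2ennreal (- g x) \<partial>M) \<le> liminf (\<lambda>n. enn2ereal (?N n))"
    unfolding en_liminf by (simp add: less_eq_ennreal.rep_eq)
  have "limsup (\<lambda>n. eintegral M (f n)) = limsup (\<lambda>n. enn2ereal (?P n) + - enn2ereal (?N n))"
    by (simp add: eintegral_def minus_ereal_def)
  also have "\<dots> \<le> limsup (\<lambda>n. enn2ereal (?P n)) + limsup (\<lambda>n. - enn2ereal (?N n))"
    by (rule ereal_limsup_add_mono)
  also have "\<dots> \<le> enn2ereal (\<integral>\<^sup>+x. e2ennreal (g x) \<partial>M) + - enn2ereal (\<integral>\<^sup>+x. e2ennreal (- g x) \<partial>M)"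
    using P N by (intro add_mono) (simp_all add: ereal_Limsup_uminus)
  finally show ?thesis by (simp add: eintegral_def minus_ereal_def)
qed

lemma e2ennreal_mult_nonneg:
  assumes "0 \<le> r"
  shows "e2ennreal (ereal r * a) = ennreal r * e2ennreal a"
proof (cases "a \<ge> 0")
  case True
  then have "ereal r * a = enn2ereal (ennreal r * e2ennreal a)"
    using assms by (simp add: times_ennreal.rep_eq enn2ereal_ennreal enn2ereal_e2ennreal)
  then show ?thesis by simp
next
  case False
  then have "ereal r * a \<le> 0" using assms by (simp add: ereal_mult_le_0_iff)
  then show ?thesis using False by (simp add: e2ennreal_neg)
qed

text \<open>The density turns the kernel over \<open>\<nu>\<close> into the kernel over
  \<open>\<mu>\<close>, which is \<open>\<pi>\<close>, and it annihilates the points where the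
  kernel is arbitrary. The identity is applied to positive and negative parts separately.\<close>

lemma eintegral_kernel_prod_density:
  assumes k: "\<kappa> \<in> measurable \<mu> (prob_algebra \<mu>)" and \<pi>: "\<pi> = kernel_prod \<mu> \<kappa>"
    and \<mu>: "\<mu> = density \<nu> (\<lambda>x. ennreal (\<rho> x))" and [measurable]: "\<rho> \<in> borel_measurable \<nu>"
    and pos: "\<And>x. 0 \<le> \<rho> x" and ne: "space \<nu> \<noteq> {}"
    and g: "g \<in> borel_measurable (\<nu> \<Otimes>\<^sub>M \<nu>)"
  shows "eintegral (kernel_prod \<nu> \<kappa>) (\<lambda>(x, y). ereal (\<rho> x) * g (x, y)) = eintegral \<pi> g"
proof -
  have s: "sets \<mu> = sets \<nu>" by (simp add: \<mu>)
  have k': "\<kappa> \<in> measurable \<nu> (prob_algebra \<mu>)" using k measurable_cong_sets[OF s refl] by blast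
  have *: "(\<integral>\<^sup>+z. (case z of (x, y) \<Rightarrow> ennreal (\<rho> x) * h (x, y)) \<partial>kernel_prod \<nu> \<kappa>) = (\<integral>\<^sup>+z. h z \<partial>\<pi>)"
    if h [measurable]: "h \<in> borel_measurable (\<nu> \<Otimes>\<^sub>M \<nu>)" for h
  proof -
    have h': "h \<in> borel_measurable (\<mu> \<Otimes>\<^sub>M \<mu>)" using h by (simp only: measurable_cong_sets[OF sets_pair_measure_cong[OF s s] refl])
    have "(\<integral>\<^sup>+z. (case z of (x, y) \<Rightarrow> ennreal (\<rho> x) * h (x, y)) \<partial>kernel_prod \<nu> \<kappa>)
      = (\<integral>\<^sup>+x. \<integral>\<^sup>+y. ennreal (\<rho> x) * h (x, y) \<partial>\<kappa> x \<partial>\<nu>)"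
      by (subst nn_integral_kernel_prod[OF k' s ne]) auto
    also have "\<dots> = (\<integral>\<^sup>+x. ennreal (\<rho> x) * (\<integral>\<^sup>+y. h (x, y) \<partial>\<kappa> x) \<partial>\<nu>)"
    proof (rule nn_integral_cong)
      fix x assume x: "x \<in> space \<nu>"
      have sk: "sets (\<kappa> x) = sets \<nu>" using measurable_space[OF k' x] s by (auto simp: space_prob_algebra)
      have "(\<lambda>y. h (x, y)) \<in> borel_measurable (\<kappa> x)"
        unfolding measurable_cong_sets[OF sk refl] using x by measurable
      then show "(\<integral>\<^sup>+y. ennreal (\<rho> x) * h (x, y) \<partial>\<kappa> x) = ennreal (\<rho> x) * (\<integral>\<^sup>+y. h (x, y) \<partial>\<kappa> x)"
        by (rule nn_integral_cmult)
    qed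
    also have "\<dots> = (\<integral>\<^sup>+x. (\<integral>\<^sup>+y. h (x, y) \<partial>\<kappa> x) \<partial>\<mu>)"
    proof -
      have "\<kappa> \<in> measurable \<nu> (subprob_algebra \<nu>)"
        using measurable_prob_algebraD[OF k'] subprob_algebra_cong[OF s] by simp
      then have "(\<lambda>x. \<integral>\<^sup>+y. h (x, y) \<partial>\<kappa> x) \<in> borel_measurable \<nu>"
        by (intro nn_integral_measurable_subprob_algebra2[where N = \<nu>]) auto
      then show ?thesis unfolding \<mu> by (subst nn_integral_density) auto
    qed
    also have "\<dots> = (\<integral>\<^sup>+z. h z \<partial>\<pi>)"
      unfolding \<pi> using ne s h' by (subst nn_integral_kernel_prod[OF k refl]) (auto dest: sets_eq_imp_space_eq)
    finally show ?thesis .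
  qed
  have "eintegral (kernel_prod \<nu> \<kappa>) (\<lambda>(x, y). ereal (\<rho> x) * g (x, y)) =
      enn2ereal (\<integral>\<^sup>+z. (case z of (x, y) \<Rightarrow> ennreal (\<rho> x) * e2ennreal (g (x, y))) \<partial>kernel_prod \<nu> \<kappa>)
    - enn2ereal (\<integral>\<^sup>+z. (case z of (x, y) \<Rightarrow> ennreal (\<rho> x) * e2ennreal (- g (x, y))) \<partial>kernel_prod \<nu> \<kappa>)"
    by (simp add: eintegral_def split_beta' e2ennreal_mult_nonneg[OF pos] flip: ereal_mult_minus_right)
  also have "\<dots> = eintegral \<pi> g"
    using *[of "\<lambda>z. e2ennreal (g z)"] *[of "\<lambda>z. e2ennreal (- g z)"] g by (simp add: eintegral_def)
  finally show ?thesis .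
qed

section \<open>Lebesgue decomposition\<close>

text \<open>The largest \<open>\<mu>\<close>-mass of a \<open>\<nu>\<close>-null set is attained, by
  the union of a maximising sequence. Off such a set \<open>S\<close> every
  \<open>\<nu>\<close>-null set is \<open>\<mu>\<close>-null, so Radon-Nikodym applies there; the
  singular part is the restriction to \<open>S\<close>.\<close>

lemma lebesgue_decomposition_exists:
  assumes "sigma_finite_measure \<nu>" "finite_measure \<mu>" and s: "sets \<mu> = sets \<nu>"
  shows "\<exists>\<rho> \<mu>s. lebesgue_decomposition \<nu> \<mu> \<rho> \<mu>s"
proof -
  interpret sigma_finite_measure \<nu> by fact
  interpret \<mu>: finite_measure \<mu> by fact
  have sp: "space \<mu> = space \<nu>" using s by (rule sets_eq_imp_space_eq)
  obtain A where A: "range A \<subseteq> emeasure \<mu> ` null_sets \<nu>" "incseq A" "Sup (emeasure \<mu> ` null_sets \<nu>) = (SUP n::nat. A n)"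
    using ennreal_Sup_countable_SUP[of "emeasure \<mu> ` null_sets \<nu>"] null_sets.empty_sets by blast
  have "\<forall>n. \<exists>B\<in>null_sets \<nu>. A n = emeasure \<mu> B" using A(1) by auto
  then obtain B where B: "\<And>n. B n \<in> null_sets \<nu>" "\<And>n. A n = emeasure \<mu> (B n)" by metis
  define S where "S = (\<Union>n. B n)"
  have S: "S \<in> null_sets \<nu>" unfolding S_def using B by (intro null_sets_UN) auto
  then have S' [measurable]: "S \<in> sets \<nu>" by auto
  have max: "emeasure \<mu> C \<le> emeasure \<mu> S" if "C \<in> null_sets \<nu>" for C
  proof -
    have "emeasure \<mu> C \<le> (SUP n. A n)" using that unfolding A(3)[symmetric] by (intro SUP_upper)
    also have "\<dots> \<le> emeasure \<mu> S" unfolding B(2) S_def using B(1) s by (intro SUP_least emeasure_mono) auto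
    finally show ?thesis .
  qed
  have null: "emeasure \<mu> (C - S) = 0" if C: "C \<in> null_sets \<nu>" for C
  proof -
    have "C - S \<in> sets \<mu>" "S \<in> sets \<mu>" using C S' unfolding s by auto
    then have "emeasure \<mu> (C - S) + emeasure \<mu> S = emeasure \<mu> ((C - S) \<union> S)"
      by (rule plus_emeasure) blast
    also have "\<dots> \<le> 0 + emeasure \<mu> S" using max[of "(C - S) \<union> S"] null_sets.Un[OF null_set_Diff[OF C S'] S] by simp
    finally have "emeasure \<mu> S + emeasure \<mu> (C - S) \<le> emeasure \<mu> S + 0" by (simp only: add.commute)
    then show ?thesis unfolding ennreal_add_left_cancel_le by simp
  qed
  let ?m = "density \<mu> (indicator (space \<nu> - S))"
  have em: "emeasure ?m C = emeasure \<mu> (C - S)" if "C \<in> sets \<nu>" for C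
    using that S' s sets.sets_into_space[OF that]
    by (subst emeasure_restricted) (auto simp: sp intro!: arg_cong[where f = "emeasure \<mu>"])
  have ac: "absolutely_continuous \<nu> ?m"
    unfolding absolutely_continuous_def using em null s by (auto simp: null_sets_def)
  have sm: "sets ?m = sets \<nu>" using s by simp
  define f where "f = RN_deriv \<nu> ?m"
  have f: "density \<nu> f = ?m" unfolding f_def by (rule density_RN_deriv[OF ac sm])
  have f_meas [measurable]: "f \<in> borel_measurable \<nu>" by (simp add: f_def)
  have "(\<integral>\<^sup>+x. f x \<partial>\<nu>) = emeasure (density \<nu> f) (space \<nu>)" by (simp add: emeasure_density cong: nn_integral_cong)
  also have "\<dots> < \<infinity>" unfolding f by (subst em) (auto simp: less_top[symmetric])
  finally have fin: "AE x in \<nu>. f x \<noteq> \<infinity>" by (intro nn_integral_PInf_AE) auto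
  have f': "density \<nu> (\<lambda>x. ennreal (enn2real (f x))) = ?m"
    unfolding f[symmetric] by (rule density_cong) (use fin in \<open>auto simp: less_top[symmetric]\<close>)
  let ?s = "density \<mu> (indicator S)"
  have "lebesgue_decomposition \<nu> \<mu> (\<lambda>x. enn2real (f x)) ?s"
    unfolding lebesgue_decomposition_def f'
  proof (intro conjI ballI allI)
    show "sets ?s = sets \<nu>" using s by simp
    fix C assume C: "C \<in> sets \<nu>"
    have "emeasure ?s C = emeasure \<mu> (S \<inter> C)" using C S' s by (intro emeasure_restricted) auto
    moreover have "emeasure \<mu> (C - S) + emeasure \<mu> (S \<inter> C) = emeasure \<mu> ((C - S) \<union> (S \<inter> C))"
      using C S' s by (intro plus_emeasure) auto
    moreover have "(C - S) \<union> (S \<inter> C) = C" by auto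
    ultimately show "emeasure \<mu> C = emeasure ?m C + emeasure ?s C" using em[OF C] by simp
  next
    have "emeasure ?s (space \<nu> - S) = emeasure \<mu> (S \<inter> (space \<nu> - S))"
      using S' s by (intro emeasure_restricted) auto
    also have "S \<inter> (space \<nu> - S) = {}" by auto
    finally show "\<exists>S\<in>null_sets \<nu>. emeasure ?s (space \<nu> - S) = 0" using S by auto
  qed auto
  then show ?thesis by blast
qed

text \<open>Off any \<open>\<nu>\<close>-null set containing the carrier of the singular part,
  \<open>\<mu>\<close> agrees with its density part. A null set containing both carriers therefore
  identifies the densities, and the singular masses follow by subtracting a finite quantity.\<close>

lemma lebesgue_decomposition_unique:
  assumes "sigma_finite_measure \<nu>" "finite_measure \<mu>" and s: "sets \<mu> = sets \<nu>"
    and 1: "lebesgue_decomposition \<nu> \<mu> \<rho> \<mu>s" and 2: "lebesgue_decomposition \<nu> \<mu> \<rho>' \<mu>s'"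
  shows "AE x in \<nu>. \<rho> x = \<rho>' x" "emeasure \<mu>s (space \<nu>) = emeasure \<mu>s' (space \<nu>)"
proof -
  interpret sigma_finite_measure \<nu> by fact
  interpret \<mu>: finite_measure \<mu> by fact
  have restr: "\<exists>S\<in>null_sets \<nu>. \<forall>T\<in>null_sets \<nu>. S \<subseteq> T \<longrightarrow> (\<forall>A\<in>sets \<nu>. emeasure (density \<nu> (\<lambda>x. ennreal (r x))) A = emeasure \<mu> (A - T))"
    if d: "lebesgue_decomposition \<nu> \<mu> r m" for r m
  proof -
    note d = d[unfolded lebesgue_decomposition_def]
    have [measurable]: "r \<in> borel_measurable \<nu>" using d by auto
    obtain S where S: "S \<in> null_sets \<nu>" "emeasure m (space \<nu> - S) = 0" using d by auto
    have "emeasure (density \<nu> (\<lambda>x. ennreal (r x))) A = emeasure \<mu> (A - T)"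
      if T: "T \<in> null_sets \<nu>" "S \<subseteq> T" and A: "A \<in> sets \<nu>" for T A
    proof -
      have "emeasure m (A - T) \<le> emeasure m (space \<nu> - S)"
        using T A S d sets.sets_into_space[OF A] by (intro emeasure_mono) auto
      then have "emeasure m (A - T) = 0" using S by simp
      moreover have "A - T \<in> sets \<nu>" using A T by auto
      ultimately have "emeasure \<mu> (A - T) = emeasure (density \<nu> (\<lambda>x. ennreal (r x))) (A - T)" using d by auto
      also have "\<dots> = emeasure (density \<nu> (\<lambda>x. ennreal (r x))) A"
      proof (rule emeasure_Diff_null_set)
        show "T \<in> null_sets (density \<nu> (\<lambda>x. ennreal (r x)))"
          using T(1) absolutely_continuousI_density[of "\<lambda>x. ennreal (r x)" \<nu>] unfolding absolutely_continuous_def by auto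
      qed (use A in simp)
      finally show ?thesis by simp
    qed
    then show ?thesis using S by blast
  qed
  obtain S where S: "S \<in> null_sets \<nu>" "\<And>T A. T \<in> null_sets \<nu> \<Longrightarrow> S \<subseteq> T \<Longrightarrow> A \<in> sets \<nu> \<Longrightarrow> emeasure (density \<nu> (\<lambda>x. ennreal (\<rho> x))) A = emeasure \<mu> (A - T)"
    using restr[OF 1] by blast
  obtain S' where S': "S' \<in> null_sets \<nu>" "\<And>T A. T \<in> null_sets \<nu> \<Longrightarrow> S' \<subseteq> T \<Longrightarrow> A \<in> sets \<nu> \<Longrightarrow> emeasure (density \<nu> (\<lambda>x. ennreal (\<rho>' x))) A = emeasure \<mu> (A - T)"
    using restr[OF 2] by blast
  have T: "S \<union> S' \<in> null_sets \<nu>" using S S' by auto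
  have m: "\<rho> \<in> borel_measurable \<nu>" "\<rho>' \<in> borel_measurable \<nu>" using 1 2 by (auto simp: lebesgue_decomposition_def)
  have eq: "density \<nu> (\<lambda>x. ennreal (\<rho> x)) = density \<nu> (\<lambda>x. ennreal (\<rho>' x))"
    by (rule measure_eqI) (use S(2)[OF T] S'(2)[OF T] in auto)
  then have "AE x in \<nu>. ennreal (\<rho> x) = ennreal (\<rho>' x)"
    using m by (subst (asm) density_unique_iff) auto
  then show "AE x in \<nu>. \<rho> x = \<rho>' x"
    using 1 2 by (auto simp: lebesgue_decomposition_def)
  have "emeasure (density \<nu> (\<lambda>x. ennreal (\<rho> x))) (space \<nu>) + emeasure \<mu>s (space \<nu>) = emeasure \<mu> (space \<nu>)"
    using 1 unfolding lebesgue_decomposition_def by force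
  also have "\<dots> = emeasure (density \<nu> (\<lambda>x. ennreal (\<rho>' x))) (space \<nu>) + emeasure \<mu>s' (space \<nu>)"
    using 2 unfolding lebesgue_decomposition_def by force
  finally have "emeasure (density \<nu> (\<lambda>x. ennreal (\<rho> x))) (space \<nu>) + emeasure \<mu>s (space \<nu>) =
    emeasure (density \<nu> (\<lambda>x. ennreal (\<rho> x))) (space \<nu>) + emeasure \<mu>s' (space \<nu>)" by (simp only: eq)
  moreover have "emeasure (density \<nu> (\<lambda>x. ennreal (\<rho> x))) (space \<nu>) \<noteq> \<infinity>"
    using S(2)[OF S(1), of "space \<nu>"] by simp
  ultimately show "emeasure \<mu>s (space \<nu>) = emeasure \<mu>s' (space \<nu>)"
    by (simp add: ennreal_add_left_cancel)
qed

lemma ac_density_decomposition: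
  assumes "sigma_finite_measure \<nu>" "finite_measure \<mu>" and s: "sets \<mu> = sets \<nu>"
  obtains \<mu>s where "lebesgue_decomposition \<nu> \<mu> (ac_density \<nu> \<mu>) \<mu>s"
    "emeasure (singular_part \<nu> \<mu>) (space \<nu>) = emeasure \<mu>s (space \<nu>)"
proof -
  have ex: "\<exists>\<rho> \<mu>s. lebesgue_decomposition \<nu> \<mu> \<rho> \<mu>s" by (rule lebesgue_decomposition_exists[OF assms])
  then have "\<exists>\<mu>s. lebesgue_decomposition \<nu> \<mu> (ac_density \<nu> \<mu>) \<mu>s"
    unfolding ac_density_def by (rule someI_ex)
  then obtain \<mu>s where 1: "lebesgue_decomposition \<nu> \<mu> (ac_density \<nu> \<mu>) \<mu>s" by blast
  have "\<exists>\<mu>s \<rho>. lebesgue_decomposition \<nu> \<mu> \<rho> \<mu>s" using ex by blast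
  then have "\<exists>\<rho>. lebesgue_decomposition \<nu> \<mu> \<rho> (singular_part \<nu> \<mu>)"
    unfolding singular_part_def by (rule someI_ex)
  then obtain \<rho> where 2: "lebesgue_decomposition \<nu> \<mu> \<rho> (singular_part \<nu> \<mu>)" by blast
  show ?thesis using that[OF 1] lebesgue_decomposition_unique(2)[OF assms 2 1] by blast
qed

lemma ac_density_absolutely_continuous:
  assumes "sigma_finite_measure \<nu>" "finite_measure \<mu>" and s: "sets \<mu> = sets \<nu>" and ac: "absolutely_continuous \<nu> \<mu>"
  shows "ac_density \<nu> \<mu> \<in> borel_measurable \<nu>" "\<And>x. 0 \<le> ac_density \<nu> \<mu> x"
    "\<mu> = density \<nu> (\<lambda>x. ennreal (ac_density \<nu> \<mu> x))"
    "emeasure (singular_part \<nu> \<mu>) (space \<nu>) = 0"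
proof -
  obtain \<mu>s where "lebesgue_decomposition \<nu> \<mu> (ac_density \<nu> \<mu>) \<mu>s"
    and sing: "emeasure (singular_part \<nu> \<mu>) (space \<nu>) = emeasure \<mu>s (space \<nu>)"
    by (rule ac_density_decomposition[OF assms(1-3)])
  then have d: "ac_density \<nu> \<mu> \<in> borel_measurable \<nu>" "\<And>x. 0 \<le> ac_density \<nu> \<mu> x" "sets \<mu>s = sets \<nu>"
    "\<And>A. A \<in> sets \<nu> \<Longrightarrow> emeasure \<mu> A = emeasure (density \<nu> (\<lambda>x. ennreal (ac_density \<nu> \<mu> x))) A + emeasure \<mu>s A"
    "\<exists>S\<in>null_sets \<nu>. emeasure \<mu>s (space \<nu> - S) = 0"
    unfolding lebesgue_decomposition_def by auto
  then obtain S where S: "S \<in> null_sets \<nu>" "emeasure \<mu>s (space \<nu> - S) = 0" by blast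
  then have "emeasure \<mu> S = 0" using ac by (auto simp: absolutely_continuous_def)
  then have "emeasure \<mu>s S = 0" using d(4)[of S] S by auto
  then have "emeasure \<mu>s ((space \<nu> - S) \<union> S) \<le> 0"
    using S d(3) emeasure_subadditive[of "space \<nu> - S" \<mu>s S] by auto
  moreover have "(space \<nu> - S) \<union> S = space \<nu>" using S sets.sets_into_space[of S \<nu>] by auto
  ultimately have z: "emeasure \<mu>s (space \<nu>) = 0" by simp
  then have "emeasure \<mu>s A = 0" if "A \<in> sets \<nu>" for A
    using that emeasure_mono[of A "space \<nu>" \<mu>s] d(3) sets.sets_into_space[OF that] by auto
  then have "\<mu> = density \<nu> (\<lambda>x. ennreal (ac_density \<nu> \<mu> x))"
    by (intro measure_eqI) (use s d(4) in auto)
  then show "ac_density \<nu> \<mu> \<in> borel_measurable \<nu>" "\<And>x. 0 \<le> ac_density \<nu> \<mu> x"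
    "\<mu> = density \<nu> (\<lambda>x. ennreal (ac_density \<nu> \<mu> x))"
    "emeasure (singular_part \<nu> \<mu>) (space \<nu>) = 0"
    using d(1,2) z sing by auto
qed

section \<open>The classes \<open>DC\<close>\<close>

definition mean_slope :: "(real \<Rightarrow> real) \<Rightarrow> real \<Rightarrow> real" where
  "mean_slope U v = U v / v"

definition DC_exponent :: "ereal \<Rightarrow> real" where
  "DC_exponent N = 1 - real_of_ereal (1 / N)"

lemma DC_exponent:
  assumes "1 < N"
  shows "0 < DC_exponent N" "DC_exponent N \<le> 1" "N \<noteq> \<infinity> \<Longrightarrow> DC_exponent N < 1"
  using assms by (cases N; simp add: DC_exponent_def one_ereal_def)+

lemma mono_real_deriv_nonneg:
  fixes f :: "real \<Rightarrow> real"
  assumes "(f has_real_derivative D) (at x)" "x > 0" "mono_on {0<..} f"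
  shows "0 \<le> D"
  using mono_on_imp_deriv_nonneg[OF assms(3,1)] assms(2) by (simp add: interior_open)

context
  fixes U :: "real \<Rightarrow> real" and N :: ereal
  assumes U: "U \<in> DC N" and N: "1 < N"
begin

lemma DC_zero: "U 0 = 0"
  using U by (simp add: DC_def)

lemma DC_deriv: "r > 0 \<Longrightarrow> (U has_real_derivative deriv U r) (at r)"
  using U unfolding DC_def by (auto intro: DERIV_deriv_iff_real_differentiable[THEN iffD2])

lemma DC_deriv2: "r > 0 \<Longrightarrow> (deriv U has_real_derivative deriv (deriv U) r) (at r)"
  using U unfolding DC_def by (auto intro: DERIV_deriv_iff_real_differentiable[THEN iffD2])

lemma DC_continuous_deriv2: "continuous_on {0<..} (deriv (deriv U))"
  using U by (simp add: DC_def)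

lemma DC_continuous: "continuous_on {0..} U"
  using U by (simp add: DC_def)

lemma DC_tangent:
  assumes "r > 0" "y \<ge> 0"
  shows "U r + deriv U r * (y - r) \<le> U y"
proof -
  have "U y - U r \<ge> deriv U r * (y - r)"
  proof (rule convex_on_imp_above_tangent)
    show "convex_on {0..} U" using U by (simp add: DC_def)
    show "r \<in> interior {0..}" using assms by simp
    show "(U has_field_derivative deriv U r) (at r within {0..})"
      using DC_deriv[OF assms(1)] by (rule has_field_derivative_at_within)
  qed (use assms in auto)
  then show ?thesis by simp
qed

lemma DC_pressure_nonneg: "r > 0 \<Longrightarrow> 0 \<le> pressure U r"
  using DC_tangent[of r 0] DC_zero by (simp add: pressure_def mult.commute)

lemma DC_deriv_mono:
  assumes "0 < r" "r \<le> s"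
  shows "deriv U r \<le> deriv U s"
proof (cases "r = s")
  case False
  have "deriv U r * (s - r) \<le> deriv U s * (s - r)"
    using DC_tangent[of r s] DC_tangent[of s r] assms by (simp add: algebra_simps)
  then show ?thesis using assms False by simp
qed simp

lemma DC_deriv2_nonneg: "r > 0 \<Longrightarrow> 0 \<le> deriv (deriv U) r"
  by (rule mono_real_deriv_nonneg[OF DC_deriv2]) (auto intro!: mono_onI DC_deriv_mono)

lemma DC_pressure_deriv: "r > 0 \<Longrightarrow> (pressure U has_real_derivative r * deriv (deriv U) r) (at r)"
  unfolding pressure_def by (auto intro!: derivative_eq_intros DC_deriv DC_deriv2)

lemma DC_quotient_mono: "mono_on {0<..} (\<lambda>r. pressure U r / r powr DC_exponent N)"
  using U unfolding DC_def DC_exponent_def by auto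

lemma DC_quotient_deriv:
  assumes "r > 0"
  shows "((\<lambda>r. pressure U r / r powr DC_exponent N) has_real_derivative
    (r * deriv (deriv U) r - DC_exponent N * pressure U r / r) / r powr DC_exponent N) (at r)"
proof -
  have "((\<lambda>r. pressure U r / r powr DC_exponent N) has_real_derivative
    (r * deriv (deriv U) r * r powr DC_exponent N - pressure U r * (DC_exponent N * r powr (DC_exponent N - 1))) /
      (r powr DC_exponent N * r powr DC_exponent N)) (at r)"
    using assms by (auto intro!: derivative_eq_intros DC_pressure_deriv)
  also have "r powr (DC_exponent N - 1) = r powr DC_exponent N / r" using assms by (simp add: powr_diff)
  also have "(r * deriv (deriv U) r * r powr DC_exponent N - pressure U r * (DC_exponent N * (r powr DC_exponent N / r))) /
      (r powr DC_exponent N * r powr DC_exponent N) =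
      (r * deriv (deriv U) r - DC_exponent N * pressure U r / r) / r powr DC_exponent N"
    using assms by (simp add: field_simps)
  finally show ?thesis .
qed

text \<open>The infinitesimal form of the monotonicity that defines \<open>DC N\<close>: the
  derivative of \<open>p(r) / r^c\<close> with \<open>c = 1 - 1/N\<close> is nonnegative.\<close>

lemma DC_pressure_le: "r > 0 \<Longrightarrow> DC_exponent N * pressure U r / r \<le> r * deriv (deriv U) r"
  using mono_real_deriv_nonneg[OF DC_quotient_deriv _ DC_quotient_mono, of r]
  by (simp add: zero_le_divide_iff not_le)

lemma mean_slope_deriv: "r > 0 \<Longrightarrow> (mean_slope U has_real_derivative pressure U r / r\<^sup>2) (at r)"
  unfolding mean_slope_def[abs_def] pressure_def
  by (auto intro!: derivative_eq_intros DC_deriv simp: power2_eq_square mult.commute)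

lemma mean_slope_mono:
  assumes "0 < r" "r \<le> s"
  shows "mean_slope U r \<le> mean_slope U s"
  by (rule DERIV_nonneg_imp_nondecreasing[OF assms(2)])
     (use mean_slope_deriv DC_pressure_nonneg assms in \<open>meson less_le_trans divide_nonneg_nonneg zero_le_power2\<close>)

text \<open>In the variable \<open>ln r\<close> the derivative of \<open>m\<close> is
  \<open>p(r) / r\<close>, hence at most \<open>C\<close>; so \<open>C * ln r - m(r)\<close> is
  nondecreasing.\<close>

lemma mean_slope_ln_lipschitz:
  assumes C: "\<And>r. r > 0 \<Longrightarrow> pressure U r \<le> C * r" and "0 < r" "r \<le> s"
  shows "mean_slope U s - mean_slope U r \<le> C * (ln s - ln r)"
proof -
  have "C * ln r - mean_slope U r \<le> C * ln s - mean_slope U s"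
  proof (rule DERIV_nonneg_imp_nondecreasing[OF assms(3)])
    fix x assume "r \<le> x" "x \<le> s"
    then have x: "x > 0" using assms by simp
    have "((\<lambda>x. C * ln x - mean_slope U x) has_real_derivative C * (1 / x) - pressure U x / x\<^sup>2) (at x)"
      using x by (auto intro!: derivative_eq_intros mean_slope_deriv)
    moreover have "C * (1 / x) - pressure U x / x\<^sup>2 \<ge> 0"
      using C[OF x] x by (simp add: power2_eq_square field_simps)
    ultimately show "\<exists>y. ((\<lambda>x. C * ln x - mean_slope U x) has_real_derivative y) (at x) \<and> y \<ge> 0" by blast
  qed
  then show ?thesis by (simp add: algebra_simps)
qed

lemma mean_slope_ln_lower:
  assumes C: "\<And>r. r > 0 \<Longrightarrow> C * r \<le> pressure U r" and "0 < r" "r \<le> s"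
  shows "C * (ln s - ln r) \<le> mean_slope U s - mean_slope U r"
proof -
  have "mean_slope U r - C * ln r \<le> mean_slope U s - C * ln s"
  proof (rule DERIV_nonneg_imp_nondecreasing[OF assms(3)])
    fix x assume "r \<le> x" "x \<le> s"
    then have x: "x > 0" using assms by simp
    have "((\<lambda>x. mean_slope U x - C * ln x) has_real_derivative pressure U x / x\<^sup>2 - C * (1 / x)) (at x)"
      using x by (auto intro!: derivative_eq_intros mean_slope_deriv)
    moreover have "pressure U x / x\<^sup>2 - C * (1 / x) \<ge> 0"
      using C[OF x] x by (simp add: power2_eq_square field_simps)
    ultimately show "\<exists>y. ((\<lambda>x. mean_slope U x - C * ln x) has_real_derivative y) (at x) \<and> y \<ge> 0" by blast
  qed
  then show ?thesis by (simp add: algebra_simps)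
qed

text \<open>Monotonicity of \<open>m\<close> makes the limit at \<open>0\<close> exist as an
  infimum; it is \<open>-\<infinity>\<close> for functions such as \<open>r ln r\<close>. The
  infimum form is the one that passes to approximating sequences.\<close>

lemma deriv_zero_eq: "deriv_zero U = (INF r\<in>{0<..}. ereal (mean_slope U r))"
  unfolding deriv_zero_def mean_slope_def[symmetric]
proof (rule tendsto_Lim)
  show "((\<lambda>r. ereal (mean_slope U r)) \<longlongrightarrow> (INF r\<in>{0<..}. ereal (mean_slope U r))) (at_right 0)"
  proof (rule order_tendstoI)
    fix a assume "a < (INF r\<in>{0<..}. ereal (mean_slope U r))"
    then have "\<And>r. r > 0 \<Longrightarrow> a < ereal (mean_slope U r)" using less_INF_D by fastforce
    then show "\<forall>\<^sub>F r in at_right 0. a < ereal (mean_slope U r)"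
      using eventually_at_right_less by (rule eventually_mono[rotated])
  next
    fix a assume "(INF r\<in>{0<..}. ereal (mean_slope U r)) < a"
    then obtain s where s: "s > 0" "ereal (mean_slope U s) < a" by (auto simp: INF_less_iff)
    have "\<forall>\<^sub>F r in at_right 0. r \<in> {0<..<s}" using s eventually_at_right_real by blast
    then show "\<forall>\<^sub>F r in at_right 0. ereal (mean_slope U r) < a"
    proof eventually_elim
      case (elim r)
      then show ?case using mean_slope_mono[of r s] s le_less_trans[of "ereal (mean_slope U r)" "ereal (mean_slope U s)"] by simp
    qed
  qed
qed simp

lemma deriv_zero_le: "r > 0 \<Longrightarrow> deriv_zero U \<le> ereal (mean_slope U r)"
  unfolding deriv_zero_eq by (rule INF_lower) simp

lemma deriv_infty_eq: "deriv_infty U = (SUP r\<in>{0<..}. ereal (mean_slope U r))"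
  unfolding deriv_infty_def mean_slope_def[symmetric]
proof (rule tendsto_Lim)
  show "((\<lambda>r. ereal (mean_slope U r)) \<longlongrightarrow> (SUP r\<in>{0<..}. ereal (mean_slope U r))) at_top"
  proof (rule order_tendstoI)
    fix a assume "(SUP r\<in>{0<..}. ereal (mean_slope U r)) < a"
    then have "\<And>r. r > 0 \<Longrightarrow> ereal (mean_slope U r) < a" using SUP_lessD by fastforce
    then show "\<forall>\<^sub>F r in at_top. ereal (mean_slope U r) < a"
      using eventually_gt_at_top[of "0::real"] by (rule eventually_mono[rotated])
  next
    fix a assume "a < (SUP r\<in>{0<..}. ereal (mean_slope U r))"
    then obtain s where s: "s > 0" "a < ereal (mean_slope U s)" by (auto simp: less_SUP_iff)
    show "\<forall>\<^sub>F r in at_top. a < ereal (mean_slope U r)"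
      using eventually_ge_at_top[of s]
    proof eventually_elim
      case (elim r)
      then show ?case using mean_slope_mono[of s r] s by (auto intro: less_le_trans)
    qed
  qed
qed simp

text \<open>The tangent at \<open>r\<close> lies below \<open>U\<close>; divided by \<open>s\<close>
  and sent to infinity it has the limit \<open>U'(r)\<close>, while \<open>U(s) / s\<close> stays
  below \<open>U'(\<infinity>)\<close>.\<close>

lemma deriv_le_deriv_infty:
  assumes "r > 0"
  shows "ereal (deriv U r) \<le> deriv_infty U"
proof -
  have lim: "((\<lambda>s. (U r - deriv U r * r) * inverse s + deriv U r) \<longlongrightarrow> (U r - deriv U r * r) * 0 + deriv U r) at_top"
    by (intro tendsto_intros tendsto_inverse_0_at_top filterlim_ident)
  have "ereal ((U r - deriv U r * r) * inverse s + deriv U r) \<le> deriv_infty U" if "s > 0" for s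
  proof -
    have "(U r - deriv U r * r) * inverse s + deriv U r = (U r + deriv U r * (s - r)) / s"
      using that by (simp add: field_simps)
    also have "\<dots> \<le> mean_slope U s"
      unfolding mean_slope_def using DC_tangent[OF assms, of s] that by (intro divide_right_mono) auto
    finally have "ereal ((U r - deriv U r * r) * inverse s + deriv U r) \<le> ereal (mean_slope U s)" by simp
    also have "ereal (mean_slope U s) \<le> deriv_infty U" unfolding deriv_infty_eq using that by (intro SUP_upper) simp
    finally show ?thesis .
  qed
  then have "\<forall>\<^sub>F s in at_top. ereal ((U r - deriv U r * r) * inverse s + deriv U r) \<le> deriv_infty U"
    using eventually_gt_at_top[of "0::real"] by (rule eventually_mono[rotated])
  moreover have "((\<lambda>s. ereal ((U r - deriv U r * r) * inverse s + deriv U r)) \<longlongrightarrow> ereal (deriv U r)) at_top"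
    using lim by simp
  ultimately show ?thesis by (intro tendsto_upperbound) auto
qed

end

text \<open>Linearity for all \<open>r < e\<close>, negative values included, makes
  \<open>U'\<close> a C^1 function on the whole line. The bound \<open>U r \<le> C * r\<close> is
  asked for finite \<open>N\<close>, where the coefficient can be infinite for \<open>K > 0\<close>
  and \<open>m\<close> itself has to be bounded. For \<open>N = \<infinity>\<close> the quotient
  \<open>p(r) / r\<close> is nondecreasing, so a bound on \<open>m\<close> would force
  \<open>p = 0\<close>; there the coefficients are bounded on bounded sets and the logarithmic
  control of \<open>m\<close> takes over.\<close>

definition tame :: "ereal \<Rightarrow> (real \<Rightarrow> real) \<Rightarrow> bool" where
  "tame N U \<longleftrightarrow> U \<in> DC N \<and> (\<exists>a e. 0 < e \<and> (\<forall>r<e. U r = a * r)) \<and>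
     (\<exists>C. \<forall>r>0. pressure U r \<le> C * r) \<and> (N \<noteq> \<infinity> \<longrightarrow> (\<exists>C. \<forall>r>0. U r \<le> C * r))"

lemma tame_near_zero:
  assumes lin: "\<forall>r<e. U r = a * r"
  shows "\<And>r. r < e \<Longrightarrow> (U has_real_derivative a) (at r)" "\<And>r. r < e \<Longrightarrow> deriv U r = a"
    "\<And>r. r < e \<Longrightarrow> (deriv U has_real_derivative 0) (at r)" "\<And>r. r < e \<Longrightarrow> deriv (deriv U) r = 0"
proof -
  have ev: "eventually (\<lambda>s. s < e) (nhds r)" if "r < e" for r
    using that by (intro eventually_nhds_in_open[of "{..<e}", simplified]) auto
  show 1: "(U has_real_derivative a) (at r)" if "r < e" for r
  proof (subst DERIV_cong_ev[OF refl _ refl])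
    show "\<forall>\<^sub>F s in nhds r. U s = a * s" using ev[OF that] by eventually_elim (use lin in blast)
  qed (auto intro!: derivative_eq_intros)
  then show 2: "deriv U r = a" if "r < e" for r using that DERIV_imp_deriv by blast
  show 3: "(deriv U has_real_derivative 0) (at r)" if "r < e" for r
  proof (subst DERIV_cong_ev[OF refl _ refl])
    show "\<forall>\<^sub>F s in nhds r. deriv U s = a" using ev[OF that] by eventually_elim (rule 2)
  qed (auto intro!: derivative_eq_intros)
  then show "deriv (deriv U) r = 0" if "r < e" for r using that DERIV_imp_deriv by blast
qed

text \<open>On the linear piece \<open>U'\<close> is constant with value \<open>U'(0)\<close>; this
  extends to \<open>0\<close>, or to the whole line, what holds for members of \<open>DC N\<close>
  on the open half-line.\<close>

lemma tameD:
  assumes t: "tame N U" and N: "1 < N"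
  shows "U \<in> DC N"
    "\<exists>a. deriv_zero U = ereal a \<and> deriv U 0 = a \<and> (\<forall>r>0. a \<le> mean_slope U r)"
    "\<And>r. (deriv U has_real_derivative deriv (deriv U) r) (at r)"
    "\<And>r. isCont (deriv (deriv U)) r"
    "\<And>r s. r \<le> s \<Longrightarrow> deriv U r \<le> deriv U s"
    "\<And>r y. 0 \<le> r \<Longrightarrow> 0 \<le> y \<Longrightarrow> U r + deriv U r * (y - r) \<le> U y"
    "\<And>r. 0 \<le> r \<Longrightarrow> ereal (deriv U r) \<le> deriv_infty U"
proof -
  show U: "U \<in> DC N" using t by (simp add: tame_def)
  obtain a e where e: "0 < e" and lin: "\<forall>r<e. U r = a * r" using t unfolding tame_def by blast
  note near = tame_near_zero[OF lin]
  have a_le: "a \<le> mean_slope U r" if "r > 0" for r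
  proof -
    define s where "s = min r (e / 2)"
    have s: "s > 0" "s < e" "s \<le> r" using that e by (auto simp: s_def)
    then have "mean_slope U s = a" using lin by (simp add: mean_slope_def)
    moreover have "mean_slope U s \<le> mean_slope U r" using s by (intro mean_slope_mono[OF U N]) auto
    ultimately show ?thesis by simp
  qed
  have "deriv_zero U = ereal a"
  proof (rule antisym)
    have "mean_slope U (e / 2) = a" using e lin by (simp add: mean_slope_def)
    then show "deriv_zero U \<le> ereal a" using deriv_zero_le[OF U N, of "e/2"] e by simp
    show "ereal a \<le> deriv_zero U" unfolding deriv_zero_eq[OF U N] using a_le by (intro INF_greatest) auto
  qed
  then show "\<exists>a. deriv_zero U = ereal a \<and> deriv U 0 = a \<and> (\<forall>r>0. a \<le> mean_slope U r)"
    using a_le near(2)[OF e] by blast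
  show d2: "(deriv U has_real_derivative deriv (deriv U) r) (at r)" for r
    using near(3)[of r] near(4)[of r] DC_deriv2[OF U N, of r] e by (cases "r < e") auto
  show "isCont (deriv (deriv U)) r" for r
  proof (cases "r < e")
    case True
    have "\<forall>\<^sub>F s in nhds r. s < e" using True by (intro eventually_nhds_in_open[of "{..<e}", simplified]) auto
    then have "\<forall>\<^sub>F s in nhds r. deriv (deriv U) s = 0" by eventually_elim (rule near(4))
    then show ?thesis by (subst isCont_cong) auto
  next
    case False
    then show ?thesis using DC_continuous_deriv2[OF U N] e
      by (auto simp: continuous_on_eq_continuous_at)
  qed
  have d2_nonneg: "0 \<le> deriv (deriv U) r" for r
    using near(4)[of r] DC_deriv2_nonneg[OF U N, of r] e by (cases "r < e") auto
  show mono: "deriv U r \<le> deriv U s" if "r \<le> s" for r s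
    by (rule DERIV_nonneg_imp_nondecreasing[OF that]) (use d2 d2_nonneg in blast)
  show "U r + deriv U r * (y - r) \<le> U y" if "0 \<le> r" "0 \<le> y" for r y
  proof (cases "r = 0")
    case True
    then show ?thesis using a_le[of y] that near(2)[OF e] DC_zero[OF U N]
      by (cases "y = 0") (auto simp: mean_slope_def field_simps)
  next
    case False
    then show ?thesis using DC_tangent[OF U N] that by simp
  qed
  show "ereal (deriv U r) \<le> deriv_infty U" if "0 \<le> r" for r
  proof -
    have "ereal (deriv U r) \<le> ereal (deriv U (r + 1))" using mono[of r "r+1"] by simp
    also have "\<dots> \<le> deriv_infty U" using that by (intro deriv_le_deriv_infty[OF U N]) auto
    finally show ?thesis .
  qed
qed

section \<open>Tame approximation\<close>

lemma divide_le_self: "0 \<le> a \<Longrightarrow> 1 \<le> b \<Longrightarrow> a / b \<le> (a::real)"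
  by (auto simp: divide_le_eq mult_le_cancel_left1)

text \<open>An approximation of \<open>U\<close> that is linear near \<open>0\<close> and whose pressure grows at most linearly.
  Damping \<open>p(r)/r\<^sup>c\<close> by nondecreasing operations keeps the function in the class \<open>DC\<close>.\<close>

locale damping =
  fixes U :: "real \<Rightarrow> real" and N :: ereal and l :: real
  assumes U: "U \<in> DC N" and N: "1 < N" and l: "1 \<le> l"
begin

abbreviation "c \<equiv> DC_exponent N"

text \<open>\<open>q / D\<close> is nondecreasing in \<open>q\<close> and at most \<open>l\<close>,
  and \<open>x\<close> is a nondecreasing cutoff vanishing up to \<open>1/l\<close>. Hence
  \<open>P / r^c\<close>, which equals \<open>x^2\<close> times \<open>q / D\<close>, is
  nondecreasing and \<open>P\<close> can serve as a pressure in \<open>DC N\<close>.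
  \<open>Q'\<close> and \<open>P'\<close> are the derivatives of \<open>p / D\<close> and
  \<open>P\<close>.\<close>

definition q where "q r = pressure U r / r powr c"
definition D where "D r = 1 + q r / l"
definition x where "x r = max 0 (1 - 1 / (l * r))"
definition Q' where "Q' r = c * pressure U r / r / D r + (r * deriv (deriv U) r - c * pressure U r / r) / (D r)\<^sup>2"
definition P where "P r = (x r)\<^sup>2 * (pressure U r / D r)"
definition P' where "P' r = 2 * x r / (l * r\<^sup>2) * (pressure U r / D r) + (x r)\<^sup>2 * Q' r"
definition g where "g r = (if r \<le> 1 / l then 0 else P r / r\<^sup>2)"
text \<open>A primitive of \<open>g\<close>, which is to be the derivative of the mean slope of
  \<open>V\<close>, normalised so that \<open>V 1 = U 1\<close>. The difference of two integrals
  from \<open>0\<close> covers \<open>r < 1\<close>, and for negative \<open>r\<close> the empty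
  interval agrees with \<open>g = 0\<close>.\<close>

definition G where "G r = integral {0..r} g - integral {0..1} g"
definition V where "V r = r * (U 1 + G r)"

lemma c: "0 < c" "c \<le> 1" "N \<noteq> \<infinity> \<Longrightarrow> c < 1"
  using DC_exponent[OF N] by auto

lemmas p_nonneg = DC_pressure_nonneg[OF U N]

lemma q_nonneg: "r > 0 \<Longrightarrow> 0 \<le> q r"
  unfolding q_def using p_nonneg by simp

lemma q_mono: "0 < r \<Longrightarrow> r \<le> s \<Longrightarrow> q r \<le> q s"
  using mono_onD[OF DC_quotient_mono[OF U N], of r s] unfolding q_def by simp

lemma D_ge: "r > 0 \<Longrightarrow> 1 \<le> D r"
  unfolding D_def using q_nonneg l by simp

lemma x_bounds: "0 \<le> x r" "r > 0 \<Longrightarrow> x r \<le> 1"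
  unfolding x_def using l by auto

lemma x_zero: "0 < r \<Longrightarrow> r \<le> 1 / l \<Longrightarrow> x r = 0"
  unfolding x_def using l by (simp add: field_simps)

lemma x_pos: "1 / l \<le> r \<Longrightarrow> x r = 1 - 1 / (l * r)"
proof -
  assume r: "1 / l \<le> r"
  then have "r > 0" using l by (auto intro: less_le_trans[of 0 "1 / l"])
  then show ?thesis unfolding x_def using l r by (simp add: field_simps)
qed

lemma x_mono: "0 < r \<Longrightarrow> r \<le> s \<Longrightarrow> x r \<le> x s"
  unfolding x_def using l by (intro max.mono) (auto simp: frac_le)

text \<open>The cutoff enters \<open>P\<close> squared because the square of the positive part is
  C^1 while the positive part is not; this is what gives \<open>V\<close> two derivatives across
  \<open>1/l\<close>.\<close>

lemma square_max_deriv: "((\<lambda>y::real. (max 0 y)\<^sup>2) has_real_derivative 2 * max 0 y) (at y)"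
proof -
  consider "y > 0" | "y < 0" | "y = 0" by linarith
  then show ?thesis
  proof cases
    case 1
    then have "\<forall>\<^sub>F z in nhds y. z > 0" by (intro eventually_nhds_in_open[of "{0<..}", simplified]) auto
    then have ev: "\<forall>\<^sub>F z in nhds y. (max 0 z)\<^sup>2 = z\<^sup>2" by eventually_elim simp
    show ?thesis using 1 by (subst DERIV_cong_ev[OF refl ev refl]) (auto intro!: derivative_eq_intros)
  next
    case 2
    then have "\<forall>\<^sub>F z in nhds y. z < 0" by (intro eventually_nhds_in_open[of "{..<0}", simplified]) auto
    then have ev: "\<forall>\<^sub>F z in nhds y. (max 0 z)\<^sup>2 = 0" by eventually_elim simp
    show ?thesis using 2 by (subst DERIV_cong_ev[OF refl ev refl]) (auto intro!: derivative_eq_intros)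
  next
    case 3
    have eq: "((max 0 h)\<^sup>2 - 0) / h = max 0 h" for h :: real
      by (cases "h > 0") (auto simp: max_def power2_eq_square)
    have "(\<lambda>h. ((max 0 h)\<^sup>2 - 0) / h) \<midarrow>0\<rightarrow> max 0 (0::real)"
      unfolding eq by (intro tendsto_intros)
    then show ?thesis using 3 by (simp add: DERIV_def)
  qed
qed

lemma x2_deriv:
  assumes "r > 0"
  shows "((\<lambda>r. (x r)\<^sup>2) has_real_derivative 2 * x r / (l * r\<^sup>2)) (at r)"
proof -
  have "((\<lambda>r. 1 - 1 / (l * r)) has_real_derivative 1 / (l * r\<^sup>2)) (at r)"
    using assms l by (auto intro!: derivative_eq_intros simp: power2_eq_square field_simps)
  from DERIV_chain2[OF square_max_deriv this]
  show ?thesis unfolding x_def by simp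
qed

text \<open>With \<open>u = r U''\<close> and \<open>a = c p / r\<close>, the numerator of the
  quotient rule is \<open>u D - (D - 1) (u - a) = a D + (u - a)\<close>. This form exhibits
  \<open>Q'\<close> as a sum of two terms that are nonnegative by \<open>DC_pressure_le\<close> and
  can only grow when \<open>D\<close> is replaced by \<open>1\<close>.\<close>

lemma pD_deriv:
  assumes r: "r > 0"
  shows "((\<lambda>r. pressure U r / D r) has_real_derivative Q' r) (at r)"
proof -
  let ?X = "r * deriv (deriv U) r - c * pressure U r / r"
  have D: "D r \<noteq> 0" using D_ge[OF r] by simp
  have "(D has_real_derivative ?X / r powr c / l) (at r)"
    unfolding D_def[abs_def] q_def[abs_def]
    using DERIV_add[OF DERIV_const[of 1] DERIV_cdivide[OF DC_quotient_deriv[OF U N r], of l]] by simp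
  then have "((\<lambda>r. pressure U r / D r) has_real_derivative
      (r * deriv (deriv U) r * D r - pressure U r * (?X / r powr c / l)) / (D r * D r)) (at r)"
    by (rule DERIV_divide[OF DC_pressure_deriv[OF U N r]]) (rule D)
  also have "pressure U r * (?X / r powr c / l) = (D r - 1) * ?X"
    unfolding D_def q_def by simp
  also have "(r * deriv (deriv U) r * D r - (D r - 1) * ?X) / (D r * D r) = Q' r"
  proof -
    have "u * D r - (D r - 1) * (u - a) = a * D r + (u - a)" for u a by (simp add: algebra_simps)
    then have "r * deriv (deriv U) r * D r - (D r - 1) * ?X = (c * pressure U r / r) * D r + ?X" .
    moreover have "(a * D r + b) / (D r * D r) = a / D r + b / (D r)\<^sup>2" for a b
      using D by (simp add: add_divide_distrib power2_eq_square)
    ultimately show ?thesis unfolding Q'_def by (simp only:)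
  qed
  finally show ?thesis .
qed

lemma P_deriv: "r > 0 \<Longrightarrow> (P has_real_derivative P' r) (at r)"
  unfolding P_def[abs_def] P'_def
  by (rule DERIV_cong[OF DERIV_mult[OF x2_deriv pD_deriv]]) auto

lemma Q'_nonneg: "r > 0 \<Longrightarrow> 0 \<le> Q' r"
  unfolding Q'_def using DC_pressure_le[OF U N, of r] p_nonneg[of r] D_ge[of r] c
  by (intro add_nonneg_nonneg divide_nonneg_nonneg) auto

lemma P'_nonneg: "r > 0 \<Longrightarrow> 0 \<le> P' r"
  unfolding P'_def using Q'_nonneg[of r] p_nonneg[of r] D_ge[of r] x_bounds(1)[of r] l by simp

lemma P_nonneg: "r > 0 \<Longrightarrow> 0 \<le> P r"
  unfolding P_def using p_nonneg[of r] D_ge[of r] by simp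

lemma P_le: "r > 0 \<Longrightarrow> P r \<le> pressure U r"
proof -
  assume r: "r > 0"
  have "P r \<le> 1 * (pressure U r / D r)"
    unfolding P_def using x_bounds[of r] r p_nonneg[of r] D_ge[of r] by (intro mult_right_mono power_le_one) auto
  also have "\<dots> \<le> pressure U r" using divide_le_self[OF p_nonneg[OF r] D_ge[OF r]] by simp
  finally show ?thesis .
qed

lemma P_zero: "0 < r \<Longrightarrow> r \<le> 1 / l \<Longrightarrow> P r = 0"
  unfolding P_def using x_zero by simp

text \<open>The damping alone gives \<open>l r^c\<close>, which for \<open>c < 1\<close> exceeds
  every linear bound near \<open>0\<close>. The cutoff repairs this: \<open>P\<close> vanishes up to
  \<open>1/l\<close>, and beyond it \<open>r^(c-1)\<close> is at most
  \<open>(1/l)^(c-1)\<close>.\<close>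

lemma P_linear:
  assumes r: "r > 0"
  shows "P r \<le> l * (1 / l) powr (c - 1) * r"
proof (cases "r \<le> 1 / l")
  case True
  then show ?thesis using P_zero[OF r] r l by simp
next
  case False
  have "pressure U r / D r = r powr c * (q r / D r)" using r by (simp add: q_def)
  also have "q r / D r \<le> l" unfolding D_def using q_nonneg[OF r] l by (simp add: field_simps add_nonneg_pos)
  then have "r powr c * (q r / D r) \<le> r powr c * l" by (intro mult_left_mono) auto
  also have "r powr c = r powr (c - 1) * r" using r by (simp add: powr_diff)
  also have "r powr (c - 1) \<le> (1 / l) powr (c - 1)" using False c l by (intro powr_mono2') auto
  then have "r powr (c - 1) * r * l \<le> (1 / l) powr (c - 1) * r * l" using r l by (intro mult_right_mono) auto
  finally have *: "pressure U r / D r \<le> l * (1 / l) powr (c - 1) * r" by (simp add: mult_ac)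
  have "P r \<le> 1 * (pressure U r / D r)"
    unfolding P_def using x_bounds[of r] r p_nonneg[of r] D_ge[of r] by (intro mult_right_mono power_le_one) auto
  then show ?thesis using * by simp
qed

lemma P_power:
  assumes r: "r > 0"
  shows "P r \<le> l * r powr c"
proof -
  have "pressure U r / D r = r powr c * (q r / D r)" using r by (simp add: q_def)
  also have "q r / D r \<le> l" unfolding D_def using q_nonneg[OF r] l by (simp add: field_simps add_nonneg_pos)
  then have "r powr c * (q r / D r) \<le> r powr c * l" by (intro mult_left_mono) auto
  finally have *: "pressure U r / D r \<le> l * r powr c" by (simp add: mult_ac)
  have "P r \<le> 1 * (pressure U r / D r)"
    unfolding P_def using x_bounds[of r] r p_nonneg[of r] D_ge[of r] by (intro mult_right_mono power_le_one) auto
  then show ?thesis using * by simp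
qed

lemma g_eq: "r > 0 \<Longrightarrow> g r = P r / r\<^sup>2"
  unfolding g_def using P_zero by simp

lemma l_inv: "0 < 1 / l" "1 / l \<le> 1" using l by auto

lemma eventually_less: "r < s \<Longrightarrow> \<forall>\<^sub>F z in nhds r. z < (s::real)"
  by (intro eventually_nhds_in_open[of "{..<s}", simplified]) auto

lemma eventually_greater: "s < r \<Longrightarrow> \<forall>\<^sub>F z in nhds r. (s::real) < z"
  by (intro eventually_nhds_in_open[of "{s<..}", simplified]) auto

lemma rg_deriv: "((\<lambda>r. r * g r) has_real_derivative (if r \<le> 1 / l then 0 else P' r / r - P r / r\<^sup>2)) (at r)"
proof (cases "r < 1 / l")
  case True
  have ev: "\<forall>\<^sub>F s in nhds r. s * g s = 0" using eventually_less[OF True] by eventually_elim (simp add: g_def)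
  show ?thesis using True by (subst DERIV_cong_ev[OF refl ev refl]) auto
next
  case False
  then have r: "r > 0" using l_inv by linarith
  have ev: "\<forall>\<^sub>F s in nhds r. s * g s = P s / s"
    using eventually_greater[OF r] by eventually_elim (simp add: g_eq power2_eq_square)
  have "((\<lambda>s. P s / s) has_real_derivative P' r / r - P r / r\<^sup>2) (at r)"
    using r by (auto intro!: derivative_eq_intros P_deriv simp: power2_eq_square field_simps)
  moreover have "P' r / r - P r / r\<^sup>2 = 0" if "r \<le> 1 / l"
    using that r x_zero[of r] by (simp add: P'_def P_def)
  ultimately show ?thesis by (subst DERIV_cong_ev[OF refl ev refl]) (auto split: if_splits)
qed

lemma g_continuous: "isCont g r"
proof (cases "r < 1 / l")
  case True
  have ev: "\<forall>\<^sub>F s in nhds r. g s = 0" using eventually_less[OF True] by eventually_elim (simp add: g_def)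
  show ?thesis by (subst isCont_cong[OF ev]) auto
next
  case False
  then have r: "r > 0" using l_inv by linarith
  have ev: "\<forall>\<^sub>F s in nhds r. g s = P s / s\<^sup>2"
    using eventually_greater[OF r] by eventually_elim (simp add: g_eq)
  have "isCont (\<lambda>s. P s / s\<^sup>2) r"
    using r DERIV_isCont[OF P_deriv[OF r]] by (intro continuous_intros) auto
  then show ?thesis by (subst isCont_cong[OF ev])
qed

lemma g_nonneg: "0 \<le> g r"
proof (cases "r \<le> 1 / l")
  case False
  then have "r > 0" using l_inv by linarith
  then show ?thesis using P_nonneg g_eq by simp
qed (simp add: g_def)

lemma G_deriv: "(G has_real_derivative g r) (at r)"
proof (cases "r < 1 / l")
  case True
  have "G s = - integral {0..1} g" if "s < 1 / l" for s
  proof -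
    have "integral {0..s} g = integral {0..s} (\<lambda>_. 0)"
      using that by (intro integral_cong) (simp add: g_def)
    then show ?thesis by (simp add: G_def)
  qed
  then have ev: "\<forall>\<^sub>F s in nhds r. G s = - integral {0..1} g" using eventually_less[OF True] by (auto elim: eventually_mono)
  show ?thesis using True by (subst DERIV_cong_ev[OF refl ev refl]) (auto simp: g_def)
next
  case False
  then have r: "r > 0" using l_inv by linarith
  have "((\<lambda>s. integral {0..s} g) has_real_derivative g r) (at r within {0..r + 1})"
    using r g_continuous by (intro integral_has_real_derivative continuous_at_imp_continuous_on) auto
  then have "((\<lambda>s. integral {0..s} g) has_real_derivative g r) (at r)"
    using r by (subst (asm) at_within_interior) auto
  then show ?thesis unfolding G_def[abs_def] by (auto intro!: derivative_eq_intros)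
qed

lemma G_one: "G 1 = 0" by (simp add: G_def)

definition V' where "V' r = U 1 + G r + r * g r"
definition V'' where "V'' r = g r + (if r \<le> 1 / l then 0 else P' r / r - P r / r\<^sup>2)"

lemma V_deriv: "(V has_real_derivative V' r) (at r)"
  unfolding V_def[abs_def] V'_def by (auto intro!: derivative_eq_intros G_deriv)

lemma V'_deriv: "(V' has_real_derivative V'' r) (at r)"
  unfolding V'_def[abs_def] V''_def
  using DERIV_add[OF DERIV_add[OF DERIV_const[of "U 1"] G_deriv[of r]] rg_deriv[of r]] by simp

lemma deriv_V: "deriv V = V'" "deriv (deriv V) = V''"
proof -
  show "deriv V = V'" using V_deriv DERIV_imp_deriv by blast
  then show "deriv (deriv V) = V''" using V'_deriv DERIV_imp_deriv by force
qed

lemma V''_eq: "r > 0 \<Longrightarrow> V'' r = P' r / r"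
  unfolding V''_def using g_eq[of r] x_zero[of r] by (auto simp: P'_def P_def)

lemma V''_nonneg: "0 \<le> V'' r"
proof (cases "r \<le> 1 / l")
  case False
  then have "r > 0" using l_inv by linarith
  then show ?thesis using P'_nonneg V''_eq by simp
qed (simp add: V''_def g_def)

lemma pressure_V: "r > 0 \<Longrightarrow> pressure V r = P r"
  unfolding pressure_def deriv_V(1) V_def V'_def using g_eq[of r] by (simp add: power2_eq_square algebra_simps)

lemma V_DC: "V \<in> DC N"
  unfolding DC_def
proof (intro CollectI conjI allI impI)
  show "continuous_on {0..} V" using V_deriv DERIV_isCont by (intro continuous_at_imp_continuous_on) blast
  show "convex_on {0..} V"
    by (rule f''_ge0_imp_convex[OF _ V_deriv V'_deriv V''_nonneg]) auto
  show "V 0 = 0" by (simp add: V_def)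
  fix r :: real assume "r > 0"
  show "V differentiable at r" using V_deriv real_differentiable_def by blast
  show "deriv V differentiable at r" unfolding deriv_V using V'_deriv real_differentiable_def by blast
next
  have "continuous_on {0<..} (\<lambda>r. P' r / r)"
  proof -
    have cp: "continuous_on {0<..} (pressure U)"
      by (rule continuous_at_imp_continuous_on) (use DC_pressure_deriv[OF U N] DERIV_isCont in blast)
    have cD: "continuous_on {0<..} D"
      unfolding D_def[abs_def] q_def using cp l by (intro continuous_intros) auto
    have cx: "continuous_on {0<..} x"
      unfolding x_def[abs_def] using l by (intro continuous_intros) auto
    have "D r \<noteq> 0" if "r > 0" for r using D_ge[OF that] by simp
    then show ?thesis
      unfolding P'_def Q'_def using cp cD cx DC_continuous_deriv2[OF U N] l by (intro continuous_intros) auto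
  qed
  then show "continuous_on {0<..} (deriv (deriv V))"
    unfolding deriv_V(2) by (rule continuous_on_eq) (simp add: V''_eq)
  show "mono_on {0<..} (\<lambda>r. pressure V r / r powr (1 - real_of_ereal (1 / N)))"
    unfolding DC_exponent_def[symmetric]
  proof (rule mono_onI)
    fix r s :: real assume rs: "r \<in> {0<..}" "s \<in> {0<..}" "r \<le> s"
    have eq: "pressure V t / t powr c = (x t)\<^sup>2 * (q t / D t)" if "t > 0" for t
      using that by (simp add: pressure_V P_def q_def)
    have "q r / D r \<le> q s / D s"
    proof -
      have "q r * D s \<le> q s * D r"
        unfolding D_def using q_mono[of r s] rs by (simp add: algebra_simps)
      then show ?thesis using D_ge[of r] D_ge[of s] rs by (simp add: frac_le_eq divide_le_eq pos_le_divide_eq mult.commute field_simps)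
    qed
    then have "(x r)\<^sup>2 * (q r / D r) \<le> (x s)\<^sup>2 * (q s / D s)"
      using rs x_mono[of r s] x_bounds(1)[of r] q_nonneg[of r] D_ge[of r]
      by (intro mult_mono power_mono) auto
    then show "pressure V r / r powr c \<le> pressure V s / s powr c" using rs by (simp only: eq greaterThan_iff)
  qed
qed

text \<open>The derivative of \<open>G\<close> is at most \<open>l r^(c-2)\<close>, which is
  integrable at infinity for \<open>c < 1\<close>; its integral from \<open>1\<close> to infinity is
  \<open>l / (1 - c)\<close>.\<close>

lemma V_bound: "N \<noteq> \<infinity> \<Longrightarrow> r > 0 \<Longrightarrow> V r \<le> (U 1 + l / (1 - c)) * r"
proof -
  assume fin: "N \<noteq> \<infinity>" and r: "r > 0"
  have c1: "c < 1" using c(3)[OF fin] .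
  have "G r \<le> l / (1 - c)"
  proof (cases "r \<le> 1")
    case True
    have "G r \<le> G 1" by (rule DERIV_nonneg_imp_nondecreasing[OF True]) (use G_deriv g_nonneg in blast)
    then show ?thesis using G_one c1 l by (simp add: order_trans)
  next
    case False
    have "G r + l / (1 - c) * r powr (c - 1) \<le> G 1 + l / (1 - c) * 1 powr (c - 1)"
    proof (rule DERIV_nonpos_imp_nonincreasing[of 1 r "\<lambda>y. G y + l / (1 - c) * y powr (c - 1)"])
      fix y assume y: "1 \<le> y" "y \<le> r"
      have "((\<lambda>y. G y + l / (1 - c) * y powr (c - 1)) has_real_derivative g y + l / (1 - c) * ((c - 1) * y powr (c - 1 - 1))) (at y)"
        using y c1 by (auto intro!: derivative_eq_intros G_deriv)
      moreover have "g y + l / (1 - c) * ((c - 1) * y powr (c - 1 - 1)) \<le> 0"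
      proof -
        have "l / (1 - c) * ((c - 1) * y powr (c - 1 - 1)) = - l * y powr (c - 2)"
          using c1 by (simp add: field_simps)
        also have "y powr (c - 2) = y powr c / y\<^sup>2" using y by (simp add: powr_diff powr_numeral)
        finally show ?thesis using P_power[of y] y g_eq[of y] by (simp add: divide_right_mono)
      qed
      ultimately show "\<exists>z. ((\<lambda>y. G y + l / (1 - c) * y powr (c - 1)) has_real_derivative z) (at y) \<and> z \<le> 0" by blast
    qed (use False in simp)
    moreover have "0 \<le> l / (1 - c) * r powr (c - 1)" using l c1 by simp
    ultimately show ?thesis using G_one by simp
  qed
  then show "V r \<le> (U 1 + l / (1 - c)) * r" unfolding V_def using r by (simp add: mult.commute)
qed

lemma V_tame: "tame N V"
  unfolding tame_def
proof (intro conjI V_DC impI)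
  have "V r = (U 1 - integral {0..1} g) * r" if "r < 1 / l" for r
  proof -
    have "integral {0..r} g = integral {0..r} (\<lambda>_. 0)"
      using that by (intro integral_cong) (simp add: g_def)
    then show ?thesis by (simp add: V_def G_def)
  qed
  then show "\<exists>a e. 0 < e \<and> (\<forall>r<e. V r = a * r)" using l_inv by blast
  show "\<exists>C. \<forall>r>0. pressure V r \<le> C * r" using P_linear by (auto simp: pressure_V)
  assume "N \<noteq> \<infinity>"
  then show "\<exists>C. \<forall>r>0. V r \<le> C * r" using V_bound by blast
qed

lemma mean_slope_V: "r > 0 \<Longrightarrow> mean_slope V r = U 1 + G r"
  by (simp add: mean_slope_def V_def)

text \<open>\<open>G\<close> and \<open>mean_slope U\<close> have the derivatives
  \<open>P / r^2\<close> and \<open>p / r^2\<close>, so the pointwise bounds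
  \<open>k p \<le> P \<le> p\<close> integrate to bounds between increments.\<close>

lemma G_compare:
  assumes ab: "0 < a" "a \<le> b" and k: "\<And>r. a \<le> r \<Longrightarrow> r \<le> b \<Longrightarrow> k * pressure U r \<le> P r"
  shows "k * (mean_slope U b - mean_slope U a) \<le> G b - G a" "G b - G a \<le> mean_slope U b - mean_slope U a"
proof -
  have "G a - k * mean_slope U a \<le> G b - k * mean_slope U b"
  proof (rule DERIV_nonneg_imp_nondecreasing[OF ab(2)])
    fix r assume r: "a \<le> r" "r \<le> b"
    have "((\<lambda>r. G r - k * mean_slope U r) has_real_derivative g r - k * (pressure U r / r\<^sup>2)) (at r)"
      using r ab by (auto intro!: derivative_eq_intros G_deriv mean_slope_deriv[OF U N])
    moreover have "g r - k * (pressure U r / r\<^sup>2) = (P r - k * pressure U r) / r\<^sup>2"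
      using r ab by (simp add: g_eq diff_divide_distrib)
    then have "g r - k * (pressure U r / r\<^sup>2) \<ge> 0" using k[OF r] by simp
    ultimately show "\<exists>y. ((\<lambda>r. G r - k * mean_slope U r) has_real_derivative y) (at r) \<and> y \<ge> 0" by blast
  qed
  then show "k * (mean_slope U b - mean_slope U a) \<le> G b - G a" by (simp add: algebra_simps)
  have "mean_slope U a - G a \<le> mean_slope U b - G b"
  proof (rule DERIV_nonneg_imp_nondecreasing[OF ab(2)])
    fix r assume r: "a \<le> r" "r \<le> b"
    have "((\<lambda>r. mean_slope U r - G r) has_real_derivative pressure U r / r\<^sup>2 - g r) (at r)"
      using r ab by (auto intro!: derivative_eq_intros G_deriv mean_slope_deriv[OF U N])
    moreover have "pressure U r / r\<^sup>2 - g r \<ge> 0"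
      using r ab P_le[of r] by (simp add: g_eq divide_right_mono)
    ultimately show "\<exists>y. ((\<lambda>r. mean_slope U r - G r) has_real_derivative y) (at r) \<and> y \<ge> 0" by blast
  qed
  then show "G b - G a \<le> mean_slope U b - mean_slope U a" by simp
qed

text \<open>The constant comes from the derivative of the cutoff: where \<open>x > 0\<close>,
  \<open>1 / (l r) = 1 - x\<close>, so
  \<open>2 x / (l r^2) = 2 x (1 - x) / r \<le> 1 / (2 r)\<close>, and
  \<open>p \<le> r^2 U'' / c\<close> by \<open>DC_pressure_le\<close>. The remaining term
  contributes at most \<open>r U''\<close>. The bound does not depend on \<open>l\<close>, as
  domination of the slope term requires.\<close>

lemma V''_le:
  assumes r: "r > 0"
  shows "V'' r \<le> (1 + 1 / (2 * c)) * deriv (deriv U) r"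
proof -
  let ?u = "deriv (deriv U) r"
  have D: "1 \<le> D r" by (rule D_ge[OF r])
  have p: "pressure U r \<le> r\<^sup>2 * ?u / c"
    using DC_pressure_le[OF U N r] r c by (simp add: power2_eq_square field_simps)
  have Q: "Q' r \<le> r * ?u"
  proof -
    have "c * pressure U r / r / D r \<le> c * pressure U r / r"
      using p_nonneg[OF r] r c D by (intro divide_le_self) auto
    moreover have "(r * ?u - c * pressure U r / r) / (D r)\<^sup>2 \<le> r * ?u - c * pressure U r / r"
    proof -
      have "1 \<le> (D r)\<^sup>2" using D by (simp add: one_le_power)
      then show ?thesis using DC_pressure_le[OF U N r]
        by (intro divide_le_self) auto
    qed
    ultimately show ?thesis unfolding Q'_def by linarith
  qed
  have pD: "pressure U r / D r \<le> r\<^sup>2 * ?u / c"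
  proof -
    have "pressure U r / D r \<le> pressure U r" by (rule divide_le_self[OF p_nonneg[OF r] D])
    then show ?thesis using p by simp
  qed
  have xx: "2 * x r / (l * r\<^sup>2) \<le> 1 / (2 * r)"
  proof (cases "x r = 0")
    case False
    then have "1 / l \<le> r" using x_zero[OF r] by linarith
    then have eq: "1 - x r = 1 / (l * r)" using x_pos by simp
    have "2 * x r / (l * r\<^sup>2) = 2 * (x r * (1 - x r)) / r" unfolding eq by (simp add: power2_eq_square)
    also have "x r * (1 - x r) \<le> 1 / 4" using zero_le_power2[of "x r - 1 / 2"] by (simp add: power2_eq_square algebra_simps)
    then have "2 * (x r * (1 - x r)) / r \<le> 2 * (1 / 4) / r" using r by (intro divide_right_mono mult_left_mono) auto
    finally show ?thesis by simp
  qed (use r in simp)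
  have "P' r \<le> 1 / (2 * r) * (r\<^sup>2 * ?u / c) + 1 * (r * ?u)"
    unfolding P'_def
  proof (intro add_mono mult_mono)
    show "(x r)\<^sup>2 \<le> 1" using x_bounds[of r] r by (simp add: power_le_one)
  qed (use xx pD Q p_nonneg[OF r] D Q'_nonneg[OF r] r x_bounds in auto)
  also have "\<dots> = r * ((1 + 1 / (2 * c)) * ?u)" using r c by (simp add: power2_eq_square field_simps)
  finally have "P' r / r \<le> (1 + 1 / (2 * c)) * ?u" using r by (simp add: divide_le_eq mult.commute)
  then show ?thesis using V''_eq[OF r] by simp
qed

end

text \<open>Both \<open>x\<close> and \<open>D\<close> are nondecreasing, so on
  \<open>[a, b]\<close> the damping factor \<open>x^2 / D\<close> is at least the one with
  \<open>x\<close> taken at the left end and \<open>D\<close> at the right end. That factor tends to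
  \<open>1\<close> as \<open>l\<close> grows.\<close>

lemma (in damping) P_ge:
  assumes "0 < a" "a \<le> y" "y \<le> b"
  shows "(x a)\<^sup>2 / D b * pressure U y \<le> P y"
proof -
  have "(x a)\<^sup>2 / D b \<le> (x y)\<^sup>2 / D y"
  proof (rule frac_le)
    show "(x a)\<^sup>2 \<le> (x y)\<^sup>2" using x_mono[of a y] x_bounds(1)[of a] assms by (intro power_mono) auto
    show "0 < D y" using D_ge[of y] assms by simp
    show "D y \<le> D b" unfolding D_def using q_mono[of y b] l assms by (simp add: divide_right_mono)
  qed simp
  then have "(x a)\<^sup>2 / D b * pressure U y \<le> (x y)\<^sup>2 / D y * pressure U y"
    using p_nonneg[of y] assms by (intro mult_right_mono) auto
  then show ?thesis by (simp add: P_def)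
qed

text \<open>Damping shrinks the increments of \<open>m\<close> away from the normalisation point
  \<open>1\<close>, so the approximating mean slopes lie between \<open>U 1\<close> and those of
  \<open>U\<close>. These two-sided bounds supply the later majorants.\<close>

theorem tame_approximation:
  assumes U: "U \<in> DC N" and N: "1 < N"
  obtains V :: "nat \<Rightarrow> real \<Rightarrow> real" and A :: real where
    "\<And>n. tame N (V n)" "0 \<le> A"
    "\<And>n r. 0 < r \<Longrightarrow> pressure (V n) r \<le> pressure U r"
    "\<And>r. 0 < r \<Longrightarrow> (\<lambda>n. pressure (V n) r) \<longlonglongrightarrow> pressure U r"
    "\<And>n r. 0 < r \<Longrightarrow> r \<le> 1 \<Longrightarrow> mean_slope U r \<le> mean_slope (V n) r \<and> mean_slope (V n) r \<le> U 1"
    "\<And>n r. 1 \<le> r \<Longrightarrow> U 1 \<le> mean_slope (V n) r \<and> mean_slope (V n) r \<le> mean_slope U r"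
    "\<And>r. 0 < r \<Longrightarrow> (\<lambda>n. mean_slope (V n) r) \<longlonglongrightarrow> mean_slope U r"
    "\<And>n r. 0 < r \<Longrightarrow> deriv (deriv (V n)) r \<le> A * deriv (deriv U) r"
    "\<And>r. 0 < r \<Longrightarrow> (\<lambda>n. deriv (deriv (V n)) r) \<longlonglongrightarrow> deriv (deriv U) r"
proof -
  define l where "l n = real (Suc n)" for n
  interpret damping U N "l n" for n
    by unfold_locales (use U N in \<open>auto simp: l_def\<close>)
  have lim0: "(\<lambda>n. 1 / (l n * a)) \<longlonglongrightarrow> 0" for a :: real
    using tendsto_mult_right_zero[OF LIMSEQ_inverse_real_of_nat, of "1 / a"] unfolding l_def by (simp add: field_simps)
  have lim0': "(\<lambda>n. a / l n) \<longlonglongrightarrow> 0" for a :: real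
    using tendsto_mult_right_zero[OF LIMSEQ_inverse_real_of_nat, of a] unfolding l_def by (simp add: divide_inverse)
  have lim_x: "(\<lambda>n. x n a) \<longlonglongrightarrow> 1" for a
  proof -
    have "(\<lambda>n. max 0 (1 - 1 / (l n * a))) \<longlonglongrightarrow> max 0 (1 - 0)"
      by (intro tendsto_intros lim0)
    then show ?thesis unfolding x_def by simp
  qed
  have lim_D: "(\<lambda>n. D n a) \<longlonglongrightarrow> 1" for a
    using tendsto_add[OF tendsto_const[of "1::real"] lim0'[of "q a"]] unfolding D_def by simp
  have lim_P: "(\<lambda>n. P n r) \<longlonglongrightarrow> pressure U r" for r
  proof -
    have "(\<lambda>n. (x n r)\<^sup>2 * (pressure U r / D n r)) \<longlonglongrightarrow> 1\<^sup>2 * (pressure U r / 1)"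
      by (intro tendsto_intros lim_x lim_D) simp
    then show ?thesis unfolding P_def by simp
  qed
  have lim_P': "(\<lambda>n. P' n r) \<longlonglongrightarrow> r * deriv (deriv U) r" if r: "r > 0" for r
  proof -
    have "(\<lambda>n. 2 * x n r * (1 / (l n * r\<^sup>2)) * (pressure U r / D n r) + (x n r)\<^sup>2 *
        (c * pressure U r / r / D n r + (r * deriv (deriv U) r - c * pressure U r / r) / (D n r)\<^sup>2))
      \<longlonglongrightarrow> 2 * 1 * 0 * (pressure U r / 1) + 1\<^sup>2 *
        (c * pressure U r / r / 1 + (r * deriv (deriv U) r - c * pressure U r / r) / 1\<^sup>2)"
      by (intro tendsto_intros lim_x lim_D lim0) simp_all
    then show ?thesis unfolding P'_def Q'_def by simp
  qed
  have m1: "mean_slope U 1 = U 1" by (simp add: mean_slope_def)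
  have V_upper: "U 1 \<le> mean_slope (V n) r" "mean_slope (V n) r \<le> mean_slope U r" if "1 \<le> r" for n r
    using G_compare[of 1 r 0 n] that P_nonneg G_one by (auto simp: mean_slope_V m1)
  have V_lower: "mean_slope U r \<le> mean_slope (V n) r" "mean_slope (V n) r \<le> U 1" if "0 < r" "r \<le> 1" for n r
    using G_compare[of r 1 0 n] that P_nonneg G_one by (auto simp: mean_slope_V m1)
  have V_lim: "(\<lambda>n. mean_slope (V n) r) \<longlonglongrightarrow> mean_slope U r" if r: "0 < r" for r
  proof -
    \<comment> \<open>The interval between \<open>r\<close> and \<open>1\<close>, so that one
      comparison treats both orders.\<close>
    define a b where "a = min r 1" and "b = max r 1"
    have ab: "0 < a" "a \<le> b" using r by (auto simp: a_def b_def)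
    let ?k = "\<lambda>n. (x n a)\<^sup>2 / D n b"
    have k: "?k n * pressure U y \<le> P n y" if "a \<le> y" "y \<le> b" for n y
      by (rule P_ge[OF ab(1) that])
    note cmp1 = G_compare(1)[OF ab k] and cmp2 = G_compare(2)[OF ab k]
    have "(\<lambda>n. ?k n * (mean_slope U b - mean_slope U a)) \<longlonglongrightarrow> 1\<^sup>2 / 1 * (mean_slope U b - mean_slope U a)"
      by (intro tendsto_intros lim_x lim_D) simp
    then have lower: "(\<lambda>n. ?k n * (mean_slope U b - mean_slope U a)) \<longlonglongrightarrow> mean_slope U b - mean_slope U a" by simp
    have lim: "(\<lambda>n. G n b - G n a) \<longlonglongrightarrow> mean_slope U b - mean_slope U a"
      by (rule tendsto_sandwich[OF always_eventually[OF allI[OF cmp1]] always_eventually[OF allI[OF cmp2]] lower tendsto_const])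
    have "(\<lambda>n. U 1 + G n r) \<longlonglongrightarrow> mean_slope U r"
    proof (cases "r \<le> 1")
      case True
      then have "a = r" "b = 1" by (auto simp: a_def b_def)
      then show ?thesis using tendsto_diff[OF tendsto_const[of "U 1"] lim] by (simp add: G_one m1)
    next
      case False
      then have "a = 1" "b = r" by (auto simp: a_def b_def)
      then show ?thesis using tendsto_add[OF tendsto_const[of "U 1"] lim] by (simp add: G_one m1)
    qed
    then show ?thesis unfolding mean_slope_V[OF r] .
  qed
  have V''_lim: "(\<lambda>n. deriv (deriv (V n)) r) \<longlonglongrightarrow> deriv (deriv U) r" if r: "0 < r" for r
    using tendsto_divide[OF lim_P'[OF r] tendsto_const[of r]] unfolding deriv_V(2) V''_eq[OF r] using r by simp
  have A: "0 \<le> 1 + 1 / (2 * c)" using c(1) by simp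
  show ?thesis
    by (rule that[of V "1 + 1 / (2 * c)"])
       (use V_tame A P_le lim_P V_upper V_lower V_lim V''_le V''_lim in \<open>auto simp only: pressure_V deriv_V(2)\<close>)
qed

section \<open>Distortion coefficients\<close>

text \<open>The distance rescaled to an angle; the absolute value lets it serve the circular and the
  hyperbolic case alike. For \<open>K > 0\<close> it equals \<open>pi\<close> at
  \<open>myers_diameter\<close>.\<close>

definition ang :: "real \<Rightarrow> real \<Rightarrow> real \<Rightarrow> real" where
  "ang K n r = r * sqrt (\<bar>K\<bar> / (n - 1))"

definition s_ratio :: "real \<Rightarrow> real \<Rightarrow> real \<Rightarrow> real \<Rightarrow> real" where
  "s_ratio K n t r = s_KN K n (t * r) / (t * s_KN K n r)"

lemma s_ratio_pos: "K > 0 \<Longrightarrow> n > 1 \<Longrightarrow> s_ratio K n t r = sin (t * ang K n r) / (t * sin (ang K n r))"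
  by (simp add: s_ratio_def s_KN_def ang_def mult.assoc)

lemma s_ratio_neg: "K < 0 \<Longrightarrow> n > 1 \<Longrightarrow> s_ratio K n t r = sinh (t * ang K n r) / (t * sinh (ang K n r))"
  by (simp add: s_ratio_def s_KN_def ang_def mult.assoc)

lemma s_ratio_zero: "t \<noteq> 0 \<Longrightarrow> r \<noteq> 0 \<Longrightarrow> s_ratio 0 n t r = 1"
  by (simp add: s_ratio_def s_KN_def)

lemma ang_less_pi:
  assumes "K > 0" "n > 1"
  shows "ang K n r < pi \<longleftrightarrow> r < myers_diameter K n"
proof -
  have s: "sqrt ((n - 1) / K) > 0" using assms by simp
  have "ang K n r * sqrt ((n - 1) / K) = r"
    using assms by (simp add: ang_def mult.assoc flip: real_sqrt_mult)
  then have "ang K n r < pi \<longleftrightarrow> r < pi * sqrt ((n - 1) / K)"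
    using mult_less_cancel_right_pos[OF s, of "ang K n r" pi] by simp
  then show ?thesis by (simp add: myers_diameter_def)
qed

lemma ang_eq_pi:
  assumes "K > 0" "n > 1" "r = myers_diameter K n"
  shows "ang K n r = pi"
  using assms by (simp add: ang_def myers_diameter_def mult.assoc flip: real_sqrt_mult)

lemma ang_pos: "K \<noteq> 0 \<Longrightarrow> n > 1 \<Longrightarrow> r > 0 \<Longrightarrow> ang K n r > 0"
  by (simp add: ang_def)

lemma sin_concave_bound:
  assumes "0 \<le> a" "a \<le> pi" "0 \<le> t" "t \<le> 1"
  shows "t * sin a \<le> sin (t * a)"
proof -
  have "concave_on {0..pi} sin"
    by (rule f''_le0_imp_concave[where f' = cos and f'' = "\<lambda>x. - sin x"])
       (auto intro!: derivative_eq_intros simp: sin_ge_zero)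
  from concave_onD[OF this assms(3,4), of 0 a] show ?thesis using assms by simp
qed

text \<open>\<open>sinh (t a) = exp (t a) (1 - exp (- 2 t a)) / 2\<close>, and convexity of the
  exponential gives \<open>1 - exp (- 2 t a) \<ge> t (1 - exp (- 2 a))\<close>. After logarithms the
  loss is linear in \<open>1 - t\<close>.\<close>

lemma sinh_lower_bound:
  fixes a t :: real
  assumes "0 \<le> a" "0 \<le> t" "t \<le> 1"
  shows "t * sinh a * exp (- (a * (1 - t))) \<le> sinh (t * a)"
proof -
  have "exp ((1 - t) *\<^sub>R 0 + t *\<^sub>R (- 2 * a)) \<le> (1 - t) * exp 0 + t * exp (- 2 * a)"
    using assms by (intro convex_onD[OF exp_convex]) auto
  then have "t * (1 - exp (- 2 * a)) \<le> 1 - exp (- 2 * (t * a))" by (simp add: algebra_simps)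
  then have "exp (t * a) * (t * (1 - exp (- 2 * a))) / 2 \<le> exp (t * a) * (1 - exp (- 2 * (t * a))) / 2"
    by (intro divide_right_mono mult_left_mono) auto
  also have "\<dots> = sinh (t * a)"
    by (simp add: sinh_field_def right_diff_distrib flip: exp_add)
  also have "exp (t * a) * (t * (1 - exp (- 2 * a))) / 2 = t * sinh a * exp (- (a * (1 - t)))"
  proof -
    have "sinh a * exp (- (a * (1 - t))) = (exp a * exp (- (a * (1 - t))) - exp (- a) * exp (- (a * (1 - t)))) / 2"
      by (simp add: sinh_field_def left_diff_distrib)
    also have "exp a * exp (- (a * (1 - t))) = exp (t * a)" by (simp add: algebra_simps flip: exp_add)
    also have "exp (- a) * exp (- (a * (1 - t))) = exp (t * a) * exp (- 2 * a)" by (simp add: algebra_simps flip: exp_add)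
    finally have eq: "sinh a * exp (- (a * (1 - t))) = (exp (t * a) - exp (t * a) * exp (- 2 * a)) / 2" .
    have "exp (t * a) * (t * (1 - exp (- 2 * a))) / 2 = t * ((exp (t * a) - exp (t * a) * exp (- 2 * a)) / 2)"
      by (simp add: right_diff_distrib mult_ac)
    then show ?thesis unfolding eq[symmetric] by (simp only: mult.assoc)
  qed
  finally show ?thesis .
qed

lemma sinh_ge_self: "0 \<le> x \<Longrightarrow> x \<le> sinh (x::real)"
proof -
  assume x: "0 \<le> x"
  have "sinh 0 - 0 \<le> sinh x - x"
  proof (rule DERIV_nonneg_imp_nondecreasing[OF x])
    fix y :: real
    have "((\<lambda>y. sinh y - y) has_real_derivative cosh y - 1) (at y)" by (auto intro!: derivative_eq_intros)
    then show "\<exists>z. ((\<lambda>y. sinh y - y) has_real_derivative z) (at y) \<and> 0 \<le> z" using cosh_real_ge_1 by force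
  qed
  then show ?thesis by simp
qed

section \<open>Coefficients as functions of the distance\<close>

definition rbeta :: "real \<Rightarrow> ereal \<Rightarrow> real \<Rightarrow> real \<Rightarrow> ereal" where
  "rbeta K N t r =
     (if N = \<infinity> then ereal (exp (K / 6 * (1 - t\<^sup>2) * r\<^sup>2))
      else if K > 0 \<and> r \<ge> myers_diameter K (real_of_ereal N) then \<infinity>
      else if r = 0 then 1
      else ereal (s_ratio K (real_of_ereal N) t r powr (real_of_ereal N - 1)))"

definition rbeta0 :: "real \<Rightarrow> ereal \<Rightarrow> real \<Rightarrow> ereal" where
  "rbeta0 K N r =
     (if N = \<infinity> then ereal (exp (K / 6 * r\<^sup>2))
      else if K > 0 \<and> r \<ge> myers_diameter K (real_of_ereal N) then \<infinity>
      else if r = 0 \<or> K = 0 then 1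
      else if K > 0 then ereal ((ang K (real_of_ereal N) r / sin (ang K (real_of_ereal N) r)) powr (real_of_ereal N - 1))
      else ereal ((ang K (real_of_ereal N) r / sinh (ang K (real_of_ereal N) r)) powr (real_of_ereal N - 1)))"

text \<open>From the critical distance on, the difference quotient of the coefficients is
  \<open>(\<infinity> - \<infinity>) / (1 - t)\<close>, which is \<open>\<infinity>\<close> in
  \<open>ereal\<close>; hence this value.\<close>

definition rbeta' :: "real \<Rightarrow> ereal \<Rightarrow> real \<Rightarrow> ereal" where
  "rbeta' K N r =
     (if N = \<infinity> then ereal (- (K / 3 * r\<^sup>2))
      else if K > 0 \<and> r \<ge> myers_diameter K (real_of_ereal N) then \<infinity>
      else if r = 0 \<or> K = 0 then 0
      else if K > 0 then ereal ((real_of_ereal N - 1) * (ang K (real_of_ereal N) r * cos (ang K (real_of_ereal N) r) / sin (ang K (real_of_ereal N) r) - 1))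
      else ereal ((real_of_ereal N - 1) * (ang K (real_of_ereal N) r * cosh (ang K (real_of_ereal N) r) / sinh (ang K (real_of_ereal N) r) - 1)))"

lemma beta_coef_eq_rbeta:
  assumes "irreversible_metric d" "t \<noteq> 0"
  shows "beta_coef d K N t x y = rbeta K N t (d x y)"
  using assms irreversible_metricD(2)[OF assms(1), of x y]
  by (simp add: beta_coef_def rbeta_def s_ratio_def Let_def)

lemma measurable_ang [measurable]: "ang K n \<in> borel_measurable borel"
  unfolding ang_def[abs_def] by measurable

lemma measurable_s_KN [measurable]: "s_KN K n \<in> borel_measurable borel"
proof -
  have [measurable]: "sinh \<in> borel_measurable (borel :: real measure)"
    by (intro borel_measurable_continuous_onI continuous_intros)
  show ?thesis unfolding s_KN_def[abs_def] by measurable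
qed

lemma measurable_rbeta [measurable]: "rbeta K N t \<in> borel_measurable borel"
  unfolding rbeta_def[abs_def] s_ratio_def by measurable

lemma measurable_rbeta0 [measurable]: "rbeta0 K N \<in> borel_measurable borel"
proof -
  have [measurable]: "sinh \<in> borel_measurable (borel :: real measure)"
    by (intro borel_measurable_continuous_onI continuous_intros)
  show ?thesis unfolding rbeta0_def[abs_def] by measurable
qed

lemma measurable_rbeta' [measurable]: "rbeta' K N \<in> borel_measurable borel"
proof -
  have [measurable]: "sinh \<in> borel_measurable (borel :: real measure)" "cosh \<in> borel_measurable (borel :: real measure)"
    by (intro borel_measurable_continuous_onI continuous_intros)+
  show ?thesis unfolding rbeta'_def[abs_def] by measurable
qed

definition subcritical :: "real \<Rightarrow> ereal \<Rightarrow> real \<Rightarrow> bool" where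
  "subcritical K N r \<longleftrightarrow> 0 \<le> r \<and> (K > 0 \<and> N \<noteq> \<infinity> \<longrightarrow> r < myers_diameter K (real_of_ereal N))"

lemma rbeta_infinite: "0 \<le> r \<Longrightarrow> \<not> subcritical K N r \<Longrightarrow> rbeta K N t r = \<infinity> \<and> rbeta0 K N r = \<infinity> \<and> rbeta' K N r = \<infinity> \<and> K > 0 \<and> N \<noteq> \<infinity>"
  by (auto simp: subcritical_def rbeta_def rbeta0_def rbeta'_def)

lemma s_ratio_power_deriv:
  fixes f :: "real \<Rightarrow> real"
  assumes "(f has_real_derivative D) (at 1)" "f 1 = 1"
  shows "((\<lambda>t. f t powr m) has_real_derivative m * D) (at 1)"
proof -
  have "((\<lambda>t. f t powr m) has_real_derivative f 1 powr m * (0 * ln (f 1) + D * m / f 1)) (at 1)"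
    using assms by (intro has_real_derivative_powr') auto
  then show ?thesis using assms by (simp add: mult.commute)
qed

text \<open>A common interface to the exponential, constant, circular and hyperbolic formulas: below
  the critical distance the coefficient is a positive real function, differentiable at
  \<open>1\<close>, and this is what the limit of the source term uses.\<close>

lemma rbeta_smooth:
  assumes N: "1 < N" and r: "subcritical K N r"
  obtains f B where "\<And>t. 0 < t \<Longrightarrow> t \<le> 1 \<Longrightarrow> rbeta K N t r = ereal (f t) \<and> 0 < f t"
    "(f has_real_derivative B) (at 1)" "f 1 = 1" "rbeta' K N r = ereal B"
proof (cases "N = \<infinity>")
  case True
  show ?thesis
    by (rule that[of "\<lambda>t. exp (K / 6 * (1 - t\<^sup>2) * r\<^sup>2)" "- (K / 3 * r\<^sup>2)"])
       (use True in \<open>auto simp: rbeta_def rbeta'_def intro!: derivative_eq_intros\<close>)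
next
  case False
  then obtain n where n: "N = ereal n" "n > 1" using N by (cases N) auto
  have r0: "r \<ge> 0" using r by (simp add: subcritical_def)
  consider "r = 0" | "r > 0" "K = 0" | "r > 0" "K > 0" | "r > 0" "K < 0" using r0 by linarith
  then show ?thesis
  proof cases
    case 1
    have "myers_diameter K n > 0" if "K > 0" using that n by (simp add: myers_diameter_def)
    then show ?thesis using 1 n
      by (intro that[of "\<lambda>_. 1" 0]) (auto simp: rbeta_def rbeta'_def)
  next
    case 2
    show ?thesis using 2 n
      by (intro that[of "\<lambda>_. 1" 0]) (auto simp: rbeta_def rbeta'_def s_ratio_zero)
  next
    case 3
    let ?a = "ang K n r"
    have a: "0 < ?a" "?a < pi" using 3 n r ang_less_pi[of K n r] ang_pos[of K n r] by (auto simp: subcritical_def)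
    have sa: "sin ?a > 0" using a by (intro sin_gt_zero) auto
    have D: "((\<lambda>t. s_ratio K n t r) has_real_derivative (?a * cos ?a / sin ?a - 1)) (at 1)"
      unfolding s_ratio_pos[OF 3(2) n(2)] using sa
      by (auto intro!: derivative_eq_intros simp: field_simps)
    have pos: "s_ratio K n t r > 0" if "0 < t" "t \<le> 1" for t
    proof -
      have "0 < t * ?a" "t * ?a < pi" using that a by (auto intro: le_less_trans[OF mult_left_le_one_le[of ?a t]])
      then have "sin (t * ?a) > 0" by (intro sin_gt_zero) auto
      then show ?thesis unfolding s_ratio_pos[OF 3(2) n(2)] using that sa by simp
    qed
    have one: "s_ratio K n 1 r = 1" unfolding s_ratio_pos[OF 3(2) n(2)] using sa by simp
    have lt: "\<not> myers_diameter K n \<le> r" using r 3 n by (simp add: subcritical_def)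
    show ?thesis
    proof (rule that[of "\<lambda>t. s_ratio K n t r powr (n - 1)" "(n - 1) * (?a * cos ?a / sin ?a - 1)"])
      fix t :: real assume t: "0 < t" "t \<le> 1"
      show "rbeta K N t r = ereal (s_ratio K n t r powr (n - 1)) \<and> 0 < s_ratio K n t r powr (n - 1)"
        using pos[OF t] lt 3 n by (simp add: rbeta_def)
    next
      show "((\<lambda>t. s_ratio K n t r powr (n - 1)) has_real_derivative (n - 1) * (?a * cos ?a / sin ?a - 1)) (at 1)"
        by (rule s_ratio_power_deriv[OF D one])
    qed (use lt 3 n one in \<open>auto simp: rbeta'_def\<close>)
  next
    case 4
    let ?a = "ang K n r"
    have a: "0 < ?a" using 4 n ang_pos[of K n r] by auto
    have sa: "sinh ?a > 0" using a by simp
    have D: "((\<lambda>t. s_ratio K n t r) has_real_derivative (?a * cosh ?a / sinh ?a - 1)) (at 1)"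
      unfolding s_ratio_neg[OF 4(2) n(2)] using sa
      by (auto intro!: derivative_eq_intros simp: field_simps)
    have pos: "s_ratio K n t r > 0" if "0 < t" for t
      unfolding s_ratio_neg[OF 4(2) n(2)] using that a by simp
    have one: "s_ratio K n 1 r = 1" unfolding s_ratio_neg[OF 4(2) n(2)] using sa by simp
    show ?thesis
    proof (rule that[of "\<lambda>t. s_ratio K n t r powr (n - 1)" "(n - 1) * (?a * cosh ?a / sinh ?a - 1)"])
      fix t :: real assume t: "0 < t" "t \<le> 1"
      show "rbeta K N t r = ereal (s_ratio K n t r powr (n - 1)) \<and> 0 < s_ratio K n t r powr (n - 1)"
        using pos[OF t(1)] 4 n by (simp add: rbeta_def)
    next
      show "((\<lambda>t. s_ratio K n t r powr (n - 1)) has_real_derivative (n - 1) * (?a * cosh ?a / sinh ?a - 1)) (at 1)"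
        by (rule s_ratio_power_deriv[OF D one])
    qed (use 4 n one in \<open>auto simp: rbeta'_def\<close>)
  qed
qed

lemma rbeta_pos: "1 < N \<Longrightarrow> 0 \<le> r \<Longrightarrow> 0 < t \<Longrightarrow> t \<le> 1 \<Longrightarrow> 0 < rbeta K N t r"
  by (cases "subcritical K N r") (metis ereal_less(2) rbeta_smooth, simp add: rbeta_infinite)

lemma rbeta_ge_one:
  assumes N: "1 < N" and K: "K > 0" and r: "0 \<le> r" and t: "0 < t" "t \<le> 1"
  shows "1 \<le> rbeta K N t r"
proof (cases "subcritical K N r")
  case sub: True
  show ?thesis
  proof (cases "N = \<infinity> \<or> r = 0")
    case True
    moreover have "t\<^sup>2 \<le> 1" using t by (simp add: power_le_one)
    ultimately show ?thesis using K by (auto simp: rbeta_def one_ereal_def)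
  next
    case False
    then obtain n where n: "N = ereal n" "n > 1" using N by (cases N) auto
    have a: "0 < ang K n r" "ang K n r < pi"
      using n sub K False r ang_less_pi[of K n r] ang_pos[of K n r] by (auto simp: subcritical_def)
    have "t * sin (ang K n r) \<le> sin (t * ang K n r)" using a t by (intro sin_concave_bound) auto
    moreover have "sin (ang K n r) > 0" using a by (intro sin_gt_zero) auto
    ultimately have "1 \<le> s_ratio K n t r" unfolding s_ratio_pos[OF K n(2)] using t by (simp add: le_divide_eq)
    then have "1 \<le> s_ratio K n t r powr (n - 1)" using n by (intro ge_one_powr_ge_zero) auto
    then show ?thesis using n by (simp add: rbeta_def one_ereal_def)
  qed
qed (use rbeta_infinite[OF r] in simp)

text \<open>At time \<open>1 - t\<close> the bound is \<open>exp (- C t)\<close>: the logarithm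
  deviates linearly in the time step, uniformly for bounded distances, which absorbs the factor
  \<open>1/t\<close> of the source quotient. For finite \<open>N\<close> the rate is
  \<open>n - 1\<close> times the angle at distance \<open>R\<close>.\<close>

lemma rbeta_ln_lower:
  assumes N: "1 < N" and K: "K \<le> 0"
  shows "\<exists>C\<ge>0. \<forall>r t. 0 \<le> r \<longrightarrow> r \<le> R \<longrightarrow> 0 < t \<longrightarrow> t \<le> 1 \<longrightarrow> exp (- (C * (1 - t))) \<le> rbeta K N t r"
proof (cases "N = \<infinity>")
  case True
  have "exp (- (\<bar>K\<bar> * R\<^sup>2 * (1 - t))) \<le> exp (K / 6 * (1 - t\<^sup>2) * r\<^sup>2)" if "0 \<le> r" "r \<le> R" "0 < t" "t \<le> 1" for r t
  proof -
    have "\<bar>K\<bar> / 6 * (1 - t\<^sup>2) * r\<^sup>2 \<le> \<bar>K\<bar> / 6 * (2 * (1 - t)) * R\<^sup>2"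
    proof (intro mult_mono)
      have "1 - t\<^sup>2 = (1 + t) * (1 - t)" by (simp add: power2_eq_square algebra_simps)
      also have "\<dots> \<le> 2 * (1 - t)" using that by (intro mult_right_mono) auto
      finally show "1 - t\<^sup>2 \<le> 2 * (1 - t)" .
    qed (use that in \<open>auto intro: power_mono power_le_one\<close>)
    also have "\<dots> = (\<bar>K\<bar> * R\<^sup>2 * (1 - t)) / 3" by simp
    also have "\<dots> \<le> \<bar>K\<bar> * R\<^sup>2 * (1 - t)" using that by (simp add: divide_le_eq)
    finally show ?thesis using K by simp
  qed
  then show ?thesis using True by (intro exI[of _ "\<bar>K\<bar> * R\<^sup>2"]) (auto simp: rbeta_def)
next
  case False
  then obtain n where n: "N = ereal n" "n > 1" using N by (cases N) auto
  let ?C = "(n - 1) * \<bar>ang K n R\<bar>"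
  have "exp (- (?C * (1 - t))) \<le> rbeta K N t r" if r: "0 \<le> r" "r \<le> R" and t: "0 < t" "t \<le> 1" for r t
  proof (cases "r = 0 \<or> K = 0")
    case True
    then have "rbeta K N t r = 1" using n t K by (auto simp: rbeta_def s_ratio_zero)
    then show ?thesis using n t by (simp add: one_ereal_def)
  next
    case False
    then have K': "K < 0" and r': "r > 0" using K r by auto
    let ?a = "ang K n r"
    have a: "0 < ?a" using ang_pos[of K n r] K' r' n by simp
    have aR: "?a \<le> \<bar>ang K n R\<bar>"
    proof -
      have "?a \<le> ang K n R" unfolding ang_def using r n by (intro mult_right_mono) auto
      then show ?thesis by simp
    qed
    have "exp (- (\<bar>ang K n R\<bar> * (1 - t))) \<le> exp (- (?a * (1 - t)))" using aR t by (simp add: mult_right_mono)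
    also have "\<dots> \<le> s_ratio K n t r"
      unfolding s_ratio_neg[OF K' n(2)] using sinh_lower_bound[of ?a t] a t by (simp add: le_divide_eq mult.commute mult.left_commute)
    finally have "exp (- (\<bar>ang K n R\<bar> * (1 - t))) powr (n - 1) \<le> s_ratio K n t r powr (n - 1)"
      using n by (intro powr_mono2) auto
    then show ?thesis using K' r' n by (simp add: rbeta_def powr_def mult_ac)
  qed
  then show ?thesis using n by (intro exI[of _ ?C]) auto
qed

text \<open>In the hyperbolic case the comparison of \<open>a / sinh a\<close> with
  \<open>sinh (t a) / (t sinh a)\<close> is \<open>t a \<le> sinh (t a)\<close>. It lets the limit
  coefficient dominate the target term at all times.\<close>

lemma rbeta0_le_rbeta:
  assumes N: "1 < N" and K: "K \<le> 0" and r: "0 \<le> r" and t: "0 < t" "t \<le> 1"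
  shows "rbeta0 K N r \<le> rbeta K N t r"
proof (cases "N = \<infinity>")
  case True
  have "K * r\<^sup>2 \<le> K * r\<^sup>2 * (1 - t\<^sup>2)"
  proof -
    have "0 \<le> - K * r\<^sup>2 * t\<^sup>2" using K by (intro mult_nonneg_nonneg) auto
    then show ?thesis by (simp add: algebra_simps)
  qed
  then show ?thesis using True by (simp add: rbeta0_def rbeta_def mult_ac)
next
  case False
  then obtain n where n: "N = ereal n" "n > 1" using N by (cases N) auto
  show ?thesis
  proof (cases "r = 0 \<or> K = 0")
    case True
    then show ?thesis using n t K by (auto simp: rbeta_def rbeta0_def s_ratio_zero)
  next
    case False
    then have K': "K < 0" and r': "r > 0" using K r by auto
    let ?a = "ang K n r"
    have a: "0 < ?a" using ang_pos[of K n r] K' r' n by simp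
    have "t * ?a \<le> sinh (t * ?a)" using a t by (intro sinh_ge_self) auto
    then have "?a / sinh ?a \<le> s_ratio K n t r"
      unfolding s_ratio_neg[OF K' n(2)] using a t by (simp add: field_simps)
    then have "(?a / sinh ?a) powr (n - 1) \<le> s_ratio K n t r powr (n - 1)"
      using n a by (intro powr_mono2) auto
    then show ?thesis using K' r' n by (simp add: rbeta_def rbeta0_def)
  qed
qed

lemma tendsto_at_right_0:
  fixes f :: "real \<Rightarrow> real"
  assumes "(f has_real_derivative D) (at 0)" "f 0 = 0"
  shows "((\<lambda>t. f t / t) \<longlongrightarrow> D) (at_right 0)"
proof -
  have "((\<lambda>t. f t / t) \<longlongrightarrow> D) (at 0)" using assms by (simp add: DERIV_def)
  then show ?thesis by (rule tendsto_mono[OF at_le, rotated]) simp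
qed

lemma rbeta_tendsto_rbeta0:
  assumes N: "1 < N" and r: "0 \<le> r"
  shows "((\<lambda>t. rbeta K N t r) \<longlongrightarrow> rbeta0 K N r) (at_right 0)"
proof (cases "subcritical K N r")
  case sub: True
  have ev: "eventually (\<lambda>t::real. t \<noteq> 0) (at_right 0)" by (simp add: eventually_at_filter)
  show ?thesis
  proof (cases "N = \<infinity>")
    case True
    have "((\<lambda>t. exp (K / 6 * (1 - t\<^sup>2) * r\<^sup>2)) \<longlongrightarrow> exp (K / 6 * (1 - 0\<^sup>2) * r\<^sup>2)) (at_right 0)"
      by (intro tendsto_intros)
    then show ?thesis using True by (simp add: rbeta_def rbeta0_def)
  next
    case False
    then obtain n where n: "N = ereal n" "n > 1" using N by (cases N) auto
    consider "r = 0" | "r > 0" "K = 0" | "r > 0" "K > 0" | "r > 0" "K < 0" using r by linarith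
    then show ?thesis
    proof cases
      case 1
      have "myers_diameter K n > 0" if "K > 0" using that n by (simp add: myers_diameter_def)
      then show ?thesis using 1 n by (auto simp: rbeta_def rbeta0_def)
    next
      case 2
      have "((\<lambda>t. rbeta K N t r) \<longlongrightarrow> 1) (at_right 0)"
        by (rule tendsto_eventually) (use ev 2 n in \<open>auto simp: rbeta_def s_ratio_zero elim!: eventually_mono\<close>)
      then show ?thesis using 2 n by (simp add: rbeta0_def)
    next
      case 3
      let ?a = "ang K n r"
      have a: "0 < ?a" "?a < pi" using 3 n sub ang_less_pi[of K n r] ang_pos[of K n r] by (auto simp: subcritical_def)
      have sa: "sin ?a > 0" using a by (intro sin_gt_zero) auto
      have "((\<lambda>t. sin (t * ?a) / t) \<longlongrightarrow> ?a) (at_right 0)"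
        by (rule tendsto_at_right_0) (auto intro!: derivative_eq_intros)
      then have "((\<lambda>t. (sin (t * ?a) / t / sin ?a) powr (n - 1)) \<longlongrightarrow> (?a / sin ?a) powr (n - 1)) (at_right 0)"
        using sa a by (intro tendsto_intros) auto
      then show ?thesis using 3 n sub by (simp add: rbeta_def rbeta0_def subcritical_def s_ratio_pos)
    next
      case 4
      let ?a = "ang K n r"
      have a: "0 < ?a" using 4 n ang_pos[of K n r] by auto
      have "((\<lambda>t. sinh (t * ?a) / t) \<longlongrightarrow> ?a) (at_right 0)"
        by (rule tendsto_at_right_0) (auto intro!: derivative_eq_intros)
      then have "((\<lambda>t. (sinh (t * ?a) / t / sinh ?a) powr (n - 1)) \<longlongrightarrow> (?a / sinh ?a) powr (n - 1)) (at_right 0)"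
        using a by (intro tendsto_intros) auto
      then show ?thesis using 4 n by (simp add: rbeta_def rbeta0_def s_ratio_neg)
    qed
  qed
qed (use rbeta_infinite[OF r] in simp)

lemma beta_zero_plus_eq:
  assumes "irreversible_metric d" "1 < N"
  shows "beta_zero_plus d K N x y = rbeta0 K N (d x y)"
  unfolding beta_zero_plus_def
proof (rule tendsto_Lim)
  have ev: "eventually (\<lambda>t::real. t \<noteq> 0) (at_right 0)" by (simp add: eventually_at_filter)
  have "eventually (\<lambda>t. rbeta K N t (d x y) = beta_coef d K N t x y) (at_right 0)"
    using ev by eventually_elim (simp add: beta_coef_eq_rbeta[OF assms(1)])
  then show "((\<lambda>t. beta_coef d K N t x y) \<longlongrightarrow> rbeta0 K N (d x y)) (at_right 0)"
    by (rule Lim_transform_eventually[OF rbeta_tendsto_rbeta0[OF assms(2) irreversible_metricD(1)[OF assms(1)]]])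
qed simp

lemma beta_deriv_one_eq:
  assumes d: "irreversible_metric d" and N: "1 < N"
  shows "beta_deriv_one d K N x y = rbeta' K N (d x y)"
  unfolding beta_deriv_one_def
proof (rule tendsto_Lim)
  have ev: "eventually (\<lambda>t::real. t \<in> {0<..<1}) (at_left 1)" by (rule eventually_at_left_real) simp
  show "((\<lambda>t. (beta_coef d K N 1 x y - beta_coef d K N t x y) / ereal (1 - t)) \<longlongrightarrow> rbeta' K N (d x y)) (at_left 1)"
  proof (cases "subcritical K N (d x y)")
    case True
    obtain f B where f: "\<And>t. 0 < t \<Longrightarrow> t \<le> 1 \<Longrightarrow> rbeta K N t (d x y) = ereal (f t) \<and> 0 < f t"
      "(f has_real_derivative B) (at 1)" "f 1 = 1" "rbeta' K N (d x y) = ereal B"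
      using rbeta_smooth[OF N True] by blast
    have "((\<lambda>t. (f t - f 1) / (t - 1)) \<longlongrightarrow> B) (at 1)"
      using f(2) by (simp add: has_field_derivative_iff)
    then have "((\<lambda>t. (f t - f 1) / (t - 1)) \<longlongrightarrow> B) (at_left 1)"
      by (rule tendsto_mono[OF at_le, rotated]) simp
    then have lim: "((\<lambda>t. ereal ((f t - f 1) / (t - 1))) \<longlongrightarrow> rbeta' K N (d x y)) (at_left 1)"
      by (simp add: f(4))
    show ?thesis
    proof (rule Lim_transform_eventually[OF lim])
      show "\<forall>\<^sub>F t in at_left 1. ereal ((f t - f 1) / (t - 1)) = (beta_coef d K N 1 x y - beta_coef d K N t x y) / ereal (1 - t)"
        using ev
      proof eventually_elim
        case (elim t)
        have "(f t - f 1) / (t - 1) = (f 1 - f t) / (1 - t)" using minus_divide_divide[of "f 1 - f t" "1 - t"] by simp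
        then show ?case using elim f(1)[of t] f(1)[of 1] by (simp add: beta_coef_eq_rbeta[OF d])
      qed
    qed
  next
    case False
    note inf = rbeta_infinite[OF irreversible_metricD(1)[OF d] False]
    have "\<forall>\<^sub>F t in at_left 1. (beta_coef d K N 1 x y - beta_coef d K N t x y) / ereal (1 - t) = \<infinity>"
      using ev by eventually_elim (use inf in \<open>simp add: beta_coef_eq_rbeta[OF d]\<close>)
    then show ?thesis using inf by (simp add: tendsto_eventually)
  qed
qed simp

section \<open>Dependence of the coefficients on the dimension\<close>

lemma myers_diameter_strict_mono:
  assumes "K > 0" "1 < n" "n < n'"
  shows "myers_diameter K n < myers_diameter K n'"
  using assms by (simp add: myers_diameter_def divide_strict_right_mono)

lemma tendsto_ang:
  assumes "n > 1"
  shows "((\<lambda>n'. ang K n' r) \<longlongrightarrow> ang K n r) (at_right n)"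
  unfolding ang_def using assms by (intro tendsto_intros) auto

lemma eventually_at_right_greater: "eventually (\<lambda>n'. n < n') (at_right (n::real))"
  by (simp add: eventually_at_right_less)

lemma filterlim_divide_at_top:
  fixes f g :: "'a \<Rightarrow> real"
  assumes f: "(f \<longlongrightarrow> c) F" "0 < c" and g: "(g \<longlongrightarrow> 0) F" "eventually (\<lambda>x. 0 < g x) F"
  shows "filterlim (\<lambda>x. f x / g x) at_top F"
proof -
  have "filterlim (\<lambda>x. inverse (g x)) at_top F"
    using g by (intro filterlim_inverse_at_top)
  from filterlim_tendsto_pos_mult_at_top[OF f this] show ?thesis by (simp add: divide_inverse)
qed

lemma powr_at_top:
  assumes "0 < (c::real)"
  shows "filterlim (\<lambda>x. x powr c) at_top at_top"
proof -
  have "filterlim (\<lambda>x. exp (c * ln x)) at_top at_top"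
    using assms by (intro filterlim_compose[OF exp_at_top] filterlim_tendsto_pos_mult_at_top[OF tendsto_const] ln_at_top)
  moreover have "\<forall>\<^sub>F x in at_top. exp (c * ln x) = x powr c"
    using eventually_gt_at_top[of 0] by eventually_elim (simp add: powr_def)
  ultimately show ?thesis by (simp add: filterlim_cong)
qed

lemma at_critical_angle:
  assumes K: "K > 0" and n: "n > 1" and r: "r = myers_diameter K n"
  shows "((\<lambda>n'. ang K n' r) \<longlongrightarrow> pi) (at_right n)"
    "\<forall>\<^sub>F n' in at_right n. 0 < ang K n' r \<and> ang K n' r < pi"
    "((\<lambda>n'. sin (ang K n' r)) \<longlongrightarrow> 0) (at_right n)"
    "\<forall>\<^sub>F n' in at_right n. 0 < sin (ang K n' r)"
proof -
  show lim: "((\<lambda>n'. ang K n' r) \<longlongrightarrow> pi) (at_right n)"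
    using tendsto_ang[OF n, of K r] ang_eq_pi[OF K n r] by simp
  from tendsto_sin[OF this] show "((\<lambda>n'. sin (ang K n' r)) \<longlongrightarrow> 0) (at_right n)" by simp
  have r0: "r > 0" using K n r by (simp add: myers_diameter_def)
  show ev: "\<forall>\<^sub>F n' in at_right n. 0 < ang K n' r \<and> ang K n' r < pi"
    using eventually_at_right_greater[of n]
  proof eventually_elim
    case (elim n')
    then show ?case using ang_pos[of K n' r] ang_less_pi[of K n' r] myers_diameter_strict_mono[OF K n elim] r r0 K n by auto
  qed
  then show "\<forall>\<^sub>F n' in at_right n. 0 < sin (ang K n' r)"
    by eventually_elim (auto intro: sin_gt_zero)
qed

text \<open>The delicate case is the critical distance: as \<open>n'\<close> decreases to
  \<open>n\<close> the angle increases to \<open>pi\<close>, its sine tends to \<open>0\<close> from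
  above, and \<open>sin (t * pi)\<close> is positive because \<open>t < 1\<close>; the ratio blows
  up to the value \<open>\<infinity>\<close> prescribed at \<open>n\<close>.\<close>

lemma rbeta_tendsto_dimension:
  assumes K: "K > 0" and n: "n > 1" and r: "0 \<le> r" "r \<le> myers_diameter K n" and t: "0 < t" "t < 1"
  shows "((\<lambda>N'. rbeta K N' t r) \<longlongrightarrow> rbeta K (ereal n) t r) (at_right (ereal n))"
  unfolding at_right_ereal filterlim_filtermap
proof -
  have sub: "\<forall>\<^sub>F n' in at_right n. r < myers_diameter K n' \<and> n' > 1"
    using eventually_at_right_greater[of n]
    by eventually_elim (use myers_diameter_strict_mono[OF K n] r n in fastforce)
  show "((\<lambda>n'. rbeta K (ereal n') t r) \<longlongrightarrow> rbeta K (ereal n) t r) (at_right n)"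
  proof (cases "r = 0")
    case True
    have "myers_diameter K n > 0" using K n by (simp add: myers_diameter_def)
    moreover have "\<forall>\<^sub>F n' in at_right n. rbeta K (ereal n') t r = 1"
      using sub by eventually_elim (use True in \<open>simp add: rbeta_def\<close>)
    ultimately show ?thesis using True by (simp add: tendsto_eventually rbeta_def)
  next
    case False
    then have r0: "r > 0" using r by simp
    have eq: "\<forall>\<^sub>F n' in at_right n. ereal ((sin (t * ang K n' r) / (t * sin (ang K n' r))) powr (n' - 1)) = rbeta K (ereal n') t r"
      using sub by eventually_elim (use r0 K in \<open>simp add: rbeta_def s_ratio_pos\<close>)
    show ?thesis
    proof (cases "r = myers_diameter K n")
      case True
      note crit = at_critical_angle[OF K n True]
      have tpi: "0 < t * pi" "t * pi < pi" using t by auto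
      have "filterlim (\<lambda>n'. sin (t * ang K n' r) / (t * sin (ang K n' r))) at_top (at_right n)"
      proof (rule filterlim_divide_at_top)
        show "((\<lambda>n'. sin (t * ang K n' r)) \<longlongrightarrow> sin (t * pi)) (at_right n)"
          by (intro tendsto_intros crit)
        show "0 < sin (t * pi)" using tpi by (intro sin_gt_zero)
        show "((\<lambda>n'. t * sin (ang K n' r)) \<longlongrightarrow> 0) (at_right n)" using tendsto_mult_left[OF crit(3), of t] by simp
        show "\<forall>\<^sub>F n' in at_right n. 0 < t * sin (ang K n' r)" using crit(4) by eventually_elim (use t in simp)
      qed
      then have top: "filterlim (\<lambda>n'. (sin (t * ang K n' r) / (t * sin (ang K n' r))) powr (n - 1)) at_top (at_right n)"
        using n by (intro filterlim_compose[OF powr_at_top]) simp_all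
      \<comment> \<open>The exponent varies with \<open>n'\<close> too; a base of at least
        \<open>1\<close> makes the fixed exponent \<open>n - 1\<close> a lower bound.\<close>
      have "\<forall>\<^sub>F n' in at_right n. 1 \<le> sin (t * ang K n' r) / (t * sin (ang K n' r))"
        using \<open>filterlim (\<lambda>n'. sin (t * ang K n' r) / (t * sin (ang K n' r))) at_top (at_right n)\<close>
        unfolding filterlim_at_top by blast
      then have "\<forall>\<^sub>F n' in at_right n. (sin (t * ang K n' r) / (t * sin (ang K n' r))) powr (n - 1)
          \<le> (sin (t * ang K n' r) / (t * sin (ang K n' r))) powr (n' - 1)"
        using eventually_at_right_greater[of n] by eventually_elim (intro powr_mono, auto)
      from filterlim_at_top_mono[OF top this]
      have "((\<lambda>n'. ereal ((sin (t * ang K n' r) / (t * sin (ang K n' r))) powr (n' - 1))) \<longlongrightarrow> \<infinity>) (at_right n)"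
        by (simp add: tendsto_PInfty_eq_at_top)
      then have "((\<lambda>n'. rbeta K (ereal n') t r) \<longlongrightarrow> \<infinity>) (at_right n)"
        by (rule Lim_transform_eventually[OF _ eq])
      then show ?thesis using True K by (simp add: rbeta_def)
    next
      case False
      then have lt: "r < myers_diameter K n" using r by simp
      have a: "0 < ang K n r" "ang K n r < pi" using lt ang_less_pi[OF K n] ang_pos[of K n r] K n r0 by auto
      have s: "0 < sin (ang K n r)" using a by (intro sin_gt_zero)
      have "0 < t * ang K n r" "t * ang K n r < pi" using t a by (auto intro: le_less_trans[OF mult_left_le_one_le[of "ang K n r" t]])
      then have s': "0 < sin (t * ang K n r)" by (intro sin_gt_zero)
      have "((\<lambda>n'. (sin (t * ang K n' r) / (t * sin (ang K n' r))) powr (n' - 1)) \<longlongrightarrow>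
          (sin (t * ang K n r) / (t * sin (ang K n r))) powr (n - 1)) (at_right n)"
        using s s' t by (intro tendsto_intros tendsto_ang[OF n]) auto
      then have "((\<lambda>n'. ereal ((sin (t * ang K n' r) / (t * sin (ang K n' r))) powr (n' - 1))) \<longlongrightarrow> rbeta K (ereal n) t r) (at_right n)"
        using lt r0 K n by (simp add: rbeta_def s_ratio_pos)
      then show ?thesis by (rule Lim_transform_eventually[OF _ eq])
    qed
  qed
qed

text \<open>At the critical distance the cotangent of the angle tends to
  \<open>-\<infinity>\<close>, since the angle approaches \<open>pi\<close> from below, whereas
  \<open>rbeta'\<close> at dimension \<open>n\<close> is \<open>\<infinity>\<close> there. Hence the
  case distinction.\<close>

lemma rbeta'_tendsto_dimension:
  assumes K: "K > 0" and n: "n > 1" and r: "0 \<le> r" "r \<le> myers_diameter K n"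
  shows "((\<lambda>N'. rbeta' K N' r) \<longlongrightarrow> (if r < myers_diameter K n then rbeta' K (ereal n) r else -\<infinity>)) (at_right (ereal n))"
  unfolding at_right_ereal filterlim_filtermap
proof -
  have sub: "\<forall>\<^sub>F n' in at_right n. r < myers_diameter K n' \<and> n' > 1"
    using eventually_at_right_greater[of n]
    by eventually_elim (use myers_diameter_strict_mono[OF K n] r n in fastforce)
  show "((\<lambda>n'. rbeta' K (ereal n') r) \<longlongrightarrow> (if r < myers_diameter K n then rbeta' K (ereal n) r else -\<infinity>)) (at_right n)"
  proof (cases "r = 0")
    case True
    have "myers_diameter K n > 0" using K n by (simp add: myers_diameter_def)
    moreover have "\<forall>\<^sub>F n' in at_right n. rbeta' K (ereal n') r = 0"
      using sub by eventually_elim (use True in \<open>simp add: rbeta'_def\<close>)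
    ultimately show ?thesis using True by (simp add: tendsto_eventually rbeta'_def)
  next
    case False
    then have r0: "r > 0" using r by simp
    let ?f = "\<lambda>n'. (n' - 1) * (ang K n' r * cos (ang K n' r) / sin (ang K n' r) - 1)"
    have eq: "\<forall>\<^sub>F n' in at_right n. ereal (?f n') = rbeta' K (ereal n') r"
      using sub by eventually_elim (use r0 K in \<open>simp add: rbeta'_def\<close>)
    show ?thesis
    proof (cases "r = myers_diameter K n")
      case True
      note crit = at_critical_angle[OF K n True]
      have "filterlim (\<lambda>n'. ((n' - 1) * (- (ang K n' r * cos (ang K n' r)) + sin (ang K n' r))) / sin (ang K n' r)) at_top (at_right n)"
      proof (rule filterlim_divide_at_top[OF _ _ crit(3,4)])
        show "((\<lambda>n'. (n' - 1) * (- (ang K n' r * cos (ang K n' r)) + sin (ang K n' r))) \<longlongrightarrow> (n - 1) * (- (pi * cos pi) + sin pi)) (at_right n)"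
          by (intro tendsto_intros crit)
        show "0 < (n - 1) * (- (pi * cos pi) + sin pi)" using n by simp
      qed
      then have "((\<lambda>n'. ereal (((n' - 1) * (- (ang K n' r * cos (ang K n' r)) + sin (ang K n' r))) / sin (ang K n' r))) \<longlongrightarrow> \<infinity>) (at_right n)"
        by (simp add: tendsto_PInfty_eq_at_top)
      then have lim: "((\<lambda>n'. - ereal (((n' - 1) * (- (ang K n' r * cos (ang K n' r)) + sin (ang K n' r))) / sin (ang K n' r))) \<longlongrightarrow> -\<infinity>) (at_right n)"
        by (rule tendsto_uminus_ereal)
      have "\<forall>\<^sub>F n' in at_right n. - ereal (((n' - 1) * (- (ang K n' r * cos (ang K n' r)) + sin (ang K n' r))) / sin (ang K n' r)) = ereal (?f n')"
        using crit(4) by eventually_elim (simp add: field_simps)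
      from Lim_transform_eventually[OF lim this]
      have "((\<lambda>n'. ereal (?f n')) \<longlongrightarrow> -\<infinity>) (at_right n)" .
      then have "((\<lambda>n'. rbeta' K (ereal n') r) \<longlongrightarrow> -\<infinity>) (at_right n)"
        by (rule Lim_transform_eventually[OF _ eq])
      then show ?thesis using True by simp
    next
      case False
      then have lt: "r < myers_diameter K n" using r by simp
      have a: "0 < ang K n r" "ang K n r < pi" using lt ang_less_pi[OF K n] ang_pos[of K n r] K n r0 by auto
      have s: "0 < sin (ang K n r)" using a by (intro sin_gt_zero)
      have "(?f \<longlongrightarrow> ?f n) (at_right n)"
        using s by (intro tendsto_intros tendsto_ang[OF n]) auto
      then have "((\<lambda>n'. ereal (?f n')) \<longlongrightarrow> rbeta' K (ereal n) r) (at_right n)"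
        using lt r0 K n by (simp add: rbeta'_def)
      then show ?thesis using lt by (simp add: Lim_transform_eventually[OF _ eq])
    qed
  qed
qed

text \<open>\<open>m ln (1 - a/m)\<close> is nondecreasing in \<open>m\<close>:
  \<open>1 - a/m'\<close> is the convex combination of \<open>1\<close> and \<open>1 - a/m\<close>
  with weight \<open>m/m'\<close> on the latter, and the logarithm is concave.\<close>

lemma one_minus_divide_powr_mono:
  fixes a m m' :: real
  assumes "0 < m" "m \<le> m'" "0 \<le> a" "a < m"
  shows "(1 - a / m) powr m \<le> (1 - a / m') powr m'"
proof -
  have "a / m < 1" using assms by simp
  moreover have "a / m' \<le> a / m" using assms by (intro divide_left_mono) auto
  ultimately have pos: "0 < 1 - a / m" "0 < 1 - a / m'" by auto
  have "(1 - m / m') * ln 1 + m / m' * ln (1 - a / m) \<le> ln ((1 - m / m') *\<^sub>R 1 + (m / m') *\<^sub>R (1 - a / m))"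
    using assms pos by (intro concave_onD[OF ln_concave]) auto
  also have "(1 - m / m') *\<^sub>R 1 + (m / m') *\<^sub>R (1 - a / m) = 1 - a / m'" using assms by (simp add: field_simps)
  finally have "m * ln (1 - a / m) \<le> m' * ln (1 - a / m')" using assms by (simp add: field_simps)
  moreover have "1 - a / m \<noteq> 0" "1 - a / m' \<noteq> 0" using pos by linarith+
  ultimately show ?thesis unfolding powr_def by (simp only: if_False exp_le_cancel_iff)
qed

text \<open>Euler's product: \<open>sin a / a\<close> is the product of the factors
  \<open>1 - a^2 / (pi k)^2\<close>. With \<open>a^2 = r^2 K / (n - 1)\<close> each factor has the
  form \<open>1 - a_k / (n - 1)\<close>, so its power \<open>n - 1\<close> is nondecreasing in
  \<open>n\<close>. Subcriticality keeps the factors positive.\<close>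

lemma sinc_power_mono:
  assumes K: "K > 0" and n: "1 < n" "n \<le> n'" and r: "0 < r" "r < myers_diameter K n"
  shows "(sin (ang K n r) / ang K n r) powr (n - 1) \<le> (sin (ang K n' r) / ang K n' r) powr (n' - 1)"
proof -
  have n': "1 < n'" using n by simp
  have r': "r < myers_diameter K n'"
    using r n myers_diameter_strict_mono[OF K n(1), of n'] by (cases "n = n'") auto
  let ?a = "\<lambda>k. r\<^sup>2 * K / (pi\<^sup>2 * (real k)\<^sup>2)"
  have lim: "(\<lambda>j. (\<Prod>k=1..j. 1 - ?a k / (m - 1)) powr (m - 1)) \<longlonglongrightarrow> (sin (ang K m r) / ang K m r) powr (m - 1)"
    and small: "?a k < m - 1" if m: "1 < m" "r < myers_diameter K m" and k: "k \<ge> 1" for m k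
  proof -
    have a: "0 < ang K m r" "ang K m r < pi" using m ang_less_pi[OF K m(1)] ang_pos[of K m r] K r by auto
    have sq: "(ang K m r)\<^sup>2 = r\<^sup>2 * K / (m - 1)" using K m by (simp add: ang_def power_mult_distrib)
    have "(\<lambda>j. \<Prod>k=1..j. 1 - (ang K m r / pi)\<^sup>2 / (real k)\<^sup>2) \<longlonglongrightarrow> sin (pi * (ang K m r / pi)) / (pi * (ang K m r / pi))"
      by (rule sin_product_formula_real') (use a in simp)
    also have "(\<lambda>j. \<Prod>k=1..j. 1 - (ang K m r / pi)\<^sup>2 / (real k)\<^sup>2) = (\<lambda>j. \<Prod>k=1..j. 1 - ?a k / (m - 1))"
      by (simp add: power_divide sq mult_ac)
    finally have "(\<lambda>j. \<Prod>k=1..j. 1 - ?a k / (m - 1)) \<longlonglongrightarrow> sin (ang K m r) / ang K m r" by simp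
    moreover have "sin (ang K m r) / ang K m r \<noteq> 0" using a sin_gt_zero[of "ang K m r"] by simp
    ultimately show "(\<lambda>j. (\<Prod>k=1..j. 1 - ?a k / (m - 1)) powr (m - 1)) \<longlonglongrightarrow> (sin (ang K m r) / ang K m r) powr (m - 1)"
      by (intro tendsto_intros) auto
    have "(ang K m r)\<^sup>2 < pi\<^sup>2" using a by (intro power_strict_mono) auto
    then have "r\<^sup>2 * K < pi\<^sup>2 * (m - 1)" using sq m by (simp add: divide_less_eq)
    also have "\<dots> \<le> pi\<^sup>2 * (m - 1) * (real k)\<^sup>2" using k m mult_left_mono[of 1 "(real k)\<^sup>2" "pi\<^sup>2 * (m - 1)"] by (simp add: one_le_power)
    finally show "?a k < m - 1" using k by (simp add: divide_less_eq mult_ac)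
  qed
  show ?thesis
  proof (rule LIMSEQ_le[OF lim[OF n(1) r(2), of 1] lim[OF n' r', of 1]])
    show "\<exists>j0. \<forall>j\<ge>j0. (\<Prod>k=1..j. 1 - ?a k / (n - 1)) powr (n - 1) \<le> (\<Prod>k=1..j. 1 - ?a k / (n' - 1)) powr (n' - 1)"
    proof (intro exI allI impI)
      fix j
      have pos: "0 < 1 - ?a k / (n - 1)" "0 < 1 - ?a k / (n' - 1)" if "k \<in> {1..j}" for k
        using small[OF n(1) r(2), of k] small[OF n' r', of k] that n n' by (auto simp: divide_less_eq mult_ac)
      have "(\<Prod>k=1..j. 1 - ?a k / (n - 1)) powr (n - 1) = (\<Prod>k=1..j. (1 - ?a k / (n - 1)) powr (n - 1))"
        by (rule prod_powr_distrib)
      also have "\<dots> \<le> (\<Prod>k=1..j. (1 - ?a k / (n' - 1)) powr (n' - 1))"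
        using n small[OF n(1) r(2)] K by (intro prod_mono conjI one_minus_divide_powr_mono) auto
      also have "\<dots> = (\<Prod>k=1..j. 1 - ?a k / (n' - 1)) powr (n' - 1)"
        by (rule prod_powr_distrib[symmetric])
      finally show "(\<Prod>k=1..j. 1 - ?a k / (n - 1)) powr (n - 1) \<le> (\<Prod>k=1..j. 1 - ?a k / (n' - 1)) powr (n' - 1)" .
    qed
  qed auto
qed

text \<open>In the subcritical range the limit coefficient is the reciprocal of the power of
  \<open>sin a / a\<close>. This monotonicity turns the limit over decreasing dimensions into a
  monotone one.\<close>

lemma rbeta0_antimono:
  assumes K: "K > 0" and n: "1 < n" "n \<le> n'" and r: "0 \<le> r"
  shows "rbeta0 K (ereal n') r \<le> rbeta0 K (ereal n) r"
proof (cases "r = 0 \<or> r \<ge> myers_diameter K n")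
  case True
  have "myers_diameter K n > 0" "myers_diameter K n' > 0" using K n by (auto simp: myers_diameter_def)
  then show ?thesis using True K by (auto simp: rbeta0_def)
next
  case False
  then have r0: "0 < r" "r < myers_diameter K n" using r by auto
  have r1: "r < myers_diameter K n'"
    using r0 n myers_diameter_strict_mono[OF K n(1), of n'] by (cases "n = n'") auto
  have inv: "(ang K m r / sin (ang K m r)) powr (m - 1) = inverse ((sin (ang K m r) / ang K m r) powr (m - 1))"
    and pos: "0 < (sin (ang K m r) / ang K m r) powr (m - 1)" if m: "1 < m" "r < myers_diameter K m" for m
  proof -
    have a: "0 < ang K m r" "ang K m r < pi" using m ang_less_pi[OF K m(1)] ang_pos[of K m r] K r0 by auto
    then have "0 < sin (ang K m r)" by (intro sin_gt_zero)
    then show "(ang K m r / sin (ang K m r)) powr (m - 1) = inverse ((sin (ang K m r) / ang K m r) powr (m - 1))"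
      "0 < (sin (ang K m r) / ang K m r) powr (m - 1)"
      using a by (simp_all add: powr_divide)
  qed
  have "(ang K n' r / sin (ang K n' r)) powr (n' - 1) \<le> (ang K n r / sin (ang K n r)) powr (n - 1)"
    using n r0 r1 pos[of n] sinc_power_mono[OF K n r0] by (simp add: inv le_imp_inverse_le)
  then show ?thesis using r0 r1 K by (simp add: rbeta0_def)
qed

section \<open>Displacement interpolations\<close>

text \<open>Evaluation at \<open>t\<close> is continuous for the compact-open topology: preimages of
  open sets are subbasic, with the compact set \<open>{t}\<close>.\<close>

lemma measurable_geodesic_eval:
  assumes "t \<in> {0..1}"
  shows "(\<lambda>\<gamma>. \<gamma> t) \<in> measurable (geodesic_borel d) (fborel d)"
  unfolding fborel_def
proof (rule measurable_measure_of)
  have sub: "{W. openin (geodesic_topology d) W} \<subseteq> Pow (geodesics d)"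
  proof safe
    fix W \<gamma> assume "openin (geodesic_topology d) W" "\<gamma> \<in> W"
    then have "\<gamma> \<in> topspace (geodesic_topology d)" using openin_subset by blast
    then show "\<gamma> \<in> geodesics d" unfolding geodesic_topology_def by (auto simp: topology_generated_by_topspace)
  qed
  have sp: "space (geodesic_borel d) = geodesics d" unfolding geodesic_borel_def using sub by (rule space_measure_of)
  fix V assume "V \<in> {V. openin (ftop d) V}"
  then have V: "openin (ftop d) V" by simp
  have "openin (geodesic_topology d) {\<gamma> \<in> geodesics d. \<gamma> ` {t} \<subseteq> V}"
    unfolding geodesic_topology_def using V assms
    by (intro topology_generated_by_Basis CollectI exI[of _ "{t}"] exI[of _ V]) auto
  also have "{\<gamma> \<in> geodesics d. \<gamma> ` {t} \<subseteq> V} = (\<lambda>\<gamma>. \<gamma> t) -` V \<inter> space (geodesic_borel d)" unfolding sp by auto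
  finally show "(\<lambda>\<gamma>. \<gamma> t) -` V \<inter> space (geodesic_borel d) \<in> sets (geodesic_borel d)"
    unfolding geodesic_borel_def using sub by (auto simp: sets_measure_of)
qed auto

lemma space_geodesic_borel: "space (geodesic_borel d) = geodesics d"
proof -
  have "{W. openin (geodesic_topology d) W} \<subseteq> Pow (geodesics d)"
  proof safe
    fix W \<gamma> assume "openin (geodesic_topology d) W" "\<gamma> \<in> W"
    then have "\<gamma> \<in> topspace (geodesic_topology d)" using openin_subset by blast
    then show "\<gamma> \<in> geodesics d" unfolding geodesic_topology_def by (auto simp: topology_generated_by_topspace)
  qed
  then show ?thesis unfolding geodesic_borel_def by (rule space_measure_of)
qed

lemma eintegral_distr:
  assumes "f \<in> measurable M N" "g \<in> borel_measurable N"
  shows "eintegral (distr M N f) g = eintegral M (\<lambda>x. g (f x))"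
  unfolding eintegral_def using assms by (simp add: nn_integral_distr)

locale transport = fbc_space d for d :: "'a \<Rightarrow> 'a \<Rightarrow> real" +
  fixes \<nu> \<mu>0 \<mu>1 :: "'a measure" and \<rho>0 :: "'a \<Rightarrow> real" and Q :: "(real \<Rightarrow> 'a) measure"
  assumes locally_finite: "locally_finite_borel d \<nu>"
    and sigma_finite: "sigma_finite_measure \<nu>"
    and \<mu>0: "\<mu>0 \<in> prob_ac_c d \<nu>" and \<mu>1: "\<mu>1 \<in> prob_ac_c d \<nu>"
    and \<rho>0_nonneg: "\<And>x. 0 \<le> \<rho>0 x" and \<rho>0_lipschitz: "forward_lipschitz d \<rho>0"
    and \<rho>0_density: "\<mu>0 = density \<nu> (\<lambda>x. ennreal (\<rho>0 x))"
    and Q_prob: "prob_space Q" and sets_Q: "sets Q = sets (geodesic_borel d)"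
    and Q_0: "interpolant d Q 0 = \<mu>0" and Q_1: "interpolant d Q 1 = \<mu>1"
begin

sublocale Q: prob_space Q by (rule Q_prob)
sublocale \<nu>: sigma_finite_measure \<nu> by (rule sigma_finite)

abbreviation "\<pi> \<equiv> endpoint_plan d Q"

lemma sets_\<nu> [measurable_cong]: "sets \<nu> = sets (fborel d)"
  using locally_finite by (simp add: locally_finite_borel_def)

lemma space_\<nu> [simp]: "space \<nu> = UNIV"
  using sets_eq_imp_space_eq[OF sets_\<nu>] by simp

lemma \<mu>0_prob: "prob_space \<mu>0" and sets_\<mu>0 [measurable_cong]: "sets \<mu>0 = sets (fborel d)"
  and \<mu>0_compact: "compactin (ftop d) (msupp d \<mu>0)" and \<mu>0_ac: "absolutely_continuous \<nu> \<mu>0"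
  using \<mu>0 by (auto simp: prob_ac_c_def prob_c_def)

lemma \<mu>1_prob: "prob_space \<mu>1" and sets_\<mu>1 [measurable_cong]: "sets \<mu>1 = sets (fborel d)"
  and \<mu>1_compact: "compactin (ftop d) (msupp d \<mu>1)" and \<mu>1_ac: "absolutely_continuous \<nu> \<mu>1"
  using \<mu>1 by (auto simp: prob_ac_c_def prob_c_def)

lemma measurable_\<rho>0 [measurable]: "\<rho>0 \<in> borel_measurable (fborel d)"
  by (rule measurable_lipschitz[OF \<rho>0_lipschitz])

lemma measurable_\<rho>0_\<nu> [measurable]: "\<rho>0 \<in> borel_measurable \<nu>"
  using measurable_\<rho>0 by (simp only: measurable_cong_sets[OF sets_\<nu> refl])

lemma eval_measurable [measurable]: "t \<in> {0..1} \<Longrightarrow> (\<lambda>\<gamma>. \<gamma> t) \<in> measurable Q (fborel d)"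
  using measurable_geodesic_eval measurable_cong_sets[OF sets_Q refl] by blast

lemma eval_measurable_01 [measurable]: "(\<lambda>\<gamma>. \<gamma> 0) \<in> measurable Q (fborel d)" "(\<lambda>\<gamma>. \<gamma> 1) \<in> measurable Q (fborel d)"
  by (auto intro: eval_measurable)

lemma space_Q: "space Q = geodesics d"
  using sets_eq_imp_space_eq[OF sets_Q] space_geodesic_borel by simp

lemma endpoint_measurable: "(\<lambda>\<gamma>. (\<gamma> 0, \<gamma> 1)) \<in> measurable Q (fborel d \<Otimes>\<^sub>M fborel d)"
  by measurable

lemma sets_\<pi> [measurable_cong]: "sets \<pi> = sets (fborel d \<Otimes>\<^sub>M fborel d)"
  by (simp add: endpoint_plan_def)

lemma \<pi>_prob: "prob_space \<pi>"
  unfolding endpoint_plan_def by (rule Q.prob_space_distr[OF endpoint_measurable])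

lemma \<pi>_fst: "distr \<pi> (fborel d) fst = \<mu>0"
  unfolding endpoint_plan_def Q_0[symmetric] interpolant_def
  by (subst distr_distr) (auto simp: comp_def)

lemma \<pi>_snd: "distr \<pi> (fborel d) snd = \<mu>1"
  unfolding endpoint_plan_def Q_1[symmetric] interpolant_def
  by (subst distr_distr) (auto simp: comp_def)

lemma geodesic_dist:
  assumes "\<gamma> \<in> space Q" "0 \<le> s" "s \<le> t" "t \<le> 1"
  shows "d (\<gamma> s) (\<gamma> t) = (t - s) * d (\<gamma> 0) (\<gamma> 1)"
  using assms unfolding space_Q geodesics_def by blast

text \<open>Endpoints lie in compact supports, inside a ball about \<open>base\<close>, where
  reversibility bounds \<open>d (\<gamma> 0) base\<close> by \<open>C * R\<close>. Since
  \<open>d (\<gamma> 0) (\<gamma> t)\<close> is at most the full length, intermediate points stay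
  within \<open>C * R + 2 * R\<close>.\<close>

lemma bounded_transport:
  obtains R where "R > 0" "AE \<gamma> in Q. (\<forall>t\<in>{0..1}. d base (\<gamma> t) < R) \<and> d (\<gamma> 0) (\<gamma> 1) < R"
proof -
  obtain R0 where R0: "\<And>x. x \<in> msupp d \<mu>0 \<Longrightarrow> d base x < R0" using compactin_bounded[OF \<mu>0_compact] by blast
  obtain R1 where R1: "\<And>x. x \<in> msupp d \<mu>1 \<Longrightarrow> d base x < R1" using compactin_bounded[OF \<mu>1_compact] by blast
  define R where "R = max 1 (max R0 R1)"
  have R: "R > 0" by (simp add: R_def)
  obtain C where C: "C \<ge> 1" "\<And>x y. d base x < R \<Longrightarrow> d base y < R \<Longrightarrow> d x y \<le> C * d y x"
    using reversible_bounded by blast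
  have CR: "0 \<le> C * R" using C R by simp
  have a0: "AE \<gamma> in Q. \<gamma> 0 \<in> msupp d \<mu>0"
    using AE_msupp[OF sets_\<mu>0] unfolding Q_0[symmetric] interpolant_def by (rule AE_distrD[rotated]) measurable
  have a1: "AE \<gamma> in Q. \<gamma> 1 \<in> msupp d \<mu>1"
    using AE_msupp[OF sets_\<mu>1] unfolding Q_1[symmetric] interpolant_def by (rule AE_distrD[rotated]) measurable
  have "AE \<gamma> in Q. (\<forall>t\<in>{0..1}. d base (\<gamma> t) < C * R + 2 * R) \<and> d (\<gamma> 0) (\<gamma> 1) < C * R + 2 * R"
    using a0 a1 AE_space
  proof eventually_elim
    case (elim \<gamma>)
    have b: "d base (\<gamma> 0) < R" "d base (\<gamma> 1) < R" using R0 R1 elim by (fastforce simp: R_def)+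
    have "d (\<gamma> 0) base \<le> C * d base (\<gamma> 0)" using C b R by simp
    also have "\<dots> \<le> C * R" using C b by (intro mult_left_mono) auto
    finally have "d (\<gamma> 0) (\<gamma> 1) < C * R + R" using d_tri[of "\<gamma> 0" "\<gamma> 1" base] b by linarith
    moreover have "d base (\<gamma> t) < C * R + 2 * R" if t: "t \<in> {0..1}" for t
    proof -
      have "d (\<gamma> 0) (\<gamma> t) = t * d (\<gamma> 0) (\<gamma> 1)" using geodesic_dist[of \<gamma> 0 t] elim t by simp
      also have "\<dots> \<le> d (\<gamma> 0) (\<gamma> 1)" using t by (simp add: mult_left_le_one_le)
      finally show ?thesis using d_tri[of base "\<gamma> t" "\<gamma> 0"] b \<open>d (\<gamma> 0) (\<gamma> 1) < C * R + R\<close> by linarith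
    qed
    ultimately show ?case using R by auto
  qed
  then show ?thesis using that[of "C * R + 2 * R"] R CR by simp
qed

definition radius :: real where
  "radius = (SOME R. R > 0 \<and> (AE \<gamma> in Q. (\<forall>t\<in>{0..1}. d base (\<gamma> t) < R) \<and> d (\<gamma> 0) (\<gamma> 1) < R))"

lemma radius: "radius > 0"
  and AE_radius: "AE \<gamma> in Q. (\<forall>t\<in>{0..1}. d base (\<gamma> t) < radius) \<and> d (\<gamma> 0) (\<gamma> 1) < radius"
proof -
  have "\<exists>R. R > 0 \<and> (AE \<gamma> in Q. (\<forall>t\<in>{0..1}. d base (\<gamma> t) < R) \<and> d (\<gamma> 0) (\<gamma> 1) < R)"
    using bounded_transport by blast
  from someI_ex[OF this]
  show "radius > 0" "AE \<gamma> in Q. (\<forall>t\<in>{0..1}. d base (\<gamma> t) < radius) \<and> d (\<gamma> 0) (\<gamma> 1) < radius"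
    unfolding radius_def by auto
qed

lemma AE_\<pi>_dist: "AE (x, y) in \<pi>. d x y < radius"
proof -
  have "AE \<gamma> in Q. case (\<gamma> 0, \<gamma> 1) of (x, y) \<Rightarrow> d x y < radius" using AE_radius by eventually_elim simp
  then show ?thesis unfolding endpoint_plan_def
    by (subst AE_distr_iff[OF endpoint_measurable]) auto
qed

lemma density_bound:
  obtains B where "B > 0" "\<And>x. d base x < radius \<Longrightarrow> \<rho>0 x \<le> B"
proof -
  obtain C where C: "C > 0" "\<And>x y. \<rho>0 y - \<rho>0 x \<le> C * d x y"
    using \<rho>0_lipschitz unfolding forward_lipschitz_def by blast
  show ?thesis
  proof
    show "\<rho>0 base + C * radius > 0" using C radius \<rho>0_nonneg[of base] by (simp add: add_nonneg_pos)
    fix x assume "d base x < radius"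
    then have "C * d base x \<le> C * radius" using C by simp
    then show "\<rho>0 x \<le> \<rho>0 base + C * radius" using C(2)[of x base] by linarith
  qed
qed

definition height :: real where
  "height = (SOME B. B > 0 \<and> (\<forall>x. d base x < radius \<longrightarrow> \<rho>0 x \<le> B))"

lemma height: "height > 0" "d base x < radius \<Longrightarrow> \<rho>0 x \<le> height"
proof -
  have "\<exists>B. B > 0 \<and> (\<forall>x. d base x < radius \<longrightarrow> \<rho>0 x \<le> B)" using density_bound by blast
  from someI_ex[OF this] show "height > 0" "d base x < radius \<Longrightarrow> \<rho>0 x \<le> height"
    unfolding height_def by auto
qed

lemma AE_\<mu>0_radius: "AE x in \<mu>0. d base x < radius"
proof -
  have "AE \<gamma> in Q. d base (\<gamma> 0) < radius" using AE_radius by eventually_elim auto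
  then show ?thesis unfolding Q_0[symmetric] interpolant_def
    using sets_fball[of base radius] by (subst AE_distr_iff[OF eval_measurable_01(1)]) (auto simp: fball_def)
qed

lemma AE_\<rho>0_le_height: "AE x in \<nu>. \<rho>0 x \<le> height"
proof -
  have "AE x in \<nu>. 0 < ennreal (\<rho>0 x) \<longrightarrow> d base x < radius"
    using AE_\<mu>0_radius unfolding \<rho>0_density by (subst (asm) AE_density) auto
  then show ?thesis
  proof eventually_elim
    case (elim x)
    then show ?case using height \<rho>0_nonneg[of x] by (cases "\<rho>0 x = 0") (auto simp: less_le)
  qed
qed

lemma AE_\<pi>_\<rho>0_pos: "AE (x, y) in \<pi>. 0 < \<rho>0 x \<and> \<rho>0 x \<le> height"
proof -
  have "AE x in \<mu>0. 0 < \<rho>0 x" unfolding \<rho>0_density by (subst AE_density) (auto simp: ennreal_less_zero_iff)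
  then have 1: "AE x in \<mu>0. 0 < \<rho>0 x \<and> \<rho>0 x \<le> height" using AE_\<mu>0_radius
    by eventually_elim (auto intro: height)
  have "AE z in \<pi>. 0 < \<rho>0 (fst z) \<and> \<rho>0 (fst z) \<le> height"
    using 1 unfolding \<pi>_fst[symmetric] by (rule AE_distrD[rotated]) measurable
  then show ?thesis by (simp add: case_prod_beta)
qed

text \<open>The Lipschitz condition bounds the decrease of \<open>\<rho>0\<close> from
  \<open>x\<close> to \<open>y\<close> by \<open>C * d y x\<close>, with the reversed distance;
  local reversibility makes it a multiple of \<open>d x y\<close>.\<close>

lemma descending_slope_finite: "descending_slope d \<rho>0 x < \<infinity>"
proof -
  obtain C where C: "C > 0" "\<And>x y. \<rho>0 y - \<rho>0 x \<le> C * d x y"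
    using \<rho>0_lipschitz unfolding forward_lipschitz_def by blast
  obtain E where E: "E \<ge> 1" "\<And>y z. d base y < d base x + 1 \<Longrightarrow> d base z < d base x + 1 \<Longrightarrow> d y z \<le> E * d z y"
    using reversible_bounded by blast
  have "descending_slope d \<rho>0 x \<le> (SUP y\<in>{y. d x y < 1 / real (Suc 0) \<and> y \<noteq> x}. ennreal (max (- (\<rho>0 y - \<rho>0 x)) 0 / d x y))"
    unfolding descending_slope_eq by (rule INF_lower) simp
  also have "\<dots> \<le> ennreal (C * E)"
  proof (rule SUP_least)
    fix y assume "y \<in> {y. d x y < 1 / real (Suc 0) \<and> y \<noteq> x}"
    then have y: "d x y < 1" "d x y > 0" using d_zero[of x y] d_nonneg[of x y] by (auto simp: order_less_le)
    then have "d base y < d base x + 1" using d_tri[of base y x] by simp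
    then have "d y x \<le> E * d x y" using E by simp
    then have "C * d y x \<le> C * (E * d x y)" using C by simp
    then have "\<rho>0 x - \<rho>0 y \<le> C * E * d x y" using C(2)[of x y] unfolding mult.assoc by linarith
    moreover have "0 \<le> C * E * d x y" using C(1) E(1) by simp
    ultimately have "max (- (\<rho>0 y - \<rho>0 x)) 0 \<le> C * E * d x y" by simp
    then show "ennreal (max (- (\<rho>0 y - \<rho>0 x)) 0 / d x y) \<le> ennreal (C * E)"
      using y by (intro ennreal_leI) (simp add: divide_le_eq)
  qed
  finally show ?thesis by (simp add: le_less_trans[OF _ ennreal_less_top])
qed

section \<open>The slope of the functional along a displacement interpolation\<close>

context
  fixes U :: "real \<Rightarrow> real" and N :: ereal
  assumes U: "tame N U" and N: "1 < N"
begin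

lemmas DC = tameD(1)[OF U N]
  and deriv2 = tameD(3)[OF U N]
  and deriv2_cont = tameD(4)[OF U N]
  and deriv_mono = tameD(5)[OF U N]
  and tangent = tameD(6)[OF U N]

lemma tame_deriv2_nonneg: "0 \<le> deriv (deriv U) r"
  using mono_on_imp_deriv_nonneg[of UNIV "deriv U" _ r] deriv2[of r] deriv_mono by (auto intro: mono_onI)

lemma tame_deriv_difference:
  assumes "b \<le> a" "\<And>s. b \<le> s \<Longrightarrow> s \<le> a \<Longrightarrow> deriv (deriv U) s \<le> c"
  shows "deriv U a - deriv U b \<le> c * (a - b)"
proof -
  have "c * b - deriv U b \<le> c * a - deriv U a"
  proof (rule DERIV_nonneg_imp_nondecreasing[OF assms(1)])
    fix x assume "b \<le> x" "x \<le> a"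
    moreover have "((\<lambda>x. c * x - deriv U x) has_real_derivative c - deriv (deriv U) x) (at x)"
      by (auto intro!: derivative_eq_intros deriv2)
    ultimately show "\<exists>y. ((\<lambda>x. c * x - deriv U x) has_real_derivative y) (at x) \<and> 0 \<le> y" using assms(2) by fastforce
  qed
  then show ?thesis by (simp add: algebra_simps)
qed

lemma tame_measurable [measurable]: "deriv U \<in> borel_measurable borel" "deriv (deriv U) \<in> borel_measurable borel"
  by (intro borel_measurable_continuous_onI continuous_at_imp_continuous_on ballI,
      use deriv2 DERIV_isCont deriv2_cont in blast)+

definition descent :: "real \<Rightarrow> (real \<Rightarrow> 'a) \<Rightarrow> real" where
  "descent t \<gamma> = (deriv U (\<rho>0 (\<gamma> 0)) - deriv U (\<rho>0 (\<gamma> t))) / t"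

definition descent_limit :: "'a \<Rightarrow> 'a \<Rightarrow> ennreal" where
  "descent_limit x y = ennreal (deriv (deriv U) (\<rho>0 x)) * descending_slope d \<rho>0 x * ennreal (d x y)"

text \<open>If \<open>\<rho>0\<close> has decreased, a mean value estimate for \<open>U'\<close> and
  the slope at the initial point bound the quotient by \<open>(U'' + e) (s + e) D\<close>, because
  \<open>d (\<gamma> 0) (\<gamma> t) = t * D\<close>; otherwise monotonicity of \<open>U'\<close>
  makes it nonpositive. Tameness supplies continuity of \<open>U''\<close> at
  \<open>\<rho>0 (\<gamma> 0)\<close> even if this value is \<open>0\<close>. Then \<open>e\<close>
  tends to \<open>0\<close>.\<close>

lemma limsup_descent:
  assumes \<gamma>: "\<gamma> \<in> space Q" and t: "\<And>n. 0 < t n \<and> t n \<le> 1" "t \<longlonglongrightarrow> 0"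
  shows "limsup (\<lambda>n. ereal (descent (t n) \<gamma>)) \<le> enn2ereal (descent_limit (\<gamma> 0) (\<gamma> 1))"
proof -
  let ?x = "\<gamma> 0" and ?D = "d (\<gamma> 0) (\<gamma> 1)"
  have dist: "d ?x (\<gamma> (t n)) = t n * ?D" for n
    using geodesic_dist[OF \<gamma>, of 0 "t n"] t(1)[of n] by simp
  show ?thesis
  proof (cases "?D = 0")
    case True
    then have "\<gamma> (t n) = ?x" for n using dist[of n] d_zero by auto
    then show ?thesis by (simp add: descent_def Limsup_const zero_ereal_def[symmetric])
  next
    case False
    then have D: "?D > 0" using d_nonneg[of "\<gamma> 0" "\<gamma> 1"] by linarith
    obtain s where s: "0 \<le> s" "descending_slope d \<rho>0 ?x = ennreal s"
      using descending_slope_finite[of ?x] by (cases "descending_slope d \<rho>0 ?x") auto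
    let ?u = "deriv (deriv U) (\<rho>0 ?x)"
    have bound: "limsup (\<lambda>n. ereal (descent (t n) \<gamma>)) \<le> ereal ((?u + e) * ((s + e) * ?D))" if e: "e > 0" for e
    proof (rule Limsup_bounded)
      have "(\<lambda>n. t n * ?D) \<longlonglongrightarrow> 0" using tendsto_mult_left_zero[OF t(2)] by simp
      then have small: "\<forall>\<^sub>F n in sequentially. d ?x (\<gamma> (t n)) < r" if "r > 0" for r
        unfolding dist using that by (rule order_tendstoD(2))
      have near: "\<forall>\<^sub>F n in sequentially. \<gamma> (t n) \<in> V" if V: "openin (ftop d) V" "?x \<in> V" for V
      proof -
        obtain r where r: "r > 0" "fball d ?x r \<subseteq> V" using V(2) V(1)[unfolded openin_iff] by blast
        show ?thesis by (rule eventually_mono[OF small[OF r(1)]]) (use r(2) in \<open>auto simp: fball_def\<close>)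
      qed
      have "\<exists>r>0. \<forall>y. \<bar>y - \<rho>0 ?x\<bar> < r \<longrightarrow> deriv (deriv U) y < ?u + e"
      proof -
        obtain r where r: "r > 0" "\<And>y. dist y (\<rho>0 ?x) < r \<Longrightarrow> dist (deriv (deriv U) y) ?u < e"
          using deriv2_cont[of "\<rho>0 ?x"] e unfolding continuous_at_eps_delta by metis
        have "deriv (deriv U) y < ?u + e" if "\<bar>y - \<rho>0 ?x\<bar> < r" for y
        proof -
          have "\<bar>deriv (deriv U) y - ?u\<bar> < e" using r(2)[of y] that unfolding dist_real_def by blast
          then show ?thesis by linarith
        qed
        then show ?thesis using r(1) by blast
      qed
      then obtain r where r: "r > 0" "\<And>y. \<bar>y - \<rho>0 ?x\<bar> < r \<Longrightarrow> deriv (deriv U) y < ?u + e" by blast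
      have "\<forall>\<^sub>F n in sequentially. \<rho>0 ?x - r < \<rho>0 (\<gamma> (t n))"
        using near[OF openin_lipschitz(2)[OF \<rho>0_lipschitz, of "\<rho>0 ?x - r"]] r(1) by simp
      moreover have "\<forall>\<^sub>F n in sequentially. max (- (\<rho>0 (\<gamma> (t n)) - \<rho>0 ?x)) 0 / d ?x (\<gamma> (t n)) < s + e"
      proof -
        have "(INF k. SUP y\<in>{y. d ?x y < 1 / real (Suc k) \<and> y \<noteq> ?x}. ennreal (max (- (\<rho>0 y - \<rho>0 ?x)) 0 / d ?x y)) < ennreal (s + e)"
          unfolding descending_slope_eq[symmetric] s(2) using s(1) e by (simp add: ennreal_less_iff)
        then obtain k where k: "(SUP y\<in>{y. d ?x y < 1 / real (Suc k) \<and> y \<noteq> ?x}. ennreal (max (- (\<rho>0 y - \<rho>0 ?x)) 0 / d ?x y)) < ennreal (s + e)"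
          by (auto simp: INF_less_iff)
        have "\<forall>\<^sub>F n in sequentially. d ?x (\<gamma> (t n)) < 1 / real (Suc k)" by (rule small) simp
        then show ?thesis
        proof eventually_elim
          case (elim n)
          have pos: "d ?x (\<gamma> (t n)) > 0" unfolding dist using D t(1)[of n] by simp
          then have "\<gamma> (t n) \<noteq> ?x" by auto
          then have "ennreal (max (- (\<rho>0 (\<gamma> (t n)) - \<rho>0 ?x)) 0 / d ?x (\<gamma> (t n))) < ennreal (s + e)"
            using elim by (intro le_less_trans[OF SUP_upper k]) auto
          then show ?case using pos by (subst (asm) ennreal_less_iff) auto
        qed
      qed
      ultimately show "\<forall>\<^sub>F n in sequentially. ereal (descent (t n) \<gamma>) \<le> ereal ((?u + e) * ((s + e) * ?D))"
      proof eventually_elim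
        case (elim n)
        let ?y = "\<rho>0 (\<gamma> (t n))"
        have tn: "t n > 0" using t(1) by simp
        have u0: "0 \<le> ?u + e" using tame_deriv2_nonneg[of "\<rho>0 ?x"] e by simp
        have se: "0 \<le> (s + e) * ?D" using s e D by simp
        show ?case
        proof (cases "?y \<le> \<rho>0 ?x")
          case True
          have "deriv U (\<rho>0 ?x) - deriv U ?y \<le> (?u + e) * (\<rho>0 ?x - ?y)"
          proof (rule tame_deriv_difference[OF True])
            fix z assume "?y \<le> z" "z \<le> \<rho>0 ?x"
            then have "\<bar>z - \<rho>0 ?x\<bar> < r" using elim by auto
            then show "deriv (deriv U) z \<le> ?u + e" using r(2) by (simp add: less_imp_le)
          qed
          also have "\<rho>0 ?x - ?y \<le> (s + e) * (t n * ?D)"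
            using elim(2) True D tn unfolding dist by (simp add: divide_less_eq)
          then have "(?u + e) * (\<rho>0 ?x - ?y) \<le> (?u + e) * ((s + e) * (t n * ?D))" using u0 by (rule mult_left_mono)
          finally have "descent (t n) \<gamma> \<le> (?u + e) * ((s + e) * (t n * ?D)) / t n"
            unfolding descent_def using tn by (intro divide_right_mono) auto
          also have "\<dots> = (?u + e) * ((s + e) * ?D)" using tn by simp
          finally show ?thesis by simp
        next
          case False
          then have "descent (t n) \<gamma> \<le> 0"
            unfolding descent_def using deriv_mono[of "\<rho>0 ?x" ?y] tn by (simp add: divide_le_0_iff)
          also have "0 \<le> (?u + e) * ((s + e) * ?D)" using u0 se by simp
          finally show ?thesis by simp
        qed
      qed
    qed
    have lim: "((\<lambda>e. ereal ((?u + e) * ((s + e) * ?D))) \<longlongrightarrow> ereal ((?u + 0) * ((s + 0) * ?D))) (at_right 0)"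
      by (intro tendsto_intros lim_ereal[THEN iffD2])
    have "limsup (\<lambda>n. ereal (descent (t n) \<gamma>)) \<le> ereal ((?u + 0) * ((s + 0) * ?D))"
    proof (rule tendsto_lowerbound[OF lim])
      show "\<forall>\<^sub>F e in at_right 0. limsup (\<lambda>n. ereal (descent (t n) \<gamma>)) \<le> ereal ((?u + e) * ((s + e) * ?D))"
        using eventually_at_right_less by (rule eventually_mono) (rule bound)
    qed simp
    also have "\<dots> = enn2ereal (descent_limit (\<gamma> 0) (\<gamma> 1))"
      unfolding descent_limit_def s(2) using s(1) D tame_deriv2_nonneg[of "\<rho>0 ?x"]
      by (simp add: ennreal_mult[symmetric] enn2ereal_ennreal mult.assoc)
    finally show ?thesis .
  qed
qed

lemma measurable_descent_limit: "(\<lambda>(x, y). descent_limit x y) \<in> borel_measurable (fborel d \<Otimes>\<^sub>M fborel d)"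
proof -
  have [measurable]: "descending_slope d \<rho>0 \<in> borel_measurable (fborel d)"
    by (rule measurable_descending_slope[OF \<rho>0_lipschitz])
  show ?thesis unfolding descent_limit_def by measurable
qed

text \<open>A bound independent of \<open>t\<close>, to serve as majorant: \<open>L\<close> bounds
  \<open>U''\<close> on the densities met, and the reversed distance in the Lipschitz condition
  costs the factor \<open>E\<close>.\<close>

lemma descent_bounded:
  obtains c where "\<And>t. 0 < t \<Longrightarrow> t \<le> 1 \<Longrightarrow> AE \<gamma> in Q. descent t \<gamma> \<le> c"
proof -
  obtain C where C: "C > 0" "\<And>x y. \<rho>0 y - \<rho>0 x \<le> C * d x y"
    using \<rho>0_lipschitz unfolding forward_lipschitz_def by blast
  obtain E where E: "E \<ge> 1" "\<And>x y. d base x < radius \<Longrightarrow> d base y < radius \<Longrightarrow> d x y \<le> E * d y x"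
    using reversible_bounded by blast
  have "compact (deriv (deriv U) ` {0..height})"
    by (intro compact_continuous_image continuous_at_imp_continuous_on) (auto intro: deriv2_cont)
  then obtain L where L: "\<And>s. s \<in> {0..height} \<Longrightarrow> deriv (deriv U) s \<le> L"
    using compact_imp_bounded bounded_imp_bdd_above unfolding bdd_above_def by (metis imageI)
  have L0: "0 \<le> L" using L[of 0] tame_deriv2_nonneg[of 0] height(1) by simp
  show ?thesis
  proof
    fix t :: real assume t: "0 < t" "t \<le> 1"
    show "AE \<gamma> in Q. descent t \<gamma> \<le> L * (C * (E * radius))"
      using AE_radius AE_space
    proof eventually_elim
      case (elim \<gamma>)
      let ?x = "\<gamma> 0" and ?z = "\<gamma> t"
      have b: "d base ?x < radius" "d base ?z < radius" using elim t by auto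
      show ?case
      proof (cases "\<rho>0 ?z \<le> \<rho>0 ?x")
        case True
        have "deriv U (\<rho>0 ?x) - deriv U (\<rho>0 ?z) \<le> L * (\<rho>0 ?x - \<rho>0 ?z)"
          by (rule tame_deriv_difference[OF True]) (use L height(2)[OF b(1)] \<rho>0_nonneg[of ?z] in auto)
        also have "\<rho>0 ?x - \<rho>0 ?z \<le> C * d ?z ?x" by (rule C)
        then have "L * (\<rho>0 ?x - \<rho>0 ?z) \<le> L * (C * d ?z ?x)" using L0 by (rule mult_left_mono)
        also have "d ?z ?x \<le> E * d ?x ?z" by (rule E(2)[OF b(2,1)])
        then have "L * (C * d ?z ?x) \<le> L * (C * (E * d ?x ?z))" using L0 C(1) by (intro mult_left_mono) auto
        also have "d ?x ?z = t * d ?x (\<gamma> 1)" using geodesic_dist[of \<gamma> 0 t] elim t by simp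
        also have "L * (C * (E * (t * d ?x (\<gamma> 1)))) \<le> L * (C * (E * (t * radius)))"
          using L0 C(1) E(1) t elim by (intro mult_left_mono) (auto intro: less_imp_le)
        finally have "descent t \<gamma> \<le> L * (C * (E * (t * radius))) / t"
          unfolding descent_def using t by (intro divide_right_mono) auto
        then show ?thesis using t by simp
      next
        case False
        then have "descent t \<gamma> \<le> 0"
          unfolding descent_def using deriv_mono[of "\<rho>0 ?x" "\<rho>0 ?z"] t by (simp add: divide_le_0_iff)
        also have "0 \<le> L * (C * (E * radius))" using L0 C(1) E(1) radius by simp
        finally show ?thesis .
      qed
    qed
  qed
qed

lemma limsup_integral_descent:
  assumes t: "\<And>n. 0 < t n \<and> t n \<le> 1" "t \<longlonglongrightarrow> 0"
  shows "limsup (\<lambda>n. eintegral Q (\<lambda>\<gamma>. ereal (descent (t n) \<gamma>))) \<le> enn2ereal (\<integral>\<^sup>+(x, y). descent_limit x y \<partial>\<pi>)"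
proof -
  obtain c where c: "\<And>t. 0 < t \<Longrightarrow> t \<le> 1 \<Longrightarrow> AE \<gamma> in Q. descent t \<gamma> \<le> c"
    using descent_bounded by blast
  have [measurable]: "(\<lambda>\<gamma>. \<gamma> (t n)) \<in> measurable Q (fborel d)" for n
    using t(1)[of n] by (intro eval_measurable) auto
  have "limsup (\<lambda>n. eintegral Q (\<lambda>\<gamma>. ereal (descent (t n) \<gamma>))) \<le> eintegral Q (\<lambda>\<gamma>. enn2ereal (descent_limit (\<gamma> 0) (\<gamma> 1)))"
  proof (rule limsup_eintegral_le[where w = "\<lambda>_. ennreal c"])
    show "(\<lambda>\<gamma>. ereal (descent (t n) \<gamma>)) \<in> borel_measurable Q" for n
      unfolding descent_def by measurable
    show "AE \<gamma> in Q. e2ennreal (ereal (descent (t n) \<gamma>)) \<le> ennreal c" for n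
      using c[of "t n"] t(1)[of n] by (auto intro: ennreal_leI elim!: eventually_mono)
    show "AE \<gamma> in Q. limsup (\<lambda>n. ereal (descent (t n) \<gamma>)) \<le> enn2ereal (descent_limit (\<gamma> 0) (\<gamma> 1))"
      using limsup_descent[OF _ t] by auto
  qed (auto simp: Q.emeasure_space_1 ennreal_mult_less_top less_top[symmetric])
  also have "\<dots> = enn2ereal (\<integral>\<^sup>+\<gamma>. descent_limit (\<gamma> 0) (\<gamma> 1) \<partial>Q)"
    by (subst eintegral_nonneg) auto
  also have "(\<integral>\<^sup>+\<gamma>. descent_limit (\<gamma> 0) (\<gamma> 1) \<partial>Q) = (\<integral>\<^sup>+(x, y). descent_limit x y \<partial>\<pi>)"
    unfolding endpoint_plan_def using measurable_descent_limit
    by (subst nn_integral_distr[OF endpoint_measurable]) auto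
  finally show ?thesis .
qed

end

declare eval_measurable [measurable del] eval_measurable_01 [measurable del]

end

section \<open>Distorted functionals\<close>

text \<open>Positive parts of the arguments only serve measurability: functions in \<open>DC\<close> are unconstrained
  on the negative half-line.\<close>

definition slope_at :: "(real \<Rightarrow> real) \<Rightarrow> real \<Rightarrow> ereal \<Rightarrow> ereal" where
  "slope_at U r b = (if b = \<infinity> then deriv_zero U else ereal (mean_slope U (max 0 (r / real_of_ereal b))))"

lemma U_distorted_eq_slope_at:
  assumes "0 \<le> r" "0 < b" "U 0 = 0"
  shows "U_distorted U r b = ereal r * slope_at U r b"
proof (cases b)
  case (real b')
  then show ?thesis using assms by (cases "r = 0") (auto simp: U_distorted_def slope_at_def mean_slope_def max_def field_simps)
qed (use assms in \<open>auto simp: U_distorted_def slope_at_def\<close>)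

lemma measurable_DC:
  assumes "U \<in> DC N"
  shows "(\<lambda>r. U (max 0 r)) \<in> borel_measurable borel" "(\<lambda>r. mean_slope U (max 0 r)) \<in> borel_measurable borel"
proof -
  have "continuous_on UNIV (\<lambda>r. U (max 0 r))"
    by (rule continuous_on_compose2[of "{0..}" U]) (use assms in \<open>auto simp: DC_def intro!: continuous_intros\<close>)
  then show *[measurable]: "(\<lambda>r. U (max 0 r)) \<in> borel_measurable borel" by (rule borel_measurable_continuous_onI)
  show "(\<lambda>r. mean_slope U (max 0 r)) \<in> borel_measurable borel"
    unfolding mean_slope_def by measurable
qed

lemma measurable_slope_at:
  assumes U: "U \<in> DC N" and [measurable]: "f \<in> borel_measurable M" "b \<in> borel_measurable M"
  shows "(\<lambda>x. slope_at U (f x) (b x)) \<in> borel_measurable M"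
proof -
  note [measurable] = measurable_compose[OF _ measurable_DC(2)[OF U]]
  show ?thesis unfolding slope_at_def by measurable
qed

context fbc_space
begin

lemma U_beta_eq:
  assumes \<nu>: "sigma_finite_measure \<nu>" "sets \<nu> = sets (fborel d)"
    and \<mu>: "prob_space \<mu>" "sets \<mu> = sets (fborel d)" "absolutely_continuous \<nu> \<mu>"
    and \<pi>: "prob_space \<pi>" "sets \<pi> = sets (fborel d \<Otimes>\<^sub>M fborel d)" "distr \<pi> (fborel d) fst = \<mu>"
    and U: "U \<in> DC N" and N: "1 < N"
    and \<beta>: "(\<lambda>(x, y). \<beta> x y) \<in> borel_measurable (fborel d \<Otimes>\<^sub>M fborel d)" "\<And>x y. 0 < \<beta> x y"
  shows "U_beta U \<nu> \<beta> \<pi> \<mu> = eintegral \<pi> (\<lambda>(x, y). slope_at U (ac_density \<nu> \<mu> x) (\<beta> x y))"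
proof -
  have fin: "finite_measure \<mu>" using \<mu>(1) by (simp add: prob_space_def)
  have s: "sets \<mu> = sets \<nu>" using \<mu>(2) \<nu>(2) by simp
  note ac = ac_density_absolutely_continuous[OF \<nu>(1) fin s \<mu>(3)]
  let ?\<kappa> = "cond_kernel \<pi> \<mu>"
  have "?\<kappa> \<in> measurable \<mu> (prob_algebra \<mu>) \<and> \<pi> = kernel_prod \<mu> ?\<kappa>"
    unfolding cond_kernel_def by (rule someI_ex[OF disintegration[OF \<mu>(1,2) \<pi>]])
  then have k: "?\<kappa> \<in> measurable \<mu> (prob_algebra \<mu>)" "\<pi> = kernel_prod \<mu> ?\<kappa>" by auto
  have sp: "space \<nu> \<noteq> {}" using sets_eq_imp_space_eq[OF \<nu>(2)] by simp
  let ?g = "\<lambda>z. slope_at U (ac_density \<nu> \<mu> (fst z)) (\<beta> (fst z) (snd z))"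
  have ac1: "ac_density \<nu> \<mu> \<in> borel_measurable (fborel d)"
    using ac(1) by (simp only: measurable_cong_sets[OF \<nu>(2) refl])
  have "?g \<in> borel_measurable (fborel d \<Otimes>\<^sub>M fborel d)"
    using \<beta>(1) measurable_compose[OF measurable_fst ac1]
    by (intro measurable_slope_at[OF U]) (auto simp: case_prod_beta)
  then have g: "?g \<in> borel_measurable (\<nu> \<Otimes>\<^sub>M \<nu>)"
    by (simp only: measurable_cong_sets[OF sets_pair_measure_cong[OF \<nu>(2) \<nu>(2)] refl])
  have "U_beta U \<nu> \<beta> \<pi> \<mu> = eintegral (kernel_prod \<nu> ?\<kappa>) (\<lambda>(x, y). U_distorted U (ac_density \<nu> \<mu> x) (\<beta> x y))"
    unfolding U_beta_def ac(4) by (simp add: zero_ennreal.rep_eq)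
  also have "\<dots> = eintegral (kernel_prod \<nu> ?\<kappa>) (\<lambda>(x, y). ereal (ac_density \<nu> \<mu> x) * ?g (x, y))"
    using ac(2) \<beta>(2) DC_zero[OF U N] by (simp add: U_distorted_eq_slope_at)
  also have "\<dots> = eintegral \<pi> ?g"
    by (rule eintegral_kernel_prod_density[OF k ac(3,1,2) sp g])
  finally show ?thesis by (simp add: case_prod_unfold)
qed

end

lemma (in prob_space) bounded_integrable:
  fixes f :: "'a \<Rightarrow> real"
  assumes "f \<in> borel_measurable M" "AE x in M. \<bar>f x\<bar> \<le> B"
  shows "integrable M f"
  using integrable_const_bound[of f B] assms by simp

context transport
begin

abbreviation "\<rho>1 \<equiv> ac_density \<nu> \<mu>1"

lemma \<rho>1: "\<rho>1 \<in> borel_measurable \<nu>" "0 \<le> \<rho>1 x" "\<mu>1 = density \<nu> (\<lambda>x. ennreal (\<rho>1 x))"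
  "emeasure (singular_part \<nu> \<mu>1) (space \<nu>) = 0"
  using ac_density_absolutely_continuous[OF sigma_finite _ _ \<mu>1_ac] \<mu>1_prob sets_\<mu>1 sets_\<nu>
  by (auto simp: prob_space_def)

lemma \<rho>0_ac: "ac_density \<nu> \<mu>0 \<in> borel_measurable \<nu>" "0 \<le> ac_density \<nu> \<mu>0 x" "AE x in \<nu>. ac_density \<nu> \<mu>0 x = \<rho>0 x"
  "emeasure (singular_part \<nu> \<mu>0) (space \<nu>) = 0"
proof -
  have fin: "finite_measure \<mu>0" using \<mu>0_prob by (simp add: prob_space_def)
  have s: "sets \<mu>0 = sets \<nu>" using sets_\<mu>0 sets_\<nu> by simp
  note ac = ac_density_absolutely_continuous[OF sigma_finite fin s \<mu>0_ac]
  show "ac_density \<nu> \<mu>0 \<in> borel_measurable \<nu>" "0 \<le> ac_density \<nu> \<mu>0 x"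
    "emeasure (singular_part \<nu> \<mu>0) (space \<nu>) = 0" by (fact ac)+
  have "density \<nu> (\<lambda>x. ennreal (ac_density \<nu> \<mu>0 x)) = density \<nu> (\<lambda>x. ennreal (\<rho>0 x))"
    using ac(3) \<rho>0_density by simp
  then have "AE x in \<nu>. ennreal (ac_density \<nu> \<mu>0 x) = ennreal (\<rho>0 x)"
    using ac(1) measurable_\<rho>0_\<nu> by (subst (asm) \<nu>.density_unique_iff) auto
  then show "AE x in \<nu>. ac_density \<nu> \<mu>0 x = \<rho>0 x"
    using ac(2) \<rho>0_nonneg by auto
qed

lemma AE_\<mu>0_ac: "AE x in \<mu>0. ac_density \<nu> \<mu>0 x = \<rho>0 x"
  by (rule absolutely_continuous_AE[OF _ \<mu>0_ac \<rho>0_ac(3)]) (simp add: sets_\<mu>0 sets_\<nu>)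

lemma AE_\<pi>_ac: "AE (x, y) in \<pi>. ac_density \<nu> \<mu>0 x = \<rho>0 x"
proof -
  have "AE z in \<pi>. ac_density \<nu> \<mu>0 (fst z) = \<rho>0 (fst z)"
    using AE_\<mu>0_ac unfolding \<pi>_fst[symmetric] by (rule AE_distrD[rotated]) measurable
  then show ?thesis by (simp add: case_prod_beta)
qed

lemma integrable_\<rho>0: "integrable \<nu> \<rho>0"
proof (rule integrableI_nonneg)
  have "(\<integral>\<^sup>+x. ennreal (\<rho>0 x) \<partial>\<nu>) = emeasure \<mu>0 (space \<mu>0)"
    unfolding \<rho>0_density using sets.top[of \<nu>] by (subst emeasure_density) auto
  then show "(\<integral>\<^sup>+x. ennreal (\<rho>0 x) \<partial>\<nu>) < \<infinity>" using prob_space.emeasure_space_1[OF \<mu>0_prob] by simp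
qed (auto simp: \<rho>0_nonneg)

lemma U_fun_\<mu>0: "U_fun U \<nu> \<mu>0 = eintegral \<nu> (\<lambda>x. ereal (U (\<rho>0 x)))"
proof -
  have "eintegral \<nu> (\<lambda>x. ereal (U (ac_density \<nu> \<mu>0 x))) = eintegral \<nu> (\<lambda>x. ereal (U (\<rho>0 x)))"
    by (rule eintegral_cong_AE) (use \<rho>0_ac(3) in auto)
  then show ?thesis unfolding U_fun_def \<rho>0_ac(4) by (simp add: zero_ennreal.rep_eq)
qed

lemma U_fun_\<mu>1: "U_fun U \<nu> \<mu>1 = eintegral \<nu> (\<lambda>x. ereal (U (\<rho>1 x)))"
  unfolding U_fun_def \<rho>1(4) by (simp add: zero_ennreal.rep_eq)

context
  fixes U :: "real \<Rightarrow> real" and N :: ereal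
  assumes U: "tame N U" and N: "1 < N"
begin

lemmas DC' = tameD(1)[OF U N]

text \<open>The truncation alters \<open>\<rho>0\<close> only on a \<open>\<nu>\<close>-null set but
  makes \<open>U' \<circ> w\<close> bounded everywhere, so it can be integrated against
  interpolants, whose singular parts may charge that null set.\<close>

definition w where "w x = min (\<rho>0 x) height"

definition dU where "dU x = deriv U (w x)"

lemma w_range: "0 \<le> w x" "w x \<le> height" "w x \<le> \<rho>0 x"
  using \<rho>0_nonneg[of x] height(1) by (auto simp: w_def)

lemma measurable_w [measurable]: "w \<in> borel_measurable (fborel d)"
  unfolding w_def[abs_def] by measurable

lemma measurable_dU [measurable]: "dU \<in> borel_measurable (fborel d)"
proof -
  note [measurable] = tame_measurable(1)[OF U N]
  show ?thesis unfolding dU_def[abs_def] by measurable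
qed

lemma dU_bounds: "deriv U 0 \<le> dU x" "dU x \<le> deriv U height" "\<bar>dU x\<bar> \<le> max \<bar>deriv U 0\<bar> \<bar>deriv U height\<bar>"
proof -
  show 1: "deriv U 0 \<le> dU x" "dU x \<le> deriv U height"
    unfolding dU_def by (intro tameD(5)[OF U N] w_range)+
  then show "\<bar>dU x\<bar> \<le> max \<bar>deriv U 0\<bar> \<bar>deriv U height\<bar>" by linarith
qed

lemma pressure_w: "0 \<le> pressure U (w x)" "integrable \<nu> (\<lambda>x. pressure U (w x))"
proof -
  have p0: "pressure U 0 = 0" using DC_zero[OF DC' N] by (simp add: pressure_def)
  show nn: "0 \<le> pressure U (w x)" for x
    using DC_pressure_nonneg[OF DC' N, of "w x"] w_range(1)[of x] p0 by (cases "w x = 0") auto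
  obtain C where C: "\<And>r. r > 0 \<Longrightarrow> pressure U r \<le> C * r" using U unfolding tame_def by blast
  have meas: "pressure U \<in> borel_measurable borel"
  proof -
    have "continuous_on UNIV U"
    proof (rule continuous_at_imp_continuous_on, rule ballI)
      fix r :: real
      obtain a e where e: "0 < e" and lin: "\<forall>r<e. U r = a * r" using U unfolding tame_def by blast
      show "isCont U r"
        using tame_near_zero(1)[OF lin, of r] DC_deriv[OF DC' N, of r] e DERIV_isCont by (cases "r < e") auto
    qed
    then have [measurable]: "U \<in> borel_measurable borel" by (rule borel_measurable_continuous_onI)
    note [measurable] = tame_measurable(1)[OF U N]
    show ?thesis unfolding pressure_def[abs_def] by measurable
  qed
  show "integrable \<nu> (\<lambda>x. pressure U (w x))"
  proof (rule Bochner_Integration.integrable_bound)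
    show "integrable \<nu> (\<lambda>x. \<bar>C\<bar> * \<rho>0 x)" using integrable_\<rho>0 by simp
    show "(\<lambda>x. pressure U (w x)) \<in> borel_measurable \<nu>" using meas by measurable
    have "pressure U (w x) \<le> \<bar>C\<bar> * \<rho>0 x" for x
    proof (cases "w x = 0")
      case False
      then have "pressure U (w x) \<le> C * w x" using C w_range(1)[of x] by simp
      also have "\<dots> \<le> \<bar>C\<bar> * \<rho>0 x" using w_range[of x] by (intro mult_mono) auto
      finally show ?thesis .
    qed (use p0 \<rho>0_nonneg in simp)
    then show "AE x in \<nu>. norm (pressure U (w x)) \<le> norm (\<bar>C\<bar> * \<rho>0 x)" using nn \<rho>0_nonneg by auto
  qed
qed

text \<open>Integration of \<open>U(\<rho>) = \<rho> U'(\<rho>) - p(\<rho>)\<close>. The same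
  pressure integral occurs in the lower bound for other measures and cancels in the
  difference.\<close>

lemma U_fun_\<mu>0_tame: "U_fun U \<nu> \<mu>0 = ereal ((\<integral>x. dU x \<partial>\<mu>0) - (\<integral>x. pressure U (w x) \<partial>\<nu>))"
proof -
  have eq: "AE x in \<nu>. U (\<rho>0 x) = \<rho>0 x * dU x - pressure U (w x)"
    using AE_\<rho>0_le_height by eventually_elim (simp add: w_def dU_def pressure_def min_def)
  have i1: "integrable \<nu> (\<lambda>x. \<rho>0 x * dU x)"
  proof (rule Bochner_Integration.integrable_bound)
    show "integrable \<nu> (\<lambda>x. max \<bar>deriv U 0\<bar> \<bar>deriv U height\<bar> * \<rho>0 x)" using integrable_\<rho>0 by simp
    show "AE x in \<nu>. norm (\<rho>0 x * dU x) \<le> norm (max \<bar>deriv U 0\<bar> \<bar>deriv U height\<bar> * \<rho>0 x)"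
    proof (rule AE_I2)
      fix x
      have "\<rho>0 x * \<bar>dU x\<bar> \<le> \<rho>0 x * max \<bar>deriv U 0\<bar> \<bar>deriv U height\<bar>"
        by (rule mult_left_mono[OF dU_bounds(3) \<rho>0_nonneg])
      then show "norm (\<rho>0 x * dU x) \<le> norm (max \<bar>deriv U 0\<bar> \<bar>deriv U height\<bar> * \<rho>0 x)"
        using \<rho>0_nonneg[of x] by (simp add: abs_mult mult.commute)
    qed
  qed measurable
  have "U_fun U \<nu> \<mu>0 = eintegral \<nu> (\<lambda>x. ereal (\<rho>0 x * dU x - pressure U (w x)))"
    unfolding U_fun_\<mu>0 by (rule eintegral_cong_AE) (use eq in auto)
  also have "\<dots> = ereal (\<integral>x. \<rho>0 x * dU x - pressure U (w x) \<partial>\<nu>)"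
    using i1 pressure_w(2) by (intro eintegral_integrable) simp
  also have "(\<integral>x. \<rho>0 x * dU x - pressure U (w x) \<partial>\<nu>) = (\<integral>x. \<rho>0 x * dU x \<partial>\<nu>) - (\<integral>x. pressure U (w x) \<partial>\<nu>)"
    using i1 pressure_w(2) by simp
  also have "(\<integral>x. \<rho>0 x * dU x \<partial>\<nu>) = (\<integral>x. dU x \<partial>\<mu>0)"
    unfolding \<rho>0_density by (subst integral_density) (auto simp: \<rho>0_nonneg)
  finally show ?thesis .
qed

text \<open>The tangent inequality at \<open>\<rho>\<^sub>0\<close>; on the singular part of \<open>\<mu>\<close> the derivative is dominated by \<open>U'(\<infinity>)\<close>.\<close>

lemma U_fun_lower_bound:
  assumes M: "prob_space M" and sM: "sets M = sets (fborel d)"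
  shows "ereal ((\<integral>x. dU x \<partial>M) - (\<integral>x. pressure U (w x) \<partial>\<nu>)) \<le> U_fun U \<nu> M"
proof -
  interpret M: prob_space M by fact
  have s: "sets M = sets \<nu>" using sM sets_\<nu> by simp
  note [measurable_cong] = sM
  let ?r = "ac_density \<nu> M"
  obtain \<mu>s where dec: "lebesgue_decomposition \<nu> M ?r \<mu>s"
    and sing: "emeasure (singular_part \<nu> M) (space \<nu>) = emeasure \<mu>s (space \<nu>)"
    by (rule ac_density_decomposition[OF sigma_finite M.finite_measure_axioms s])
  then have r [measurable]: "?r \<in> borel_measurable \<nu>" and r0: "\<And>x. 0 \<le> ?r x" and ss: "sets \<mu>s = sets \<nu>"
    and sum: "\<And>A. A \<in> sets \<nu> \<Longrightarrow> emeasure M A = emeasure (density \<nu> (\<lambda>x. ennreal (?r x))) A + emeasure \<mu>s A"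
    unfolding lebesgue_decomposition_def by auto
  obtain S where S: "S \<in> null_sets \<nu>" "emeasure \<mu>s (space \<nu> - S) = 0"
    using dec unfolding lebesgue_decomposition_def by blast
  have S_sets [measurable]: "S \<in> sets \<nu>" using S by auto
  have S_M [measurable]: "S \<in> sets M" using S_sets s by simp
  have ac: "emeasure (density \<nu> (\<lambda>x. ennreal (?r x))) A = 0" if "A \<in> null_sets \<nu>" for A
    using that absolutely_continuousI_density[of "\<lambda>x. ennreal (?r x)" \<nu>] unfolding absolutely_continuous_def by auto
  have sing_null: "emeasure \<mu>s A = 0" if "A \<in> sets \<nu>" "A \<inter> S = {}" for A
  proof -
    have "emeasure \<mu>s A \<le> emeasure \<mu>s (space \<nu> - S)"
      using that S_sets ss sets.compl_sets[OF S_sets] by (intro emeasure_mono) auto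
    then show ?thesis using S(2) by simp
  qed
  have MS: "emeasure M S = emeasure \<mu>s (space \<nu>)"
  proof -
    have "emeasure \<mu>s (space \<nu>) = emeasure \<mu>s ((space \<nu> - S) \<union> S)" by (intro arg_cong[where f = "emeasure \<mu>s"]) auto
    also have "\<dots> = emeasure \<mu>s (space \<nu> - S) + emeasure \<mu>s S"
    proof (rule plus_emeasure[symmetric])
      show "space \<nu> - S \<in> sets \<mu>s" "S \<in> sets \<mu>s" unfolding ss by (rule sets.compl_sets[OF S_sets], rule S_sets)
    qed blast
    finally show ?thesis using S sum[OF S_sets] ac[OF S(1)] by simp
  qed
  \<comment> \<open>Off the carrier \<open>S\<close> of the singular part, \<open>M\<close> is its
    absolutely continuous part; integrals against \<open>M\<close> can thus be split along
    \<open>S\<close>.\<close>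
  have dens: "density M (indicator (- S)) = density \<nu> (\<lambda>x. ennreal (?r x))"
  proof (rule measure_eqI)
    fix A assume "A \<in> sets (density M (indicator (- S)))"
    then have A: "A \<in> sets \<nu>" using s by simp
    have "- S \<in> sets M" using S_sets s sets.compl_sets[OF S_sets] by (simp add: Compl_eq_Diff_UNIV)
    then have "emeasure (density M (indicator (- S))) A = emeasure M (- S \<inter> A)"
      using A s by (intro emeasure_restricted) auto
    also have "- S \<inter> A = A - S" by auto
    also have "emeasure M (A - S) = emeasure (density \<nu> (\<lambda>x. ennreal (?r x))) (A - S)"
      using A S_sets sum[of "A - S"] sing_null[of "A - S"] by auto
    also have "\<dots> = emeasure (density \<nu> (\<lambda>x. ennreal (?r x))) A"
      using A ac[OF S(1)] by (intro emeasure_Diff_null_set) (auto simp: null_sets_def)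
    finally show "emeasure (density M (indicator (- S))) A = emeasure (density \<nu> (\<lambda>x. ennreal (?r x))) A" .
  qed (use s in simp)
  have int_dU: "integrable M dU"
    by (rule M.bounded_integrable[OF _ AE_I2[OF dU_bounds(3)]]) measurable
  have compl [measurable]: "- S \<in> sets M" using S_sets s sets.compl_sets[OF S_sets] by (simp add: Compl_eq_Diff_UNIV)
  have i1: "integrable M (\<lambda>x. indicator (- S) x * dU x)" and i2: "integrable M (\<lambda>x. indicator S x * dU x)"
    using integrable_mult_indicator[OF compl int_dU] integrable_mult_indicator[OF S_M int_dU] by simp_all
  have split: "(\<integral>x. dU x \<partial>M) = (\<integral>x. indicator (- S) x * dU x \<partial>M) + (\<integral>x. indicator S x * dU x \<partial>M)"
    unfolding Bochner_Integration.integral_add[OF i1 i2, symmetric]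
    by (intro Bochner_Integration.integral_cong) (auto split: split_indicator)
  have dens': "density M (\<lambda>x. ennreal (indicator (- S) x)) = density \<nu> (\<lambda>x. ennreal (?r x))"
    using dens by (simp add: ennreal_indicator)
  have ac_part: "(\<integral>x. indicator (- S) x * dU x \<partial>M) = (\<integral>x. ?r x * dU x \<partial>\<nu>)" "integrable \<nu> (\<lambda>x. ?r x * dU x)"
  proof -
    have "(\<integral>x. indicator (- S) x * dU x \<partial>M) = (\<integral>x. dU x \<partial>density M (\<lambda>x. ennreal (indicator (- S) x)))"
      by (subst integral_density) auto
    also have "\<dots> = (\<integral>x. ?r x * dU x \<partial>\<nu>)"
      unfolding dens' by (subst integral_density) (auto simp: r0)
    finally show "(\<integral>x. indicator (- S) x * dU x \<partial>M) = (\<integral>x. ?r x * dU x \<partial>\<nu>)" .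
    have "integrable (density M (\<lambda>x. ennreal (indicator (- S) x))) dU"
      using i1 by (subst integrable_density) auto
    then show "integrable \<nu> (\<lambda>x. ?r x * dU x)"
      unfolding dens' by (subst (asm) integrable_density) (auto simp: r0)
  qed
  have "ereal ((\<integral>x. ?r x * dU x \<partial>\<nu>) - (\<integral>x. pressure U (w x) \<partial>\<nu>)) = eintegral \<nu> (\<lambda>x. ereal (?r x * dU x - pressure U (w x)))"
    using ac_part(2) pressure_w(2) by (subst eintegral_integrable) auto
  also have "\<dots> \<le> eintegral \<nu> (\<lambda>x. ereal (U (?r x)))"
  proof (rule eintegral_mono_AE, rule AE_I2)
    fix x
    show "ereal (?r x * dU x - pressure U (w x)) \<le> ereal (U (?r x))"
      using tameD(6)[OF U N w_range(1)[of x] r0[of x]] by (simp add: dU_def pressure_def algebra_simps)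
  qed
  finally have 1: "ereal ((\<integral>x. ?r x * dU x \<partial>\<nu>) - (\<integral>x. pressure U (w x) \<partial>\<nu>)) \<le> eintegral \<nu> (\<lambda>x. ereal (U (?r x)))" .
  \<comment> \<open>If \<open>U'(\<infinity>) = \<infinity>\<close>, the right side is
    \<open>\<infinity>\<close> unless \<open>S\<close> has no mass, and then both sides
    vanish.\<close>
  have 2: "ereal (\<integral>x. indicator S x * dU x \<partial>M) \<le> deriv_infty U * enn2ereal (emeasure M S)"
  proof -
    have eS: "enn2ereal (emeasure M S) = ereal (measure M S)" by (simp add: M.emeasure_eq_measure enn2ereal_ennreal)
    have inf: "ereal (dU x) \<le> deriv_infty U" for x
      unfolding dU_def by (rule tameD(7)[OF U N w_range(1)])
    show ?thesis
    proof (cases "deriv_infty U")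
      case (real D)
      have iS: "integrable M (indicat_real S)"
        by (rule M.bounded_integrable[where B = 1]) (auto split: split_indicator)
      have "(\<integral>x. indicator S x * dU x \<partial>M) \<le> (\<integral>x. indicator S x * D \<partial>M)"
        by (rule integral_mono[OF i2]) (use inf real iS in \<open>auto split: split_indicator intro!: integrable_mult_left\<close>)
      also have "\<dots> = D * measure M S" by simp
      finally show ?thesis using real eS by simp
    next
      case PInf
      show ?thesis
      proof (cases "measure M S = 0")
        case True
        then have "AE x in M. x \<notin> S" using S_M by (intro AE_not_in) (auto simp: null_sets_def M.emeasure_eq_measure)
        then have "AE x in M. indicator S x * dU x = 0" by eventually_elim simp
        then have "(\<integral>x. indicator S x * dU x \<partial>M) = 0" by (rule integral_eq_zero_AE)
        then show ?thesis using True eS by (simp add: zero_ereal_def[symmetric])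
      next
        case False
        then have "measure M S > 0" by (simp add: zero_less_measure_iff)
        then show ?thesis using PInf eS by simp
      qed
    next
      case MInf
      then show ?thesis using inf by simp
    qed
  qed
  have "ereal ((\<integral>x. dU x \<partial>M) - (\<integral>x. pressure U (w x) \<partial>\<nu>)) =
    ereal ((\<integral>x. ?r x * dU x \<partial>\<nu>) - (\<integral>x. pressure U (w x) \<partial>\<nu>)) + ereal (\<integral>x. indicator S x * dU x \<partial>M)"
    unfolding split ac_part(1) by simp
  also have "\<dots> \<le> eintegral \<nu> (\<lambda>x. ereal (U (?r x))) + deriv_infty U * enn2ereal (emeasure M S)"
    using 1 2 by (rule add_mono)
  finally show ?thesis unfolding U_fun_def sing MS .
qed

text \<open>The identity at \<open>\<mu>0\<close> minus the tangent bound at the interpolant: the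
  pressure integrals cancel, and the two integrals of \<open>dU\<close> become one over geodesics.
  Finiteness of that integral is recorded for the later division by \<open>t\<close>.\<close>

lemma U_fun_interpolant_lower:
  assumes t: "0 < t" "t \<le> 1"
  shows "U_fun U \<nu> \<mu>0 \<le> U_fun U \<nu> (interpolant d Q t) + ereal t * eintegral Q (\<lambda>\<gamma>. ereal (descent U t \<gamma>))"
    "\<exists>D. eintegral Q (\<lambda>\<gamma>. ereal (descent U t \<gamma>)) = ereal D"
proof -
  have ev [measurable]: "(\<lambda>\<gamma>. \<gamma> t) \<in> measurable Q (fborel d)" using t by (intro eval_measurable) auto
  have M: "prob_space (interpolant d Q t)" unfolding interpolant_def by (rule Q.prob_space_distr[OF ev])
  have int: "(\<integral>x. dU x \<partial>interpolant d Q s) = (\<integral>\<gamma>. dU (\<gamma> s) \<partial>Q)" "integrable Q (\<lambda>\<gamma>. dU (\<gamma> s))" if "s \<in> {0..1}" for s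
  proof -
    note [measurable] = eval_measurable[OF that]
    show "(\<integral>x. dU x \<partial>interpolant d Q s) = (\<integral>\<gamma>. dU (\<gamma> s) \<partial>Q)"
      unfolding interpolant_def by (rule integral_distr) measurable
    show "integrable Q (\<lambda>\<gamma>. dU (\<gamma> s))"
      by (rule Q.bounded_integrable[OF _ AE_I2[OF dU_bounds(3)]]) measurable
  qed
  have ts: "t \<in> {0..1}" "(0::real) \<in> {0..1}" using t by auto
  let ?h = "\<lambda>\<gamma>. (dU (\<gamma> 0) - dU (\<gamma> t)) / t"
  have hi: "integrable Q ?h" using int[OF ts(1)] int[OF ts(2)] by simp
  \<comment> \<open>Almost every geodesic stays in the ball where
    \<open>\<rho>0 \<le> height\<close>, so the truncation is invisible along it.\<close>
  have "eintegral Q (\<lambda>\<gamma>. ereal (descent U t \<gamma>)) = eintegral Q (\<lambda>\<gamma>. ereal (?h \<gamma>))"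
  proof (rule eintegral_cong_AE)
    show "AE \<gamma> in Q. ereal (descent U t \<gamma>) = ereal (?h \<gamma>)" using AE_radius
    proof eventually_elim
      case (elim \<gamma>)
      then have "\<rho>0 (\<gamma> 0) \<le> height" "\<rho>0 (\<gamma> t) \<le> height" using t by (auto intro: height)
      then show ?case by (simp add: descent_def[OF U N] dU_def w_def min_def)
    qed
  qed
  also have "\<dots> = ereal (\<integral>\<gamma>. ?h \<gamma> \<partial>Q)" by (rule eintegral_integrable[OF hi])
  also have "(\<integral>\<gamma>. ?h \<gamma> \<partial>Q) = ((\<integral>x. dU x \<partial>\<mu>0) - (\<integral>x. dU x \<partial>interpolant d Q t)) / t"
    using int[OF ts(1)] int[OF ts(2)] by (simp add: Q_0[symmetric])
  finally have D: "eintegral Q (\<lambda>\<gamma>. ereal (descent U t \<gamma>)) = ereal (((\<integral>x. dU x \<partial>\<mu>0) - (\<integral>x. dU x \<partial>interpolant d Q t)) / t)" .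
  then show "\<exists>D. eintegral Q (\<lambda>\<gamma>. ereal (descent U t \<gamma>)) = ereal D" by blast
  have "U_fun U \<nu> \<mu>0 = ereal ((\<integral>x. dU x \<partial>interpolant d Q t) - (\<integral>x. pressure U (w x) \<partial>\<nu>))
      + ereal t * ereal (((\<integral>x. dU x \<partial>\<mu>0) - (\<integral>x. dU x \<partial>interpolant d Q t)) / t)"
    unfolding U_fun_\<mu>0_tame using t by simp
  also have "\<dots> \<le> U_fun U \<nu> (interpolant d Q t) + ereal t * eintegral Q (\<lambda>\<gamma>. ereal (descent U t \<gamma>))"
    unfolding D by (intro add_right_mono U_fun_lower_bound[OF M]) (simp add: interpolant_def)
  finally show "U_fun U \<nu> \<mu>0 \<le> U_fun U \<nu> (interpolant d Q t) + ereal t * eintegral Q (\<lambda>\<gamma>. ereal (descent U t \<gamma>))" .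
qed

end

end

section \<open>Distorted functionals of tame functions\<close>

text \<open>Real-valued counterpart of \<open>slope_at\<close>: for tame functions
  \<open>U'(0)\<close> is finite and equals \<open>deriv U 0\<close>, so integrals against the plan
  can be ordinary ones.\<close>

definition tame_slope :: "(real \<Rightarrow> real) \<Rightarrow> real \<Rightarrow> ereal \<Rightarrow> real" where
  "tame_slope U r b = (if b = \<infinity> then deriv U 0 else mean_slope U (max 0 (r / real_of_ereal b)))"

context
  fixes U :: "real \<Rightarrow> real" and N :: ereal
  assumes U: "tame N U" and N: "1 < N"
begin

lemma tame_DC: "U \<in> DC N" by (rule tameD(1)[OF U N])

lemma slope_at_tame: "slope_at U r b = ereal (tame_slope U r b)"
  using tameD(2)[OF U N] by (auto simp: slope_at_def tame_slope_def)

lemma mean_slope_ge: "r > 0 \<Longrightarrow> deriv U 0 \<le> mean_slope U r"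
  using tameD(2)[OF U N] by auto

lemma tame_slope_ge:
  assumes "r > 0" "b > 0"
  shows "deriv U 0 \<le> tame_slope U r b"
  using assms mean_slope_ge[of "r / real_of_ereal b"] by (cases b) (auto simp: tame_slope_def max_def)

lemma tame_slope_antimono:
  assumes "r > 0" "0 < b" "b \<le> b'"
  shows "tame_slope U r b' \<le> tame_slope U r b"
proof (cases "b' = \<infinity>")
  case True
  then show ?thesis using tame_slope_ge[OF assms(1,2)] by (simp add: tame_slope_def)
next
  case False
  then obtain c c' where c: "b = ereal c" "b' = ereal c'" "0 < c" "c \<le> c'"
    using assms by (cases b; cases b') auto
  have "mean_slope U (r / c') \<le> mean_slope U (r / c)"
    using assms c by (intro mean_slope_mono[OF tame_DC N] divide_left_mono) auto
  then show ?thesis using c assms by (simp add: tame_slope_def max_def)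
qed

lemma tame_slope_one: "r > 0 \<Longrightarrow> tame_slope U r 1 = mean_slope U r"
  by (simp add: tame_slope_def one_ereal_def max_def)

lemma tame_pressure_linear: "\<exists>C\<ge>0. \<forall>r>0. pressure U r \<le> C * r"
proof -
  obtain C where C: "\<forall>r>0. pressure U r \<le> C * r" using U unfolding tame_def by blast
  have "0 \<le> C * 1" using C DC_pressure_nonneg[OF tame_DC N, of 1] by (meson order_trans zero_less_one)
  then show ?thesis using C by auto
qed

text \<open>\<open>U'(0)\<close> bounds \<open>m\<close> from below and the linear bound on
  \<open>U\<close> bounds it from above, whatever the coefficient is.\<close>

lemma tame_slope_bounded:
  assumes "N \<noteq> \<infinity>"
  shows "\<exists>C. \<forall>r>0. \<forall>b>0. \<bar>tame_slope U r b\<bar> \<le> C"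
proof -
  obtain C where C: "\<And>r. r > 0 \<Longrightarrow> U r \<le> C * r" using U assms unfolding tame_def by blast
  have "\<bar>tame_slope U r b\<bar> \<le> max \<bar>deriv U 0\<bar> \<bar>C\<bar>" if rb: "r > 0" "b > 0" for r b
  proof (cases "b = \<infinity>")
    case False
    then obtain c where c: "b = ereal c" "c > 0" using rb by (cases b) auto
    have v: "r / c > 0" using rb c by simp
    have "mean_slope U (r / c) \<le> C" using C[OF v] v unfolding mean_slope_def by (subst divide_le_eq) auto
    then show ?thesis using mean_slope_ge[OF v] v c by (simp add: tame_slope_def max_def abs_le_iff) linarith
  qed (simp add: tame_slope_def)
  then show ?thesis by blast
qed

text \<open>Passing from \<open>b\<close> to \<open>b'\<close> multiplies the argument
  \<open>r / b\<close> by at most \<open>exp c\<close>, and \<open>m\<close> grows by at most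
  \<open>C\<close> times the increment of the logarithm.\<close>

lemma tame_slope_exp_bound:
  assumes C: "\<And>r. r > 0 \<Longrightarrow> pressure U r \<le> C * r" and r: "r > 0" and b: "0 < b" and c: "0 \<le> c"
    and le: "ereal (exp (- c)) * b \<le> b'"
  shows "tame_slope U r b' \<le> tame_slope U r b + C * c"
proof -
  have C0: "0 \<le> C * c"
  proof -
    have "0 \<le> C * 1" using C[of 1] DC_pressure_nonneg[OF tame_DC N, of 1] by simp
    then show ?thesis using c by simp
  qed
  have "0 < ereal (exp (- c)) * b" using b by (cases b) auto
  then have b': "0 < b'" using le by (rule less_le_trans)
  show ?thesis
  proof (cases "b = \<infinity> \<or> b' = \<infinity>")
    case True
    then have "b' = \<infinity>" using le by auto
    then show ?thesis using tame_slope_ge[OF r b] C0 by (simp add: tame_slope_def)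
  next
    case False
    then obtain v v' where v: "b = ereal v" "b' = ereal v'" "v > 0" "v' > 0" using b b' by (cases b; cases b') auto
    have "exp (- c) * v \<le> v'" using le v by simp
    then have "r / v' \<le> r / (exp (- c) * v)" using r v by (intro divide_left_mono) auto
    also have "\<dots> = exp c * (r / v)" by (simp add: exp_minus field_simps)
    finally have "mean_slope U (r / v') \<le> mean_slope U (exp c * (r / v))"
      using r v by (intro mean_slope_mono[OF tame_DC N]) auto
    moreover have "mean_slope U (exp c * (r / v)) - mean_slope U (r / v) \<le> C * (ln (exp c * (r / v)) - ln (r / v))"
      using r v c by (intro mean_slope_ln_lipschitz[OF tame_DC N C]) (auto simp: divide_right_mono mult_le_cancel_right1)
    moreover have "exp c * (r / v) = exp (c + ln (r / v))" using r v by (simp add: exp_add)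
    then have "ln (exp c * (r / v)) = c + ln (r / v)" by (simp only: ln_exp)
    then have "ln (exp c * (r / v)) - ln (r / v) = c" by simp
    ultimately show ?thesis using v r by (simp add: tame_slope_def max_def)
  qed
qed

lemma tame_slope_tendsto:
  assumes b: "(b \<longlonglongrightarrow> b0)" and b0: "0 < b0" and r: "r > 0" and inf: "b0 = \<infinity> \<Longrightarrow> \<forall>n. b n = \<infinity>"
  shows "(\<lambda>n. tame_slope U r (b n)) \<longlonglongrightarrow> tame_slope U r b0"
proof (cases "b0 = \<infinity>")
  case True
  then show ?thesis using inf by simp
next
  case False
  then obtain c where c: "b0 = ereal c" "c > 0" using b0 by (cases b0) auto
  have lim: "(\<lambda>n. real_of_ereal (b n)) \<longlonglongrightarrow> c" using b c by (simp add: lim_real_of_ereal)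
  have fin: "\<forall>\<^sub>F n in sequentially. 0 < b n \<and> b n < \<infinity>"
    using order_tendstoD(1)[OF b, of 0] order_tendstoD(2)[OF b, of \<infinity>] c by (auto intro: eventually_conj)
  have "isCont (mean_slope U) (r / c)"
    using mean_slope_deriv[OF tame_DC N, of "r / c"] r c DERIV_isCont by auto
  then have lim2: "(\<lambda>n. mean_slope U (r / real_of_ereal (b n))) \<longlonglongrightarrow> mean_slope U (r / c)"
    using c by (intro isCont_tendsto_compose[of _ "mean_slope U"] tendsto_divide lim tendsto_const) auto
  have "\<forall>\<^sub>F n in sequentially. mean_slope U (r / real_of_ereal (b n)) = tame_slope U r (b n)"
    using fin
  proof eventually_elim
    case (elim n)
    then obtain v where "b n = ereal v" "v > 0" by (cases "b n") auto
    then show ?case using r by (simp add: tame_slope_def max_def)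
  qed
  from Lim_transform_eventually[OF lim2 this] show ?thesis
    using c r by (simp add: tame_slope_def max_def)
qed

lemma measurable_tame_slope:
  assumes [measurable]: "f \<in> borel_measurable M" "b \<in> borel_measurable M"
  shows "(\<lambda>x. tame_slope U (f x) (b x)) \<in> borel_measurable M"
proof -
  have "(\<lambda>x. real_of_ereal (slope_at U (f x) (b x))) \<in> borel_measurable M"
    using measurable_slope_at[OF tame_DC assms] by measurable
  then show ?thesis by (simp add: slope_at_tame)
qed

text \<open>Bounded convergence, with the bound from \<open>tame_slope_bounded\<close>. At the
  critical distance the coefficients are finite and tend to \<open>\<infinity>\<close>, so that
  their slopes have to be shown to approach \<open>U'(0)\<close>.\<close>

lemma eintegral_dimension_limit:
  assumes P: "prob_space P" and [measurable]: "r \<in> borel_measurable P" "\<delta> \<in> borel_measurable P"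
    and pos: "AE z in P. 0 < r z" and \<delta>: "\<And>z. 0 \<le> \<delta> z" "\<And>z. \<delta> z \<le> myers_diameter K n"
    and K: "K > 0" and n: "N = ereal n" and t: "0 < t" "t < 1"
  shows "((\<lambda>N'. eintegral P (\<lambda>z. slope_at U (r z) (rbeta K N' t (\<delta> z)))) \<longlongrightarrow>
    eintegral P (\<lambda>z. slope_at U (r z) (rbeta K N t (\<delta> z)))) (at_right N)"
proof -
  interpret P: prob_space P by fact
  have n1: "n > 1" using N n by simp
  obtain C where C: "\<And>r b. r > 0 \<Longrightarrow> b > 0 \<Longrightarrow> \<bar>tame_slope U r b\<bar> \<le> C"
    using tame_slope_bounded n by auto
  have meas: "(\<lambda>z. tame_slope U (r z) (rbeta K N' t (\<delta> z))) \<in> borel_measurable P" for N'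
    by (intro measurable_tame_slope) auto
  have bound: "AE z in P. \<bar>tame_slope U (r z) (rbeta K N' t (\<delta> z))\<bar> \<le> C" if "1 < N'" for N'
    using pos by eventually_elim (use rbeta_pos[OF that \<delta>(1) t(1)] t(2) in \<open>auto intro!: C\<close>)
  have eq: "eintegral P (\<lambda>z. slope_at U (r z) (rbeta K N' t (\<delta> z))) = ereal (\<integral>z. tame_slope U (r z) (rbeta K N' t (\<delta> z)) \<partial>P)"
    if "1 < N'" for N'
    unfolding slope_at_tame by (rule eintegral_integrable[OF P.bounded_integrable[OF meas bound[OF that]]])
  show ?thesis
    unfolding tendsto_at_iff_sequentially
  proof (intro allI impI)
    fix X :: "nat \<Rightarrow> ereal" assume X: "\<forall>i. X i \<in> {N<..} - {N}" "X \<longlonglongrightarrow> N"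
    then have X1: "1 < X i" for i using N by (auto intro: less_trans)
    have "(\<lambda>i. \<integral>z. tame_slope U (r z) (rbeta K (X i) t (\<delta> z)) \<partial>P) \<longlonglongrightarrow> (\<integral>z. tame_slope U (r z) (rbeta K N t (\<delta> z)) \<partial>P)"
    proof (rule integral_dominated_convergence[where w = "\<lambda>_. C"])
      show "AE z in P. norm (tame_slope U (r z) (rbeta K (X i) t (\<delta> z))) \<le> C" for i
        using bound[OF X1[of i]] by simp
      show "AE z in P. (\<lambda>i. tame_slope U (r z) (rbeta K (X i) t (\<delta> z))) \<longlonglongrightarrow> tame_slope U (r z) (rbeta K N t (\<delta> z))"
        using pos
      proof eventually_elim
        case (elim z)
        have lim: "(\<lambda>i. rbeta K (X i) t (\<delta> z)) \<longlonglongrightarrow> rbeta K N t (\<delta> z)"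
          using rbeta_tendsto_dimension[OF K n1 \<delta>(1,2) t, of z, folded n] X
          unfolding tendsto_at_iff_sequentially comp_def by blast
        have fin: "rbeta K (X i) t (\<delta> z) \<noteq> \<infinity>" for i
        proof (cases "X i")
          case (real m)
          then have "myers_diameter K n < myers_diameter K m"
            using X(1)[rule_format, of i] n n1 by (intro myers_diameter_strict_mono[OF K]) auto
          then show ?thesis using \<delta>(2)[of z] real by (auto simp: rbeta_def one_ereal_def)
        qed (use X1[of i] in \<open>auto simp: rbeta_def\<close>)
        show ?case
        proof (cases "rbeta K N t (\<delta> z) = \<infinity>")
          case False
          then show ?thesis
            using rbeta_pos[OF N \<delta>(1) t(1)] t(2) elim lim by (intro tame_slope_tendsto) auto
        next
          case True
          have "\<exists>v>0. rbeta K (X i) t (\<delta> z) = ereal v" for i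
          proof -
            have "0 < rbeta K (X i) t (\<delta> z)" using rbeta_pos[OF X1[of i] \<delta>(1)[of z] t(1)] t(2) by simp
            then show ?thesis using fin[of i] by (cases "rbeta K (X i) t (\<delta> z)") auto
          qed
          then obtain b where b: "\<And>i. rbeta K (X i) t (\<delta> z) = ereal (b i)" "\<And>i. 0 < b i" by metis
          have "(\<lambda>i. ereal (b i)) \<longlonglongrightarrow> \<infinity>" using lim True b(1) by simp
          then have top: "filterlim b at_top sequentially" by (simp add: tendsto_PInfty_eq_at_top)
          \<comment> \<open>Once \<open>r / b i\<close> is below \<open>e\<close>, the linear piece
            of \<open>U\<close> makes the slope exactly \<open>U'(0)\<close>: the sequence is
            eventually constant.\<close>
          obtain a e where e: "0 < e" and lin: "\<forall>r<e. U r = a * r" using U unfolding tame_def by blast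
          have "\<forall>\<^sub>F i in sequentially. r z / e < b i" using top by (simp add: filterlim_at_top_dense)
          then have "\<forall>\<^sub>F i in sequentially. tame_slope U (r z) (rbeta K (X i) t (\<delta> z)) = deriv U 0"
          proof eventually_elim
            fix i assume i: "r z / e < b i"
            let ?v = "r z / b i"
            have v: "0 < ?v" "?v < e" using elim b(2)[of i] e i by (auto simp: field_simps)
            then have "tame_slope U (r z) (rbeta K (X i) t (\<delta> z)) = mean_slope U ?v"
              unfolding b(1) by (simp add: tame_slope_def max_def)
            also have "\<dots> = a" using v lin elim b(2)[of i] by (simp add: mean_slope_def)
            finally show "tame_slope U (r z) (rbeta K (X i) t (\<delta> z)) = deriv U 0"
              using tame_near_zero(2)[OF lin e] by simp
          qed
          then show ?thesis using True by (simp add: tame_slope_def tendsto_eventually)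
        qed
      qed
    qed (use meas in auto)
    then have "(\<lambda>i. ereal (\<integral>z. tame_slope U (r z) (rbeta K (X i) t (\<delta> z)) \<partial>P)) \<longlonglongrightarrow>
        eintegral P (\<lambda>z. slope_at U (r z) (rbeta K N t (\<delta> z)))"
      by (simp only: eq[OF N] lim_ereal)
    moreover have "(\<lambda>i. ereal (\<integral>z. tame_slope U (r z) (rbeta K (X i) t (\<delta> z)) \<partial>P)) =
        (\<lambda>N'. eintegral P (\<lambda>z. slope_at U (r z) (rbeta K N' t (\<delta> z)))) \<circ> X"
      by (rule ext) (simp only: comp_apply eq[OF X1])
    ultimately show "((\<lambda>N'. eintegral P (\<lambda>z. slope_at U (r z) (rbeta K N' t (\<delta> z)))) \<circ> X) \<longlonglongrightarrow>
        eintegral P (\<lambda>z. slope_at U (r z) (rbeta K N t (\<delta> z)))"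
      by (simp only:)
  qed
qed

end

section \<open>The convention at maximal diameter\<close>

definition (in fbc_space) maximal_diameter :: "real \<Rightarrow> ereal \<Rightarrow> bool" where
  "maximal_diameter K N \<longleftrightarrow> K > 0 \<and> N \<noteq> \<infinity> \<and>
     (SUP (x, y)\<in>UNIV. ereal (d x y)) = ereal (myers_diameter K (real_of_ereal N))"

context fbc_space
begin

lemma myers_limit_eq:
  "myers_limit d K N F = (if maximal_diameter K N then Lim (at_right N) F else F N)"
  by (simp add: myers_limit_def maximal_diameter_def)

lemma maximal_diameter_dist_le: "maximal_diameter K N \<Longrightarrow> d x y \<le> myers_diameter K (real_of_ereal N)"
proof -
  assume m: "maximal_diameter K N"
  have "ereal (d x y) \<le> (SUP (x, y)\<in>UNIV. ereal (d x y))" by (rule SUP_upper2[of "(x, y)"]) auto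
  then show ?thesis using m by (simp add: maximal_diameter_def)
qed

lemma trivial_limit_at_right: "1 < N \<Longrightarrow> N \<noteq> \<infinity> \<Longrightarrow> at_right (N::ereal) \<noteq> bot"
  by (cases N) (auto simp: at_right_ereal filtermap_bot_iff)

text \<open>For tame functions the limit over larger dimensions is just the value at
  \<open>N\<close>, so at intermediate times the convention disappears from the curvature-dimension
  inequality. The range \<open>t < 1\<close> reflects the blow-up of the coefficient at the critical
  distance.\<close>

lemma myers_limit_U_beta_tame:
  assumes \<nu>: "sigma_finite_measure \<nu>" "sets \<nu> = sets (fborel d)"
    and \<mu>: "prob_space \<mu>" "sets \<mu> = sets (fborel d)" "absolutely_continuous \<nu> \<mu>"
    and \<pi>: "prob_space \<pi>" "sets \<pi> = sets (fborel d \<Otimes>\<^sub>M fborel d)" "distr \<pi> (fborel d) fst = \<mu>"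
    and U: "tame N U" and N: "1 < N"
    and \<delta>: "(\<lambda>(x, y). \<delta> x y) \<in> borel_measurable (fborel d \<Otimes>\<^sub>M fborel d)" "\<And>x y. 0 \<le> \<delta> x y"
      "\<And>x y. maximal_diameter K N \<Longrightarrow> \<delta> x y \<le> myers_diameter K (real_of_ereal N)"
    and t: "0 < t" "t < 1"
  shows "myers_limit d K N (\<lambda>N'. U_beta U \<nu> (\<lambda>x y. rbeta K N' t (\<delta> x y)) \<pi> \<mu>) =
    eintegral \<pi> (\<lambda>(x, y). slope_at U (ac_density \<nu> \<mu> x) (rbeta K N t (\<delta> x y)))"
proof -
  have eq: "U_beta U \<nu> (\<lambda>x y. rbeta K N' t (\<delta> x y)) \<pi> \<mu> =
    eintegral \<pi> (\<lambda>(x, y). slope_at U (ac_density \<nu> \<mu> x) (rbeta K N' t (\<delta> x y)))" if "1 < N'" for N'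
  proof (rule U_beta_eq[OF \<nu> \<mu> \<pi> tameD(1)[OF U N] N])
    show "(\<lambda>(x, y). rbeta K N' t (\<delta> x y)) \<in> borel_measurable (fborel d \<Otimes>\<^sub>M fborel d)"
      using measurable_compose[OF \<delta>(1) measurable_rbeta] by (simp add: case_prod_unfold)
    show "0 < rbeta K N' t (\<delta> x y)" for x y using rbeta_pos[OF that \<delta>(2) t(1)] t(2) by simp
  qed
  show ?thesis
  proof (cases "maximal_diameter K N")
    case True
    then obtain n where n: "N = ereal n" "K > 0" using N by (cases N) (auto simp: maximal_diameter_def)
    have fin: "finite_measure \<mu>" using \<mu>(1) by (simp add: prob_space_def)
    have s: "sets \<mu> = sets \<nu>" using \<mu>(2) \<nu>(2) by simp
    note ac = ac_density_absolutely_continuous[OF \<nu>(1) fin s \<mu>(3)]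
    have ac1: "ac_density \<nu> \<mu> \<in> borel_measurable (fborel d)"
      using ac(1) by (simp only: measurable_cong_sets[OF \<nu>(2) refl])
    have fst: "fst \<in> measurable \<pi> (fborel d)" by (simp add: measurable_cong_sets[OF \<pi>(2) refl])
    have "AE x in \<mu>. 0 < ac_density \<nu> \<mu> x"
      by (subst ac(3), subst AE_density) (use ac(1) in \<open>auto simp: ennreal_less_zero_iff\<close>)
    then have pos: "AE z in \<pi>. 0 < ac_density \<nu> \<mu> (fst z)"
      unfolding \<pi>(3)[symmetric] by (rule AE_distrD[OF fst])
    have "((\<lambda>N'. eintegral \<pi> (\<lambda>z. slope_at U (ac_density \<nu> \<mu> (fst z)) (rbeta K N' t (\<delta> (fst z) (snd z))))) \<longlongrightarrow>
      eintegral \<pi> (\<lambda>z. slope_at U (ac_density \<nu> \<mu> (fst z)) (rbeta K N t (\<delta> (fst z) (snd z))))) (at_right N)"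
    proof (rule eintegral_dimension_limit[OF U N \<pi>(1) _ _ pos _ _ n(2,1) t])
      show "(\<lambda>z. ac_density \<nu> \<mu> (fst z)) \<in> borel_measurable \<pi>" by (rule measurable_compose[OF fst ac1])
      show "(\<lambda>z. \<delta> (fst z) (snd z)) \<in> borel_measurable \<pi>"
        using \<delta>(1) by (simp add: measurable_cong_sets[OF \<pi>(2) refl] case_prod_unfold)
    qed (use \<delta>(2,3) True n in auto)
    then have lim: "((\<lambda>N'. eintegral \<pi> (\<lambda>(x, y). slope_at U (ac_density \<nu> \<mu> x) (rbeta K N' t (\<delta> x y)))) \<longlongrightarrow>
      eintegral \<pi> (\<lambda>(x, y). slope_at U (ac_density \<nu> \<mu> x) (rbeta K N t (\<delta> x y)))) (at_right N)"
      by (simp add: case_prod_unfold)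
    have nb: "at_right N \<noteq> bot" using trivial_limit_at_right[OF N] n by simp
    have "\<forall>\<^sub>F N' in at_right N. N < N'" by (simp add: eventually_at_filter)
    then have ev: "\<forall>\<^sub>F N' in at_right N. eintegral \<pi> (\<lambda>(x, y). slope_at U (ac_density \<nu> \<mu> x) (rbeta K N' t (\<delta> x y))) =
        U_beta U \<nu> (\<lambda>x y. rbeta K N' t (\<delta> x y)) \<pi> \<mu>"
      by eventually_elim (use N in \<open>simp add: eq\<close>)
    have "Lim (at_right N) (\<lambda>N'. U_beta U \<nu> (\<lambda>x y. rbeta K N' t (\<delta> x y)) \<pi> \<mu>) =
      eintegral \<pi> (\<lambda>(x, y). slope_at U (ac_density \<nu> \<mu> x) (rbeta K N t (\<delta> x y)))"
      by (rule tendsto_Lim[OF nb Lim_transform_eventually[OF lim ev]])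
    then show ?thesis using True by (simp add: myers_limit_eq)
  qed (simp add: myers_limit_eq eq[OF N])
qed

text \<open>Pairs at maximal distance receive \<open>-\<infinity>\<close> from the limit in the
  dimension, in contrast to the value of \<open>rbeta'\<close> there.\<close>

lemma beta_deriv_KN_eq:
  assumes N: "1 < N"
  shows "beta_deriv_KN d K N x y =
    (if maximal_diameter K N \<and> d x y = myers_diameter K (real_of_ereal N) then -\<infinity> else rbeta' K N (d x y))"
proof (cases "maximal_diameter K N")
  case True
  then obtain n where n: "N = ereal n" "K > 0" using N by (cases N) (auto simp: maximal_diameter_def)
  have le: "d x y \<le> myers_diameter K n" using maximal_diameter_dist_le[OF True, of x y] n by simp
  have lim: "((\<lambda>N'. rbeta' K N' (d x y)) \<longlongrightarrow> (if d x y < myers_diameter K n then rbeta' K (ereal n) (d x y) else -\<infinity>)) (at_right N)"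
    using rbeta'_tendsto_dimension[OF n(2) _ d_nonneg le] N n by simp
  have nb: "at_right N \<noteq> bot" using trivial_limit_at_right[OF N] n by simp
  have "\<forall>\<^sub>F N' in at_right N. N < N'" by (simp add: eventually_at_filter)
  then have ev: "\<forall>\<^sub>F N' in at_right N. rbeta' K N' (d x y) = beta_deriv_one d K N' x y"
    by eventually_elim (use N in \<open>simp add: beta_deriv_one_eq[OF metric]\<close>)
  have "Lim (at_right N) (\<lambda>N'. beta_deriv_one d K N' x y) = (if d x y < myers_diameter K n then rbeta' K (ereal n) (d x y) else -\<infinity>)"
    by (rule tendsto_Lim[OF nb Lim_transform_eventually[OF lim ev]])
  then show ?thesis using True le n by (simp add: beta_deriv_KN_def myers_limit_eq)
qed (simp add: beta_deriv_KN_def myers_limit_eq beta_deriv_one_eq[OF metric N])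

lemma measurable_beta_deriv_KN:
  assumes N: "1 < N"
  shows "(\<lambda>(x, y). beta_deriv_KN d K N x y) \<in> borel_measurable (fborel d \<Otimes>\<^sub>M fborel d)"
  unfolding beta_deriv_KN_eq[OF N] by measurable

end

text \<open>Below the critical distance this is the chain rule for \<open>m (r / f s)\<close> at
  \<open>s = 1\<close>. From the critical distance on, the distorted slope is constantly
  \<open>U'(0)\<close>, which is at most \<open>m(r)\<close>, so the quotient is nonpositive; this
  suffices unless \<open>B = -\<infinity>\<close> and the pressure is positive, and then the factor
  \<open>1/t\<close> drives the quotient to \<open>-\<infinity>\<close>.\<close>

lemma limsup_distortion_quotient:
  assumes U: "tame N U" and N: "1 < N" and r: "r > 0" and \<delta>: "0 \<le> \<delta>"
    and t: "\<And>n. 0 < t n \<and> t n < 1" "t \<longlonglongrightarrow> 0"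
    and B: "B = rbeta' K N \<delta> \<or> (B = -\<infinity> \<and> K > 0 \<and> N \<noteq> \<infinity> \<and> \<delta> = myers_diameter K (real_of_ereal N))"
  shows "limsup (\<lambda>n. ereal ((1 - t n) / t n * (tame_slope U r (rbeta K N (1 - t n) \<delta>) - mean_slope U r)))
    \<le> ereal (pressure U r / r) * B"
proof (cases "subcritical K N \<delta>")
  case True
  then have B': "B = rbeta' K N \<delta>" using B by (auto simp: subcritical_def)
  obtain f D where f: "\<And>s. 0 < s \<Longrightarrow> s \<le> 1 \<Longrightarrow> rbeta K N s \<delta> = ereal (f s) \<and> 0 < f s"
    "(f has_real_derivative D) (at 1)" "f 1 = 1" "rbeta' K N \<delta> = ereal D"
    using rbeta_smooth[OF N True] by blast
  let ?g = "\<lambda>s. mean_slope U (r / f s)"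
  have "((\<lambda>s. r / f s) has_real_derivative - (r * D)) (at 1)"
    using f(2,3) by (auto intro!: derivative_eq_intros)
  from DERIV_chain2[OF _ this, of "mean_slope U" "pressure U r / r\<^sup>2"]
  have "(?g has_real_derivative pressure U r / r\<^sup>2 * - (r * D)) (at 1)"
    using mean_slope_deriv[OF tameD(1)[OF U N] N r] f(3) by simp
  also have "pressure U r / r\<^sup>2 * - (r * D) = - (pressure U r / r * D)" using r by (simp add: power2_eq_square)
  finally have "((\<lambda>h. (?g (1 + h) - ?g 1) / h) \<longlongrightarrow> - (pressure U r / r * D)) (at 0)"
    by (simp add: DERIV_def)
  moreover have "filterlim (\<lambda>n. - t n) (at 0) sequentially"
    unfolding filterlim_at using t tendsto_minus[OF t(2)] by (auto simp: less_imp_neq[symmetric] intro!: always_eventually)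
  ultimately have "(\<lambda>n. (?g (1 + - t n) - ?g 1) / - t n) \<longlonglongrightarrow> - (pressure U r / r * D)"
    by (rule filterlim_compose)
  from tendsto_minus[OF this] have lim: "(\<lambda>n. (?g (1 - t n) - ?g 1) / t n) \<longlonglongrightarrow> pressure U r / r * D" by simp
  have "(\<lambda>n. (1 - t n) * ((?g (1 - t n) - ?g 1) / t n)) \<longlonglongrightarrow> (1 - 0) * (pressure U r / r * D)"
    by (intro tendsto_mult tendsto_diff tendsto_const t(2) lim)
  then have "(\<lambda>n. ereal ((1 - t n) * ((?g (1 - t n) - ?g 1) / t n))) \<longlonglongrightarrow> ereal (pressure U r / r) * B"
    by (simp add: B' f(4))
  moreover have "(1 - t n) * ((?g (1 - t n) - ?g 1) / t n) =
      (1 - t n) / t n * (tame_slope U r (rbeta K N (1 - t n) \<delta>) - mean_slope U r)" for n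
    using f(1)[of "1 - t n"] f(3) t(1)[of n] r by (simp add: tame_slope_def max_def)
  ultimately have "(\<lambda>n. ereal ((1 - t n) / t n * (tame_slope U r (rbeta K N (1 - t n) \<delta>) - mean_slope U r))) \<longlonglongrightarrow> ereal (pressure U r / r) * B"
    by (simp only:)
  then show ?thesis by (intro eq_refl lim_imp_Limsup) simp_all
next
  case False
  note inf = rbeta_infinite[OF \<delta> False]
  have p: "0 \<le> pressure U r" by (rule DC_pressure_nonneg[OF tameD(1)[OF U N] N r])
  let ?m = "deriv U 0 - mean_slope U r"
  have m: "?m \<le> 0" using mean_slope_ge[OF U N r] by simp
  have eq: "(1 - t n) / t n * (tame_slope U r (rbeta K N (1 - t n) \<delta>) - mean_slope U r) = (1 - t n) / t n * ?m" for n
    using inf by (simp add: tame_slope_def)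
  have le0: "(1 - t n) / t n * ?m \<le> 0" for n
    using m t(1)[of n] by (intro mult_nonneg_nonpos) auto
  have limsup0: "limsup (\<lambda>n. ereal ((1 - t n) / t n * ?m)) \<le> 0"
    by (rule Limsup_bounded) (use le0 in \<open>auto simp: zero_ereal_def\<close>)
  show ?thesis
  proof (cases "B = -\<infinity> \<and> pressure U r > 0")
    case False
    then have "0 \<le> ereal (pressure U r / r) * B" using B inf p r by (auto simp: not_less)
    with limsup0 show ?thesis unfolding eq by (rule order_trans)
  next
    case True
    \<comment> \<open>Positive pressure makes \<open>m\<close> strictly increasing at
      \<open>r\<close>; just below \<open>r\<close> it is smaller than \<open>m(r)\<close> and still
      at least \<open>U'(0)\<close>.\<close>
    have "?m < 0"
    proof -
      have "pressure U r / r\<^sup>2 > 0" using True r by simp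
      from DERIV_pos_inc_left[OF mean_slope_deriv[OF tameD(1)[OF U N] N r] this]
      obtain e where e: "e > 0" "\<And>h. h > 0 \<Longrightarrow> h < e \<Longrightarrow> mean_slope U (r - h) < mean_slope U r" by blast
      define h where "h = min (e / 2) (r / 2)"
      have "mean_slope U (r - h) < mean_slope U r" using e r by (intro e(2)) (auto simp: h_def)
      moreover have "deriv U 0 \<le> mean_slope U (r - h)"
        by (rule mean_slope_ge[OF U N]) (use r in \<open>auto simp: h_def min_def\<close>)
      ultimately show ?thesis by simp
    qed
    have "filterlim (\<lambda>n. (1 - t n) * - ?m / t n) at_top sequentially"
    proof (rule filterlim_divide_at_top[OF _ _ t(2)])
      show "(\<lambda>n. (1 - t n) * - ?m) \<longlonglongrightarrow> (1 - 0) * - ?m" by (intro tendsto_mult tendsto_diff tendsto_const t(2))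
      show "0 < (1 - 0) * - ?m" using \<open>?m < 0\<close> by simp
    qed (use t in auto)
    then have "(\<lambda>n. ereal ((1 - t n) * - ?m / t n)) \<longlonglongrightarrow> \<infinity>" by (simp add: tendsto_PInfty_eq_at_top)
    then have "(\<lambda>n. - ereal ((1 - t n) * - ?m / t n)) \<longlonglongrightarrow> - \<infinity>" by (rule tendsto_uminus_ereal)
    moreover have "- (a * - m / b) = a / b * m" for a b m :: real by simp
    then have "- ereal ((1 - t n) * - ?m / t n) = ereal ((1 - t n) / t n * ?m)" for n by (simp only: uminus_ereal.simps)
    ultimately have "(\<lambda>n. ereal ((1 - t n) / t n * ?m)) \<longlonglongrightarrow> - \<infinity>" by (simp only:)
    then have "limsup (\<lambda>n. ereal ((1 - t n) / t n * ?m)) = - \<infinity>" by (simp add: lim_imp_Limsup)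
    then show ?thesis unfolding eq by simp
  qed
qed

lemma rbeta0_pos:
  assumes N: "1 < N" and r: "0 \<le> r"
  shows "0 < rbeta0 K N r" "subcritical K N r \<Longrightarrow> rbeta0 K N r \<noteq> \<infinity>"
proof -
  show "subcritical K N r \<Longrightarrow> rbeta0 K N r \<noteq> \<infinity>" by (auto simp: rbeta0_def subcritical_def one_ereal_def)
  show "0 < rbeta0 K N r"
  proof (cases "N = \<infinity> \<or> K \<le> 0")
    case True
    then show ?thesis
    proof
      assume "N = \<infinity>" then show ?thesis by (simp add: rbeta0_def)
    next
      assume K: "K \<le> 0"
      show ?thesis
      proof (cases "N = \<infinity> \<or> r = 0 \<or> K = 0")
        case False
        then obtain n where n: "N = ereal n" "n > 1" using N by (cases N) auto
        have a: "ang K n r > 0" using ang_pos[of K n r] False K r n by auto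
        have "0 < (ang K n r / sinh (ang K n r)) powr (n - 1)" using a by simp
        then show ?thesis using False K n by (simp add: rbeta0_def)
      qed (use K in \<open>auto simp: rbeta0_def\<close>)
    qed
  next
    case False
    then have K: "K > 0" by simp
    have "1 \<le> rbeta0 K N r"
    proof (rule tendsto_lowerbound[OF rbeta_tendsto_rbeta0[OF N r]])
      have "\<forall>\<^sub>F t in at_right (0::real). t \<in> {0<..<1}" by (rule eventually_at_right_real) simp
      then show "\<forall>\<^sub>F t in at_right 0. 1 \<le> rbeta K N t r"
        by eventually_elim (use rbeta_ge_one[OF N K r] in auto)
    qed simp
    then show ?thesis by (simp add: less_le_trans[of 0 1])
  qed
qed

section \<open>The inequality for tame functions along a given plan\<close>

locale cd_transport = transport +
  fixes K :: real and N :: ereal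
  assumes N: "1 < N"
    and optimal: "optimal_plan d \<mu>0 \<mu>1 \<pi>"
    and cd: "\<And>U t. U \<in> DC N \<Longrightarrow> t \<in> {0..1} \<Longrightarrow> U_fun U \<nu> (interpolant d Q t) \<le>
      ereal (1 - t) * U_KN d K N U \<nu> (1 - t) \<pi> \<mu>0 + ereal t * U_KN_rev d K N U \<nu> t \<pi> \<mu>1"
begin

sublocale \<pi>: prob_space \<pi> by (rule \<pi>_prob)

text \<open>Formed with the coefficient at \<open>N\<close> itself, without the limit over larger
  dimensions; \<open>target_term_le\<close> compares it with the functional of the theorem.\<close>

definition target_term :: "(real \<Rightarrow> real) \<Rightarrow> ereal" where
  "target_term U = eintegral \<pi> (\<lambda>(x, y). slope_at U (\<rho>1 y) (rbeta0 K N (d x y)))"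

text \<open>The division by \<open>\<rho>0\<close> compensates for integration against the plan in
  place of its kernel over \<open>\<nu>\<close>.\<close>

definition curvature_term :: "(real \<Rightarrow> real) \<Rightarrow> ereal" where
  "curvature_term U = eintegral \<pi> (\<lambda>(x, y). ereal (pressure U (\<rho>0 x) / \<rho>0 x) * beta_deriv_KN d K N x y)"

definition slope_term :: "(real \<Rightarrow> real) \<Rightarrow> ennreal" where
  "slope_term U = (\<integral>\<^sup>+(x, y). ennreal (deriv (deriv U) (\<rho>0 x)) * descending_slope d \<rho>0 x * ennreal (d x y) \<partial>\<pi>)"

lemma swap_measurable: "(\<lambda>(x, y). (y, x)) \<in> measurable \<pi> (fborel d \<Otimes>\<^sub>M fborel d)"
  by measurable

lemma swap_plan_props: "prob_space (swap_plan d \<pi>)" "sets (swap_plan d \<pi>) = sets (fborel d \<Otimes>\<^sub>M fborel d)"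
  "distr (swap_plan d \<pi>) (fborel d) fst = \<mu>1"
proof -
  show "prob_space (swap_plan d \<pi>)" unfolding swap_plan_def by (rule \<pi>.prob_space_distr[OF swap_measurable])
  show "sets (swap_plan d \<pi>) = sets (fborel d \<Otimes>\<^sub>M fborel d)" by (simp add: swap_plan_def)
  have "distr (swap_plan d \<pi>) (fborel d) fst = distr \<pi> (fborel d) (fst \<circ> (\<lambda>(x, y). (y, x)))"
    unfolding swap_plan_def by (rule distr_distr[OF _ swap_measurable]) measurable
  also have "fst \<circ> (\<lambda>(x, y). (y, x)) = snd" by auto
  finally show "distr (swap_plan d \<pi>) (fborel d) fst = \<mu>1" using \<pi>_snd by simp
qed

lemma eintegral_swap:
  assumes "g \<in> borel_measurable (fborel d \<Otimes>\<^sub>M fborel d)"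
  shows "eintegral (swap_plan d \<pi>) g = eintegral \<pi> (\<lambda>(x, y). g (y, x))"
  unfolding swap_plan_def eintegral_distr[OF swap_measurable assms] by (simp add: case_prod_unfold)

lemma measurable_\<rho>1 [measurable]: "\<rho>1 \<in> borel_measurable (fborel d)"
  using \<rho>1(1) by (simp only: measurable_cong_sets[OF sets_\<nu> refl])

lemma AE_\<pi>_\<rho>1_pos: "AE (x, y) in \<pi>. 0 < \<rho>1 y"
proof -
  have 1: "AE x in \<mu>1. 0 < \<rho>1 x"
    by (subst \<rho>1(3), subst AE_density) (use \<rho>1(1) in \<open>auto simp: ennreal_less_zero_iff\<close>)
  have "AE z in \<pi>. 0 < \<rho>1 (snd z)"
    using 1 unfolding \<pi>_snd[symmetric] by (rule AE_distrD[rotated]) measurable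
  then show ?thesis by (simp add: case_prod_unfold)
qed

context
  fixes U :: "real \<Rightarrow> real"
  assumes U: "tame N U"
begin

lemmas DC_U = tameD(1)[OF U N]

lemma U_KN_tame:
  assumes t: "0 < t" "t < 1"
  shows "U_KN d K N U \<nu> t \<pi> \<mu>0 = eintegral \<pi> (\<lambda>(x, y). ereal (tame_slope U (\<rho>0 x) (rbeta K N t (d x y))))"
proof -
  have eq: "beta_coef d K N' t = (\<lambda>x y. rbeta K N' t (d x y))" for N'
    using t by (intro ext) (simp add: beta_coef_eq_rbeta[OF metric])
  have "U_KN d K N U \<nu> t \<pi> \<mu>0 = eintegral \<pi> (\<lambda>(x, y). slope_at U (ac_density \<nu> \<mu>0 x) (rbeta K N t (d x y)))"
    unfolding U_KN_def eq
    by (rule myers_limit_U_beta_tame[OF sigma_finite sets_\<nu> \<mu>0_prob sets_\<mu>0 \<mu>0_ac \<pi>_prob sets_\<pi> \<pi>_fst U N measurable_dist _ _ t])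
       (auto intro: maximal_diameter_dist_le)
  also have "\<dots> = eintegral \<pi> (\<lambda>(x, y). ereal (tame_slope U (\<rho>0 x) (rbeta K N t (d x y))))"
    by (rule eintegral_cong_AE) (use AE_\<pi>_ac in \<open>auto simp: slope_at_tame[OF U N]\<close>)
  finally show ?thesis .
qed

lemma U_KN_rev_tame:
  assumes t: "0 < t" "t < 1"
  shows "U_KN_rev d K N U \<nu> t \<pi> \<mu>1 = eintegral \<pi> (\<lambda>(x, y). slope_at U (\<rho>1 y) (rbeta K N t (d x y)))"
proof -
  have eq: "(\<lambda>x y. beta_coef d K N' t y x) = (\<lambda>x y. rbeta K N' t (d y x))" for N'
    using t by (intro ext) (simp add: beta_coef_eq_rbeta[OF metric])
  have m: "(\<lambda>(x, y). d y x) \<in> borel_measurable (fborel d \<Otimes>\<^sub>M fborel d)" by measurable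
  have "U_KN_rev d K N U \<nu> t \<pi> \<mu>1 = eintegral (swap_plan d \<pi>) (\<lambda>(x, y). slope_at U (\<rho>1 x) (rbeta K N t (d y x)))"
    unfolding U_KN_rev_def eq
    by (rule myers_limit_U_beta_tame[OF sigma_finite sets_\<nu> \<mu>1_prob sets_\<mu>1 \<mu>1_ac swap_plan_props U N m _ _ t])
       (auto intro: maximal_diameter_dist_le)
  also have "\<dots> = eintegral \<pi> (\<lambda>(x, y). slope_at U (\<rho>1 y) (rbeta K N t (d x y)))"
  proof (subst eintegral_swap)
    have "(\<lambda>z. slope_at U (\<rho>1 (fst z)) (rbeta K N t (d (snd z) (fst z)))) \<in> borel_measurable (fborel d \<Otimes>\<^sub>M fborel d)"
      by (intro measurable_slope_at[OF DC_U]) measurable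
    then show "(\<lambda>(x, y). slope_at U (\<rho>1 x) (rbeta K N t (d y x))) \<in> borel_measurable (fborel d \<Otimes>\<^sub>M fborel d)"
      by (simp add: case_prod_unfold)
  qed simp
  finally show ?thesis .
qed

text \<open>What remains of the source term after \<open>(1 - t) m(\<rho>0)\<close> has been
  subtracted and the inequality divided by \<open>t\<close>; the coefficient \<open>1\<close>
  produces \<open>m(\<rho>0)\<close>.\<close>

definition quotient :: "real \<Rightarrow> 'a \<times> 'a \<Rightarrow> real" where
  "quotient t z = (1 - t) / t * (tame_slope U (\<rho>0 (fst z)) (rbeta K N (1 - t) (d (fst z) (snd z))) - tame_slope U (\<rho>0 (fst z)) 1)"

lemma measurable_source_slope [measurable]:
  "(\<lambda>z. tame_slope U (\<rho>0 (fst z)) (rbeta K N t (d (fst z) (snd z)))) \<in> borel_measurable (fborel d \<Otimes>\<^sub>M fborel d)"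
  "(\<lambda>z. tame_slope U (\<rho>0 (fst z)) 1) \<in> borel_measurable (fborel d \<Otimes>\<^sub>M fborel d)"
  by (intro measurable_tame_slope[OF U N]; measurable)+

text \<open>The coefficient at time \<open>1 - t\<close> is at least \<open>exp (- E t)\<close>,
  with \<open>E = 0\<close> for positive curvature, where it is at least \<open>1\<close>. The
  logarithmic Lipschitz bound then gives the excess \<open>C * E * t\<close>.\<close>

lemma source_slope_bound:
  obtains C where "C \<ge> 0" "\<And>t. 0 < t \<Longrightarrow> t < 1 \<Longrightarrow>
    AE z in \<pi>. tame_slope U (\<rho>0 (fst z)) (rbeta K N (1 - t) (d (fst z) (snd z))) \<le> tame_slope U (\<rho>0 (fst z)) 1 + C * t"
proof -
  obtain C where C: "C \<ge> 0" "\<And>r. r > 0 \<Longrightarrow> pressure U r \<le> C * r" using tame_pressure_linear[OF U N] by blast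
  obtain E where E: "E \<ge> 0" "\<And>r t. 0 \<le> r \<Longrightarrow> r \<le> radius \<Longrightarrow> 0 < t \<Longrightarrow> t \<le> 1 \<Longrightarrow> exp (- (E * (1 - t))) \<le> rbeta K N t r"
  proof (cases "K > 0")
    case True
    show ?thesis
      by (rule that[of 0]) (use rbeta_ge_one[OF N True] in \<open>auto simp: one_ereal_def\<close>)
  next
    case False
    then show ?thesis using rbeta_ln_lower[OF N, of K radius] that by auto
  qed
  show ?thesis
  proof
    show "C * E \<ge> 0" using C E by simp
    fix t :: real assume t: "0 < t" "t < 1"
    have "AE z in \<pi>. d (fst z) (snd z) < radius" "AE z in \<pi>. 0 < \<rho>0 (fst z)"
      using AE_\<pi>_dist AE_\<pi>_\<rho>0_pos by (auto simp: case_prod_unfold elim!: eventually_mono)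
    then show "AE z in \<pi>. tame_slope U (\<rho>0 (fst z)) (rbeta K N (1 - t) (d (fst z) (snd z))) \<le> tame_slope U (\<rho>0 (fst z)) 1 + C * E * t"
    proof eventually_elim
      case (elim z)
      have "ereal (exp (- (E * t))) * 1 \<le> rbeta K N (1 - t) (d (fst z) (snd z))"
        using E(2)[of "d (fst z) (snd z)" "1 - t"] elim t by simp
      from tame_slope_exp_bound[OF U N C(2) elim(2) _ _ this] show ?case using E t by (simp add: mult.assoc)
    qed
  qed
qed

lemma AE_source_slope_abs:
  obtains B where "\<And>t. 0 < t \<Longrightarrow> t < 1 \<Longrightarrow> AE z in \<pi>. \<bar>tame_slope U (\<rho>0 (fst z)) (rbeta K N (1 - t) (d (fst z) (snd z)))\<bar> \<le> B"
    "AE z in \<pi>. \<bar>tame_slope U (\<rho>0 (fst z)) 1\<bar> \<le> B"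
proof -
  obtain C where C: "C \<ge> 0" "\<And>t. 0 < t \<Longrightarrow> t < 1 \<Longrightarrow>
    AE z in \<pi>. tame_slope U (\<rho>0 (fst z)) (rbeta K N (1 - t) (d (fst z) (snd z))) \<le> tame_slope U (\<rho>0 (fst z)) 1 + C * t"
    using source_slope_bound by blast
  define B where "B = max \<bar>deriv U 0\<bar> (\<bar>mean_slope U height\<bar> + C)"
  have pos: "AE z in \<pi>. 0 < \<rho>0 (fst z) \<and> \<rho>0 (fst z) \<le> height"
    using AE_\<pi>_\<rho>0_pos by (simp add: case_prod_unfold)
  have one: "tame_slope U r 1 \<le> \<bar>mean_slope U height\<bar>" if "0 < r" "r \<le> height" for r
    using mean_slope_mono[OF DC_U N that] tame_slope_one[OF U N that(1)] by linarith
  show ?thesis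
  proof
    fix t :: real assume t: "0 < t" "t < 1"
    show "AE z in \<pi>. \<bar>tame_slope U (\<rho>0 (fst z)) (rbeta K N (1 - t) (d (fst z) (snd z)))\<bar> \<le> B"
      using pos C(2)[OF t]
    proof eventually_elim
      case (elim z)
      have "deriv U 0 \<le> tame_slope U (\<rho>0 (fst z)) (rbeta K N (1 - t) (d (fst z) (snd z)))"
        using elim t by (intro tame_slope_ge[OF U N] rbeta_pos[OF N]) auto
      moreover have "C * t \<le> C" using C t by (simp add: mult_left_le)
      ultimately show ?case using one[of "\<rho>0 (fst z)"] elim unfolding B_def by linarith
    qed
  next
    show "AE z in \<pi>. \<bar>tame_slope U (\<rho>0 (fst z)) 1\<bar> \<le> B"
      using pos
    proof eventually_elim
      case (elim z)
      have "deriv U 0 \<le> tame_slope U (\<rho>0 (fst z)) 1" using elim by (intro tame_slope_ge[OF U N]) auto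
      then show ?case using one[of "\<rho>0 (fst z)"] elim C(1) unfolding B_def by linarith
    qed
  qed
qed

lemma integrable_source_slope:
  "0 < t \<Longrightarrow> t < 1 \<Longrightarrow> integrable \<pi> (\<lambda>z. tame_slope U (\<rho>0 (fst z)) (rbeta K N (1 - t) (d (fst z) (snd z))))"
  "integrable \<pi> (\<lambda>z. tame_slope U (\<rho>0 (fst z)) 1)"
proof -
  obtain B where B: "\<And>t. 0 < t \<Longrightarrow> t < 1 \<Longrightarrow> AE z in \<pi>. \<bar>tame_slope U (\<rho>0 (fst z)) (rbeta K N (1 - t) (d (fst z) (snd z)))\<bar> \<le> B"
    "AE z in \<pi>. \<bar>tame_slope U (\<rho>0 (fst z)) 1\<bar> \<le> B"
    using AE_source_slope_abs by blast
  show "0 < t \<Longrightarrow> t < 1 \<Longrightarrow> integrable \<pi> (\<lambda>z. tame_slope U (\<rho>0 (fst z)) (rbeta K N (1 - t) (d (fst z) (snd z))))"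
    by (rule \<pi>.bounded_integrable[OF _ B(1)]) measurable
  show "integrable \<pi> (\<lambda>z. tame_slope U (\<rho>0 (fst z)) 1)"
    by (rule \<pi>.bounded_integrable[OF _ B(2)]) measurable
qed

lemma U_fun_\<mu>0_eq_integral: "U_fun U \<nu> \<mu>0 = ereal (\<integral>z. tame_slope U (\<rho>0 (fst z)) 1 \<partial>\<pi>)"
proof -
  let ?f = "\<lambda>x. tame_slope U (\<rho>0 x) 1"
  have f [measurable]: "?f \<in> borel_measurable (fborel d)"
    by (intro measurable_tame_slope[OF U N]) measurable
  have fst [measurable]: "fst \<in> measurable \<pi> (fborel d)" by measurable
  have eq: "U (\<rho>0 x) = \<rho>0 x * ?f x" for x
    using \<rho>0_nonneg[of x] DC_zero[OF DC_U N] tame_slope_one[OF U N, of "\<rho>0 x"]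
    by (cases "\<rho>0 x = 0") (auto simp: mean_slope_def)
  have "integrable \<mu>0 ?f"
    unfolding \<pi>_fst[symmetric] integrable_distr_eq[OF fst f] by (rule integrable_source_slope(2))
  then have i: "integrable \<nu> (\<lambda>x. \<rho>0 x * ?f x)"
    unfolding \<rho>0_density by (subst (asm) integrable_density) (auto simp: \<rho>0_nonneg)
  have "U_fun U \<nu> \<mu>0 = ereal (\<integral>x. \<rho>0 x * ?f x \<partial>\<nu>)"
    unfolding U_fun_\<mu>0 eq by (rule eintegral_integrable[OF i])
  also have "(\<integral>x. \<rho>0 x * ?f x \<partial>\<nu>) = (\<integral>x. ?f x \<partial>\<mu>0)"
    unfolding \<rho>0_density by (subst integral_density) (auto simp: \<rho>0_nonneg)
  also have "\<dots> = (\<integral>z. ?f (fst z) \<partial>\<pi>)"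
    unfolding \<pi>_fst[symmetric] by (rule integral_distr[OF fst f])
  finally show ?thesis .
qed

text \<open>With \<open>a\<close> the value at \<open>\<mu>0\<close>, the bound along the
  interpolation and the curvature-dimension inequality give
  \<open>a \<le> (1 - t) \<alpha> + t B + t D\<close>. Subtracting \<open>(1 - t) a\<close> and
  dividing by \<open>t\<close> leaves the source quotient. The numbers \<open>a\<close>,
  \<open>\<alpha>\<close>, \<open>D\<close> are finite, while the target term \<open>B\<close> may
  be infinite.\<close>

lemma finite_time_inequality:
  assumes t: "0 < t" "t < 1"
  shows "U_fun U \<nu> \<mu>0 \<le> eintegral \<pi> (\<lambda>(x, y). slope_at U (\<rho>1 y) (rbeta K N t (d x y))) +
    eintegral \<pi> (\<lambda>z. ereal (quotient t z)) + eintegral Q (\<lambda>\<gamma>. ereal (descent U t \<gamma>))"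
proof -
  let ?B = "eintegral \<pi> (\<lambda>(x, y). slope_at U (\<rho>1 y) (rbeta K N t (d x y)))"
  let ?s = "\<lambda>z. tame_slope U (\<rho>0 (fst z)) (rbeta K N (1 - t) (d (fst z) (snd z)))"
  define \<alpha> where "\<alpha> = (\<integral>z. ?s z \<partial>\<pi>)"
  define a where "a = (\<integral>z. tame_slope U (\<rho>0 (fst z)) 1 \<partial>\<pi>)"
  note i = integrable_source_slope(1)[OF t] integrable_source_slope(2)
  have Ut: "U_fun U \<nu> \<mu>0 \<le> U_fun U \<nu> (interpolant d Q t) + ereal t * eintegral Q (\<lambda>\<gamma>. ereal (descent U t \<gamma>))"
    using U_fun_interpolant_lower(1)[OF U N, of t] t by simp
  obtain D where D: "eintegral Q (\<lambda>\<gamma>. ereal (descent U t \<gamma>)) = ereal D"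
    using U_fun_interpolant_lower(2)[OF U N, of t] t by auto
  have A: "U_KN d K N U \<nu> (1 - t) \<pi> \<mu>0 = ereal \<alpha>"
    using U_KN_tame[of "1 - t"] t eintegral_integrable[OF i(1)] by (simp add: case_prod_unfold \<alpha>_def)
  have q: "eintegral \<pi> (\<lambda>z. ereal (quotient t z)) = ereal ((1 - t) / t * (\<alpha> - a))"
  proof -
    have "eintegral \<pi> (\<lambda>z. ereal (quotient t z)) = ereal (\<integral>z. quotient t z \<partial>\<pi>)"
      unfolding quotient_def using i by (intro eintegral_integrable) simp
    also have "(\<integral>z. quotient t z \<partial>\<pi>) = (1 - t) / t * (\<alpha> - a)"
      unfolding quotient_def \<alpha>_def a_def using i by simp
    finally show ?thesis .
  qed
  have "ereal a \<le> ereal (1 - t) * ereal \<alpha> + ereal t * ?B + ereal t * ereal D"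
  proof -
    have "ereal a \<le> U_fun U \<nu> (interpolant d Q t) + ereal t * ereal D"
      using Ut unfolding D U_fun_\<mu>0_eq_integral a_def .
    also have "\<dots> \<le> (ereal (1 - t) * ereal \<alpha> + ereal t * ?B) + ereal t * ereal D"
      using cd[OF DC_U, of t] t unfolding A U_KN_rev_tame[OF t] by (intro add_right_mono) auto
    finally show ?thesis .
  qed
  \<comment> \<open>A variable \<open>b\<close> for the target term allows the division by cases:
    real, \<open>\<infinity>\<close> (trivial), \<open>-\<infinity>\<close> (contradicts the
    premise).\<close>
  moreover have "ereal a \<le> ?B + ereal ((1 - t) / t * (\<alpha> - a)) + ereal D"
    if "ereal a \<le> ereal (1 - t) * ereal \<alpha> + ereal t * b + ereal t * ereal D" "b = ?B" for b
  proof (cases b)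
    case (real b')
    have "a \<le> (1 - t) * \<alpha> + t * b' + t * D" using that(1) real by simp
    moreover have "t * (b' + (1 - t) / t * (\<alpha> - a) + D) = t * b' + (1 - t) * (\<alpha> - a) + t * D"
      using t by (simp add: distrib_left)
    ultimately have "t * a \<le> t * (b' + (1 - t) / t * (\<alpha> - a) + D)" by (simp add: algebra_simps)
    then have "a \<le> b' + (1 - t) / t * (\<alpha> - a) + D" using t by simp
    then show ?thesis using real that(2)[symmetric] by simp
  next
    case PInf
    then show ?thesis using that(2)[symmetric] by simp
  next
    case MInf
    then show ?thesis using that t by simp
  qed
  ultimately show ?thesis unfolding U_fun_\<mu>0_eq_integral a_def[symmetric] q D by blast
qed

lemma limsup_quotient:
  assumes t: "\<And>n. 0 < t n \<and> t n < 1" "t \<longlonglongrightarrow> 0"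
  shows "limsup (\<lambda>n. eintegral \<pi> (\<lambda>z. ereal (quotient (t n) z))) \<le> curvature_term U"
proof -
  obtain C where C: "C \<ge> 0" "\<And>t. 0 < t \<Longrightarrow> t < 1 \<Longrightarrow>
    AE z in \<pi>. tame_slope U (\<rho>0 (fst z)) (rbeta K N (1 - t) (d (fst z) (snd z))) \<le> tame_slope U (\<rho>0 (fst z)) 1 + C * t"
    using source_slope_bound by blast
  have pos: "AE z in \<pi>. 0 < \<rho>0 (fst z)"
    using AE_\<pi>_\<rho>0_pos by (auto simp: case_prod_unfold elim!: eventually_mono)
  show ?thesis
    unfolding curvature_term_def
  proof (rule limsup_eintegral_le[where w = "\<lambda>_. ennreal C"])
    show "(\<lambda>z. ereal (quotient (t n) z)) \<in> borel_measurable \<pi>" for n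
      unfolding quotient_def by measurable
    show "AE z in \<pi>. e2ennreal (ereal (quotient (t n) z)) \<le> ennreal C" for n
      using C(2)[of "t n"] t(1)[of n]
    proof (simp, elim eventually_mono)
      fix z assume "tame_slope U (\<rho>0 (fst z)) (rbeta K N (1 - t n) (d (fst z) (snd z))) \<le> tame_slope U (\<rho>0 (fst z)) 1 + C * t n"
      \<comment> \<open>The excess \<open>C * t n\<close> absorbs the factor \<open>1 / t n\<close>,
        which leaves a majorant independent of \<open>n\<close>.\<close>
      then have "quotient (t n) z \<le> (1 - t n) / t n * (C * t n)"
        unfolding quotient_def using t(1)[of n] by (intro mult_left_mono) auto
      also have "\<dots> = (1 - t n) * C" using t(1)[of n] by simp
      also have "\<dots> \<le> C" using t(1)[of n] C(1) by (simp add: mult_left_le_one_le)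
      finally show "ennreal (quotient (t n) z) \<le> ennreal C" by (rule ennreal_leI)
    qed
    show "AE z in \<pi>. limsup (\<lambda>n. ereal (quotient (t n) z)) \<le> (case z of (x, y) \<Rightarrow> ereal (pressure U (\<rho>0 x) / \<rho>0 x) * beta_deriv_KN d K N x y)"
      using pos
    proof eventually_elim
      case (elim z)
      show ?case
        unfolding quotient_def tame_slope_one[OF U N elim] case_prod_unfold
        by (rule limsup_distortion_quotient[OF U N elim d_nonneg t])
           (auto simp: beta_deriv_KN_eq[OF N] maximal_diameter_def)
    qed
  qed (auto simp: \<pi>.emeasure_space_1 ennreal_mult_less_top less_top[symmetric])
qed

text \<open>Three sources of domination: for \<open>K \<le> 0\<close> the limit coefficient is the
  smallest and gives the largest slope; for \<open>K > 0\<close> and \<open>N = \<infinity>\<close>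
  the coefficient is at least a fixed multiple of the limit one, which costs a constant; for
  \<open>K > 0\<close> and finite \<open>N\<close> tame slopes are bounded.\<close>

lemma limsup_target:
  assumes t: "\<And>n. 0 < t n \<and> t n < 1" "t \<longlonglongrightarrow> 0"
  shows "limsup (\<lambda>n. eintegral \<pi> (\<lambda>(x, y). slope_at U (\<rho>1 y) (rbeta K N (t n) (d x y)))) \<le> target_term U"
proof -
  let ?f = "\<lambda>b z. slope_at U (\<rho>1 (snd z)) (b (d (fst z) (snd z)))"
  have meas: "(\<lambda>z. slope_at U (\<rho>1 (snd z)) (rbeta K N s (d (fst z) (snd z)))) \<in> borel_measurable \<pi>"
    "(\<lambda>z. slope_at U (\<rho>1 (snd z)) (rbeta0 K N (d (fst z) (snd z)))) \<in> borel_measurable \<pi>" for s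
    by (intro measurable_slope_at[OF DC_U]; measurable)+
  have pos: "AE z in \<pi>. 0 < \<rho>1 (snd z)" using AE_\<pi>_\<rho>1_pos by (simp add: case_prod_unfold)
  have dist: "AE z in \<pi>. d (fst z) (snd z) < radius" using AE_\<pi>_dist by (simp add: case_prod_unfold)
  have target: "target_term U = eintegral \<pi> (?f (rbeta0 K N))" by (simp add: target_term_def case_prod_unfold)
  obtain C where C: "C \<ge> 0" "\<And>s. 0 < s \<Longrightarrow> s < 1 \<Longrightarrow>
      AE z in \<pi>. tame_slope U (\<rho>1 (snd z)) (rbeta K N s (d (fst z) (snd z))) \<le> max 0 (tame_slope U (\<rho>1 (snd z)) (rbeta0 K N (d (fst z) (snd z)))) + C"
  proof (cases "K \<le> 0")
    case True
    show ?thesis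
    proof (rule that[of 0])
      fix s :: real assume s: "0 < s" "s < 1"
      show "AE z in \<pi>. tame_slope U (\<rho>1 (snd z)) (rbeta K N s (d (fst z) (snd z))) \<le> max 0 (tame_slope U (\<rho>1 (snd z)) (rbeta0 K N (d (fst z) (snd z)))) + 0"
        using pos
      proof eventually_elim
        case (elim z)
        have "tame_slope U (\<rho>1 (snd z)) (rbeta K N s (d (fst z) (snd z))) \<le> tame_slope U (\<rho>1 (snd z)) (rbeta0 K N (d (fst z) (snd z)))"
          using s by (intro tame_slope_antimono[OF U N elim] rbeta0_pos[OF N] rbeta0_le_rbeta[OF N True]) auto
        then show ?case by simp
      qed
    qed simp
  next
    case False
    show ?thesis
    proof (cases "N = \<infinity>")
      case True
      obtain C where C: "C \<ge> 0" "\<And>r. r > 0 \<Longrightarrow> pressure U r \<le> C * r" using tame_pressure_linear[OF U N] by blast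
      let ?c = "K / 6 * radius\<^sup>2"
      have c: "0 \<le> ?c" using False by simp
      show ?thesis
      proof (rule that[of "C * ?c"])
        show "0 \<le> C * ?c" using C c by simp
        fix s :: real assume s: "0 < s" "s < 1"
        show "AE z in \<pi>. tame_slope U (\<rho>1 (snd z)) (rbeta K N s (d (fst z) (snd z))) \<le> max 0 (tame_slope U (\<rho>1 (snd z)) (rbeta0 K N (d (fst z) (snd z)))) + C * ?c"
          using pos dist
        proof eventually_elim
          case (elim z)
          let ?r = "d (fst z) (snd z)"
          have "K / 6 * s\<^sup>2 * ?r\<^sup>2 \<le> K / 6 * 1 * radius\<^sup>2"
            using False s elim(2) by (intro mult_mono power_mono) (auto simp: power_le_one)
          then have "- ?c + K / 6 * ?r\<^sup>2 \<le> K / 6 * (1 - s\<^sup>2) * ?r\<^sup>2" by (simp add: algebra_simps)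
          then have "exp (- ?c) * exp (K / 6 * ?r\<^sup>2) \<le> exp (K / 6 * (1 - s\<^sup>2) * ?r\<^sup>2)" by (simp flip: exp_add)
          then have "ereal (exp (- ?c)) * rbeta0 K N ?r \<le> rbeta K N s ?r" using True by (simp add: rbeta0_def rbeta_def)
          from tame_slope_exp_bound[OF U N C(2) elim(1) rbeta0_pos(1)[OF N d_nonneg] c this]
          show ?case by simp
        qed
      qed
    next
      case False
      obtain C where C: "\<And>r b. r > 0 \<Longrightarrow> b > 0 \<Longrightarrow> \<bar>tame_slope U r b\<bar> \<le> C"
        using tame_slope_bounded[OF U N False] by auto
      show ?thesis
      proof (rule that[of "\<bar>C\<bar>"])
        fix s :: real assume s: "0 < s" "s < 1"
        show "AE z in \<pi>. tame_slope U (\<rho>1 (snd z)) (rbeta K N s (d (fst z) (snd z))) \<le> max 0 (tame_slope U (\<rho>1 (snd z)) (rbeta0 K N (d (fst z) (snd z)))) + \<bar>C\<bar>"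
          using pos
        proof eventually_elim
          case (elim z)
          have "0 < rbeta K N s (d (fst z) (snd z))" using rbeta_pos[OF N d_nonneg s(1)] s(2) by simp
          from C[OF elim this] show ?case by linarith
        qed
      qed simp
    qed
  qed
  show ?thesis
  \<comment> \<open>An infinite integral of the positive part makes \<open>target_term U\<close>
    equal to \<open>\<infinity>\<close> by the convention on \<open>eintegral\<close>; otherwise
    that positive part plus \<open>C\<close> is an integrable majorant.\<close>
  proof (cases "(\<integral>\<^sup>+z. e2ennreal (?f (rbeta0 K N) z) \<partial>\<pi>) = \<infinity>")
    case True
    then have "target_term U = \<infinity>" unfolding target eintegral_def by (simp add: top_ennreal.rep_eq top_ereal_def)
    then show ?thesis by simp
  next
    case False
    show ?thesis
      unfolding target_term_def case_prod_unfold
    proof (rule limsup_eintegral_le[where w = "\<lambda>z. e2ennreal (?f (rbeta0 K N) z) + ennreal C"])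
      show "(\<integral>\<^sup>+z. e2ennreal (?f (rbeta0 K N) z) + ennreal C \<partial>\<pi>) < \<infinity>"
        using False meas(2) by (subst nn_integral_add) (auto simp: \<pi>.emeasure_space_1 less_top)
      show "AE z in \<pi>. e2ennreal (?f (rbeta K N (t n)) z) \<le> e2ennreal (?f (rbeta0 K N) z) + ennreal C" for n
        using C(2)[OF t(1)[of n, THEN conjunct1] t(1)[of n, THEN conjunct2]]
      proof eventually_elim
        case (elim z)
        have "ennreal (tame_slope U (\<rho>1 (snd z)) (rbeta K N (t n) (d (fst z) (snd z))))
          \<le> ennreal (max 0 (tame_slope U (\<rho>1 (snd z)) (rbeta0 K N (d (fst z) (snd z)))) + C)"
          using elim by (rule ennreal_leI)
        then show ?case using C(1) by (simp add: slope_at_tame[OF U N] max_def ennreal_neg split: if_splits)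
      qed
      show "AE z in \<pi>. limsup (\<lambda>n. ?f (rbeta K N (t n)) z) \<le> ?f (rbeta0 K N) z"
        using pos
      proof eventually_elim
        case (elim z)
        let ?r = "d (fst z) (snd z)"
        have "filterlim t (at_right 0) sequentially"
          unfolding filterlim_at using t by (auto intro!: always_eventually simp: less_imp_neq[symmetric])
        then have "(\<lambda>n. rbeta K N (t n) ?r) \<longlonglongrightarrow> rbeta0 K N ?r"
          by (rule filterlim_compose[OF rbeta_tendsto_rbeta0[OF N d_nonneg]])
        then have "(\<lambda>n. tame_slope U (\<rho>1 (snd z)) (rbeta K N (t n) ?r)) \<longlonglongrightarrow> tame_slope U (\<rho>1 (snd z)) (rbeta0 K N ?r)"
        proof (rule tame_slope_tendsto[OF U N _ rbeta0_pos(1)[OF N d_nonneg] elim])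
          assume "rbeta0 K N ?r = \<infinity>"
          then have "\<not> subcritical K N ?r" using rbeta0_pos(2)[OF N d_nonneg] by blast
          then show "\<forall>n. rbeta K N (t n) ?r = \<infinity>" using rbeta_infinite[OF d_nonneg] by blast
        qed
        then show ?case unfolding slope_at_tame[OF U N] by (intro eq_refl lim_imp_Limsup) simp_all
      qed
    qed (use meas in measurable)
  qed
qed

theorem tame_hwi: "U_fun U \<nu> \<mu>0 \<le> target_term U + curvature_term U + enn2ereal (slope_term U)"
proof -
  \<comment> \<open>The shift by \<open>2\<close> keeps both \<open>t n\<close> and
    \<open>1 - t n\<close> strictly between \<open>0\<close> and \<open>1\<close>.\<close>
  define t where "t n = 1 / (real n + 2)" for n
  have t: "0 < t n \<and> t n < 1" for n by (simp add: t_def)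
  have t0: "t \<longlonglongrightarrow> 0"
  proof -
    have "(\<lambda>n. inverse (real (Suc (Suc n)))) \<longlonglongrightarrow> 0"
      using LIMSEQ_inverse_real_of_nat by (rule LIMSEQ_Suc)
    then show ?thesis by (simp add: t_def[abs_def] inverse_eq_divide add.commute)
  qed
  let ?F = "\<lambda>n. eintegral \<pi> (\<lambda>(x, y). slope_at U (\<rho>1 y) (rbeta K N (t n) (d x y)))"
  let ?G = "\<lambda>n. eintegral \<pi> (\<lambda>z. ereal (quotient (t n) z))"
  let ?H = "\<lambda>n. eintegral Q (\<lambda>\<gamma>. ereal (descent U (t n) \<gamma>))"
  have H: "limsup ?H \<le> enn2ereal (slope_term U)"
    using limsup_integral_descent[OF U N, of t] t t0 by (simp add: slope_term_def descent_limit_def[OF U N] less_imp_le)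
  have "U_fun U \<nu> \<mu>0 = limsup (\<lambda>n::nat. U_fun U \<nu> \<mu>0)" by (simp add: Limsup_const)
  also have "\<dots> \<le> limsup (\<lambda>n. ?F n + ?G n + ?H n)"
    using finite_time_inequality t by (intro Limsup_mono always_eventually) auto
  also have "\<dots> \<le> limsup (\<lambda>n. ?F n + ?G n) + limsup ?H" by (rule ereal_limsup_add_mono)
  also have "\<dots> \<le> (limsup ?F + limsup ?G) + limsup ?H" by (intro add_right_mono ereal_limsup_add_mono)
  also have "\<dots> \<le> target_term U + curvature_term U + enn2ereal (slope_term U)"
    by (intro add_mono limsup_target limsup_quotient t t0 H)
  finally show ?thesis .
qed

end

end

section \<open>The inequality for general functionals\<close>

text \<open>\<open>DC N\<close> controls the derivatives on the open half-line only, so the value at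
  \<open>0\<close> is split off: it is \<open>0\<close> for the pressure and some constant for
  \<open>U''\<close>.\<close>

lemma measurable_DC_compose:
  assumes U: "U \<in> DC N" and N: "1 < N" and [measurable]: "f \<in> borel_measurable M" and f: "\<And>x. 0 \<le> f x"
  shows "(\<lambda>x. U (f x)) \<in> borel_measurable M" "(\<lambda>x. pressure U (f x)) \<in> borel_measurable M"
    "(\<lambda>x. deriv (deriv U) (f x)) \<in> borel_measurable M"
proof -
  have "(\<lambda>x. U (max 0 (f x))) \<in> borel_measurable M" by (rule measurable_compose[OF assms(3) measurable_DC(1)[OF U]])
  then show "(\<lambda>x. U (f x)) \<in> borel_measurable M" using f by (simp add: max_def)
  have "continuous_on {0<..} (pressure U)"
    by (rule continuous_at_imp_continuous_on) (use DC_pressure_deriv[OF U N] DERIV_isCont in blast)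
  then have m1: "(\<lambda>r. indicator {0<..} r *\<^sub>R pressure U r) \<in> borel_measurable borel"
    by (intro borel_measurable_continuous_on_indicator) auto
  have m2: "(\<lambda>r. indicator {0<..} r *\<^sub>R deriv (deriv U) r) \<in> borel_measurable borel"
    using DC_continuous_deriv2[OF U N] by (intro borel_measurable_continuous_on_indicator) auto
  have p0: "pressure U 0 = 0" using DC_zero[OF U N] by (simp add: pressure_def)
  have "(\<lambda>x. pressure U (f x)) = (\<lambda>x. indicator {0<..} (f x) *\<^sub>R pressure U (f x))"
  proof
    fix x
    show "pressure U (f x) = indicator {0<..} (f x) *\<^sub>R pressure U (f x)"
      using f[of x] p0 by (cases "f x = 0") (auto simp: less_le)
  qed
  then show "(\<lambda>x. pressure U (f x)) \<in> borel_measurable M"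
    using measurable_compose[OF assms(3) m1] by (simp only:)
  have "(\<lambda>x. deriv (deriv U) (f x)) = (\<lambda>x. if f x = 0 then deriv (deriv U) 0 else indicator {0<..} (f x) *\<^sub>R deriv (deriv U) (f x))"
    using f by (auto simp: fun_eq_iff less_le)
  moreover have "(\<lambda>x. if f x = 0 then deriv (deriv U) 0 else indicator {0<..} (f x) *\<^sub>R deriv (deriv U) (f x)) \<in> borel_measurable M"
    using measurable_compose[OF assms(3) m2] by measurable
  ultimately show "(\<lambda>x. deriv (deriv U) (f x)) \<in> borel_measurable M" by (simp only:)
qed

text \<open>\<open>B\<close> may be infinite. The bound \<open>a n \<le> a0\<close> settles
  \<open>a0 = 0\<close>, where every product is \<open>0\<close>; for
  \<open>B = -\<infinity>\<close> and \<open>a0 > 0\<close> the factors are eventually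
  positive.\<close>

lemma limsup_ereal_mult:
  assumes a: "a \<longlonglongrightarrow> a0" and nn: "\<And>n. 0 \<le> a n" "\<And>n. a n \<le> a0"
  shows "limsup (\<lambda>n. ereal (a n) * B) \<le> ereal a0 * B"
proof (cases B)
  case (real b)
  have "(\<lambda>n. ereal (a n * b)) \<longlonglongrightarrow> ereal (a0 * b)" using tendsto_mult_right[OF a, of b] by simp
  then have "limsup (\<lambda>n. ereal (a n * b)) = ereal (a0 * b)" by (intro lim_imp_Limsup) simp_all
  then show ?thesis using real by simp
next
  case PInf
  show ?thesis
  proof (cases "a0 = 0")
    case True
    then have "a n = 0" for n using nn[of n] by simp
    then show ?thesis using True by (simp add: Limsup_const)
  next
    case False
    then have "a0 > 0" using nn[of 0] by linarith
    then show ?thesis using PInf by simp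
  qed
next
  case MInf
  show ?thesis
  proof (cases "a0 = 0")
    case True
    then have "a n = 0" for n using nn[of n] by simp
    then show ?thesis using True by (simp add: Limsup_const)
  next
    case False
    then have "a0 > 0" using nn[of 0] by linarith
    then have "\<forall>\<^sub>F n in sequentially. 0 < a n" using order_tendstoD(1)[OF a] by blast
    then have "\<forall>\<^sub>F n in sequentially. ereal (a n) * B \<le> ereal a0 * B"
      by eventually_elim (use MInf \<open>a0 > 0\<close> in simp)
    then show ?thesis by (rule Limsup_bounded)
  qed
qed

context transport
begin

text \<open>Compactness and local finiteness give the support finite \<open>\<nu>\<close>-measure,
  so that constants on it are integrable.\<close>

lemma support_finite:
  assumes "\<mu> = density \<nu> (\<lambda>x. ennreal (\<rho> x))" "\<rho> \<in> borel_measurable \<nu>" "\<And>x. 0 \<le> \<rho> x"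
    "compactin (ftop d) (msupp d \<mu>)"
  shows "msupp d \<mu> \<in> sets \<nu>" "emeasure \<nu> (msupp d \<mu>) < \<infinity>" "AE x in \<nu>. x \<notin> msupp d \<mu> \<longrightarrow> \<rho> x = 0"
proof -
  have "- msupp d \<mu> \<in> sets \<nu>" using sets_open[OF closed_msupp] sets_\<nu> by simp
  then have "space \<nu> - (- msupp d \<mu>) \<in> sets \<nu>" by (rule sets.compl_sets)
  then show m: "msupp d \<mu> \<in> sets \<nu>" by (simp add: Diff_eq)
  show "emeasure \<nu> (msupp d \<mu>) < \<infinity>" by (rule emeasure_compactin_finite[OF locally_finite assms(4) m])
  have s: "sets \<mu> = sets (fborel d)" using assms(1) sets_\<nu> by simp
  have "AE x in density \<nu> (\<lambda>x. ennreal (\<rho> x)). x \<in> msupp d \<mu>"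
    using AE_msupp[OF s] unfolding assms(1)[symmetric] .
  then have "AE x in \<nu>. 0 < ennreal (\<rho> x) \<longrightarrow> x \<in> msupp d \<mu>"
    using assms(2) by (subst (asm) AE_density) auto
  then show "AE x in \<nu>. x \<notin> msupp d \<mu> \<longrightarrow> \<rho> x = 0"
  proof eventually_elim
    case (elim x)
    then show ?case using assms(3)[of x] by (auto simp: less_le)
  qed
qed

text \<open>\<open>U(r) / r\<close> can be unbounded near \<open>0\<close>, where a multiple of
  \<open>\<rho>0\<close> fails to dominate; a constant on the compact support does.\<close>

lemma integrable_U_\<rho>0:
  assumes U: "U \<in> DC N" and N: "1 < N"
  shows "integrable \<nu> (\<lambda>x. U (\<rho>0 x))"
proof -
  note S = support_finite[OF \<rho>0_density measurable_\<rho>0_\<nu> \<rho>0_nonneg \<mu>0_compact]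
  have "compact (U ` {0..height})"
    by (intro compact_continuous_image continuous_on_subset[OF DC_continuous[OF U N]]) auto
  then obtain L where L: "\<And>s. s \<in> {0..height} \<Longrightarrow> norm (U s) \<le> L"
    using compact_imp_bounded[of "U ` {0..height}"] unfolding bounded_iff by blast
  show ?thesis
  proof (rule Bochner_Integration.integrable_bound)
    show "integrable \<nu> (\<lambda>x. indicator (msupp d \<mu>0) x * L)"
      using S by (intro integrable_mult_left) (simp add: integrable_real_indicator)
    show "(\<lambda>x. U (\<rho>0 x)) \<in> borel_measurable \<nu>"
      by (rule measurable_DC_compose(1)[OF U N measurable_\<rho>0_\<nu> \<rho>0_nonneg])
    show "AE x in \<nu>. norm (U (\<rho>0 x)) \<le> norm (indicator (msupp d \<mu>0) x * L)"
      using S(3) AE_\<rho>0_le_height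
    proof eventually_elim
      case (elim x)
      show ?case
      proof (cases "x \<in> msupp d \<mu>0")
        case True
        then show ?thesis using L[of "\<rho>0 x"] elim(2) \<rho>0_nonneg[of x] by simp
      next
        case False
        then show ?thesis using elim(1) DC_zero[OF U N] by simp
      qed
    qed
  qed
qed

end

context cd_transport
begin

context
  fixes U :: "real \<Rightarrow> real"
  assumes U: "U \<in> DC N"
begin

text \<open>The left side of the inequality converges, the right side is controlled by upper limits.
  Majorants: the positive part of the limit slope plus the constant \<open>U 1\<close> for the
  target term, since mean slopes stay below the larger of \<open>m\<close> and \<open>U 1\<close>;
  the limit integrand for the curvature term, by \<open>p_le\<close>; \<open>A\<close> times the
  limit integrand for the slope term, by \<open>d2_le\<close>.\<close>

lemma tame_sequence_limits:
  fixes V :: "nat \<Rightarrow> real \<Rightarrow> real" and A :: real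
  assumes tame: "\<And>n. tame N (V n)" and A: "0 \<le> A"
    and p_le: "\<And>n r. 0 < r \<Longrightarrow> pressure (V n) r \<le> pressure U r"
    and p_lim: "\<And>r. 0 < r \<Longrightarrow> (\<lambda>n. pressure (V n) r) \<longlonglongrightarrow> pressure U r"
    and low: "\<And>n r. 0 < r \<Longrightarrow> r \<le> 1 \<Longrightarrow> mean_slope U r \<le> mean_slope (V n) r \<and> mean_slope (V n) r \<le> U 1"
    and high: "\<And>n r. 1 \<le> r \<Longrightarrow> U 1 \<le> mean_slope (V n) r \<and> mean_slope (V n) r \<le> mean_slope U r"
    and m_lim: "\<And>r. 0 < r \<Longrightarrow> (\<lambda>n. mean_slope (V n) r) \<longlonglongrightarrow> mean_slope U r"
    and d2_le: "\<And>n r. 0 < r \<Longrightarrow> deriv (deriv (V n)) r \<le> A * deriv (deriv U) r"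
    and d2_lim: "\<And>r. 0 < r \<Longrightarrow> (\<lambda>n. deriv (deriv (V n)) r) \<longlonglongrightarrow> deriv (deriv U) r"
  shows "(\<lambda>n. U_fun (V n) \<nu> \<mu>0) \<longlonglongrightarrow> U_fun U \<nu> \<mu>0"
    "limsup (\<lambda>n. target_term (V n)) \<le> target_term U"
    "limsup (\<lambda>n. curvature_term (V n)) \<le> curvature_term U"
    "limsup (\<lambda>n. enn2ereal (slope_term (V n))) \<le> enn2ereal (slope_term U)"
proof -
  note VDC = tameD(1)[OF tame N]
  have V0: "V n 0 = 0" for n by (rule DC_zero[OF VDC N])
  have V_eq: "V n r = r * mean_slope (V n) r" if "0 < r" for n r using that by (simp add: mean_slope_def)
  have U_eq: "U r = r * mean_slope U r" if "0 < r" for r using that by (simp add: mean_slope_def)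
  have V_lim: "(\<lambda>n. V n r) \<longlonglongrightarrow> U r" if "0 \<le> r" for r
  proof (cases "r = 0")
    case False
    then have r: "0 < r" using that by simp
    show ?thesis unfolding V_eq[OF r] U_eq[OF r] by (intro tendsto_mult_left m_lim r)
  qed (simp add: V0 DC_zero[OF U N])
  have V_bound: "\<bar>V n r\<bar> \<le> \<bar>U r\<bar> + r * \<bar>U 1\<bar>" if "0 \<le> r" for n r
  proof (cases "r = 0")
    case False
    then have r: "0 < r" using that by simp
    have "\<bar>mean_slope (V n) r\<bar> \<le> \<bar>mean_slope U r\<bar> + \<bar>U 1\<bar>"
      using low[OF r, of n] high[of r n] by (cases "r \<le> 1") auto
    then have "r * \<bar>mean_slope (V n) r\<bar> \<le> r * (\<bar>mean_slope U r\<bar> + \<bar>U 1\<bar>)" using r by (intro mult_left_mono) auto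
    then show ?thesis using r unfolding V_eq[OF r] U_eq[OF r] by (simp add: abs_mult distrib_left)
  qed (simp add: V0)
  show "(\<lambda>n. U_fun (V n) \<nu> \<mu>0) \<longlonglongrightarrow> U_fun U \<nu> \<mu>0"
  proof -
    have eq: "U_fun W \<nu> \<mu>0 = ereal (\<integral>x. W (\<rho>0 x) \<partial>\<nu>)" if "W \<in> DC N" for W
      unfolding U_fun_\<mu>0 by (rule eintegral_integrable[OF integrable_U_\<rho>0[OF that N]])
    have "(\<lambda>n. \<integral>x. V n (\<rho>0 x) \<partial>\<nu>) \<longlonglongrightarrow> (\<integral>x. U (\<rho>0 x) \<partial>\<nu>)"
    proof (rule integral_dominated_convergence[where w = "\<lambda>x. \<bar>U (\<rho>0 x)\<bar> + \<rho>0 x * \<bar>U 1\<bar>"])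
      show "integrable \<nu> (\<lambda>x. \<bar>U (\<rho>0 x)\<bar> + \<rho>0 x * \<bar>U 1\<bar>)"
        using integrable_U_\<rho>0[OF U N] integrable_\<rho>0 by simp
      show "AE x in \<nu>. (\<lambda>n. V n (\<rho>0 x)) \<longlonglongrightarrow> U (\<rho>0 x)" using V_lim[OF \<rho>0_nonneg] by simp
      show "AE x in \<nu>. norm (V n (\<rho>0 x)) \<le> \<bar>U (\<rho>0 x)\<bar> + \<rho>0 x * \<bar>U 1\<bar>" for n
        using V_bound[OF \<rho>0_nonneg] by simp
    qed (use integrable_U_\<rho>0[OF U N] integrable_U_\<rho>0[OF VDC N] in auto)
    then show ?thesis unfolding eq[OF U] eq[OF VDC] by simp
  qed
  let ?b = "\<lambda>z. rbeta0 K N (d (fst z) (snd z))"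
  have pos1: "AE z in \<pi>. 0 < \<rho>1 (snd z)" using AE_\<pi>_\<rho>1_pos by (simp add: case_prod_unfold)
  have pos0: "AE z in \<pi>. 0 < \<rho>0 (fst z)" using AE_\<pi>_\<rho>0_pos by (auto simp: case_prod_unfold elim!: eventually_mono)
  show "limsup (\<lambda>n. target_term (V n)) \<le> target_term U"
  proof -
    have meas: "(\<lambda>z. slope_at W (\<rho>1 (snd z)) (?b z)) \<in> borel_measurable \<pi>" if "W \<in> DC N" for W
      by (intro measurable_slope_at[OF that]) measurable
    have dz: "deriv_zero (V n) \<le> ereal (mean_slope (V n) s)" if "s > 0" for n s by (rule deriv_zero_le[OF VDC N that])
    have upper: "slope_at (V n) r b \<le> max (slope_at U r b) (ereal (U 1))" if rb: "r > 0" "b > 0" for n r b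
    proof (cases "b = \<infinity>")
      case True
      have "deriv_zero (V n) \<le> ereal (mean_slope (V n) 1)" by (rule dz) simp
      also have "\<dots> \<le> ereal (U 1)" using low[of 1 n] by simp
      finally show ?thesis using True by (simp add: slope_at_def le_max_iff_disj)
    next
      case False
      then obtain c where c: "b = ereal c" "c > 0" using rb by (cases b) auto
      have v: "r / c > 0" using rb c by simp
      have "mean_slope (V n) (r / c) \<le> max (mean_slope U (r / c)) (U 1)"
        using low[OF v, of n] high[of "r / c" n] by (cases "r / c \<le> 1") auto
      then show ?thesis using c v by (auto simp: slope_at_def max_def split: if_splits)
    qed
    have limit: "limsup (\<lambda>n. slope_at (V n) r b) \<le> slope_at U r b" if rb: "r > 0" "b > 0" for r b
    proof (cases "b = \<infinity>")
      case True
      \<comment> \<open>Each \<open>U'(0)\<close> of the sequence is an infimum of mean slopes, so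
        its upper limit is below every limit \<open>m(s)\<close> and hence below their infimum,
        which may be \<open>-\<infinity>\<close>.\<close>
      have "limsup (\<lambda>n. deriv_zero (V n)) \<le> ereal (mean_slope U s)" if s: "s > 0" for s
      proof -
        have "limsup (\<lambda>n. deriv_zero (V n)) \<le> limsup (\<lambda>n. ereal (mean_slope (V n) s))"
          by (intro Limsup_mono always_eventually allI dz s)
        also have "\<dots> = ereal (mean_slope U s)" using m_lim[OF s] by (intro lim_imp_Limsup) simp_all
        finally show ?thesis .
      qed
      then have "limsup (\<lambda>n. deriv_zero (V n)) \<le> deriv_zero U"
        unfolding deriv_zero_eq[OF U N] by (intro INF_greatest) auto
      then show ?thesis using True by (simp add: slope_at_def)
    next
      case False
      then obtain c where c: "b = ereal c" "c > 0" using rb by (cases b) auto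
      have "(\<lambda>n. ereal (mean_slope (V n) (r / c))) \<longlonglongrightarrow> ereal (mean_slope U (r / c))"
        using m_lim[of "r / c"] rb c by simp
      then have "limsup (\<lambda>n. ereal (mean_slope (V n) (r / c))) = ereal (mean_slope U (r / c))" by (intro lim_imp_Limsup) simp_all
      moreover have "max 0 (r / c) = r / c" using rb c by simp
      ultimately show ?thesis using c by (simp add: slope_at_def)
    qed
    show ?thesis
    proof (cases "(\<integral>\<^sup>+z. e2ennreal (slope_at U (\<rho>1 (snd z)) (?b z)) \<partial>\<pi>) = \<infinity>")
      case True
      then have "target_term U = \<infinity>"
        unfolding target_term_def case_prod_unfold eintegral_def by (simp add: top_ennreal.rep_eq top_ereal_def)
      then show ?thesis by simp
    next
      case False
      show ?thesis
        unfolding target_term_def case_prod_unfold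
      proof (rule limsup_eintegral_le[where w = "\<lambda>z. e2ennreal (slope_at U (\<rho>1 (snd z)) (?b z)) + ennreal (U 1)"])
        show "(\<integral>\<^sup>+z. e2ennreal (slope_at U (\<rho>1 (snd z)) (?b z)) + ennreal (U 1) \<partial>\<pi>) < \<infinity>"
          using False meas[OF U] by (subst nn_integral_add) (auto simp: \<pi>.emeasure_space_1 less_top)
        show "AE z in \<pi>. e2ennreal (slope_at (V n) (\<rho>1 (snd z)) (?b z)) \<le> e2ennreal (slope_at U (\<rho>1 (snd z)) (?b z)) + ennreal (U 1)" for n
          using pos1
        proof eventually_elim
          case (elim z)
          have "e2ennreal (slope_at (V n) (\<rho>1 (snd z)) (?b z)) \<le> e2ennreal (max (slope_at U (\<rho>1 (snd z)) (?b z)) (ereal (U 1)))"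
            by (intro e2ennreal_mono upper elim rbeta0_pos(1)[OF N]) simp
          also have "\<dots> \<le> e2ennreal (slope_at U (\<rho>1 (snd z)) (?b z)) + ennreal (U 1)"
            by (simp add: max_def)
          finally show ?case .
        qed
        show "AE z in \<pi>. limsup (\<lambda>n. slope_at (V n) (\<rho>1 (snd z)) (?b z)) \<le> slope_at U (\<rho>1 (snd z)) (?b z)"
          using pos1 by eventually_elim (intro limit rbeta0_pos(1)[OF N], auto)
      qed (use meas[OF U] meas[OF VDC] in measurable)
    qed
  qed
  show "limsup (\<lambda>n. curvature_term (V n)) \<le> curvature_term U"
  proof -
    let ?B = "\<lambda>z. beta_deriv_KN d K N (fst z) (snd z)"
    let ?f = "\<lambda>W z. ereal (pressure W (\<rho>0 (fst z)) / \<rho>0 (fst z)) * ?B z"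
    have fst\<pi>: "(\<lambda>z. \<rho>0 (fst z)) \<in> borel_measurable \<pi>" by measurable
    have mB [measurable]: "?B \<in> borel_measurable \<pi>"
      using measurable_beta_deriv_KN[OF N, of K] by (simp add: case_prod_unfold measurable_cong_sets[OF sets_\<pi> refl])
    have meas: "?f W \<in> borel_measurable \<pi>" if "W \<in> DC N" for W
    proof -
      note [measurable] = measurable_DC_compose(2)[OF that N fst\<pi> \<rho>0_nonneg] fst\<pi>
      show ?thesis by measurable
    qed
    show ?thesis
    proof (cases "(\<integral>\<^sup>+z. e2ennreal (?f U z) \<partial>\<pi>) = \<infinity>")
      case True
      then have "curvature_term U = \<infinity>"
        unfolding curvature_term_def case_prod_unfold eintegral_def by (simp add: top_ennreal.rep_eq top_ereal_def)
      then show ?thesis by simp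
    next
      case False
      show ?thesis
        unfolding curvature_term_def case_prod_unfold
      proof (rule limsup_eintegral_le[where w = "\<lambda>z. e2ennreal (?f U z)"])
        show "AE z in \<pi>. e2ennreal (?f (V n) z) \<le> e2ennreal (?f U z)" for n
          using pos0
        proof eventually_elim
          case (elim z)
          have "0 \<le> pressure (V n) (\<rho>0 (fst z))" by (rule DC_pressure_nonneg[OF VDC N elim])
          then have "0 \<le> pressure (V n) (\<rho>0 (fst z)) / \<rho>0 (fst z)"
            "pressure (V n) (\<rho>0 (fst z)) / \<rho>0 (fst z) \<le> pressure U (\<rho>0 (fst z)) / \<rho>0 (fst z)"
            using elim p_le[OF elim, of n] by (auto intro: divide_right_mono)
          then show ?case by (simp add: e2ennreal_mult_nonneg mult_right_mono ennreal_leI)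
        qed
        show "AE z in \<pi>. limsup (\<lambda>n. ?f (V n) z) \<le> ?f U z"
          using pos0
        proof eventually_elim
          case (elim z)
          have "(\<lambda>n. pressure (V n) (\<rho>0 (fst z)) / \<rho>0 (fst z)) \<longlonglongrightarrow> pressure U (\<rho>0 (fst z)) / \<rho>0 (fst z)"
            using elim by (intro tendsto_divide p_lim tendsto_const) auto
          then show ?case
            using elim p_le[OF elim] DC_pressure_nonneg[OF VDC N elim]
            by (intro limsup_ereal_mult) (auto intro: divide_right_mono)
        qed
      qed (use False meas[OF U] meas[OF VDC] in \<open>auto simp: less_top\<close>)
    qed
  qed
  show "limsup (\<lambda>n. enn2ereal (slope_term (V n))) \<le> enn2ereal (slope_term U)"
  proof -
    let ?f = "\<lambda>W z. ennreal (deriv (deriv W) (\<rho>0 (fst z))) * descending_slope d \<rho>0 (fst z) * ennreal (d (fst z) (snd z))"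
    have fst\<pi>: "(\<lambda>z. \<rho>0 (fst z)) \<in> borel_measurable \<pi>" by measurable
    note [measurable] = measurable_descending_slope[OF \<rho>0_lipschitz]
    have meas: "?f W \<in> borel_measurable \<pi>" if "W \<in> DC N" for W
    proof -
      note [measurable] = measurable_DC_compose(3)[OF that N fst\<pi> \<rho>0_nonneg]
      show ?thesis by measurable
    qed
    have eq: "slope_term W = (\<integral>\<^sup>+z. ?f W z \<partial>\<pi>)" for W by (simp add: slope_term_def case_prod_unfold)
    have en_limsup: "limsup (\<lambda>n. enn2ereal (u n)) = enn2ereal (limsup u)" for u :: "nat \<Rightarrow> ennreal"
      by (rule Limsup_compose_continuous_mono) (auto simp: continuous_on_enn2ereal mono_def less_eq_ennreal.rep_eq)
    have "limsup (\<lambda>n. slope_term (V n)) \<le> slope_term U"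
    proof (cases "slope_term U = \<infinity>")
      case False
      have "limsup (\<lambda>n. \<integral>\<^sup>+z. ?f (V n) z \<partial>\<pi>) \<le> (\<integral>\<^sup>+z. limsup (\<lambda>n. ?f (V n) z) \<partial>\<pi>)"
      proof (rule nn_integral_limsup[where w = "\<lambda>z. ennreal A * ?f U z"])
        show "AE z in \<pi>. ?f (V n) z \<le> ennreal A * ?f U z" for n
          using pos0
        proof eventually_elim
          case (elim z)
          have "ennreal (deriv (deriv (V n)) (\<rho>0 (fst z))) \<le> ennreal A * ennreal (deriv (deriv U) (\<rho>0 (fst z)))"
            using ennreal_leI[OF d2_le[OF elim, of n]] A DC_deriv2_nonneg[OF U N elim] by (simp add: ennreal_mult)
          then show ?case unfolding mult.assoc[symmetric] by (intro mult_right_mono) auto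
        qed
        show "(\<integral>\<^sup>+z. ennreal A * ?f U z \<partial>\<pi>) < \<infinity>"
          using False meas[OF U] by (subst nn_integral_cmult) (auto simp: eq ennreal_mult_less_top less_top)
      qed (use meas[OF U] meas[OF VDC] in measurable)
      also have "\<dots> = (\<integral>\<^sup>+z. ?f U z \<partial>\<pi>)"
      proof (rule nn_integral_cong_AE)
        show "AE z in \<pi>. limsup (\<lambda>n. ?f (V n) z) = ?f U z"
          using pos0
        proof eventually_elim
          case (elim z)
          obtain s where s: "0 \<le> s" "descending_slope d \<rho>0 (fst z) = ennreal s"
            using descending_slope_finite[of "fst z"] by (cases "descending_slope d \<rho>0 (fst z)") auto
          have f: "?f W z = ennreal (deriv (deriv W) (\<rho>0 (fst z)) * s * d (fst z) (snd z))" if "W \<in> DC N" for W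
            using DC_deriv2_nonneg[OF that N elim] s by (simp add: ennreal_mult[symmetric])
          have "(\<lambda>n. ?f (V n) z) \<longlonglongrightarrow> ?f U z"
            unfolding f[OF U] f[OF VDC] by (intro tendsto_ennrealI tendsto_mult d2_lim elim tendsto_const)
          then show ?case by (intro lim_imp_Limsup) simp_all
        qed
      qed
      finally show ?thesis by (simp only: eq)
    qed simp
    then show ?thesis unfolding en_limsup by (simp add: less_eq_ennreal.rep_eq)
  qed
qed

theorem general_hwi: "U_fun U \<nu> \<mu>0 \<le> target_term U + curvature_term U + enn2ereal (slope_term U)"
proof -
  obtain V :: "nat \<Rightarrow> real \<Rightarrow> real" and A :: real where V: "\<And>n. tame N (V n)" "0 \<le> A"
    "\<And>n r. 0 < r \<Longrightarrow> pressure (V n) r \<le> pressure U r"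
    "\<And>r. 0 < r \<Longrightarrow> (\<lambda>n. pressure (V n) r) \<longlonglongrightarrow> pressure U r"
    "\<And>n r. 0 < r \<Longrightarrow> r \<le> 1 \<Longrightarrow> mean_slope U r \<le> mean_slope (V n) r \<and> mean_slope (V n) r \<le> U 1"
    "\<And>n r. 1 \<le> r \<Longrightarrow> U 1 \<le> mean_slope (V n) r \<and> mean_slope (V n) r \<le> mean_slope U r"
    "\<And>r. 0 < r \<Longrightarrow> (\<lambda>n. mean_slope (V n) r) \<longlonglongrightarrow> mean_slope U r"
    "\<And>n r. 0 < r \<Longrightarrow> deriv (deriv (V n)) r \<le> A * deriv (deriv U) r"
    "\<And>r. 0 < r \<Longrightarrow> (\<lambda>n. deriv (deriv (V n)) r) \<longlonglongrightarrow> deriv (deriv U) r"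
    using tame_approximation[OF U N] by blast
  note lim = tame_sequence_limits[OF V]
  have "U_fun U \<nu> \<mu>0 = limsup (\<lambda>n. U_fun (V n) \<nu> \<mu>0)"
    using lim(1) by (intro lim_imp_Limsup[symmetric]) simp_all
  also have "\<dots> \<le> limsup (\<lambda>n. target_term (V n) + curvature_term (V n) + enn2ereal (slope_term (V n)))"
    by (intro Limsup_mono always_eventually allI tame_hwi V)
  also have "\<dots> \<le> limsup (\<lambda>n. target_term (V n) + curvature_term (V n)) + limsup (\<lambda>n. enn2ereal (slope_term (V n)))"
    by (rule ereal_limsup_add_mono)
  also have "\<dots> \<le> (limsup (\<lambda>n. target_term (V n)) + limsup (\<lambda>n. curvature_term (V n))) + limsup (\<lambda>n. enn2ereal (slope_term (V n)))"
    by (intro add_right_mono ereal_limsup_add_mono)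
  also have "\<dots> \<le> target_term U + curvature_term U + enn2ereal (slope_term U)"
    by (intro add_mono lim)
  finally show ?thesis .
qed

end

end

section \<open>The terms of the inequality\<close>

lemma slope_at_antimono:
  assumes U: "U \<in> DC N" and N: "1 < N" and "0 < r" "0 < b" "b \<le> b'"
  shows "slope_at U r b' \<le> slope_at U r b"
proof (cases "b = \<infinity>")
  case False
  then obtain c where c: "b = ereal c" "c > 0" using assms by (cases b) auto
  then have v: "r / c > 0" using assms by simp
  show ?thesis
  proof (cases "b' = \<infinity>")
    case True
    then show ?thesis using deriv_zero_le[OF U N v] v c by (simp add: slope_at_def max_def)
  next
    case False
    then obtain c' where c': "b' = ereal c'" "c \<le> c'" using assms c by (cases b') auto
    have "r / c' \<le> r / c" "0 < r / c'" using assms c c' by (auto intro: divide_left_mono)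
    then have "mean_slope U (r / c') \<le> mean_slope U (r / c)" by (intro mean_slope_mono[OF U N])
    then show ?thesis using c c' \<open>0 < r / c'\<close> v by (simp add: slope_at_def max_def)
  qed
qed (use assms in simp)

text \<open>\<open>Lim\<close> is meaningful only if the limit exists; monotonicity provides it as
  an infimum, and lower bounds pass to infima.\<close>

lemma le_Lim_at_right:
  fixes F :: "ereal \<Rightarrow> ereal"
  assumes nb: "at_right N \<noteq> bot" and N: "N \<noteq> \<infinity>"
    and mono: "\<And>m m'. N < m \<Longrightarrow> m \<le> m' \<Longrightarrow> m' < \<infinity> \<Longrightarrow> F m \<le> F m'"
    and le: "\<And>m. N < m \<Longrightarrow> m < \<infinity> \<Longrightarrow> c \<le> F m"
  shows "c \<le> Lim (at_right N) F"
proof -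
  let ?I = "INF m\<in>{N<..<\<infinity>}. F m"
  have "N < \<infinity>" using N by (simp add: less_top[symmetric] top_ereal_def)
  have ev: "\<forall>\<^sub>F m in at_right N. m \<in> {N<..<b}" if "N < b" for b
    using eventually_at_right[OF that, of "\<lambda>m. m \<in> {N<..<b}"] that by auto
  have "(F \<longlongrightarrow> ?I) (at_right N)"
  proof (rule order_tendstoI)
    fix a assume "a < ?I"
    then have "a < F m" if "m \<in> {N<..<\<infinity>}" for m using that by (rule less_INF_D)
    then show "\<forall>\<^sub>F m in at_right N. a < F m"
      using ev[OF \<open>N < \<infinity>\<close>] by (auto elim: eventually_mono)
  next
    fix a assume "?I < a"
    then obtain b where b: "N < b" "b < \<infinity>" "F b < a" by (auto simp: INF_less_iff)
    show "\<forall>\<^sub>F m in at_right N. F m < a"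
      using ev[OF b(1)] by eventually_elim (use b mono in \<open>auto intro: le_less_trans less_imp_le\<close>)
  qed
  then have "Lim (at_right N) F = ?I" by (rule tendsto_Lim[OF nb])
  then show ?thesis using le by (auto intro: INF_greatest)
qed

context cd_transport
begin

lemma U_beta_rbeta0_swap:
  assumes U: "U \<in> DC N" and N': "1 < N'"
  shows "U_beta U \<nu> (\<lambda>x y. beta_zero_plus d K N' y x) (swap_plan d \<pi>) \<mu>1 =
    eintegral \<pi> (\<lambda>(x, y). slope_at U (\<rho>1 y) (rbeta0 K N' (d x y)))"
proof -
  let ?g = "\<lambda>(x, y). slope_at U (\<rho>1 x) (rbeta0 K N' (d y x))"
  have "U_beta U \<nu> (\<lambda>x y. beta_zero_plus d K N' y x) (swap_plan d \<pi>) \<mu>1 = eintegral (swap_plan d \<pi>) ?g"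
    unfolding beta_zero_plus_eq[OF metric N']
    by (rule U_beta_eq[OF sigma_finite sets_\<nu> \<mu>1_prob sets_\<mu>1 \<mu>1_ac swap_plan_props U N])
       (measurable, simp add: rbeta0_pos(1)[OF N'])
  also have "\<dots> = eintegral \<pi> (\<lambda>(x, y). ?g (y, x))"
  proof (rule eintegral_swap)
    show "?g \<in> borel_measurable (fborel d \<Otimes>\<^sub>M fborel d)"
      unfolding case_prod_unfold by (intro measurable_slope_at[OF U]) measurable
  qed
  finally show ?thesis by (simp add: case_prod_unfold)
qed

text \<open>Coefficients at \<open>0+\<close> decrease with the dimension, so distorted slopes
  increase with it. At maximal diameter the limit is therefore an infimum over larger dimensions of
  quantities that are at least the one at \<open>N\<close>.\<close>

lemma target_term_le:
  assumes U: "U \<in> DC N"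
  shows "target_term U \<le> U_KN_rev_zero_plus d K N U \<nu> \<pi> \<mu>1"
proof (cases "maximal_diameter K N")
  case False
  then show ?thesis
    unfolding U_KN_rev_zero_plus_def myers_limit_eq U_beta_rbeta0_swap[OF U N] target_term_def by simp
next
  case True
  then obtain n where n: "N = ereal n" "K > 0" using N by (cases N) (auto simp: maximal_diameter_def)
  have pos: "AE z in \<pi>. 0 < \<rho>1 (snd z)" using AE_\<pi>_\<rho>1_pos by (simp add: case_prod_unfold)
  have anti: "eintegral \<pi> (\<lambda>(x, y). slope_at U (\<rho>1 y) (rbeta0 K m (d x y)))
      \<le> eintegral \<pi> (\<lambda>(x, y). slope_at U (\<rho>1 y) (rbeta0 K m' (d x y)))" if m: "N \<le> m" "m \<le> m'" "m' < \<infinity>" for m m'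
    unfolding case_prod_unfold
  proof (rule eintegral_mono_AE, use pos in eventually_elim)
    fix z :: "'a \<times> 'a" assume z: "0 < \<rho>1 (snd z)"
    have m1: "1 < m'" "1 < m" using m N by auto
    obtain a a' where a: "m = ereal a" "m' = ereal a'" using m m1 by (cases m; cases m') auto
    have "rbeta0 K m' (d (fst z) (snd z)) \<le> rbeta0 K m (d (fst z) (snd z))"
      unfolding a using m1 m a by (intro rbeta0_antimono[OF n(2)]) auto
    then show "slope_at U (\<rho>1 (snd z)) (rbeta0 K m (d (fst z) (snd z))) \<le> slope_at U (\<rho>1 (snd z)) (rbeta0 K m' (d (fst z) (snd z)))"
      by (intro slope_at_antimono[OF U N z] rbeta0_pos(1)[OF m1(1)]) auto
  qed
  have eq: "U_beta U \<nu> (\<lambda>x y. beta_zero_plus d K m y x) (swap_plan d \<pi>) \<mu>1 =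
      eintegral \<pi> (\<lambda>(x, y). slope_at U (\<rho>1 y) (rbeta0 K m (d x y)))" if "N < m" for m
    using that N by (intro U_beta_rbeta0_swap[OF U]) auto
  have Nf: "N \<noteq> \<infinity>" using n by simp
  have "target_term U \<le> Lim (at_right N) (\<lambda>N'. U_beta U \<nu> (\<lambda>x y. beta_zero_plus d K N' y x) (swap_plan d \<pi>) \<mu>1)"
  proof (rule le_Lim_at_right[OF trivial_limit_at_right[OF N Nf] Nf])
    fix m m' assume m: "N < m" "m \<le> m'" "m' < \<infinity>"
    then have "N < m'" by simp
    then show "U_beta U \<nu> (\<lambda>x y. beta_zero_plus d K m y x) (swap_plan d \<pi>) \<mu>1 \<le> U_beta U \<nu> (\<lambda>x y. beta_zero_plus d K m' y x) (swap_plan d \<pi>) \<mu>1"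
      using m eq by (simp add: anti)
  next
    fix m assume m: "N < m" "m < \<infinity>"
    then show "target_term U \<le> U_beta U \<nu> (\<lambda>x y. beta_zero_plus d K m y x) (swap_plan d \<pi>) \<mu>1"
      unfolding eq[OF m(1)] target_term_def by (intro anti) auto
  qed
  then show ?thesis using True unfolding U_KN_rev_zero_plus_def myers_limit_eq by simp
qed

text \<open>Where \<open>\<rho>0\<close> vanishes so does \<open>p(\<rho>0)\<close>, hence dividing
  and multiplying by \<open>\<rho>0\<close> changes nothing there either.\<close>

lemma curvature_term_eq:
  assumes U: "U \<in> DC N"
  shows "eintegral (kernel_prod \<nu> (cond_kernel \<pi> \<mu>0))
      (\<lambda>(x, y). ereal (pressure U (\<rho>0 x)) * beta_deriv_KN d K N x y) = curvature_term U"
proof -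
  let ?\<kappa> = "cond_kernel \<pi> \<mu>0"
  let ?g = "\<lambda>(x, y). ereal (pressure U (\<rho>0 x) / \<rho>0 x) * beta_deriv_KN d K N x y"
  have "?\<kappa> \<in> measurable \<mu>0 (prob_algebra \<mu>0) \<and> \<pi> = kernel_prod \<mu>0 ?\<kappa>"
    unfolding cond_kernel_def by (rule someI_ex[OF disintegration[OF \<mu>0_prob sets_\<mu>0 \<pi>_prob sets_\<pi> \<pi>_fst]])
  then have k: "?\<kappa> \<in> measurable \<mu>0 (prob_algebra \<mu>0)" "\<pi> = kernel_prod \<mu>0 ?\<kappa>" by auto
  note m1 = measurable_compose[OF measurable_fst measurable_DC_compose(2)[OF U N measurable_\<rho>0 \<rho>0_nonneg]]
  note m2 = measurable_beta_deriv_KN[OF N, of K, unfolded case_prod_unfold]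
  have "?g \<in> borel_measurable (fborel d \<Otimes>\<^sub>M fborel d)"
    unfolding case_prod_unfold using m1 m2 by measurable
  then have g: "?g \<in> borel_measurable (\<nu> \<Otimes>\<^sub>M \<nu>)"
    by (simp only: measurable_cong_sets[OF sets_pair_measure_cong[OF sets_\<nu> sets_\<nu>] refl])
  have p0: "pressure U 0 = 0" using DC_zero[OF U N] by (simp add: pressure_def)
  have "ereal (\<rho>0 x) * ?g (x, y) = ereal (pressure U (\<rho>0 x)) * beta_deriv_KN d K N x y" for x y
    using p0 by (cases "\<rho>0 x = 0") (simp_all add: mult.assoc[symmetric])
  then show ?thesis
    using eintegral_kernel_prod_density[OF k \<rho>0_density measurable_\<rho>0_\<nu> \<rho>0_nonneg _ g]
    by (simp add: curvature_term_def)
qed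

text \<open>The tangent of \<open>U\<close> at \<open>1\<close>, restricted to the compact support,
  is an integrable minorant of \<open>U(\<rho>1)\<close>; finiteness from above then gives
  integrability. The identity \<open>U(\<rho>1) = \<rho>1 m(\<rho>1)\<close> moves the integral to
  \<open>\<mu>1\<close> and, through the second marginal, to the plan.\<close>

lemma target_integrable:
  assumes U: "U \<in> DC N" and fin: "U_fun U \<nu> \<mu>1 < \<infinity>"
  shows "integrable \<pi> (\<lambda>z. mean_slope U (\<rho>1 (snd z)))"
    "U_fun U \<nu> \<mu>1 = ereal (\<integral>z. mean_slope U (\<rho>1 (snd z)) \<partial>\<pi>)"
proof -
  note S = support_finite[OF \<rho>1(3) \<rho>1(1) \<rho>1(2) \<mu>1_compact]
  note m = measurable_DC_compose(1)[OF U N \<rho>1(1) \<rho>1(2)]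
  have i1: "integrable \<nu> \<rho>1"
  proof (rule integrableI_nonneg)
    have sp: "space \<mu>1 = UNIV" using sets_eq_imp_space_eq[OF sets_\<mu>1] by simp
    have "(\<integral>\<^sup>+x. ennreal (\<rho>1 x) \<partial>\<nu>) = emeasure (density \<nu> (\<lambda>x. ennreal (\<rho>1 x))) UNIV"
      using \<rho>1(1) sets.top[of \<nu>] by (simp add: emeasure_density)
    also have "\<dots> = emeasure \<mu>1 UNIV" by (simp only: \<rho>1(3)[symmetric])
    also have "\<dots> = 1" using prob_space.emeasure_space_1[OF \<mu>1_prob] by (simp only: sp)
    finally show "(\<integral>\<^sup>+x. ennreal (\<rho>1 x) \<partial>\<nu>) < \<infinity>" by simp
  qed (use \<rho>1 in auto)
  let ?l = "\<lambda>x. deriv U 1 * \<rho>1 x + (U 1 - deriv U 1) * indicator (msupp d \<mu>1) x"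
  have il: "integrable \<nu> ?l"
    using i1 S by (intro Bochner_Integration.integrable_add integrable_mult_right) (auto simp: integrable_real_indicator)
  have low: "AE x in \<nu>. ?l x \<le> U (\<rho>1 x)"
    using S(3)
  proof eventually_elim
    case (elim x)
    show ?case
    proof (cases "x \<in> msupp d \<mu>1")
      case True
      then show ?thesis using DC_tangent[OF U N, of 1 "\<rho>1 x"] \<rho>1(2)[of x] by (simp add: algebra_simps)
    qed (use elim DC_zero[OF U N] in simp)
  qed
  have neg: "(\<integral>\<^sup>+x. ennreal (- U (\<rho>1 x)) \<partial>\<nu>) < \<infinity>"
  proof -
    have "(\<integral>\<^sup>+x. ennreal (- U (\<rho>1 x)) \<partial>\<nu>) \<le> (\<integral>\<^sup>+x. ennreal (- ?l x) \<partial>\<nu>)"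
      by (rule nn_integral_mono_AE) (use low in eventually_elim, auto intro!: ennreal_leI)
    also have "\<dots> < \<infinity>" using il unfolding real_integrable_def by (auto simp: less_top)
    finally show ?thesis .
  qed
  have "(\<integral>\<^sup>+x. ennreal (U (\<rho>1 x)) \<partial>\<nu>) \<noteq> \<infinity>"
  proof
    assume "(\<integral>\<^sup>+x. ennreal (U (\<rho>1 x)) \<partial>\<nu>) = \<infinity>"
    then have "U_fun U \<nu> \<mu>1 = \<infinity>" using neg
      unfolding U_fun_\<mu>1 eintegral_def
      by (cases "\<integral>\<^sup>+x. ennreal (- U (\<rho>1 x)) \<partial>\<nu>") (auto simp: enn2ereal_ennreal)
    then show False using fin by simp
  qed
  then have iU: "integrable \<nu> (\<lambda>x. U (\<rho>1 x))"
    using m neg unfolding real_integrable_def by (auto simp: less_top)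
  have eq: "U (\<rho>1 x) = \<rho>1 x * mean_slope U (\<rho>1 x)" for x
    using DC_zero[OF U N] by (cases "\<rho>1 x = 0") (simp_all add: mean_slope_def)
  have ms: "(\<lambda>x. mean_slope U (\<rho>1 x)) \<in> borel_measurable \<nu>"
    using m \<rho>1(1) unfolding mean_slope_def by measurable
  have "integrable (density \<nu> (\<lambda>x. ennreal (\<rho>1 x))) (\<lambda>x. mean_slope U (\<rho>1 x))"
    using iU ms \<rho>1(1,2) by (subst integrable_density) (auto simp: eq[symmetric])
  then have im: "integrable \<mu>1 (\<lambda>x. mean_slope U (\<rho>1 x))" by (simp only: \<rho>1(3)[symmetric])
  have snd: "snd \<in> measurable \<pi> (fborel d)" by measurable
  show "integrable \<pi> (\<lambda>z. mean_slope U (\<rho>1 (snd z)))"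
    by (rule integrable_distr[OF snd]) (simp only: \<pi>_snd im)
  have "(\<integral>z. mean_slope U (\<rho>1 (snd z)) \<partial>\<pi>) = (\<integral>x. mean_slope U (\<rho>1 x) \<partial>\<mu>1)"
    using integral_distr[OF snd, of "\<lambda>x. mean_slope U (\<rho>1 x)"] ms
    by (simp only: \<pi>_snd measurable_cong_sets[OF sets_\<nu> refl])
  also have "\<dots> = (\<integral>x. mean_slope U (\<rho>1 x) \<partial>density \<nu> (\<lambda>x. ennreal (\<rho>1 x)))" by (simp only: \<rho>1(3)[symmetric])
  also have "\<dots> = (\<integral>x. U (\<rho>1 x) \<partial>\<nu>)"
    using ms \<rho>1(1,2) by (subst integral_density) (auto simp: eq[symmetric])
  finally show "U_fun U \<nu> \<mu>1 = ereal (\<integral>z. mean_slope U (\<rho>1 (snd z)) \<partial>\<pi>)"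
    unfolding U_fun_\<mu>1 eintegral_integrable[OF iU] by simp
qed

lemma W2_eq: "W2 d \<mu>0 \<mu>1 = esqrt (transport_cost d \<pi>)"
proof -
  have "(INF \<pi>\<in>couplings d \<mu>0 \<mu>1. transport_cost d \<pi>) = transport_cost d \<pi>"
    using optimal unfolding optimal_plan_def by (intro antisym INF_lower INF_greatest) auto
  then show ?thesis by (simp add: W2_def)
qed

lemma transport_cost_eq:
  "integrable \<pi> (\<lambda>z. (d (fst z) (snd z))\<^sup>2)"
  "transport_cost d \<pi> = ennreal (\<integral>z. (d (fst z) (snd z))\<^sup>2 \<partial>\<pi>)"
proof -
  have "AE z in \<pi>. d (fst z) (snd z) < radius" using AE_\<pi>_dist by (simp add: case_prod_unfold)
  then have "AE z in \<pi>. \<bar>(d (fst z) (snd z))\<^sup>2\<bar> \<le> radius\<^sup>2"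
    by eventually_elim (simp add: power_mono less_imp_le)
  then show i: "integrable \<pi> (\<lambda>z. (d (fst z) (snd z))\<^sup>2)"
    by (rule \<pi>.bounded_integrable[rotated]) measurable
  show "transport_cost d \<pi> = ennreal (\<integral>z. (d (fst z) (snd z))\<^sup>2 \<partial>\<pi>)"
    unfolding transport_cost_def case_prod_unfold by (rule nn_integral_eq_integral[OF i]) simp
qed

lemma W2_square: "(enn2ereal (W2 d \<mu>0 \<mu>1))\<^sup>2 = ereal (\<integral>z. (d (fst z) (snd z))\<^sup>2 \<partial>\<pi>)"
proof -
  have "0 \<le> (\<integral>z. (d (fst z) (snd z))\<^sup>2 \<partial>\<pi>)" by (rule integral_nonneg_AE) simp
  then show ?thesis unfolding W2_eq transport_cost_eq(2) esqrt_def
    by (simp add: enn2ereal_ennreal power2_eq_square)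
qed

text \<open>Cauchy-Schwarz for the plan: one factor depends on \<open>x\<close> alone, so its
  squared integral becomes the Fisher information through the first marginal; the other gives the
  optimal cost.\<close>

lemma slope_term_le:
  assumes U: "U \<in> DC N"
  shows "slope_term U \<le> W2 d \<mu>0 \<mu>1 * esqrt (fisher_minus d U \<nu> \<rho>0)"
proof -
  let ?f = "\<lambda>x. ennreal (deriv (deriv U) (\<rho>0 x)) * descending_slope d \<rho>0 x"
  let ?D = "\<lambda>z. ennreal (d (fst z) (snd z))"
  note [measurable] = measurable_descending_slope[OF \<rho>0_lipschitz]
    measurable_DC_compose(3)[OF U N measurable_\<rho>0 \<rho>0_nonneg]
  have f [measurable]: "?f \<in> borel_measurable (fborel d)" by measurable
  have fst [measurable]: "fst \<in> measurable \<pi> (fborel d)" by measurable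
  have F: "(\<integral>\<^sup>+z. (?f (fst z))\<^sup>2 \<partial>\<pi>) = fisher_minus d U \<nu> \<rho>0"
  proof -
    have "(\<integral>\<^sup>+z. (?f (fst z))\<^sup>2 \<partial>\<pi>) = (\<integral>\<^sup>+x. (?f x)\<^sup>2 \<partial>\<mu>0)"
      unfolding \<pi>_fst[symmetric] by (subst nn_integral_distr) auto
    also have "\<dots> = (\<integral>\<^sup>+x. ennreal (\<rho>0 x) * (?f x)\<^sup>2 \<partial>\<nu>)"
      using f by (subst \<rho>0_density, subst nn_integral_density) (auto simp: measurable_cong_sets[OF sets_\<nu> refl])
    also have "\<dots> = fisher_minus d U \<nu> \<rho>0"
      unfolding fisher_minus_def
    proof (rule nn_integral_cong)
      fix x
      show "ennreal (\<rho>0 x) * (?f x)\<^sup>2 = ennreal (\<rho>0 x * (deriv (deriv U) (\<rho>0 x))\<^sup>2) * (descending_slope d \<rho>0 x)\<^sup>2"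
      proof (cases "\<rho>0 x = 0")
        case False
        then have "0 \<le> deriv (deriv U) (\<rho>0 x)" using \<rho>0_nonneg[of x] by (intro DC_deriv2_nonneg[OF U N]) simp
        then show ?thesis using \<rho>0_nonneg[of x]
          by (simp add: power_mult_distrib ennreal_mult ennreal_power mult.assoc)
      qed simp
    qed
    finally show ?thesis .
  qed
  have CS: "(slope_term U)\<^sup>2 \<le> fisher_minus d U \<nu> \<rho>0 * transport_cost d \<pi>"
  proof -
    have "(\<integral>\<^sup>+z. ?f (fst z) * ?D z \<partial>\<pi>)\<^sup>2 \<le> (\<integral>\<^sup>+z. (?f (fst z))\<^sup>2 \<partial>\<pi>) * (\<integral>\<^sup>+z. (?D z)\<^sup>2 \<partial>\<pi>)"
      by (rule Cauchy_Schwarz_nn_integral) measurable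
    then show ?thesis unfolding F transport_cost_def slope_term_def case_prod_unfold
      by (simp add: ennreal_power)
  qed
  let ?c = "\<integral>z. (d (fst z) (snd z))\<^sup>2 \<partial>\<pi>"
  have c: "0 \<le> ?c" by (rule integral_nonneg_AE) simp
  show ?thesis
  proof (cases "fisher_minus d U \<nu> \<rho>0 = \<infinity>")
    case True
    show ?thesis
    \<comment> \<open>For infinite information and zero cost the product is \<open>0\<close> by
      convention, and Cauchy-Schwarz with the same convention forces
      \<open>slope_term U = 0\<close>.\<close>
    proof (cases "?c = 0")
      case True
      then have "(slope_term U)\<^sup>2 \<le> 0" using CS unfolding transport_cost_eq(2) by simp
      then show ?thesis by (simp add: power2_eq_square)
    next
      case False
      then have "W2 d \<mu>0 \<mu>1 \<noteq> 0" using c unfolding W2_eq transport_cost_eq(2) esqrt_def by simp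
      then show ?thesis using True by (simp add: esqrt_def ennreal_mult_top)
    qed
  next
    case False
    then obtain b where b: "fisher_minus d U \<nu> \<rho>0 = ennreal b" "0 \<le> b" by (cases "fisher_minus d U \<nu> \<rho>0") auto
    have le: "(slope_term U)\<^sup>2 \<le> ennreal (?c * b)"
      using CS b c unfolding transport_cost_eq(2) by (simp add: ennreal_mult mult.commute)
    then have "slope_term U \<noteq> \<infinity>" by (auto simp: power2_eq_square top_unique)
    then obtain v where v: "slope_term U = ennreal v" "0 \<le> v" by (cases "slope_term U") auto
    then have "v\<^sup>2 \<le> ?c * b" using le b c by (simp add: ennreal_power)
    then have "v \<le> sqrt ?c * sqrt b" using real_le_rsqrt by (simp add: real_sqrt_mult[symmetric])
    then have "slope_term U \<le> ennreal (sqrt ?c * sqrt b)" unfolding v(1) by (rule ennreal_leI)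
    also have "\<dots> = W2 d \<mu>0 \<mu>1 * esqrt (fisher_minus d U \<nu> \<rho>0)"
      using b c unfolding W2_eq transport_cost_eq(2) esqrt_def by (simp add: ennreal_mult)
    finally show ?thesis .
  qed
qed

end

section \<open>The flat and the infinite-dimensional case\<close>

context cd_transport
begin

context
  fixes U :: "real \<Rightarrow> real"
  assumes U: "U \<in> DC N" and fin: "U_fun U \<nu> \<mu>1 < \<infinity>"
begin

text \<open>For \<open>K = 0\<close> all coefficients are \<open>1\<close> with derivative
  \<open>0\<close>, so the target term is the value at \<open>\<mu>1\<close> and the curvature term
  vanishes. The value at \<open>\<mu>1\<close> is real here, which makes the subtraction
  legitimate.\<close>

lemma flat_hwi:
  assumes K: "K = 0"
  shows "U_fun U \<nu> \<mu>0 - U_fun U \<nu> \<mu>1 \<le> enn2ereal (slope_term U)"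
proof -
  note i = target_integrable[OF U fin]
  have b: "rbeta0 K N r = 1" for r using K by (simp add: rbeta0_def one_ereal_def)
  have b': "beta_deriv_KN d K N x y = 0" for x y
    using K by (simp add: beta_deriv_KN_eq[OF N] maximal_diameter_def rbeta'_def)
  have "slope_at U (\<rho>1 y) 1 = ereal (mean_slope U (\<rho>1 y))" for y
    using \<rho>1(2)[of y] by (simp add: slope_at_def one_ereal_def max_def)
  then have "target_term U = eintegral \<pi> (\<lambda>z. ereal (mean_slope U (\<rho>1 (snd z))))"
    by (simp add: target_term_def b case_prod_unfold)
  then have "target_term U = U_fun U \<nu> \<mu>1" using eintegral_integrable[OF i(1)] i(2) by simp
  moreover have "curvature_term U = 0"
    by (simp add: curvature_term_def b' case_prod_unfold eintegral_def zero_ennreal.rep_eq)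
  ultimately have "U_fun U \<nu> \<mu>0 \<le> U_fun U \<nu> \<mu>1 + enn2ereal (slope_term U)"
    using general_hwi[OF U] by simp
  then show ?thesis unfolding i(2) by (cases "U_fun U \<nu> \<mu>0"; cases "enn2ereal (slope_term U)") auto
qed

text \<open>\<open>\<kappa> / 2 = \<kappa> / 6 + \<kappa> / 3\<close>: the first share comes from
  the coefficient \<open>exp (K d^2 / 6)\<close> in the target term, the second from the derivative
  \<open>- K d^2 / 3\<close> in the curvature term. The alternative of zero distance in the
  hypothesis covers plans on the diagonal, where no lower bound \<open>\<kappa>\<close> for
  \<open>K p(r) / r\<close> need exist.\<close>

lemma infinite_dimensional_bound:
  assumes Ninf: "N = \<infinity>"
    and \<kappa>: "AE z in \<pi>. d (fst z) (snd z) = 0 \<or> (\<forall>r>0. \<kappa> * r \<le> K * pressure U r)"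
  shows "U_fun U \<nu> \<mu>0 - U_fun U \<nu> \<mu>1 \<le>
    enn2ereal (slope_term U) - ereal (\<kappa> / 2 * (\<integral>z. (d (fst z) (snd z))\<^sup>2 \<partial>\<pi>))"
proof -
  let ?d = "\<lambda>z. d (fst z) (snd z)"
  note i = target_integrable[OF U fin] and c = transport_cost_eq(1)
  have pos1: "AE z in \<pi>. 0 < \<rho>1 (snd z)" using AE_\<pi>_\<rho>1_pos by (simp add: case_prod_unfold)
  have pos0: "AE z in \<pi>. 0 < \<rho>0 (fst z)" using AE_\<pi>_\<rho>0_pos by (auto simp: case_prod_unfold elim!: eventually_mono)
  have it: "integrable \<pi> (\<lambda>z. mean_slope U (\<rho>1 (snd z)) - \<kappa> / 6 * (?d z)\<^sup>2)"
    and ic: "integrable \<pi> (\<lambda>z. - (\<kappa> / 3) * (?d z)\<^sup>2)"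
    by (intro Bochner_Integration.integrable_diff integrable_mult_right i(1) c)+
  have "target_term U \<le> eintegral \<pi> (\<lambda>z. ereal (mean_slope U (\<rho>1 (snd z)) - \<kappa> / 6 * (?d z)\<^sup>2))"
    unfolding target_term_def case_prod_unfold
  proof (rule eintegral_mono_AE, use pos1 \<kappa> in eventually_elim)
    fix z :: "'a \<times> 'a"
    assume z: "0 < \<rho>1 (snd z)" "?d z = 0 \<or> (\<forall>r>0. \<kappa> * r \<le> K * pressure U r)"
    define r where "r = \<rho>1 (snd z)"
    define \<delta> where "\<delta> = (?d z)\<^sup>2"
    let ?s = "r / exp (K / 6 * \<delta>)"
    have r: "0 < r" "0 < ?s" using z by (auto simp: r_def)
    have \<delta>: "0 \<le> \<delta>" by (simp add: \<delta>_def)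
    have ln: "ln r - ln ?s = K / 6 * \<delta>" using r by (simp add: ln_div)
    have "mean_slope U ?s \<le> mean_slope U r - \<kappa> / 6 * \<delta>"
      using z(2)
    proof
      assume "?d z = 0"
      then show ?thesis by (simp add: \<delta>_def)
    next
      assume k: "\<forall>r>0. \<kappa> * r \<le> K * pressure U r"
      \<comment> \<open>Division by \<open>K\<close> yields a lower bound on the pressure for
        \<open>K > 0\<close> and an upper bound for \<open>K < 0\<close>; since the order of
        \<open>?s\<close> and \<open>r\<close> reverses as well, both give the same
        estimate.\<close>
      consider "K > 0" | "K < 0" | "K = 0" by linarith
      then show ?thesis
      proof cases
        case 1
        have "?s \<le> r" using r 1 \<delta> by (simp add: divide_le_eq)
        then have "\<kappa> / K * (ln r - ln ?s) \<le> mean_slope U r - mean_slope U ?s"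
          using k 1 r by (intro mean_slope_ln_lower[OF U N]) (auto simp: field_simps)
        then show ?thesis unfolding ln using 1 by simp
      next
        case 2
        have "K * \<delta> \<le> 0" using 2 \<delta> by (simp add: mult_nonpos_nonneg)
        then have "r \<le> ?s" using r by (simp add: le_divide_eq)
        then have "mean_slope U ?s - mean_slope U r \<le> \<kappa> / K * (ln ?s - ln r)"
          using k 2 r by (intro mean_slope_ln_lipschitz[OF U N]) (auto simp: field_simps)
        moreover have "\<kappa> / K * (ln ?s - ln r) = - (\<kappa> / 6 * \<delta>)" using ln 2 by (simp add: field_simps)
        ultimately show ?thesis by linarith
      next
        case 3
        then have "\<kappa> \<le> 0" using k[rule_format, of 1] by simp
        then have "\<kappa> * \<delta> \<le> 0" using \<delta> by (simp add: mult_nonpos_nonneg)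
        then show ?thesis using 3 by simp
      qed
    qed
    moreover have "slope_at U (\<rho>1 (snd z)) (rbeta0 K N (?d z)) = ereal (mean_slope U ?s)"
      using r Ninf by (simp add: slope_at_def rbeta0_def r_def[symmetric] \<delta>_def[symmetric] max_def)
    ultimately show "slope_at U (\<rho>1 (snd z)) (rbeta0 K N (?d z)) \<le> ereal (mean_slope U (\<rho>1 (snd z)) - \<kappa> / 6 * (?d z)\<^sup>2)"
      by (simp add: r_def[symmetric] \<delta>_def[symmetric])
  qed
  also have "\<dots> = U_fun U \<nu> \<mu>1 - ereal (\<kappa> / 6 * (\<integral>z. (?d z)\<^sup>2 \<partial>\<pi>))"
    unfolding eintegral_integrable[OF it] i(2)
    by (subst Bochner_Integration.integral_diff) (use i(1) c in auto)
  finally have target: "target_term U \<le> U_fun U \<nu> \<mu>1 - ereal (\<kappa> / 6 * (\<integral>z. (?d z)\<^sup>2 \<partial>\<pi>))" .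
  have "curvature_term U \<le> eintegral \<pi> (\<lambda>z. ereal (- (\<kappa> / 3) * (?d z)\<^sup>2))"
    unfolding curvature_term_def case_prod_unfold
  proof (rule eintegral_mono_AE, use pos0 \<kappa> in eventually_elim)
    fix z :: "'a \<times> 'a"
    assume z: "0 < \<rho>0 (fst z)" "?d z = 0 \<or> (\<forall>r>0. \<kappa> * r \<le> K * pressure U r)"
    have "pressure U (\<rho>0 (fst z)) / \<rho>0 (fst z) * - (K / 3 * (?d z)\<^sup>2) \<le> - (\<kappa> / 3) * (?d z)\<^sup>2"
      using z(2)
    proof
      assume "\<forall>r>0. \<kappa> * r \<le> K * pressure U r"
      then have "\<kappa> \<le> K * pressure U (\<rho>0 (fst z)) / \<rho>0 (fst z)" using z by (simp add: le_divide_eq)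
      then have "\<kappa> * ((?d z)\<^sup>2 / 3) \<le> K * pressure U (\<rho>0 (fst z)) / \<rho>0 (fst z) * ((?d z)\<^sup>2 / 3)"
        by (rule mult_right_mono) simp
      then show ?thesis by (simp add: field_simps)
    qed simp
    then show "ereal (pressure U (\<rho>0 (fst z)) / \<rho>0 (fst z)) * beta_deriv_KN d K N (fst z) (snd z) \<le> ereal (- (\<kappa> / 3) * (?d z)\<^sup>2)"
      unfolding beta_deriv_KN_eq[OF N] using Ninf by (simp add: maximal_diameter_def rbeta'_def)
  qed
  also have "\<dots> = ereal (- (\<kappa> / 3) * (\<integral>z. (?d z)\<^sup>2 \<partial>\<pi>))"
    unfolding eintegral_integrable[OF ic] by simp
  finally have curvature: "curvature_term U \<le> ereal (- (\<kappa> / 3) * (\<integral>z. (?d z)\<^sup>2 \<partial>\<pi>))" .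
  have "U_fun U \<nu> \<mu>0 \<le> (U_fun U \<nu> \<mu>1 - ereal (\<kappa> / 6 * (\<integral>z. (?d z)\<^sup>2 \<partial>\<pi>))) +
      ereal (- (\<kappa> / 3) * (\<integral>z. (?d z)\<^sup>2 \<partial>\<pi>)) + enn2ereal (slope_term U)"
    by (rule order_trans[OF general_hwi[OF U] add_right_mono[OF add_mono[OF target curvature]]])
  then show ?thesis unfolding i(2)
    by (cases "U_fun U \<nu> \<mu>0"; cases "enn2ereal (slope_term U)") (auto simp: field_simps)
qed

text \<open>\<open>K_infty K U\<close> may be \<open>-\<infinity>\<close>. For positive cost the
  right side is then \<open>\<infinity>\<close>. For zero cost its product with the cost is
  \<open>0\<close> in any case, and the bound is applied with the constant \<open>0\<close> on the
  diagonal.\<close>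

lemma infinite_dimensional_hwi:
  assumes Ninf: "N = \<infinity>"
  shows "U_fun U \<nu> \<mu>0 - U_fun U \<nu> \<mu>1 \<le>
    enn2ereal (slope_term U) - K_infty K U / 2 * (enn2ereal (W2 d \<mu>0 \<mu>1))\<^sup>2"
proof -
  let ?c = "\<integral>z. (d (fst z) (snd z))\<^sup>2 \<partial>\<pi>"
  have c: "0 \<le> ?c" by (rule integral_nonneg_AE) simp
  have up: "K_infty K U \<le> ereal (K * pressure U r / r)" if "r > 0" for r
    unfolding K_infty_def using that by (intro INF_lower) simp
  show ?thesis
  proof (cases "?c = 0")
    case True
    then have "AE z in \<pi>. (d (fst z) (snd z))\<^sup>2 = 0"
      using integral_nonneg_eq_0_iff_AE[OF transport_cost_eq(1)] by simp
    then have "AE z in \<pi>. d (fst z) (snd z) = 0 \<or> (\<forall>r>0. 0 * r \<le> K * pressure U r)"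
      by eventually_elim simp
    from infinite_dimensional_bound[OF Ninf this] show ?thesis unfolding W2_square True by (simp add: zero_ereal_def[symmetric])
  next
    case False
    show ?thesis
    proof (cases "K_infty K U")
      case (real \<kappa>)
      have "\<kappa> * r \<le> K * pressure U r" if "r > 0" for r
        using up[OF that] that unfolding real by (simp add: le_divide_eq)
      then have "AE z in \<pi>. d (fst z) (snd z) = 0 \<or> (\<forall>r>0. \<kappa> * r \<le> K * pressure U r)" by simp
      from infinite_dimensional_bound[OF Ninf this] show ?thesis unfolding W2_square real by simp
    next
      case PInf
      then show ?thesis using up[of 1] by simp
    next
      case MInf
      then have "K_infty K U / 2 * ereal ?c = -\<infinity>" using c False by (simp add: less_le)
      then show ?thesis unfolding W2_square by simp
    qed
  qed
qed

end

end

lemma msupp_absolutely_continuous: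
  assumes "absolutely_continuous \<nu> \<mu>" "sets \<nu> = sets (fborel d)"
  shows "msupp d \<mu> \<subseteq> msupp d \<nu>"
proof
  fix x assume x: "x \<in> msupp d \<mu>"
  show "x \<in> msupp d \<nu>"
    unfolding msupp_def
  proof (safe, rule ccontr)
    fix V assume V: "openin (ftop d) V" "x \<in> V" "\<not> 0 < emeasure \<nu> V"
    then have "V \<in> null_sets \<nu>" using assms(2) by (auto simp: null_sets_def fborel_def not_gr_zero)
    then have "emeasure \<mu> V = 0" using assms(1) by (auto simp: absolutely_continuous_def)
    then show False using x V unfolding msupp_def by auto
  qed
qed

theorem theorem5p25:
  fixes d :: "'a \<Rightarrow> 'a \<Rightarrow> real" and \<nu> \<mu>0 \<mu>1 :: "'a measure"
    and K :: real and N :: ereal and \<rho>0 :: "'a \<Rightarrow> real"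
  assumes "1 < N"
    and "weak_CD d \<nu> K N"
    and "\<mu>0 \<in> prob_ac_c d \<nu>" and "\<mu>1 \<in> prob_ac_c d \<nu>"
    and "\<forall>x. 0 \<le> \<rho>0 x" and "forward_lipschitz d \<rho>0"
    and "\<mu>0 = density \<nu> (\<lambda>x. ennreal (\<rho>0 x))"
  shows "\<exists>\<pi>. optimal_plan d \<mu>0 \<mu>1 \<pi> \<and>
    (\<forall>U\<in>DC N.
      let J = \<integral>\<^sup>+(x, y). ennreal (deriv (deriv U) (\<rho>0 x)) * descending_slope d \<rho>0 x * ennreal (d x y) \<partial>\<pi>
      in
        U_fun U \<nu> \<mu>0 \<le>
          U_KN_rev_zero_plus d K N U \<nu> \<pi> \<mu>1
          + eintegral (kernel_prod \<nu> (cond_kernel \<pi> \<mu>0))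
              (\<lambda>(x, y). ereal (pressure U (\<rho>0 x)) * beta_deriv_KN d K N x y)
          + enn2ereal J
      \<and> (K = 0 \<and> U_fun U \<nu> \<mu>1 < \<infinity> \<longrightarrow>
          U_fun U \<nu> \<mu>0 - U_fun U \<nu> \<mu>1 \<le> enn2ereal J \<and>
          J \<le> W2 d \<mu>0 \<mu>1 * esqrt (fisher_minus d U \<nu> \<rho>0))
      \<and> (N = \<infinity> \<and> U_fun U \<nu> \<mu>1 < \<infinity> \<longrightarrow>
          U_fun U \<nu> \<mu>0 - U_fun U \<nu> \<mu>1
            \<le> enn2ereal J - K_infty K U / 2 * (enn2ereal (W2 d \<mu>0 \<mu>1))\<^sup>2 \<and>
          enn2ereal J - K_infty K U / 2 * (enn2ereal (W2 d \<mu>0 \<mu>1))\<^sup>2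
            \<le> enn2ereal (W2 d \<mu>0 \<mu>1 * esqrt (fisher_minus d U \<nu> \<rho>0))
               - K_infty K U / 2 * (enn2ereal (W2 d \<mu>0 \<mu>1))\<^sup>2))"
proof -
  have cd: "forward_metric_space d" "forward_boundedly_compact d" "locally_finite_borel d \<nu>" "sigma_finite_measure \<nu>"
    using assms(2) by (auto simp: weak_CD_def forward_geodesic_space_def)
  have s: "sets \<nu> = sets (fborel d)" using cd(3) by (simp add: locally_finite_borel_def)
  have c: "\<mu>0 \<in> prob_c d" "\<mu>1 \<in> prob_c d" and ac: "absolutely_continuous \<nu> \<mu>0" "absolutely_continuous \<nu> \<mu>1"
    using assms(3,4) by (auto simp: prob_ac_c_def)
  have "\<exists>\<mu> \<pi>. displacement_interpolation d \<mu> \<pi> \<and> \<mu> 0 = \<mu>0 \<and> \<mu> 1 = \<mu>1 \<and>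
         (\<forall>U\<in>DC N. \<forall>t\<in>{0..1}.
            U_fun U \<nu> (\<mu> t) \<le>
              ereal (1 - t) * U_KN d K N U \<nu> (1 - t) \<pi> \<mu>0 + ereal t * U_KN_rev d K N U \<nu> t \<pi> \<mu>1)"
    using assms(2) c msupp_absolutely_continuous[OF ac(1) s] msupp_absolutely_continuous[OF ac(2) s]
    unfolding weak_CD_def by blast
  then obtain \<mu> \<pi> where \<mu>: "displacement_interpolation d \<mu> \<pi>" "\<mu> 0 = \<mu>0" "\<mu> 1 = \<mu>1"
    "\<And>U t. U \<in> DC N \<Longrightarrow> t \<in> {0..1} \<Longrightarrow> U_fun U \<nu> (\<mu> t) \<le>
        ereal (1 - t) * U_KN d K N U \<nu> (1 - t) \<pi> \<mu>0 + ereal t * U_KN_rev d K N U \<nu> t \<pi> \<mu>1"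
    by blast
  obtain Q where Q: "dynamical_optimal_plan d Q" "\<And>t. t \<in> {0..1} \<Longrightarrow> \<mu> t = interpolant d Q t" "\<pi> = endpoint_plan d Q"
    using \<mu>(1) unfolding displacement_interpolation_def by blast
  have ends: "interpolant d Q 0 = \<mu>0" "interpolant d Q 1 = \<mu>1"
    using Q(2)[of 0] Q(2)[of 1] \<mu>(2,3) by auto
  have opt: "optimal_plan d \<mu>0 \<mu>1 (endpoint_plan d Q)" and Qp: "prob_space Q" "sets Q = sets (geodesic_borel d)"
    using Q(1) unfolding dynamical_optimal_plan_def ends by auto
  \<comment> \<open>The plan is the endpoint plan of the interpolation supplied by the
    curvature-dimension condition. It is fixed before \<open>U\<close>, so the same plan serves
    every \<open>U\<close> in \<open>DC N\<close>.\<close>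
  interpret cd_transport d \<nu> \<mu>0 \<mu>1 \<rho>0 Q K N
  proof (intro cd_transport.intro transport.intro fbc_space.intro transport_axioms.intro cd_transport_axioms.intro)
    show "U_fun U \<nu> (interpolant d Q t) \<le>
      ereal (1 - t) * U_KN d K N U \<nu> (1 - t) (endpoint_plan d Q) \<mu>0 + ereal t * U_KN_rev d K N U \<nu> t (endpoint_plan d Q) \<mu>1"
      if "U \<in> DC N" "t \<in> {0..1}" for U t
      using \<mu>(4)[OF that] unfolding Q(3) Q(2)[OF that(2)] .
    show "0 \<le> \<rho>0 x" for x using assms(5) by simp
  qed (fact cd assms ends opt Qp)+
  show ?thesis
  proof (intro exI[of _ "endpoint_plan d Q"] conjI ballI opt)
    fix U assume U: "U \<in> DC N"
    have le: "enn2ereal (slope_term U) \<le> enn2ereal (W2 d \<mu>0 \<mu>1 * esqrt (fisher_minus d U \<nu> \<rho>0))"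
      using slope_term_le[OF U] by (simp add: less_eq_ennreal.rep_eq)
    have "U_fun U \<nu> \<mu>0 \<le> U_KN_rev_zero_plus d K N U \<nu> (endpoint_plan d Q) \<mu>1 + curvature_term U + enn2ereal (slope_term U)"
      by (rule order_trans[OF general_hwi[OF U] add_right_mono[OF add_right_mono[OF target_term_le[OF U]]]])
    then show "let J = \<integral>\<^sup>+(x, y). ennreal (deriv (deriv U) (\<rho>0 x)) * descending_slope d \<rho>0 x * ennreal (d x y) \<partial>endpoint_plan d Q
      in
        U_fun U \<nu> \<mu>0 \<le>
          U_KN_rev_zero_plus d K N U \<nu> (endpoint_plan d Q) \<mu>1
          + eintegral (kernel_prod \<nu> (cond_kernel (endpoint_plan d Q) \<mu>0))
              (\<lambda>(x, y). ereal (pressure U (\<rho>0 x)) * beta_deriv_KN d K N x y)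
          + enn2ereal J
      \<and> (K = 0 \<and> U_fun U \<nu> \<mu>1 < \<infinity> \<longrightarrow>
          U_fun U \<nu> \<mu>0 - U_fun U \<nu> \<mu>1 \<le> enn2ereal J \<and>
          J \<le> W2 d \<mu>0 \<mu>1 * esqrt (fisher_minus d U \<nu> \<rho>0))
      \<and> (N = \<infinity> \<and> U_fun U \<nu> \<mu>1 < \<infinity> \<longrightarrow>
          U_fun U \<nu> \<mu>0 - U_fun U \<nu> \<mu>1
            \<le> enn2ereal J - K_infty K U / 2 * (enn2ereal (W2 d \<mu>0 \<mu>1))\<^sup>2 \<and>
          enn2ereal J - K_infty K U / 2 * (enn2ereal (W2 d \<mu>0 \<mu>1))\<^sup>2
            \<le> enn2ereal (W2 d \<mu>0 \<mu>1 * esqrt (fisher_minus d U \<nu> \<rho>0))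
               - K_infty K U / 2 * (enn2ereal (W2 d \<mu>0 \<mu>1))\<^sup>2)"
      unfolding Let_def slope_term_def[symmetric] curvature_term_eq[OF U]
      using flat_hwi[OF U] infinite_dimensional_hwi[OF U] slope_term_le[OF U] ereal_minus_mono[OF le order_refl]
      by blast
  qed
qed

end
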